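(* Let $d\ge2$, let $D\subset\mathbb{R}^d$ be a quasi-open set of finite Lebesgue measure, let $m>0$ and let $k\ge2$ be an integer. Set $$\alpha_k=\inf\{\lambda_k(\Omega)\ :\ \Omega \text{ quasi-open},\ D\subset\Omega,\ |\Omega|\le m\},$$ and for $a>0$ and $j\ge1$ set $\lambda_j^*(a)=\inf\{\lambda_j(\Omega):\Omega\subset\mathbb{R}^d\text{ quasi-open},\ |\Omega|\le a\}$. Then one of the following holds: (i) the infimum $\alpha_k$ is attained, i.e. there is a quasi-open $\Omega$ with $D\subset\Omega$, $|\Omega|\le m$ and $\lambda_k(\Omega)=\alpha_k$; (ii) there exist $l\in\{1,\dots,k-1\}$ and a quasi-open set $\Omega$ with $D\subset\Omega$, $|\Omega|\le m$, such that $\alpha_k=\lambda_{k-l}(\Omega)=\lambda_l^*(m-|\Omega|)$; (iii) there exists $l\in\{1,\dots,k-1\}$ such that $\alpha_k=\lambda_l^*(m-|D|)>\lambda_{k-l}(D)$.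
   Context: Capacity: $\mathrm{cap}(E)=\inf\{\|u\|_{H^1(\mathbb{R}^d)}^2: u\in H^1(\mathbb{R}^d),\ u\ge1 \text{ a.e. in a neighbourhood of } E\}$. A set $\Omega$ is quasi-open if for every $\varepsilon>0$ there is an open $\Omega_\varepsilon\supset\Omega$ with $\mathrm{cap}(\Omega_\varepsilon\setminus\Omega)<\varepsilon$. For quasi-open $\Omega$, $H^1_0(\Omega)=\{u\in H^1(\mathbb{R}^d): u=0 \text{ quasi-everywhere on } \mathbb{R}^d\setminus\Omega\}$, and $\lambda_k(\Omega)$ is the $k$-th eigenvalue (with multiplicity) of the Dirichlet Laplacian on $\Omega$, defined by the min-max formula over $k$-dimensional subspaces of $H^1_0(\Omega)$ of the Rayleigh quotient $\int|\nabla u|^2/\int u^2$. *)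

theory Defs
  imports "HOL-Analysis.Analysis"
begin

definition partial_deriv :: "('a::euclidean_space \<Rightarrow> real) \<Rightarrow> 'a \<Rightarrow> 'a \<Rightarrow> real" where
  "partial_deriv f b x = frechet_derivative f (at x) b"

coinductive smooth_fun :: "('a::euclidean_space \<Rightarrow> real) \<Rightarrow> bool" where
  "(\<forall>x. f differentiable (at x)) \<Longrightarrow> (\<forall>b\<in>Basis. smooth_fun (partial_deriv f b))
     \<Longrightarrow> smooth_fun f"

definition test_fun :: "('a::euclidean_space \<Rightarrow> real) \<Rightarrow> bool" where
  "test_fun \<phi> \<longleftrightarrow> smooth_fun \<phi> \<and> compact (closure {x. \<phi> x \<noteq> 0})"

definition L2 :: "('a::euclidean_space \<Rightarrow> real) \<Rightarrow> bool" where
  "L2 u \<longleftrightarrow> u \<in> borel_measurable lebesgue \<and> integrable lebesgue (\<lambda>x. (u x)\<^sup>2)"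

definition weak_grad :: "('a::euclidean_space \<Rightarrow> real) \<Rightarrow> ('a \<Rightarrow> 'a) \<Rightarrow> bool" where
  "weak_grad u g \<longleftrightarrow>
     (\<forall>b\<in>Basis. L2 (\<lambda>x. g x \<bullet> b)) \<and>
     (\<forall>\<phi>. test_fun \<phi> \<longrightarrow> (\<forall>b\<in>Basis.
        (LINT x|lebesgue. u x * partial_deriv \<phi> b x) = - (LINT x|lebesgue. (g x \<bullet> b) * \<phi> x)))"

definition H1 :: "('a::euclidean_space \<Rightarrow> real) set" where
  "H1 = {u. L2 u \<and> (\<exists>g. weak_grad u g)}"

definition grad :: "('a::euclidean_space \<Rightarrow> real) \<Rightarrow> 'a \<Rightarrow> 'a" where
  "grad u = (SOME g. weak_grad u g)"

definition H1_norm_sq :: "('a::euclidean_space \<Rightarrow> real) \<Rightarrow> real" where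
  "H1_norm_sq u = (LINT x|lebesgue. (u x)\<^sup>2) + (LINT x|lebesgue. (norm (grad u x))\<^sup>2)"

definition cap :: "'a::euclidean_space set \<Rightarrow> ereal" where
  "cap E = (INF u \<in> {u \<in> H1. \<exists>U. open U \<and> E \<subseteq> U \<and> (AE x in lebesgue. x \<in> U \<longrightarrow> 1 \<le> u x)}.
              ereal (H1_norm_sq u))"

definition quasi_open :: "'a::euclidean_space set \<Rightarrow> bool" where
  "quasi_open \<Omega> \<longleftrightarrow> (\<forall>\<epsilon>>0. \<exists>U. open U \<and> \<Omega> \<subseteq> U \<and> cap (U - \<Omega>) < ereal \<epsilon>)"

definition quasi_continuous :: "('a::euclidean_space \<Rightarrow> real) \<Rightarrow> bool" where
  "quasi_continuous v \<longleftrightarrow> (\<forall>\<epsilon>>0. \<exists>U. open U \<and> cap U < ereal \<epsilon> \<and> continuous_on (- U) v)"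

definition H10 :: "'a::euclidean_space set \<Rightarrow> ('a \<Rightarrow> real) set" where
  "H10 \<Omega> = {u \<in> H1. \<exists>v. quasi_continuous v \<and> (AE x in lebesgue. v x = u x)
                        \<and> cap {x. x \<notin> \<Omega> \<and> v x \<noteq> 0} = 0}"

definition rayleigh :: "('a::euclidean_space \<Rightarrow> real) \<Rightarrow> real" where
  "rayleigh u = (LINT x|lebesgue. (norm (grad u x))\<^sup>2) / (LINT x|lebesgue. (u x)\<^sup>2)"

text \<open>A k-dimensional subspace of H^1_0(Omega) (functions identified a.e.) is the span of
  k elements u 0, ..., u (k-1) that are linearly independent modulo a.e. equality.\<close>
definition dirichlet_eig :: "'a::euclidean_space set \<Rightarrow> nat \<Rightarrow> ereal" where
  "dirichlet_eig \<Omega> k =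
     (INF u \<in> {u :: nat \<Rightarrow> 'a \<Rightarrow> real. (\<forall>i<k. u i \<in> H10 \<Omega>) \<and>
                 (\<forall>c. (AE x in lebesgue. (\<Sum>i<k. c i * u i x) = 0) \<longrightarrow> (\<forall>i<k. c i = 0))}.
        (SUP c \<in> {c :: nat \<Rightarrow> real. \<not> (AE x in lebesgue. (\<Sum>i<k. c i * u i x) = 0)}.
           ereal (rayleigh (\<lambda>x. \<Sum>i<k. c i * u i x))))"

text \<open>The type argument fixes the ambient space R^d.\<close>
definition lambda_star :: "'a::euclidean_space itself \<Rightarrow> nat \<Rightarrow> real \<Rightarrow> ereal" where
  "lambda_star _ j a = (INF \<Omega> \<in> {\<Omega> :: 'a set. quasi_open \<Omega> \<and> emeasure lebesgue \<Omega> \<le> ennreal a}.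
                        dirichlet_eig \<Omega> j)"

end

theory Submission
  imports Defs "HOL-Library.Diagonal_Subsequence"
begin

text \<open>
  Everything is phrased for tuples of functions: \<open>rb k La u\<close> says that the span of
  \<open>u 0, ..., u (k-1)\<close> has dimension \<open>k\<close> and Rayleigh quotients at most \<open>La\<close>. A minimizing
  sequence of orthonormal tuples converges locally in $L^2$ to a tuple \<open>u\<close>. The quadratic form
  \<open>en - (\<alpha> + \<epsilon>) nrm2\<close>, pulled back to coefficient space along \<open>u\<close>, splits that space into a
  negative part of dimension \<open>k - l\<close>, carried by the limit set, and a complementary part of
  dimension \<open>l\<close> on which, by the IMS localization formula, the mass escaping to infinity has
  Rayleigh quotients at most \<open>\<alpha> + 2\<epsilon>\<close>. If everything escapes (\<open>l = k\<close>), recentring the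
  minimizing sequence and splitting it again produces \<open>l < k\<close>, by strict monotonicity under
  dilation.

  If the eigenvalue of the limit set lies below \<open>\<alpha>\<close>, countably many small balls are removed from
  it outside \<open>D\<close> as long as the eigenvalue stays at most \<open>\<alpha>\<close>; either the value \<open>\<alpha>\<close> is
  attained on the way or only \<open>D\<close> survives. A strict inequality in the remaining eigenvalue
  would allow one to glue a dilated limit set to a distant competitor and to beat \<open>\<alpha>\<close>.

  $H^1$ is handled by difference quotients: \<open>S u t\<close> sums \<open>\<integral>(u(x + t b) - u(x))\<^sup>2\<close> over the basis
  vectors \<open>b\<close>, and \<open>en u\<close> is both a bound for and the limit of \<open>S u t / t\<^sup>2\<close>.
\<close>

text \<open>Gradients are chosen by \<open>SOME\<close> and known only through the weak formulation.
  In place of chain and product rules, pointwise inequalities between increments pass through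
  \<open>S\<close> to energies; cut-offs, truncations, dilations and semicontinuity are all treated
  this way. Weak convergence never appears: by the parallelogram law, iterated midpoints of a
  bounded sequence converge strongly, and whatever is stable under midpoints (vanishing on a ball,
  bounded support, a norm bound) survives.

  Infima need not be attained, so bounds are stated at level \<alpha> + \<epsilon>. The escaping
  dimension l may then vary with \<epsilon> and is fixed by the pigeonhole principle.

  The condition d >= 2 enters because points then have capacity zero, which lets a small ball be
  removed at arbitrarily small cost in the eigenvalue. A set D with |D| > m makes \<alpha> infinite;
  this falls under (iii) with l = k - 1, since \<open>lambda_star\<close> is infinite at nonpositive
  volume and a quasi-open set of positive measure carries a nonzero Sobolev function.\<close>

notation (input) LIMSEQ (infix "---->" 60)

subsection \<open>The space of square integrable functions\<close>

lemma affine_measurable: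
 fixes t :: "'a::euclidean_space"
 assumes "c ~= (0::real)"
 shows "(%x. t + c *\<^sub>R x) \<in> lebesgue \<rightarrow>\<^sub>M lebesgue"
 using lebesgue_affine_measurable[of "%_. c" t] assms
 unfolding scaleR_scaleR[symmetric] scaleR_sum_right[symmetric] euclidean_representation by simp

lemma affine_density:
 fixes t :: "'a::euclidean_space"
 assumes "c ~= (0::real)"
 shows "(lebesgue :: 'a measure) = density (distr lebesgue lebesgue (%x. t + c *\<^sub>R x)) (%_. ennreal (\<bar>c\<bar> ^ DIM('a)))"
 using lebesgue_affine_euclidean[of "%_. c" t] assms
 unfolding scaleR_scaleR[symmetric] scaleR_sum_right[symmetric] euclidean_representation by simp

lemma affine_AE:
 fixes t :: "'a::euclidean_space"
 assumes c: "c ~= (0::real)" and P: "AE x in lebesgue. P x"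
 shows "AE x in lebesgue. P (t + c *\<^sub>R x)"
proof -
 have "AE x in density (distr lebesgue lebesgue (%x. t + c *\<^sub>R x)) (%_. ennreal (\<bar>c\<bar> ^ DIM('a))). P x"
  using P by (subst affine_density[OF c, symmetric])
 then have "AE x in distr lebesgue lebesgue (%x. t + c *\<^sub>R x). P x"
  using c by (subst (asm) AE_density) auto
 then show ?thesis
  by (rule AE_distrD[OF affine_measurable[OF c]])
qed

lemma affine_integrable:
 fixes f :: "'a::euclidean_space => real"
 assumes c: "c ~= 0" and f: "integrable lebesgue f"
 shows "integrable lebesgue (%x. f (t + c *\<^sub>R x))"
proof -
 have m: "f \<in> borel_measurable lebesgue" using f by auto
 have "integrable (density (distr lebesgue lebesgue (%x. t + c *\<^sub>R x)) (%_. ennreal (\<bar>c\<bar> ^ DIM('a)))) f"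
  using f affine_density[OF c, of t] by simp
 then have "integrable (distr lebesgue lebesgue (%x. t + c *\<^sub>R x)) (%x. \<bar>c\<bar> ^ DIM('a) *\<^sub>R f x)"
  using m by (subst (asm) integrable_density) (auto)
 then have "integrable lebesgue (%x. \<bar>c\<bar> ^ DIM('a) *\<^sub>R f (t + c *\<^sub>R x))"
  using m by (subst (asm) integrable_distr_eq[OF affine_measurable[OF c]]) auto
 then show ?thesis using c by simp
qed

lemma affine_integral:
 fixes f :: "'a::euclidean_space => real"
 assumes c: "c ~= 0" and m: "f \<in> borel_measurable lebesgue"
 shows "(LINT x|lebesgue. f (t + c *\<^sub>R x)) = (LINT x|lebesgue. f x) / \<bar>c\<bar> ^ DIM('a)"
proof -
 have "(LINT x|lebesgue. f x) = (LINT x|density (distr lebesgue lebesgue (%x. t + c *\<^sub>R x)) (%_. ennreal (\<bar>c\<bar> ^ DIM('a))). f x)"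
  using affine_density[OF c, of t] by simp
 also have "... = (LINT x|distr lebesgue lebesgue (%x. t + c *\<^sub>R x). \<bar>c\<bar> ^ DIM('a) *\<^sub>R f x)"
  using m by (subst integral_density) auto
 also have "... = (LINT x|lebesgue. \<bar>c\<bar> ^ DIM('a) *\<^sub>R f (t + c *\<^sub>R x))"
  using m by (subst integral_distr[OF affine_measurable[OF c]]) auto
 finally show ?thesis using c by simp
qed

lemma affine_borel:
 fixes t :: "'a::euclidean_space"
 assumes "c ~= (0::real)" "f \<in> borel_measurable lebesgue"
 shows "(%x. f (t + c *\<^sub>R x)) \<in> borel_measurable lebesgue"
 using measurable_compose[OF affine_measurable[OF assms(1)] assms(2)] .

lemma shift_borel:
 fixes y :: "'a::euclidean_space"
 shows "f \<in> borel_measurable lebesgue ==> (%x. f (x + y)) \<in> borel_measurable lebesgue"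
 using affine_borel[of 1 f y] by (simp add: add.commute)

lemma shift_AE:
 fixes y :: "'a::euclidean_space"
 shows "AE x in lebesgue. P x ==> AE x in lebesgue. P (x + y)"
 using affine_AE[of 1 P y] by (simp add: add.commute)

lemma shift_integral:
 fixes f :: "'a::euclidean_space => real"
 shows "f \<in> borel_measurable lebesgue ==> (LINT x|lebesgue. f (x + y)) = (LINT x|lebesgue. f x)"
 using affine_integral[of 1 f y] by (simp add: add.commute)

lemma continuous_borel_lebesgue:
 fixes f :: "'a::euclidean_space => real"
 shows "continuous_on UNIV f ==> f \<in> borel_measurable lebesgue"
 by (rule measurable_completion) (simp add: borel_measurable_continuous_onI)

text \<open>Fubini is applied to products of Borel measures, whereas L2 functions are only Lebesgue
  measurable; a Borel representative bridges the two.\<close>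

lemma borel_rep:
 fixes f :: "'a::euclidean_space => real"
 assumes "f \<in> borel_measurable lebesgue"
 obtains g where "g \<in> borel_measurable borel" "AE x in lebesgue. f x = g x"
proof -
 obtain g where "g \<in> borel_measurable lborel" "AE x in lborel. f x = g x"
  using completion_ex_borel_measurable_real[OF assms] by auto
 then show ?thesis using that[of g] by (auto intro: AE_completion)
qed

section \<open>The L2 seminorm and its inner product\<close>

definition nrm2 :: "('a::euclidean_space => real) => real" where
 "nrm2 u = (LINT x|lebesgue. (u x)\<^sup>2)"

definition nrm :: "('a::euclidean_space => real) => real" where
 "nrm u = sqrt (nrm2 u)"

definition ip :: "('a::euclidean_space => real) => ('a => real) => real" where
 "ip u v = (LINT x|lebesgue. u x * v x)"

lemma L2_meas: "L2 u ==> u \<in> borel_measurable lebesgue"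
 by (simp add: L2_def)

lemma nrm2_nonneg [simp]: "0 <= nrm2 u"
 unfolding nrm2_def by simp

lemma nrm_nonneg [simp]: "0 <= nrm u"
 unfolding nrm_def by simp

lemma nrm_sq: "(nrm u)\<^sup>2 = nrm2 u"
 unfolding nrm_def by simp

lemma L2_bound:
 assumes "L2 u" "v \<in> borel_measurable lebesgue" "AE x in lebesgue. \<bar>v x\<bar> <= C * \<bar>u x\<bar>"
 shows "L2 v"
proof -
 have "integrable lebesgue (%x. C\<^sup>2 * (u x)\<^sup>2)" using assms(1) by (simp add: L2_def)
 then have "integrable lebesgue (%x. (v x)\<^sup>2)"
 proof (rule Bochner_Integration.integrable_bound)
  show "(%x. (v x)\<^sup>2) \<in> borel_measurable lebesgue" using assms(2) by auto
  show "AE x in lebesgue. norm ((v x)\<^sup>2) <= norm (C\<^sup>2 * (u x)\<^sup>2)"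
   using assms(3)
  proof eventually_elim
   case (elim x)
   have "\<bar>v x\<bar>\<^sup>2 <= (C * \<bar>u x\<bar>)\<^sup>2" using elim by (intro power_mono) auto
   then show ?case by (simp add: power_mult_distrib)
  qed
 qed
 then show ?thesis using assms(2) by (simp add: L2_def)
qed

lemma L2_cong:
 assumes "L2 u" "v \<in> borel_measurable lebesgue" "AE x in lebesgue. v x = u x"
 shows "L2 v"
 by (rule L2_bound[OF assms(1,2), of 1]) (use assms(3) in auto)

lemma nrm2_cong:
 assumes "u \<in> borel_measurable lebesgue" "v \<in> borel_measurable lebesgue" "AE x in lebesgue. v x = u x"
 shows "nrm2 v = nrm2 u"
 unfolding nrm2_def using assms by (intro integral_cong_AE) auto

lemma nrm2_mono:
 assumes "L2 u" "v \<in> borel_measurable lebesgue" "AE x in lebesgue. \<bar>v x\<bar> <= \<bar>u x\<bar>"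
 shows "nrm2 v <= nrm2 u"
proof -
 have "L2 v" by (rule L2_bound[OF assms(1,2), of 1]) (use assms(3) in auto)
 then show ?thesis using assms unfolding nrm2_def L2_def
  by (intro integral_mono_AE) (auto simp: abs_le_square_iff elim!: eventually_mono)
qed

lemma L2_zero [simp]: "L2 (%x. 0)" by (simp add: L2_def)

lemma nrm2_zero [simp]: "nrm2 (%x. 0) = 0" by (simp add: nrm2_def)

lemma L2_prod_integrable:
 assumes "L2 u" "L2 v" shows "integrable lebesgue (%x. u x * v x)"
proof -
 have "integrable lebesgue (%x. (u x)\<^sup>2 + (v x)\<^sup>2)" using assms by (simp add: L2_def)
 then show ?thesis
 proof (rule Bochner_Integration.integrable_bound)
  show "(%x. u x * v x) \<in> borel_measurable lebesgue" using assms by (auto simp: L2_def)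
  show "AE x in lebesgue. norm (u x * v x) <= norm ((u x)\<^sup>2 + (v x)\<^sup>2)"
  proof (rule AE_I2)
   fix x
   have "2 * (\<bar>u x\<bar> * \<bar>v x\<bar>) <= (u x)\<^sup>2 + (v x)\<^sup>2"
    using sum_squares_bound[of "\<bar>u x\<bar>" "\<bar>v x\<bar>"] by simp
   moreover have "0 <= \<bar>u x\<bar> * \<bar>v x\<bar>" by simp
   ultimately have "\<bar>u x\<bar> * \<bar>v x\<bar> <= (u x)\<^sup>2 + (v x)\<^sup>2" by linarith
   then show "norm (u x * v x) <= norm ((u x)\<^sup>2 + (v x)\<^sup>2)" by (simp add: abs_mult)
  qed
 qed
qed

lemma L2_cmult: "L2 u ==> L2 (%x. c * u x)"
 by (rule L2_bound[of u _ "\<bar>c\<bar>"]) (auto simp: L2_def abs_mult)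

lemma L2_uminus: "L2 u ==> L2 (%x. - u x)"
 using L2_cmult[of u "-1"] by simp

lemma L2_add:
 assumes "L2 u" "L2 v" shows "L2 (%x. u x + v x)"
proof -
 have "(u x + v x)\<^sup>2 = (u x)\<^sup>2 + 2 * (u x * v x) + (v x)\<^sup>2" for x
  by (simp add: power2_eq_square algebra_simps)
 moreover have "(%x. u x + v x) \<in> borel_measurable lebesgue" using assms by (auto simp: L2_def)
 ultimately show ?thesis using assms L2_prod_integrable[OF assms] by (simp add: L2_def)
qed

lemma L2_diff:
 assumes "L2 u" "L2 v" shows "L2 (%x. u x - v x)"
 using L2_add[OF assms(1) L2_uminus[OF assms(2)]] by simp

lemma L2_sum:
 assumes "!!i. i \<in> I ==> L2 (f i)" shows "L2 (%x. \<Sum>i\<in>I. f i x)"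
 using assms by (induction I rule: infinite_finite_induct) (auto intro: L2_add)

lemma L2_abs: "L2 u ==> L2 (%x. \<bar>u x\<bar>)"
 by (rule L2_bound[of u _ 1]) (auto simp: L2_def)

lemma L2_mult_bdd:
 assumes "L2 u" "ph \<in> borel_measurable lebesgue" "!!x. \<bar>ph x\<bar> <= C"
 shows "L2 (%x. ph x * u x)"
 by (rule L2_bound[OF assms(1), of _ C]) (use assms in \<open>auto simp: L2_def abs_mult intro!: mult_right_mono\<close>)

lemma L2_indicator_mult:
 assumes "L2 u" "A \<in> sets lebesgue"
 shows "L2 (%x. indicator A x * u x)"
 by (rule L2_mult_bdd[OF assms(1), of _ 1]) (use assms in \<open>auto split: split_indicator\<close>)

lemma L2_affine: "c ~= 0 ==> L2 u ==> L2 (%x. u (t + c *\<^sub>R x))"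
 unfolding L2_def using affine_integrable[of c "%x. (u x)\<^sup>2" t] affine_borel by auto

lemma L2_shift: "L2 u ==> L2 (%x. u (x + y))"
 using L2_affine[of 1 u y] by (simp add: add.commute)

lemma nrm2_affine:
 fixes u :: "'a::euclidean_space => real"
 shows "c ~= 0 ==> L2 u ==> nrm2 (%x. u (t + c *\<^sub>R x)) = nrm2 u / \<bar>c\<bar> ^ DIM('a)"
 unfolding nrm2_def using affine_integral[of c "%x. (u x)\<^sup>2" t] by (auto simp: L2_def)

lemma nrm2_shift: "L2 u ==> nrm2 (%x. u (x + y)) = nrm2 u"
 using nrm2_affine[of 1 u y] by (simp add: add.commute)

lemma nrm2_cmult: "nrm2 (%x. c * u x) = c\<^sup>2 * nrm2 u"
 by (simp add: nrm2_def power_mult_distrib)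

lemma ip_commute: "ip u v = ip v u" by (simp add: ip_def mult.commute)

lemma nrm2_add:
 assumes "L2 u" "L2 v"
 shows "nrm2 (%x. u x + v x) = nrm2 u + 2 * ip u v + nrm2 v"
proof -
 have "(u x + v x)\<^sup>2 = (u x)\<^sup>2 + 2 * (u x * v x) + (v x)\<^sup>2" for x
  by (simp add: power2_eq_square algebra_simps)
 then show ?thesis using assms L2_prod_integrable[OF assms]
  by (simp add: L2_def nrm2_def ip_def)
qed

lemma ip_uminus: "ip u (%x. - v x) = - ip u v"
 by (simp add: ip_def)

lemma nrm2_uminus: "nrm2 (%x. - v x) = nrm2 v"
 by (simp add: nrm2_def)

lemma nrm2_diff:
 assumes "L2 u" "L2 v"
 shows "nrm2 (%x. u x - v x) = nrm2 u - 2 * ip u v + nrm2 v"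
 using nrm2_add[OF assms(1) L2_uminus[OF assms(2)]] by (simp add: ip_uminus nrm2_uminus)

lemma nrm2_diff_commute: "nrm2 (%x. u x - v x) = nrm2 (%x. v x - u x)"
 unfolding nrm2_def by (simp add: power2_commute)

lemma nrm2_parallelogram:
 assumes "L2 u" "L2 v"
 shows "nrm2 (%x. u x + v x) + nrm2 (%x. u x - v x) = 2 * nrm2 u + 2 * nrm2 v"
 using nrm2_add[OF assms] nrm2_diff[OF assms] by simp

lemma ip_add_left: "L2 u ==> L2 v ==> L2 w ==> ip (%x. u x + v x) w = ip u w + ip v w"
 unfolding ip_def by (simp add: distrib_right L2_prod_integrable)

lemma ip_diff_left: "L2 u ==> L2 v ==> L2 w ==> ip (%x. u x - v x) w = ip u w - ip v w"
 unfolding ip_def by (simp add: left_diff_distrib L2_prod_integrable)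

lemma ip_cmult_left: "ip (%x. c * u x) w = c * ip u w"
 unfolding ip_def by (simp add: mult.assoc)

lemma ip_sum_left:
 assumes "!!i. i \<in> I ==> L2 (f i)" "L2 w"
 shows "ip (%x. \<Sum>i\<in>I. f i x) w = (\<Sum>i\<in>I. ip (f i) w)"
 using assms unfolding ip_def
 by (simp add: sum_distrib_right Bochner_Integration.integral_sum L2_prod_integrable)

lemma ip_self: "ip u u = nrm2 u" by (simp add: ip_def nrm2_def power2_eq_square)

text \<open>The polynomial in t given by the squared norm of \<open>u + t v\<close> is nonnegative
  and is evaluated at its minimum.\<close>

lemma cauchy_schwarz2:
 assumes u: "L2 u" and v: "L2 v"
 shows "(ip u v)\<^sup>2 <= nrm2 u * nrm2 v"
proof -
 have *: "0 <= nrm2 u + 2 * t * ip u v + t\<^sup>2 * nrm2 v" for t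
  using nrm2_add[OF u L2_cmult[OF v, of t]] nrm2_nonneg[of "%x. u x + t * v x"]
  by (simp add: nrm2_cmult ip_commute[of u] ip_cmult_left)
 show ?thesis
 proof (cases "nrm2 v = 0")
  case True
  have "ip u v = 0"
  proof (rule ccontr)
   assume n: "ip u v ~= 0"
   \<comment> \<open>A nonnegative affine function of t is constant; this t would give it the value
     -1.\<close>
   have "0 <= nrm2 u + 2 * (- (nrm2 u + 1) / (2 * ip u v)) * ip u v"
    using *[of "- (nrm2 u + 1) / (2 * ip u v)"] True by simp
   also have "... = -1" using n by (simp add: field_simps)
   finally show False by simp
  qed
  then show ?thesis using True by simp
 next
  case False
  then have p: "nrm2 v > 0" using nrm2_nonneg[of v] by linarith
  have "0 <= nrm2 u + 2 * (- ip u v / nrm2 v) * ip u v + (- ip u v / nrm2 v)\<^sup>2 * nrm2 v" by (rule *)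
  also have "... = nrm2 u - (ip u v)\<^sup>2 / nrm2 v" using p by (simp add: field_simps power2_eq_square)
  finally show ?thesis using p by (simp add: field_simps)
 qed
qed

lemma cauchy_schwarz:
 assumes "L2 u" "L2 v" shows "\<bar>ip u v\<bar> <= nrm u * nrm v"
 using cauchy_schwarz2[OF assms] unfolding nrm_def real_sqrt_mult[symmetric]
 by (metis real_sqrt_abs real_sqrt_le_iff)

lemma nrm_add:
 assumes "L2 u" "L2 v" shows "nrm (%x. u x + v x) <= nrm u + nrm v"
proof (rule power2_le_imp_le)
 show "(nrm (%x. u x + v x))\<^sup>2 <= (nrm u + nrm v)\<^sup>2"
  using cauchy_schwarz[OF assms] nrm2_add[OF assms] by (simp add: power2_sum nrm_sq)
qed simp

lemma nrm_uminus: "nrm (%x. - u x) = nrm u" by (simp add: nrm_def nrm2_uminus)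

lemma nrm_cmult: "nrm (%x. c * u x) = \<bar>c\<bar> * nrm u"
 by (simp add: nrm_def nrm2_cmult real_sqrt_mult)

lemma nrm_diff:
 assumes "L2 u" "L2 v" shows "nrm (%x. u x - v x) <= nrm u + nrm v"
 using nrm_add[OF assms(1) L2_uminus[OF assms(2)]] by (simp add: nrm_uminus)

lemma nrm_diff_commute: "nrm (%x. u x - v x) = nrm (%x. v x - u x)"
 by (simp add: nrm_def nrm2_diff_commute[of u])

lemma nrm_triangle:
 assumes "L2 u" "L2 v" "L2 w"
 shows "nrm (%x. u x - w x) <= nrm (%x. u x - v x) + nrm (%x. v x - w x)"
 using nrm_add[OF L2_diff[OF assms(1,2)] L2_diff[OF assms(2,3)]] by simp

lemma nrm_diff_rev:
 assumes "L2 u" "L2 v" shows "\<bar>nrm u - nrm v\<bar> <= nrm (%x. u x - v x)"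
 using nrm_add[OF L2_diff[OF assms] assms(2)] nrm_add[OF L2_diff[OF assms(2,1)] assms(1)]
  nrm_diff_commute[of u v] by simp

lemma nrm_sum:
 assumes "finite I" "!!i. i \<in> I ==> L2 (f i)"
 shows "nrm (%x. \<Sum>i\<in>I. f i x) <= (\<Sum>i\<in>I. nrm (f i))"
 using assms
proof (induction I)
 case empty then show ?case by (simp add: nrm_def)
next
 case (insert a I)
 have "nrm (%x. f a x + (\<Sum>i\<in>I. f i x)) <= nrm (f a) + nrm (%x. \<Sum>i\<in>I. f i x)"
  using insert by (intro nrm_add L2_sum) auto
 then show ?case using insert by simp
qed

lemma nrm2_eq_0:
 assumes "L2 u" shows "nrm2 u = 0 \<longleftrightarrow> (AE x in lebesgue. u x = 0)"
 unfolding nrm2_def using assms by (subst integral_nonneg_eq_0_iff_AE) (auto simp: L2_def)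

lemma nn_integral_nrm2:
 assumes "L2 u" shows "(\<integral>\<^sup>+x. ennreal ((u x)\<^sup>2) \<partial>lebesgue) = ennreal (nrm2 u)"
 unfolding nrm2_def using assms by (intro nn_integral_eq_integral) (auto simp: L2_def)

lemma L2_nn:
 assumes "u \<in> borel_measurable lebesgue" "(\<integral>\<^sup>+x. ennreal ((u x)\<^sup>2) \<partial>lebesgue) <= ennreal C" "0 <= C"
 shows "L2 u" "nrm2 u <= C"
proof -
 show l: "L2 u" unfolding L2_def
 proof (intro conjI assms(1) integrableI_bounded)
  show "(%x. (u x)\<^sup>2) \<in> borel_measurable lebesgue" using assms(1) by auto
  show "(\<integral>\<^sup>+x. ennreal (norm ((u x)\<^sup>2)) \<partial>lebesgue) < \<infinity>"
   using assms(2) by (simp add: order.strict_trans1)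
 qed
 show "nrm2 u <= C" using nn_integral_nrm2[OF l] assms(2,3) by (simp)
qed

section \<open>Fatou, completeness and almost everywhere convergence\<close>

lemma fatou_nrm2:
 assumes L: "!!i. L2 (g i)" and m: "f \<in> borel_measurable lebesgue"
  and ae: "AE x in lebesgue. (%i. g i x) ----> f x"
  and b: "!!i. nrm2 (g i) <= C i" and C: "C ----> c"
 shows "L2 f" "nrm2 f <= c"
proof -
 have Cn: "0 <= C i" for i using b[of i] nrm2_nonneg[of "g i"] by linarith
 have c0: "0 <= c" using Cn C by (meson LIMSEQ_le_const)
 have "(\<integral>\<^sup>+x. ennreal ((f x)\<^sup>2) \<partial>lebesgue) = (\<integral>\<^sup>+x. liminf (%i. ennreal ((g i x)\<^sup>2)) \<partial>lebesgue)"
 proof (rule nn_integral_cong_AE)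
  show "AE x in lebesgue. ennreal ((f x)\<^sup>2) = liminf (%i. ennreal ((g i x)\<^sup>2))"
   using ae
  proof eventually_elim
   case (elim x)
   have "(%i. ennreal ((g i x)\<^sup>2)) ----> ennreal ((f x)\<^sup>2)" by (intro tendsto_ennrealI tendsto_power elim)
   then show ?case by (rule lim_imp_Liminf[OF sequentially_bot, symmetric])
  qed
 qed
 also have "... <= liminf (%i. \<integral>\<^sup>+x. ennreal ((g i x)\<^sup>2) \<partial>lebesgue)"
  using L by (intro nn_integral_liminf) (auto simp: L2_def)
 also have "... <= liminf (%i. ennreal (C i))"
  using b L by (intro Liminf_mono always_eventually) (auto simp: nn_integral_nrm2 ennreal_leI)
 also have "... = ennreal c" using C by (intro lim_imp_Liminf tendsto_ennrealI) auto
 finally have *: "(\<integral>\<^sup>+x. ennreal ((f x)\<^sup>2) \<partial>lebesgue) <= ennreal c" .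
 show "L2 f" "nrm2 f <= c" using L2_nn[OF m * c0] by auto
qed

lemma fatou_nrm:
 assumes L: "!!i. L2 (g i)" and m: "f \<in> borel_measurable lebesgue"
  and ae: "AE x in lebesgue. (%i. g i x) ----> f x"
  and b: "!!i. nrm (g i) <= C i" and C: "C ----> c"
 shows "L2 f" "nrm f <= c"
proof -
 have b2: "nrm2 (g i) <= (C i)\<^sup>2" for i using power_mono[OF b[of i], of 2] by (simp add: nrm_sq)
 note * = fatou_nrm2[OF L m ae b2 tendsto_power[OF C]]
 have Cn: "0 <= C i" for i using b[of i] nrm_nonneg[of "g i"] by linarith
 have c0: "0 <= c" using Cn C by (meson LIMSEQ_le_const)
 show "L2 f" using * by simp
 show "nrm f <= c" using *(2) c0 unfolding nrm_def by (simp add: real_le_lsqrt)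
qed

lemma rapid_subseq:
 fixes P :: "nat => nat => nat => bool"
 assumes "!!i. \<exists>N. \<forall>m\<ge>N. \<forall>n\<ge>N. P i m n"
 obtains r :: "nat => nat" where "strict_mono r" "!!i m n. m \<ge> r i ==> n \<ge> r i ==> P i m n"
proof -
 obtain N where N: "!!i m n. m \<ge> N i ==> n \<ge> N i ==> P i m n" using assms by metis
 \<comment> \<open>The summand i makes r strictly increasing, the sum makes it dominate the
   threshold \<open>N i\<close>.\<close>
 define r where "r i = i + (\<Sum>j\<le>i. N j)" for i
 have "strict_mono r" by (rule strict_monoI_Suc) (simp add: r_def)
 moreover have "N i <= r i" for i
  using member_le_sum[of i "{..i}" N] by (simp add: r_def)
 ultimately show ?thesis using that[of r] N by (meson le_trans)
qed

text \<open>Riesz-Fischer in local form. The Cauchy property is known only on each set of an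
  exhaustion, while the bound \<open>C\<close> is global and makes the limit globally square
  integrable. Along a rapid subsequence the i-th step is controlled on \<open>S i\<close>, and every
  point lies in all late \<open>S i\<close>.\<close>

lemma L2loc_complete:
 fixes f :: "nat => 'a::euclidean_space => real"
 assumes L: "!!n. L2 (f n)" and S: "!!n. S n \<in> sets lebesgue" "incseq S" "(\<Union>n. S n) = UNIV"
  and b: "!!n. nrm2 (f n) <= C"
  and cau: "!!R e. 0 < e ==> \<exists>N. \<forall>m\<ge>N. \<forall>n\<ge>N. nrm (%x. indicator (S R) x * (f m x - f n x)) < e"
 obtains r g where "strict_mono r" "L2 g" "nrm2 g <= C" "AE x in lebesgue. (%n. f (r n) x) ----> g x"
  "!!R. (%n. nrm (%x. indicator (S R) x * (f n x - g x))) ----> 0"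
proof -
 have "\<exists>N. \<forall>m\<ge>N. \<forall>n\<ge>N. nrm (%x. indicator (S i) x * (f m x - f n x)) < (1/4)^i" for i
  by (rule cau) simp
 then obtain r where r: "strict_mono r"
  "!!i m n. m \<ge> r i ==> n \<ge> r i ==> nrm (%x. indicator (S i) x * (f m x - f n x)) < (1/4)^i"
  by (rule rapid_subseq[of "%i m n. nrm (%x. indicator (S i) x * (f m x - f n x)) < (1/4)^i"]) auto
 define h where "h i x = indicator (S i) x * (f (r i) x - f (r (Suc i)) x)" for i x
 have hL: "L2 (h i)" for i unfolding h_def by (intro L2_indicator_mult L2_diff L S)
 have hm: "h i \<in> borel_measurable lebesgue" for i using hL[of i] by (rule L2_meas)
 have hm2: "(%x. ennreal (4^i * (h i x)\<^sup>2)) \<in> borel_measurable lebesgue" for i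
  by (intro measurable_compose[OF _ measurable_ennreal] borel_measurable_times borel_measurable_const borel_measurable_power hm)
 have hm3: "(%x. ennreal ((h i x)\<^sup>2)) \<in> borel_measurable lebesgue" for i
  by (intro measurable_compose[OF _ measurable_ennreal] borel_measurable_power hm)
 \<comment> \<open>The decay 16^-i survives the weight 4^i in the series below; finiteness of that
   series almost everywhere forces increments under 2^-i eventually.\<close>
 have hn: "nrm2 (h i) <= (1/16)^i" for i
 proof -
  have "nrm (h i) < (1/4)^i" unfolding h_def using r(1) by (intro r(2)) (auto simp: strict_mono_less_eq)
  then have "(nrm (h i))\<^sup>2 <= ((1/4)^i)\<^sup>2" by (intro power_mono) auto
  also have "... = (1/16)^i" by (simp add: power2_eq_square power_mult_distrib[symmetric])
  finally show ?thesis by (simp add: nrm_sq)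
 qed
 have "(\<integral>\<^sup>+x. (\<Sum>i. ennreal (4^i * (h i x)\<^sup>2)) \<partial>lebesgue) = (\<Sum>i. \<integral>\<^sup>+x. ennreal (4^i * (h i x)\<^sup>2) \<partial>lebesgue)"
  by (intro nn_integral_suminf hm2)
 also have "... = (\<Sum>i. ennreal (4^i * nrm2 (h i)))"
 proof (rule arg_cong[where f=suminf], rule ext)
  fix i
  have "(\<integral>\<^sup>+x. ennreal (4^i * (h i x)\<^sup>2) \<partial>lebesgue) = (\<integral>\<^sup>+x. ennreal (4^i) * ennreal ((h i x)\<^sup>2) \<partial>lebesgue)"
   by (rule nn_integral_cong) (rule ennreal_mult, auto)
  also have "... = ennreal (4^i) * ennreal (nrm2 (h i))"
   by (subst nn_integral_cmult[OF hm3]) (rule arg_cong[OF nn_integral_nrm2[OF hL]])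
  also have "... = ennreal (4^i * nrm2 (h i))" by (rule ennreal_mult[symmetric]) auto
  finally show "(\<integral>\<^sup>+x. ennreal (4^i * (h i x)\<^sup>2) \<partial>lebesgue) = ennreal (4^i * nrm2 (h i))" .
 qed
 also have "... <= (\<Sum>i. ennreal ((1/4)^i))"
 proof (intro suminf_le summableI ennreal_leI)
  fix i :: nat
  have "4^i * nrm2 (h i) <= 4^i * (1/16)^i" using hn[of i] by (intro mult_left_mono) auto
  also have "... = (1/4::real)^i" by (simp add: power_mult_distrib[symmetric])
  finally show "4^i * nrm2 (h i) <= (1/4)^i" .
 qed
 also have "... = ennreal (\<Sum>i. (1/4)^i)" by (intro suminf_ennreal2) (auto intro: summable_geometric)
 finally have "(\<integral>\<^sup>+x. (\<Sum>i. ennreal (4^i * (h i x)\<^sup>2)) \<partial>lebesgue) ~= \<infinity>"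
  by (auto simp: top_unique)
 then have ae1: "AE x in lebesgue. (\<Sum>i. ennreal (4^i * (h i x)\<^sup>2)) ~= \<infinity>"
  by (intro nn_integral_PInf_AE borel_measurable_suminf_order hm2)
 define g where "g x = lim (%n. f (r n) x)" for x
 have gm: "g \<in> borel_measurable lebesgue"
  unfolding g_def using L by (intro borel_measurable_lim_metric) (auto simp: L2_def)
 have ae: "AE x in lebesgue. (%n. f (r n) x) ----> g x"
  using ae1
 proof eventually_elim
  case (elim x)
  have s: "summable (%i. 4^i * (h i x)\<^sup>2)" by (rule summable_suminf_not_top) (use elim in auto)
  obtain R where R: "x \<in> S R" using S(3) by blast
  have "(%i. 4^i * (h i x)\<^sup>2) ----> 0" by (rule summable_LIMSEQ_zero[OF s])
  then have "\<forall>\<^sub>F i in sequentially. 4^i * (h i x)\<^sup>2 < 1" by (rule order_tendstoD) simp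
  then have ev: "\<forall>\<^sub>F i in sequentially. norm (f (r (Suc i)) x - f (r i) x) <= (1/2)^i"
   using eventually_ge_at_top[of R]
  proof eventually_elim
   case (elim i)
   have "x \<in> S i" using R elim(2) S(2) by (meson incseqD subsetD)
   then have "4^i * (f (r i) x - f (r (Suc i)) x)\<^sup>2 < 1" using elim(1) by (simp add: h_def)
   moreover have q: "((1/2::real)^i)\<^sup>2 = 1 / 4^i" by (simp add: power2_eq_square power_divide power_mult_distrib[symmetric])
   ultimately have "(f (r i) x - f (r (Suc i)) x)\<^sup>2 <= ((1/2)^i)\<^sup>2"
    using q by (simp add: field_simps)
   then have "\<bar>f (r i) x - f (r (Suc i)) x\<bar> <= \<bar>(1/2)^i\<bar>" by (simp only: abs_le_square_iff)
   then show ?case by (simp add: abs_minus_commute)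
  qed
  have "summable (%i. f (r (Suc i)) x - f (r i) x)"
   by (rule summable_comparison_test_ev[where g="%i. (1/2)^i"])
    (use ev in \<open>auto intro: summable_geometric\<close>)
  then have "(%n. \<Sum>i<n. f (r (Suc i)) x - f (r i) x) ----> (\<Sum>i. f (r (Suc i)) x - f (r i) x)"
   by (simp add: summable_LIMSEQ)
  then have "(%n. f (r n) x - f (r 0) x) ----> (\<Sum>i. f (r (Suc i)) x - f (r i) x)"
   using sum_lessThan_telescope[of "%i. f (r i) x"] by simp
  then have "(%n. f (r n) x - f (r 0) x + f (r 0) x) ----> (\<Sum>i. f (r (Suc i)) x - f (r i) x) + f (r 0) x"
   by (intro tendsto_add tendsto_const)
  then have "convergent (%n. f (r n) x)" by (auto simp: convergent_def)
  then show ?case by (simp add: g_def convergent_LIMSEQ_iff)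
 qed
 have gL: "L2 g" "nrm2 g <= C" using fatou_nrm2[OF L gm ae b tendsto_const] by auto
 have "(%n. nrm (%x. indicator (S R) x * (f n x - g x))) ----> 0" for R
 proof (rule LIMSEQ_I)
  fix e :: real assume e: "0 < e"
  obtain N where N: "!!m n. m \<ge> N ==> n \<ge> N ==> nrm (%x. indicator (S R) x * (f m x - f n x)) < e/2"
   using cau[of "e/2" R] e by auto
  have "nrm (%x. indicator (S R) x * (f n x - g x)) <= e/2" if n: "n \<ge> N" for n
  proof (rule fatou_nrm(2)[where g="%i x. indicator (S R) x * (f n x - f (r (i + N)) x)" and C="%_. e/2"])
   show "L2 (%x. indicator (S R) x * (f n x - f (r (i + N)) x))" for i
    by (intro L2_indicator_mult L2_diff L S)
   show "(%x. indicator (S R) x * (f n x - g x)) \<in> borel_measurable lebesgue"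
    by (intro L2_meas L2_indicator_mult L2_diff L S gL)
   show "AE x in lebesgue. (%i. indicator (S R) x * (f n x - f (r (i + N)) x)) ----> indicator (S R) x * (f n x - g x)"
    using ae by eventually_elim (intro tendsto_intros LIMSEQ_ignore_initial_segment[of "%i. f (r i) _"])
   show "nrm (%x. indicator (S R) x * (f n x - f (r (i + N)) x)) <= e / 2" for i
    using N[of n "r (i+N)"] n seq_suble[OF r(1), of "i+N"] by (simp add: less_imp_le)
  qed simp
  then show "\<exists>no. \<forall>n\<ge>no. norm (nrm (%x. indicator (S R) x * (f n x - g x)) - 0) < e"
   using e by (intro exI[of _ N]) (auto intro: order.strict_trans1[of _ "e/2"])
 qed
 then show ?thesis using that[OF r(1) gL ae] by blast
qed

lemma L2_complete:
 fixes f :: "nat => 'a::euclidean_space => real"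
 assumes L: "!!n. L2 (f n)" and b: "!!n. nrm2 (f n) <= C"
  and cau: "!!e. 0 < e ==> \<exists>N. \<forall>m\<ge>N. \<forall>n\<ge>N. nrm (%x. f m x - f n x) < e"
 obtains r g where "strict_mono r" "L2 g" "nrm2 g <= C" "AE x in lebesgue. (%n. f (r n) x) ----> g x"
  "(%n. nrm (%x. f n x - g x)) ----> 0"
 using L2loc_complete[of f "%_. UNIV" C thesis] assms by (auto simp: incseq_def)

text \<open>Completeness applied to the differences \<open>f n - g\<close>; their almost everywhere
  limit has norm zero by Fatou.\<close>

lemma L2_conv_AE_subseq:
 fixes f :: "nat => 'a::euclidean_space => real"
 assumes L: "!!n. L2 (f n)" "L2 g" and c: "(%n. nrm (%x. f n x - g x)) ----> 0"
 obtains r where "strict_mono r" "AE x in lebesgue. (%n. f (r n) x) ----> g x"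
proof -
 have cau: "\<exists>N. \<forall>m\<ge>N. \<forall>n\<ge>N. nrm (%x. (f m x - g x) - (f n x - g x)) < e" if e: "0 < e" for e
 proof -
  have "\<forall>\<^sub>F n in sequentially. nrm (%x. f n x - g x) < e/2" using c e by (intro order_tendstoD) auto
  then obtain N where N: "!!n. n \<ge> N ==> nrm (%x. f n x - g x) < e/2" by (auto simp: eventually_sequentially)
  show ?thesis
  proof (intro exI allI impI)
   fix m n assume "m \<ge> N" "n \<ge> N"
   then show "nrm (%x. (f m x - g x) - (f n x - g x)) < e"
    using N[of m] N[of n] nrm_diff[OF L2_diff[OF L(1)[of m] L(2)] L2_diff[OF L(1)[of n] L(2)]] by linarith
  qed
 qed
 have "Bseq (%n. nrm (%x. f n x - g x))" using c by (simp add: convergentI convergent_imp_Bseq)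
 then obtain K where K: "!!n. nrm (%x. f n x - g x) <= K" by (auto simp: Bseq_def)
 have b: "nrm2 (%x. f n x - g x) <= K\<^sup>2" for n using power_mono[OF K[of n], of 2] by (simp add: nrm_sq)
 obtain r w where w: "strict_mono r" "L2 w" "AE x in lebesgue. (%n. f (r n) x - g x) ----> w x"
  by (rule L2_complete[of "%n x. f n x - g x" "K\<^sup>2"]) (use L cau b in \<open>auto intro: L2_diff\<close>)
 have "nrm w <= 0"
 proof (rule fatou_nrm(2)[OF _ _ w(3)])
  show "L2 (%x. f (r i) x - g x)" for i by (intro L2_diff L)
  show "w \<in> borel_measurable lebesgue" using w by (simp add: L2_def)
  show "nrm (%x. f (r i) x - g x) <= nrm (%x. f (r i) x - g x)" for i by simp
  show "(%i. nrm (%x. f (r i) x - g x)) ----> 0" using LIMSEQ_subseq_LIMSEQ[OF c w(1)] by (simp add: o_def)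
 qed
 then have "nrm2 w = 0" using nrm_sq[of w] nrm_nonneg[of w] by (metis antisym power_zero_numeral)
 then have w0: "AE x in lebesgue. w x = 0" using nrm2_eq_0[OF w(2)] by simp
 have "AE x in lebesgue. (%n. f (r n) x) ----> g x"
  using w(3) w0
 proof eventually_elim
  case (elim x)
  then have "(%n. f (r n) x - g x + g x) ----> 0 + g x" by (intro tendsto_add tendsto_const) simp
  then show ?case by simp
 qed
 then show ?thesis using that[OF w(1)] by blast
qed

lemma dominated_nrm:
 fixes f :: "nat => 'a::euclidean_space => real"
 assumes m: "!!n. f n \<in> borel_measurable lebesgue" and w: "L2 w"
  and ae: "AE x in lebesgue. (%n. f n x) ----> 0" and d: "!!n. AE x in lebesgue. \<bar>f n x\<bar> <= \<bar>w x\<bar>"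
 shows "(%n. nrm (f n)) ----> 0"
proof -
 have "(%n. LINT x|lebesgue. (f n x)\<^sup>2) ----> (\<integral>x. 0 \<partial>(lebesgue :: 'a measure))"
 proof (rule integral_dominated_convergence[where w="%x. (w x)\<^sup>2"])
  show "(%x::'a. 0::real) \<in> borel_measurable lebesgue" by simp
  show "(%x. (f n x)\<^sup>2) \<in> borel_measurable lebesgue" for n using m by auto
  show "integrable lebesgue (%x. (w x)\<^sup>2)" using w by (simp add: L2_def)
  show "AE x in lebesgue. (%n. (f n x)\<^sup>2) ----> 0"
   using ae
  proof eventually_elim
   case (elim x)
   then show ?case using tendsto_power[OF elim, of 2] by simp
  qed
  show "AE x in lebesgue. norm ((f n x)\<^sup>2) <= (w x)\<^sup>2" for n using d[of n] by (auto simp: abs_le_square_iff)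
 qed
 then have "(%n. sqrt (nrm2 (f n))) ----> sqrt 0" unfolding nrm2_def by (intro tendsto_real_sqrt) simp
 then show ?thesis by (simp add: nrm_def)
qed

subsection \<open>A smooth bump function\<close>

text \<open>The derivatives of exp(-1/t), extended by zero, are combinations of these functions:
  dividing by powers of t keeps the family closed under differentiation, also at t = 0.\<close>

definition psi :: "nat => real => real" where
 "psi n t = (if t > 0 then exp (- (1/t)) / t ^ n else 0)"

lemma psi_tendsto_0: "(psi n \<longlongrightarrow> 0) (at_right 0)"
proof -
 have "((%t. (inverse t) ^ n / exp (inverse t)) \<longlongrightarrow> 0) (at_right (0::real))"
  using filterlim_compose[OF tendsto_power_div_exp_0 filterlim_inverse_at_top_right] .
 moreover have "\<forall>\<^sub>F t in at_right (0::real). (inverse t) ^ n / exp (inverse t) = psi n t"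
  unfolding eventually_at_filter by (auto simp: psi_def exp_minus field_simps)
 ultimately show ?thesis by (rule Lim_transform_eventually)
qed

lemma psi_deriv: "(psi n has_real_derivative (psi (n+2) t - real n * psi (n+1) t)) (at t)"
proof -
 consider "t > 0" | "t < 0" | "t = 0" by linarith
 then show ?thesis
 proof cases
  case 1
  have "((%t. exp (- (1/t)) / t ^ n) has_real_derivative (psi (n+2) t - real n * psi (n+1) t)) (at t)"
  proof -
   have a: "((%t. exp (- (1/t))) has_real_derivative exp (- (1/t)) * (1/t\<^sup>2)) (at t)"
    using 1 by (auto intro!: derivative_eq_intros simp: power2_eq_square)
   have b: "((%t. 1/t) has_real_derivative (- (1/t\<^sup>2))) (at t)"
    using 1 by (auto intro!: derivative_eq_intros simp: power2_eq_square)
   have "exp (- (1/t)) * (1/t\<^sup>2) * (1/t)^n + of_nat n * (- (1/t\<^sup>2) * (1/t)^(n - Suc 0)) * exp (- (1/t))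
    = psi (n+2) t - real n * psi (n+1) t"
    using 1 by (cases n) (auto simp: psi_def field_simps power2_eq_square)
   from DERIV_cong[OF DERIV_mult[OF a DERIV_power[OF b, of n]] this]
   show ?thesis by (simp add: power_one_over)
  qed
  moreover have "\<forall>\<^sub>F x in nhds t. exp (- (1/x)) / x ^ n = psi n x"
   using eventually_nhds_in_open[of "{0<..}" t] 1 by (auto simp: psi_def elim!: eventually_mono)
  ultimately show ?thesis
   by (subst DERIV_cong_ev[OF refl _ refl, of _ "%t. exp (- (1/t)) / t ^ n"]) (auto elim: eventually_mono)
 next
  case 2
  have "((%_. 0::real) has_real_derivative (psi (n+2) t - real n * psi (n+1) t)) (at t)"
   using 2 by (simp add: psi_def)
  moreover have "\<forall>\<^sub>F x in nhds t. 0 = psi n x"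
   using eventually_nhds_in_open[of "{..<0}" t] 2 by (auto simp: psi_def elim!: eventually_mono)
  ultimately show ?thesis
   by (subst DERIV_cong_ev[OF refl _ refl, of _ "%_. 0"]) (auto elim: eventually_mono)
 next
  case 3
  have "((%h. psi n h / h) \<longlongrightarrow> 0) (at 0)"
  proof (rule filterlim_split_at)
   have "\<forall>\<^sub>F h in at_left (0::real). 0 = psi n h / h" unfolding eventually_at_filter by (auto simp: psi_def)
   then show "((%h. psi n h / h) \<longlongrightarrow> 0) (at_left 0)" by (rule Lim_transform_eventually[OF tendsto_const])
   have "\<forall>\<^sub>F h in at_right (0::real). psi (n+1) h = psi n h / h"
    unfolding eventually_at_filter by (auto simp: psi_def field_simps)
   then show "((%h. psi n h / h) \<longlongrightarrow> 0) (at_right 0)" by (rule Lim_transform_eventually[OF psi_tendsto_0])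
  qed
  then show ?thesis using 3 by (simp add: DERIV_def psi_def)
 qed
qed

text \<open>An algebra that contains the radial bumps around a (here e is a squared radius) and is
  closed under partial derivatives. It is the invariant for the coinductive predicate
  \<open>smooth_fun\<close>, so no formula for higher derivatives has to be written down.\<close>

inductive bcl :: "real => 'a::euclidean_space => ('a => real) => bool" for e a where
 bcl_psi: "bcl e a (%x. psi n (e - (x - a) \<bullet> (x - a)))"
| bcl_const: "bcl e a (%x. c)"
| bcl_inner: "bcl e a (%x. x \<bullet> b)"
| bcl_add: "bcl e a f ==> bcl e a g ==> bcl e a (%x. f x + g x)"
| bcl_mult: "bcl e a f ==> bcl e a g ==> bcl e a (%x. f x * g x)"

lemma bcl_deriv:
 assumes "bcl e a f"
 shows "\<exists>f'. (\<forall>x. (f has_derivative f' x) (at x)) & (\<forall>b. bcl e a (%x. f' x b))"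
 using assms
proof induction
 case (bcl_psi n)
 let ?d = "%t. psi (n+2) t - real n * psi (n+1) t"
 have "((%x. psi n (e - (x - a) \<bullet> (x - a))) has_derivative
   (%h. (- (2 * (h \<bullet> (x - a)))) * ?d (e - (x - a) \<bullet> (x - a)))) (at x)" for x
  by (rule has_derivative_compose[OF _ psi_deriv[unfolded has_field_derivative_def], THEN has_derivative_eq_rhs])
   (auto intro!: derivative_eq_intros simp: inner_commute algebra_simps)
 moreover have "bcl e a (%x. (- (2 * (b \<bullet> (x - a)))) * ?d (e - (x - a) \<bullet> (x - a)))" for b
 proof -
  have "bcl e a (%x. ((-2) * (x \<bullet> b) + (2 * (a \<bullet> b))) *
   (psi (n+2) (e - (x - a) \<bullet> (x - a)) + (- real n) * psi (n+1) (e - (x - a) \<bullet> (x - a))))"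
   by (intro bcl.intros)
  also have "(%x. ((-2) * (x \<bullet> b) + (2 * (a \<bullet> b))) *
   (psi (n+2) (e - (x - a) \<bullet> (x - a)) + (- real n) * psi (n+1) (e - (x - a) \<bullet> (x - a))))
   = (%x. (- (2 * (b \<bullet> (x - a)))) * ?d (e - (x - a) \<bullet> (x - a)))"
   by (rule ext) (simp add: inner_diff_right inner_commute[of b])
  finally show ?thesis .
 qed
 ultimately show ?case
  by (intro exI[of _ "%x b. (- (2 * (b \<bullet> (x - a)))) * ?d (e - (x - a) \<bullet> (x - a))"]) simp
next
 case (bcl_const c)
 then show ?case by (intro exI[of _ "%x h. 0"]) (auto intro: bcl.intros)
next
 case (bcl_inner b)
 then show ?case by (intro exI[of _ "%x h. h \<bullet> b"]) (auto intro: bcl.intros intro!: derivative_eq_intros)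
next
 case (bcl_add f g)
 then obtain f' g' where "\<forall>x. (f has_derivative f' x) (at x)" "\<forall>b. bcl e a (%x. f' x b)"
  "\<forall>x. (g has_derivative g' x) (at x)" "\<forall>b. bcl e a (%x. g' x b)" by auto
 then show ?case
  by (intro exI[of _ "%x h. f' x h + g' x h"]) (auto intro!: bcl.intros derivative_intros)
next
 case (bcl_mult f g)
 then obtain f' g' where "\<forall>x. (f has_derivative f' x) (at x)" "\<forall>b. bcl e a (%x. f' x b)"
  "\<forall>x. (g has_derivative g' x) (at x)" "\<forall>b. bcl e a (%x. g' x b)" by auto
 with bcl_mult(1,2) show ?case
  by (intro exI[of _ "%x h. f x * g' x h + f' x h * g x"]) (auto intro!: bcl.intros derivative_intros)
qed

lemma bcl_partial:
 assumes "bcl e a f"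
 shows "f differentiable (at x)" "bcl e a (partial_deriv f b)"
proof -
 obtain f' where f': "!!x. (f has_derivative f' x) (at x)" "!!b. bcl e a (%x. f' x b)"
  using bcl_deriv[OF assms] by auto
 show "f differentiable (at x)" using f'(1) by (auto simp: differentiable_def)
 have "partial_deriv f b = (%x. f' x b)"
  unfolding partial_deriv_def using frechet_derivative_at[OF f'(1)] by auto
 then show "bcl e a (partial_deriv f b)" using f'(2) by simp
qed

lemma bcl_smooth: "bcl e a f ==> smooth_fun f"
 by (coinduction arbitrary: f) (simp add: bcl_partial)

section \<open>Test functions and their difference quotients\<close>

lemma smooth_fun_differentiable: "smooth_fun f ==> f differentiable (at x)"
 by (erule smooth_fun.cases) auto

lemma smooth_fun_partial: "smooth_fun f ==> b \<in> Basis ==> smooth_fun (partial_deriv f b)"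
 by (erule smooth_fun.cases) auto

lemma smooth_fun_continuous: "smooth_fun f ==> continuous_on UNIV f"
 by (intro continuous_at_imp_continuous_on ballI differentiable_imp_continuous_within smooth_fun_differentiable)

lemma partial_deriv_line:
 assumes "smooth_fun ph"
 shows "((%h. ph (x + h *\<^sub>R b)) has_real_derivative partial_deriv ph b (x + h *\<^sub>R b)) (at h)"
proof -
 let ?F = "frechet_derivative ph (at (x + h *\<^sub>R b))"
 have d: "(ph has_derivative ?F) (at (x + h *\<^sub>R b))"
  using smooth_fun_differentiable[OF assms] frechet_derivative_works by blast
 have "((%h. x + h *\<^sub>R b) has_derivative (%k. k *\<^sub>R b)) (at h)"
  by (auto intro!: derivative_eq_intros)
 from has_derivative_compose[OF this d]
 have "((%h. ph (x + h *\<^sub>R b)) has_derivative (%k. ?F (k *\<^sub>R b))) (at h)" .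
 moreover have "?F (k *\<^sub>R b) = partial_deriv ph b (x + h *\<^sub>R b) * k" for k
  using linear_scale[OF has_derivative_linear[OF d]] by (simp add: partial_deriv_def)
 ultimately show ?thesis by (simp add: has_field_derivative_def)
qed

text \<open>Gathers what dominated convergence needs in one direction b: a common radius for the
  supports and a common constant for size, derivative and Lipschitz bound.\<close>

lemma test_fun_facts:
 assumes "test_fun ph" and b: "b \<in> Basis"
 obtains R K where "0 < R" "0 < K" "!!x. R <= norm x ==> ph x = 0" "!!x. R <= norm x ==> partial_deriv ph b x = 0"
  "!!x. \<bar>ph x\<bar> <= K" "!!x. \<bar>partial_deriv ph b x\<bar> <= K" "!!x h. \<bar>ph (x + h *\<^sub>R b) - ph x\<bar> <= K * \<bar>h\<bar>"
proof -
 have s: "smooth_fun ph" and c: "compact (closure {x. ph x ~= 0})" using assms by (auto simp: test_fun_def)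
 have sd: "smooth_fun (partial_deriv ph b)" by (rule smooth_fun_partial[OF s b])
 obtain R0 where R0: "!!x. x \<in> closure {x. ph x ~= 0} ==> norm x <= R0"
  using compact_imp_bounded[OF c] by (auto simp: bounded_iff)
 define R where "R = \<bar>R0\<bar> + 1"
 have out: "x \<notin> closure {x. ph x ~= 0}" if "R <= norm x" for x using R0[of x] that unfolding R_def by linarith
 have p0: "ph x = 0" if "R <= norm x" for x using out[OF that] closure_subset[of "{x. ph x ~= 0}"] by auto
 have d0: "partial_deriv ph b x = 0" if "R <= norm x" for x
 proof -
  have "(ph has_derivative (%_. 0)) (at x)"
  proof (rule has_derivative_transform_within_open[where f="%_. 0" and s="- closure {x. ph x ~= 0}"])
   show "x \<in> - closure {x. ph x ~= 0}" using out[OF that] by simp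
   show "0 = ph y" if "y \<in> - closure {x. ph x ~= 0}" for y using that closure_subset[of "{x. ph x ~= 0}"] by auto
  qed auto
  from frechet_derivative_at[OF this, symmetric] show ?thesis by (simp add: partial_deriv_def)
 qed
 have bd: "\<exists>K. \<forall>x. \<bar>f x\<bar> <= K" if "continuous_on UNIV f" "!!x. R <= norm x ==> f x = 0" for f :: "'a => real"
 proof -
  have "compact (f ` cball 0 R)" by (intro compact_continuous_image continuous_on_subset[OF that(1)]) auto
  then obtain K where K': "\<forall>x\<in>cball 0 R. \<bar>f x\<bar> <= K"
   using compact_imp_bounded[of "f ` cball 0 R"] by (auto simp: bounded_iff)
  then have K: "\<bar>f x\<bar> <= K" if "norm x <= R" for x using that by simp
  have "\<bar>f x\<bar> <= \<bar>K\<bar>" for x using K[of x] that(2)[of x] by (cases "norm x <= R") auto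
  then show ?thesis by blast
 qed
 obtain K1 where K1: "!!x. \<bar>ph x\<bar> <= K1" using bd[OF smooth_fun_continuous[OF s] p0] by auto
 obtain K2 where K2: "!!x. \<bar>partial_deriv ph b x\<bar> <= K2" using bd[OF smooth_fun_continuous[OF sd] d0] by auto
 define K where "K = \<bar>K1\<bar> + \<bar>K2\<bar> + 1"
 have K: "\<bar>ph x\<bar> <= K" "\<bar>partial_deriv ph b x\<bar> <= K" for x using K1[of x] K2[of x] by (auto simp: K_def)
 have lip: "\<bar>ph (x + h *\<^sub>R b) - ph x\<bar> <= K * \<bar>h\<bar>" for x h
 proof -
  have "norm (ph (x + h *\<^sub>R b) - ph (x + 0 *\<^sub>R b)) <= K * norm (h - 0)"
   by (rule field_differentiable_bound[where S=UNIV and f'="%h. partial_deriv ph b (x + h *\<^sub>R b)"])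
    (use partial_deriv_line[OF s] K in auto)
  then show ?thesis by simp
 qed
 have "0 < R" "0 < K" by (auto simp: R_def K_def)
 then show ?thesis using that[of R K] p0 d0 K lip by blast
qed

lemma indicator_L2:
 assumes "A \<in> sets lebesgue" "emeasure lebesgue A < \<infinity>"
 shows "L2 (%x. indicator A x :: real)"
 unfolding L2_def
proof
 show "(%x. indicator A x :: real) \<in> borel_measurable lebesgue" using assms by auto
 have "integrable lebesgue (indicator A :: 'a => real)" using assms by (simp add: integrable_indicator_iff)
 moreover have "(%x. (indicator A x :: real)\<^sup>2) = indicator A" by (auto split: split_indicator)
 ultimately show "integrable lebesgue (%x. (indicator A x :: real)\<^sup>2)" by simp
qed

lemma cball_L2: "L2 (%x. indicator (cball (a::'a::euclidean_space) R) x :: real)"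
 by (rule indicator_L2) (use emeasure_lborel_cball_finite[of a R] in auto)

lemma bounded_support_L2:
 fixes f :: "'a::euclidean_space => real"
 assumes "f \<in> borel_measurable lebesgue" "!!x. \<bar>f x\<bar> <= K" "!!x. R < norm x ==> f x = 0"
 shows "L2 f"
proof (rule L2_bound[OF cball_L2[of 0 R] assms(1), of K])
 show "AE x in lebesgue. \<bar>f x\<bar> <= K * \<bar>indicat_real (cball 0 R) x\<bar>"
  using assms(2,3) by (intro AE_I2) (auto split: split_indicator simp: not_le)
qed

lemma test_fun_L2:
 assumes "test_fun ph" and b: "b \<in> Basis"
 shows "L2 ph" "L2 (partial_deriv ph b)"
proof -
 have s: "smooth_fun ph" using assms by (auto simp: test_fun_def)
 have sd: "smooth_fun (partial_deriv ph b)" by (rule smooth_fun_partial[OF s b])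
 obtain R K where f: "!!x. R <= norm x ==> ph x = 0" "!!x. R <= norm x ==> partial_deriv ph b x = 0"
  "!!x. \<bar>ph x\<bar> <= K" "!!x. \<bar>partial_deriv ph b x\<bar> <= K"
  by (rule test_fun_facts[OF assms]) blast
 show "L2 ph"
  by (rule bounded_support_L2[of _ K R]) (use f s in \<open>auto intro: continuous_borel_lebesgue smooth_fun_continuous\<close>)
 show "L2 (partial_deriv ph b)"
  by (rule bounded_support_L2[of _ K R]) (use f sd in \<open>auto intro: continuous_borel_lebesgue smooth_fun_continuous\<close>)
qed

lemma difference_quotient_tendsto:
 fixes u :: "'a::euclidean_space => real"
 assumes t: "test_fun ph" and b: "b \<in> Basis" and u: "L2 u"
 shows "((%h. LINT y|lebesgue. u y * ((ph (y + h *\<^sub>R b) - ph y) / h)) \<longlongrightarrow> (LINT y|lebesgue. u y * partial_deriv ph b y)) (at 0)"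
 unfolding tendsto_at_iff_sequentially o_def
proof (intro allI impI)
 fix X :: "nat => real" assume X: "\<forall>i. X i \<in> UNIV - {0}" "X ----> 0"
 have s: "smooth_fun ph" using t by (auto simp: test_fun_def)
 have sd: "smooth_fun (partial_deriv ph b)" by (rule smooth_fun_partial[OF s b])
 obtain R K where R: "0 < R" "0 < K" "!!x. R <= norm x ==> ph x = 0" "!!x h. \<bar>ph (x + h *\<^sub>R b) - ph x\<bar> <= K * \<bar>h\<bar>"
  by (rule test_fun_facts[OF t b]) blast
 have "Bseq X" using X(2) by (simp add: convergentI convergent_imp_Bseq)
 then obtain B where B: "!!n. \<bar>X n\<bar> <= B" by (auto simp: Bseq_def)
 have um: "u \<in> borel_measurable lebesgue" using u by (simp add: L2_meas)
 have pm: "ph \<in> borel_measurable lebesgue" using s by (intro continuous_borel_lebesgue smooth_fun_continuous)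
 show "(%n. LINT y|lebesgue. u y * ((ph (y + X n *\<^sub>R b) - ph y) / X n)) ----> (LINT y|lebesgue. u y * partial_deriv ph b y)"
 \<comment> \<open>Shifts bounded by B keep every quotient supported in the ball of radius R + B,
   where the Lipschitz constant K dominates it.\<close>
 proof (rule integral_dominated_convergence[where w="%y. K * (\<bar>u y\<bar> * indicator (cball 0 (R + B)) y)"])
  show "(%y. u y * partial_deriv ph b y) \<in> borel_measurable lebesgue"
   using um continuous_borel_lebesgue[OF smooth_fun_continuous[OF sd]] by auto
  show "(%y. u y * ((ph (y + X n *\<^sub>R b) - ph y) / X n)) \<in> borel_measurable lebesgue" for n
   using um pm shift_borel[OF pm, of "X n *\<^sub>R b"] by auto
  show "integrable lebesgue (%y. K * (\<bar>u y\<bar> * indicator (cball 0 (R + B)) y))"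
   by (intro integrable_mult_right L2_prod_integrable L2_abs u cball_L2)
  show "AE y in lebesgue. (%n. u y * ((ph (y + X n *\<^sub>R b) - ph y) / X n)) ----> u y * partial_deriv ph b y"
  proof (rule AE_I2)
   fix y
   have "((%h. (ph (y + h *\<^sub>R b) - ph y) / h) \<longlongrightarrow> partial_deriv ph b y) (at 0)"
    using partial_deriv_line[OF s, of y b 0] by (simp add: DERIV_def)
   then have "(%n. (ph (y + X n *\<^sub>R b) - ph y) / X n) ----> partial_deriv ph b y"
    unfolding tendsto_at_iff_sequentially o_def using X by blast
   then show "(%n. u y * ((ph (y + X n *\<^sub>R b) - ph y) / X n)) ----> u y * partial_deriv ph b y"
    by (intro tendsto_mult_left)
  qed
  show "AE y in lebesgue. norm (u y * ((ph (y + X n *\<^sub>R b) - ph y) / X n)) <= K * (\<bar>u y\<bar> * indicator (cball 0 (R + B)) y)" for n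
  proof (rule AE_I2)
   fix y
   have Xn: "X n ~= 0" using X(1) by auto
   show "norm (u y * ((ph (y + X n *\<^sub>R b) - ph y) / X n)) <= K * (\<bar>u y\<bar> * indicator (cball 0 (R + B)) y)"
   proof (cases "norm y <= R + B")
    case True
    have "\<bar>(ph (y + X n *\<^sub>R b) - ph y) / X n\<bar> <= K" using R(4)[of y "X n"] Xn by (simp add: divide_le_eq)
    then have "\<bar>u y\<bar> * \<bar>(ph (y + X n *\<^sub>R b) - ph y) / X n\<bar> <= \<bar>u y\<bar> * K" by (intro mult_left_mono) auto
    then show ?thesis using True by (simp add: abs_mult mult.commute)
   next
    case False
    have n1: "norm (X n *\<^sub>R b) <= B" using B[of n] b by simp
    have "norm y <= norm (y + X n *\<^sub>R b) + norm (X n *\<^sub>R b)"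
     using norm_triangle_ineq4[of "y + X n *\<^sub>R b" "X n *\<^sub>R b"] by simp
    then have "R <= norm (y + X n *\<^sub>R b)" using n1 False by linarith
    moreover have "R <= norm y" using False B[of n] by linarith
    ultimately have "ph (y + X n *\<^sub>R b) = 0" "ph y = 0" using R(3) by auto
    then show ?thesis using R(2) by simp
   qed
  qed
 qed
qed

section \<open>The mollifier and its normalization\<close>

definition eta0 :: "real => 'a::euclidean_space => real" where
 "eta0 e x = psi 0 (e\<^sup>2 - x \<bullet> x)"

definition eta :: "real => 'a::euclidean_space => real" where
 "eta e x = eta0 e x / (LINT y|lebesgue. eta0 e (y::'a))"

lemma eta0_props:
 shows "0 <= eta0 e x" "eta0 e x <= 1" "0 < e ==> eta0 e x ~= 0 \<longleftrightarrow> norm x < e" "eta0 e (- x) = eta0 e x"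
proof -
 show "0 <= eta0 e x" "eta0 e x <= 1" "eta0 e (- x) = eta0 e x" by (auto simp: eta0_def psi_def)
 assume e: "0 < e"
 have "(norm x)\<^sup>2 < e\<^sup>2 \<longleftrightarrow> norm x < e"
  using e power_strict_mono[of "norm x" e 2] power2_less_imp_less[of "norm x" e] by auto
 then show "eta0 e x ~= 0 \<longleftrightarrow> norm x < e" by (simp add: eta0_def psi_def power2_norm_eq_inner)
qed

lemma eta0_bcl: "bcl (e\<^sup>2) a (%y. c * eta0 e (y - a))"
 unfolding eta0_def by (intro bcl.intros)

lemma eta0_continuous: "continuous_on UNIV (eta0 e :: 'a::euclidean_space => real)"
 using smooth_fun_continuous[OF bcl_smooth[OF eta0_bcl[of e 0 1]]] by simp

lemma eta0_pos:
 assumes "0 < e" shows "0 < (LINT y|lebesgue. eta0 e (y::'a::euclidean_space))"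
  "integrable lebesgue (eta0 e :: 'a => real)"
proof -
 have m: "(eta0 e :: 'a => real) \<in> borel_measurable lebesgue" by (rule continuous_borel_lebesgue[OF eta0_continuous])
 have "L2 (eta0 e :: 'a => real)"
 proof (rule bounded_support_L2[OF m, of 1 e])
  show "\<bar>eta0 e x\<bar> <= 1" for x :: 'a using eta0_props(1,2)[of e x] by simp
  show "eta0 e x = 0" if "e < norm x" for x :: 'a using eta0_props(3)[OF assms, of x] that by auto
 qed
 then have "integrable lebesgue (%x::'a. eta0 e x * indicator (cball 0 e) x)"
  by (rule L2_prod_integrable[OF _ cball_L2])
 also have "(%x::'a. eta0 e x * indicator (cball 0 e) x) = eta0 e"
 proof
  fix x :: 'a
  show "eta0 e x * indicator (cball 0 e) x = eta0 e x"
   using eta0_props(3)[OF assms, of x] by (cases "norm x <= e") auto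
 qed
 finally show i: "integrable lebesgue (eta0 e :: 'a => real)" .
 have "(LINT y|lebesgue. eta0 e (y::'a)) ~= 0"
 proof
  assume "(LINT y|lebesgue. eta0 e (y::'a)) = 0"
  then have "AE y in lebesgue. eta0 e (y::'a) = 0"
   using integral_nonneg_eq_0_iff_AE[OF i] eta0_props(1) by auto
  then have "AE y in lebesgue. y \<notin> ball (0::'a) e"
  proof eventually_elim
   case (elim y)
   then show ?case using eta0_props(3)[OF assms, of y] by auto
  qed
  then have "ball (0::'a) e \<in> null_sets lebesgue"
   using AE_iff_null_sets[of "ball (0::'a) e" lebesgue] by simp
  then have "negligible (ball (0::'a) e)" by (simp add: negligible_iff_null_sets)
  then show False using open_not_negligible[of "ball (0::'a) e"] assms by auto
 qed
 moreover have "0 <= (LINT y|lebesgue. eta0 e (y::'a))" by (simp add: eta0_props(1))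
 ultimately show "0 < (LINT y|lebesgue. eta0 e (y::'a))" by linarith
qed

lemma eta_props:
 fixes x :: "'a::euclidean_space"
 assumes "0 < e"
 shows "0 <= eta e x" "eta e (- x) = eta e x" "e <= norm x ==> eta e x = 0"
  "continuous_on UNIV (eta e :: 'a => real)" "integrable lebesgue (eta e :: 'a => real)"
  "(LINT y|lebesgue. eta e (y::'a)) = 1" "\<bar>eta e x\<bar> <= 1 / (LINT y|lebesgue. eta0 e (y::'a))"
proof -
 note p = eta0_pos[OF assms, where 'a='a]
 show "0 <= eta e x" unfolding eta_def using p(1) by (intro divide_nonneg_pos eta0_props)
 show "eta e (- x) = eta e x" by (simp add: eta_def eta0_props)
 show "e <= norm x ==> eta e x = 0" using eta0_props(3)[OF assms, of x] by (auto simp: eta_def)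
 have eq: "(eta e :: 'a => real) = (%x. eta0 e x / (LINT y|lebesgue. eta0 e (y::'a)))" by (auto simp: eta_def)
 show "continuous_on UNIV (eta e :: 'a => real)" unfolding eq using p(1)
  by (intro continuous_intros eta0_continuous) auto
 show "integrable lebesgue (eta e :: 'a => real)" unfolding eq using p(2) by simp
 show "(LINT y|lebesgue. eta e (y::'a)) = 1" unfolding eq using p(1) by simp
 show "\<bar>eta e x\<bar> <= 1 / (LINT y|lebesgue. eta0 e (y::'a))" unfolding eta_def using p(1) eta0_props(1,2)[of e x]
  by (simp add: divide_right_mono)
qed

lemma eta_test_fun:
 assumes "0 < e" shows "test_fun (%y. eta e (z - y))"
 unfolding test_fun_def
proof
 have eq: "(%y. eta e (z - y)) = (%y. (1 / (LINT y|lebesgue. eta0 e (y::'a))) * eta0 e (y - z))"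
  using eta0_props(4)[of e "_ - z"] by (auto simp: eta_def minus_diff_eq)
 show "smooth_fun (%y. eta e (z - y))" unfolding eq by (rule bcl_smooth[OF eta0_bcl])
 have "{y. eta e (z - y) ~= 0} \<subseteq> cball z e"
  proof
  fix y assume "y \<in> {y. eta e (z - y) ~= 0}"
  then show "y \<in> cball z e" using eta_props(3)[OF assms, of "z - y"] by (cases "e <= norm (z - y)") (auto simp: dist_norm)
 qed
 then have "bounded (closure {y. eta e (z - y) ~= 0})"
  by (intro bounded_closure bounded_subset[OF bounded_cball])
 then show "compact (closure {y. eta e (z - y) ~= 0})"
  by (simp add: compact_eq_bounded_closed)
qed

lemma eta_L2: "0 < e ==> L2 (%y. eta e (z - y))"
 using test_fun_L2(1)[OF eta_test_fun] nonempty_Basis by blast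

subsection \<open>Mollification\<close>

text \<open>The variance of G under the probability density p is nonnegative. The right-hand side is
  an extended integral, so that it may be infinite and the estimate can be integrated by Tonelli
  without further conditions.\<close>

lemma weighted_jensen:
 fixes p :: "'b::euclidean_space => real"
 assumes p: "p \<in> borel_measurable borel" "!!z. 0 <= p z" "integrable lborel p" "(LINT z|lborel. p z) = 1"
  and G: "G \<in> borel_measurable borel"
 shows "ennreal ((LINT z|lborel. p z * G z)\<^sup>2) <= (\<integral>\<^sup>+z. ennreal (p z * (G z)\<^sup>2) \<partial>lborel)"
proof (cases "(\<integral>\<^sup>+z. ennreal (p z * (G z)\<^sup>2) \<partial>lborel) = \<infinity>")
 case False
 have i2: "integrable lborel (%z. p z * (G z)\<^sup>2)"
 proof (rule integrableI_bounded)
  show "(%z. p z * (G z)\<^sup>2) \<in> borel_measurable lborel" using p G by simp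
  show "(\<integral>\<^sup>+z. ennreal (norm (p z * (G z)\<^sup>2)) \<partial>lborel) < \<infinity>"
   using False p(2) by (simp add: abs_mult less_top)
 qed
 have i1: "integrable lborel (%z. p z * G z)"
 proof (rule Bochner_Integration.integrable_bound[OF Bochner_Integration.integrable_add[OF p(3) i2]])
  show "(%z. p z * G z) \<in> borel_measurable lborel" using p G by simp
  have "norm (p z * G z) <= norm (p z + p z * (G z)\<^sup>2)" for z
  proof -
   have "2 * \<bar>G z\<bar> <= 1 + (G z)\<^sup>2" using sum_squares_bound[of 1 "\<bar>G z\<bar>"] by simp
   then have "\<bar>G z\<bar> <= 1 + (G z)\<^sup>2" using abs_ge_zero[of "G z"] by linarith
   then have "p z * \<bar>G z\<bar> <= p z * (1 + (G z)\<^sup>2)" using p(2) by (intro mult_left_mono) auto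
   then show ?thesis using p(2)[of z] by (simp add: abs_mult algebra_simps)
  qed
  then show "AE z in lborel. norm (p z * G z) <= norm (p z + p z * (G z)\<^sup>2)" by simp
 qed
 define m where "m = (LINT z|lborel. p z * G z)"
 have "0 <= (LINT z|lborel. p z * (G z - m)\<^sup>2)" using p(2) by (intro Bochner_Integration.integral_nonneg) simp
 also have "(%z. p z * (G z - m)\<^sup>2) = (%z. p z * (G z)\<^sup>2 - 2 * m * (p z * G z) + m\<^sup>2 * p z)"
  by (rule ext) (simp add: power2_eq_square algebra_simps)
 also have "(LINT z|lborel. p z * (G z)\<^sup>2 - 2 * m * (p z * G z) + m\<^sup>2 * p z) = (LINT z|lborel. p z * (G z)\<^sup>2) - 2 * m * m + m\<^sup>2"
  using i1 i2 p(3,4) by (simp add: m_def)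
 finally have "m\<^sup>2 <= (LINT z|lborel. p z * (G z)\<^sup>2)" by (simp add: power2_eq_square)
 then have "ennreal (m\<^sup>2) <= ennreal (LINT z|lborel. p z * (G z)\<^sup>2)" by (rule ennreal_leI)
 also have "... = (\<integral>\<^sup>+z. ennreal (p z * (G z)\<^sup>2) \<partial>lborel)"
  using p(2) by (intro nn_integral_eq_integral[symmetric] i2) simp
 finally show ?thesis by (simp add: m_def)
qed simp

text \<open>Jensen followed by Fubini. It serves twice: with the mollifier as density, and with the
  uniform density on [0,1] when an increment is written as an integral along a segment.\<close>

lemma averaged_nrm2:
 fixes p :: "'b::euclidean_space => real" and G :: "'a::euclidean_space => 'b => real"
 assumes p: "p \<in> borel_measurable borel" "!!z. 0 <= p z" "integrable lborel p" "(LINT z|lborel. p z) = 1"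
  and G: "(%(x, z). G x z) \<in> borel_measurable borel"
  and K: "!!z. p z ~= 0 ==> (\<integral>\<^sup>+x. ennreal ((G x z)\<^sup>2) \<partial>lborel) <= ennreal K" "0 <= K"
 shows "(\<integral>\<^sup>+x. ennreal ((LINT z|lborel. p z * G x z)\<^sup>2) \<partial>lborel) <= ennreal K"
proof -
 have G'[measurable]: "(%q. G (fst q) (snd q)) \<in> borel_measurable (lborel \<Otimes>\<^sub>M lborel)"
  using G by (simp add: case_prod_beta' lborel_prod)
 note p(1)[measurable]
 have Gx: "G x \<in> borel_measurable borel" for x
  using measurable_compose[OF measurable_Pair1'[of x lborel lborel] G'] by simp
 have Gz: "(%x. G x z) \<in> borel_measurable borel" for z
  using measurable_compose[OF measurable_Pair2'[of z lborel lborel] G'] by simp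
 have "(\<integral>\<^sup>+x. ennreal ((LINT z|lborel. p z * G x z)\<^sup>2) \<partial>lborel)
   <= (\<integral>\<^sup>+x. \<integral>\<^sup>+z. ennreal (p z * (G x z)\<^sup>2) \<partial>lborel \<partial>lborel)"
  by (intro nn_integral_mono weighted_jensen p Gx)
 also have "... = (\<integral>\<^sup>+z. \<integral>\<^sup>+x. ennreal (p z * (G x z)\<^sup>2) \<partial>lborel \<partial>lborel)"
  by (rule lborel_pair.Fubini'[symmetric]) simp
 also have "... <= (\<integral>\<^sup>+z. ennreal (p z) * ennreal K \<partial>lborel)"
 proof (rule nn_integral_mono)
  fix z
  have "(\<integral>\<^sup>+x. ennreal (p z * (G x z)\<^sup>2) \<partial>lborel) = (\<integral>\<^sup>+x. ennreal (p z) * ennreal ((G x z)\<^sup>2) \<partial>lborel)"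
   using p(2) by (intro nn_integral_cong ennreal_mult) auto
  also have "... = ennreal (p z) * (\<integral>\<^sup>+x. ennreal ((G x z)\<^sup>2) \<partial>lborel)"
   using Gz by (intro nn_integral_cmult) simp
  also have "... <= ennreal (p z) * ennreal K"
   using K(1)[of z] by (cases "p z = 0") (auto intro: mult_left_mono)
  finally show "(\<integral>\<^sup>+x. ennreal (p z * (G x z)\<^sup>2) \<partial>lborel) <= ennreal (p z) * ennreal K" .
 qed
 also have "... = (\<integral>\<^sup>+z. ennreal (p z) \<partial>lborel) * ennreal K"
  by (rule nn_integral_multc) simp
 also have "(\<integral>\<^sup>+z. ennreal (p z) \<partial>lborel) = 1"
  using p by (subst nn_integral_eq_integral) auto
 finally show ?thesis by simp
qed

definition conv :: "real => ('a::euclidean_space => real) => 'a => real" where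
 "conv e u x = (LINT y|lebesgue. eta e (x - y) * u y)"

lemma conv_ip: "conv e u x = ip u (%y. eta e (x - y))"
 by (simp add: conv_def ip_def mult.commute)

lemma conv_integrable: "0 < e ==> L2 u ==> integrable lebesgue (%y. eta e (x - y) * u y)"
 by (intro L2_prod_integrable eta_L2)

lemma conv_cong:
 fixes u :: "'a::euclidean_space => real"
 assumes "u \<in> borel_measurable lebesgue" "v \<in> borel_measurable lebesgue" "0 < e" "AE x in lebesgue. v x = u x"
 shows "conv e v = conv e u"
proof
 fix x :: 'a
 have "(%y. eta e (x - y)) \<in> borel_measurable lebesgue" using eta_L2[OF assms(3)] by (rule L2_meas)
 then show "conv e v x = conv e u x"
  unfolding conv_def using assms by (intro integral_cong_AE) auto
qed

lemma conv_diff: "0 < e ==> L2 u ==> L2 v ==> conv e (%x. u x - v x) x = conv e u x - conv e v x"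
 unfolding conv_ip by (simp add: ip_diff_left eta_L2)

lemma conv_swap:
 assumes "u \<in> borel_measurable lebesgue" "0 < e"
 shows "conv e u x = (LINT z|lebesgue. eta e z * u (x - z))"
proof -
 have m: "(%y. eta e (x - y) * u y) \<in> borel_measurable lebesgue"
  using L2_meas[OF eta_L2[OF assms(2), of x]] assms by simp
 show ?thesis using affine_integral[of "-1" "%y. eta e (x - y) * u y" x] m
  by (simp add: conv_def)
qed

lemma conv_continuous:
 fixes u :: "'a::euclidean_space => real"
 assumes e: "0 < e" and u: "L2 u"
 shows "continuous_on UNIV (conv e u)"
proof (rule continuous_at_imp_continuous_on, rule ballI)
 fix x :: 'a
 show "isCont (conv e u) x"
  unfolding continuous_at_sequentially o_def
 proof (intro allI impI)
  fix X assume X: "X ----> x"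
  then have "Bseq X" by (simp add: convergentI convergent_imp_Bseq)
  then obtain B where B: "!!n. norm (X n) <= B" by (auto simp: Bseq_def)
  define K where "K = 1 / (LINT y|lebesgue. eta0 e (y::'a))"
  have K: "\<bar>eta e z\<bar> <= K" for z :: 'a using eta_props(7)[OF e] by (simp add: K_def)
  show "(%n. conv e u (X n)) ----> conv e u x"
   unfolding conv_def
  proof (rule integral_dominated_convergence[where w="%y. K * (\<bar>u y\<bar> * indicator (cball 0 (B + e)) y)"])
   have m: "(%y. eta e (z - y) * u y) \<in> borel_measurable lebesgue" for z
    using L2_meas[OF eta_L2[OF e, of z]] L2_meas[OF u] by simp
   show "(%y. eta e (x - y) * u y) \<in> borel_measurable lebesgue" by (rule m)
   show "(%y. eta e (X n - y) * u y) \<in> borel_measurable lebesgue" for n by (rule m)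
   show "integrable lebesgue (%y. K * (\<bar>u y\<bar> * indicator (cball 0 (B + e)) y))"
    by (intro integrable_mult_right L2_prod_integrable L2_abs u cball_L2)
   show "AE y in lebesgue. (%n. eta e (X n - y) * u y) ----> eta e (x - y) * u y"
   proof (rule AE_I2)
    fix y
    have "isCont (eta e) (x - y)" using eta_props(4)[OF e, where 'a='a] by (simp add: continuous_on_eq_continuous_at)
    then have "(%n. eta e (X n - y)) ----> eta e (x - y)"
     by (rule isCont_tendsto_compose) (intro tendsto_intros X)
    then show "(%n. eta e (X n - y) * u y) ----> eta e (x - y) * u y" by (intro tendsto_mult_right)
   qed
   show "AE y in lebesgue. norm (eta e (X n - y) * u y) <= K * (\<bar>u y\<bar> * indicator (cball 0 (B + e)) y)" for n
   proof (rule AE_I2)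
    fix y
    show "norm (eta e (X n - y) * u y) <= K * (\<bar>u y\<bar> * indicator (cball 0 (B + e)) y)"
    proof (cases "norm y <= B + e")
     case True
     then show ?thesis using mult_right_mono[OF K[of "X n - y"], of "\<bar>u y\<bar>"] by (simp add: abs_mult)
    next
     case False
     have "norm y <= norm (X n - y) + norm (X n)" by norm
     then have "e <= norm (X n - y)" using False B[of n] by linarith
     then have "eta e (X n - y) = 0" by (rule eta_props(3)[OF e])
     then show ?thesis using False by simp
    qed
   qed
  qed
 qed
qed

text \<open>The constant c merges two uses: c = 0 shows that mollification contracts L2, c = 1 that
  it stays close to u when small translations do.\<close>

lemma conv_average:
 fixes u :: "'a::euclidean_space => real"
 assumes e: "0 < e" and u: "u \<in> borel_measurable borel"
  and K: "!!z. norm z < e ==> nrm2 (%x. u (x - z) - c * u x) <= K" and L: "L2 u"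
 shows "L2 (%x. conv e u x - c * u x)" "nrm2 (%x. conv e u x - c * u x) <= K"
proof -
 have ul: "u \<in> borel_measurable lebesgue" using L by (rule L2_meas)
 have em: "(eta e :: 'a => real) \<in> borel_measurable borel"
  using eta_props(4)[OF e] by (rule borel_measurable_continuous_onI)
 have ei: "integrable lborel (eta e :: 'a => real)" "(LINT y|lborel. eta e (y::'a)) = 1"
  using eta_props(5,6)[OF e, where 'a='a] em by (auto simp: integrable_completion integral_completion)
 have K0: "0 <= K" using K[of 0] e nrm2_nonneg by (metis norm_zero order_trans)
 have eq: "conv e u x - c * u x = (LINT z|lborel. eta e z * (u (x - z) - c * u x))" for x
 proof -
  have m: "(%z. eta e z * u (x - z)) \<in> borel_measurable borel" using em u by simp
  have iz: "integrable lebesgue (%z. eta e z * u (x - z))"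
   using affine_integrable[OF _ conv_integrable[OF e L, of x], of "-1" x] by simp
  have c1: "conv e u x = (LINT z|lborel. eta e z * u (x - z))"
   using m by (simp add: conv_swap[OF ul e] integral_completion)
  have "(LINT z|lborel. eta e z * (u (x - z) - c * u x)) = (LINT z|lborel. eta e z * u (x - z) - (c * u x) * eta e z)"
   by (simp add: algebra_simps)
  also have "... = (LINT z|lborel. eta e z * u (x - z)) - c * u x"
   using iz m ei by (simp add: integrable_completion)
  finally show ?thesis using c1 by simp
 qed
 have "(\<integral>\<^sup>+x. ennreal ((LINT z|lborel. eta e z * (u (x - z) - c * u x))\<^sup>2) \<partial>lborel) <= ennreal K"
 proof (rule averaged_nrm2[OF em eta_props(1)[OF e] ei _ _ K0])
  show "(%(x, z). u (x - z) - c * u x) \<in> borel_measurable borel"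
   using u by (simp add: borel_prod[symmetric] case_prod_beta')
  fix z :: 'a assume "eta e z ~= 0"
  then have z: "norm z < e" using eta_props(3)[OF e, of z] by force
  have L': "L2 (%x. u (x - z) - c * u x)" using L2_diff[OF L2_shift[OF L, of "-z"] L2_cmult[OF L, of c]] by simp
  show "(\<integral>\<^sup>+x. ennreal ((u (x - z) - c * u x)\<^sup>2) \<partial>lborel) <= ennreal K"
   using nn_integral_nrm2[OF L'] K[OF z] by (simp add: nn_integral_completion ennreal_leI)
 qed
 then have b: "(\<integral>\<^sup>+x. ennreal ((conv e u x - c * u x)\<^sup>2) \<partial>lebesgue) <= ennreal K"
  by (simp add: nn_integral_completion eq)
 have "(%x. conv e u x - c * u x) \<in> borel_measurable lebesgue"
  using continuous_borel_lebesgue[OF conv_continuous[OF e L]] ul by simp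
 from L2_nn[OF this b K0] show "L2 (%x. conv e u x - c * u x)" "nrm2 (%x. conv e u x - c * u x) <= K" by auto
qed

lemma conv_L2:
 assumes e: "0 < e" and L: "L2 u"
 shows "L2 (conv e u)" "nrm (conv e u) <= nrm u"
proof -
 obtain v where v: "v \<in> borel_measurable borel" "AE x in lebesgue. u x = v x"
  using borel_rep[OF L2_meas[OF L]] by blast
 have ae: "AE x in lebesgue. v x = u x" using v(2) by eventually_elim simp
 have vl: "v \<in> borel_measurable lebesgue" using v(1) by (intro measurable_completion) simp
 have vL: "L2 v" by (rule L2_cong[OF L vl ae])
 have c: "conv e v = conv e u" by (rule conv_cong[OF L2_meas[OF L] vl e ae])
 have n: "nrm2 v = nrm2 u" by (rule nrm2_cong[OF L2_meas[OF L] vl ae])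
 have "nrm2 (%x. v (x - z) - 0 * v x) <= nrm2 v" for z using nrm2_shift[OF vL, of "-z"] by simp
 from conv_average[OF e v(1) this vL]
 have "L2 (conv e v)" "nrm2 (conv e v) <= nrm2 v" by simp_all
 then show "L2 (conv e u)" "nrm (conv e u) <= nrm u" using c n by (auto simp: nrm_def)
qed

lemma conv_near:
 assumes e: "0 < e" and L: "L2 u" and K: "!!z. norm z < e ==> nrm (%x. u (x + z) - u x) <= K"
 shows "nrm (%x. conv e u x - u x) <= K"
proof -
 obtain v where v: "v \<in> borel_measurable borel" "AE x in lebesgue. u x = v x"
  using borel_rep[OF L2_meas[OF L]] by blast
 have ae: "AE x in lebesgue. v x = u x" using v(2) by eventually_elim simp
 have vl: "v \<in> borel_measurable lebesgue" using v(1) by (intro measurable_completion) simp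
 have vL: "L2 v" by (rule L2_cong[OF L vl ae])
 have c: "conv e v = conv e u" by (rule conv_cong[OF L2_meas[OF L] vl e ae])
 have K0: "0 <= K" using K[of 0] e nrm_nonneg by (metis norm_zero order_trans)
 have "nrm2 (%x. v (x - z) - 1 * v x) <= K\<^sup>2" if z: "norm z < e" for z
 proof -
  have "nrm2 (%x. v (x + -z) - v x) = nrm2 (%x. u (x + -z) - u x)"
  proof (intro nrm2_cong L2_meas L2_diff L2_shift L vL)
   show "AE x in lebesgue. v (x + - z) - v x = u (x + - z) - u x"
    using ae shift_AE[OF ae, of "-z"] by eventually_elim simp
  qed
  also have "... = (nrm (%x. u (x + -z) - u x))\<^sup>2" by (simp add: nrm_sq)
  also have "... <= K\<^sup>2" using K[of "-z"] z by (intro power_mono) auto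
  finally show ?thesis by simp
 qed
 from conv_average(2)[OF e v(1) this vL]
 have "nrm2 (%x. conv e v x - v x) <= K\<^sup>2" by simp
 moreover have "nrm2 (%x. conv e u x - u x) = nrm2 (%x. conv e v x - v x)"
  using ae c by (intro nrm2_cong L2_meas L2_diff conv_L2 e vL L) auto
 ultimately show ?thesis using K0 by (simp add: nrm_def real_le_lsqrt)
qed

text \<open>Height and support of u are cut at level n; then u is replaced by continuous functions
  converging to it almost everywhere, subjected to the same cuts, which supply the dominating
  function.\<close>

lemma L2_dense_Cc:
 fixes u :: "'a::euclidean_space => real"
 assumes L: "L2 u" and d: "0 < d"
 obtains h R where "continuous_on UNIV h" "!!x. R <= norm x ==> h x = 0" "L2 h" "nrm (%x. u x - h x) < d"
proof -
 have "u measurable_on UNIV" by (rule lebesgue_measurable_imp_measurable_on[OF L2_meas[OF L]]) simp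
 then obtain N g where N: "negligible N" "!!n. continuous_on UNIV (g n)" "!!x. x \<notin> N ==> (%n. g n x) ----> u x"
  by (auto simp: measurable_on_def)
 have aeN: "AE x in lebesgue. x \<notin> N"
  using N(1) by (auto simp: negligible_iff_null_sets intro: AE_not_in)
 define cl where "cl M t = max (- M) (min M t)" for M t :: real
 define ch where "ch M x = max 0 (min 1 (M + 1 - norm x))" for M :: real and x :: 'a
 have chb: "0 <= ch M x" "ch M x <= 1" for M x by (auto simp: ch_def)
 have clb: "\<bar>cl M t\<bar> <= M" "\<bar>cl M t\<bar> <= \<bar>t\<bar>" if "0 <= M" for M t using that by (auto simp: cl_def)
 have chc: "continuous_on UNIV (ch M)" for M unfolding ch_def by (intro continuous_intros)
 have um: "u \<in> borel_measurable lebesgue" using L by (rule L2_meas)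
 have chm: "ch M \<in> borel_measurable lebesgue" for M using chc by (rule continuous_borel_lebesgue)
 have clm: "(%x. cl M (f x)) \<in> borel_measurable lebesgue" if "f \<in> borel_measurable lebesgue" for M f
  using that unfolding cl_def by simp
 let ?v = "%M x. ch M x * cl M (u x)"
 have "(%n. nrm (%x. u x - ?v (real n) x)) ----> 0"
 proof (rule dominated_nrm[where w="%x. 2 * u x"])
  show "(%x. u x - ?v (real n) x) \<in> borel_measurable lebesgue" for n using um chm clm[OF um] by simp
  show "L2 (%x. 2 * u x)" by (rule L2_cmult[OF L])
  show "AE x in lebesgue. (%n. u x - ?v (real n) x) ----> 0"
  proof (rule AE_I2, rule tendsto_eventually)
   fix x
   have "\<forall>\<^sub>F n in sequentially. max \<bar>u x\<bar> (norm x) <= real n"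
    using filterlim_real_sequentially[unfolded filterlim_at_top] by blast
   then show "\<forall>\<^sub>F n in sequentially. u x - ?v (real n) x = 0"
    by eventually_elim (auto simp: ch_def cl_def)
  qed
  show "AE x in lebesgue. \<bar>u x - ?v (real n) x\<bar> <= \<bar>2 * u x\<bar>" for n
  proof (rule AE_I2)
   fix x
   have "\<bar>?v (real n) x\<bar> <= 1 * \<bar>u x\<bar>" unfolding abs_mult
    using chb clb(2)[of "real n"] by (intro mult_mono) auto
   then show "\<bar>u x - ?v (real n) x\<bar> <= \<bar>2 * u x\<bar>" by linarith
  qed
 qed
 then have "\<forall>\<^sub>F n in sequentially. nrm (%x. u x - ?v (real n) x) < d/2" using d by (intro order_tendstoD) auto
 then obtain n where n: "nrm (%x. u x - ?v (real n) x) < d/2" by (auto simp: eventually_sequentially)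
 define M where "M = real n"
 have M0: "0 <= M" by (simp add: M_def)
 let ?h = "%k x. ch M x * cl M (g k x)"
 have hc: "continuous_on UNIV (?h k)" for k
  unfolding cl_def by (intro continuous_intros chc N(2))
 have h0: "?h k x = 0" if "M + 1 <= norm x" for k x using that by (simp add: ch_def)
 have hb: "\<bar>?h k x\<bar> <= M" for k x
 proof -
  have "\<bar>?h k x\<bar> <= 1 * M" unfolding abs_mult using chb clb(1)[OF M0] by (intro mult_mono) auto
  then show ?thesis by simp
 qed
 have hL: "L2 (?h k)" for k
  by (rule bounded_support_L2[OF continuous_borel_lebesgue[OF hc] hb, of "M+1"]) (use h0 in auto)
 have vb: "\<bar>?v M x\<bar> <= M" for x
 proof -
  have "\<bar>?v M x\<bar> <= 1 * M" unfolding abs_mult using chb clb(1)[OF M0] by (intro mult_mono) auto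
  then show ?thesis by simp
 qed
 have vm: "?v M \<in> borel_measurable lebesgue" using chm clm[OF um] by simp
 have v0: "?v M x = 0" if "M + 1 < norm x" for x using that by (simp add: ch_def)
 have vL: "L2 (?v M)" by (rule bounded_support_L2[OF vm vb v0])
 have "(%k. nrm (%x. ?v M x - ?h k x)) ----> 0"
 proof (rule dominated_nrm[where w="%x. (2 * M) * indicator (cball 0 (M + 1)) x"])
  show "(%x. ?v M x - ?h k x) \<in> borel_measurable lebesgue" for k using L2_meas[OF L2_diff[OF vL hL]] .
  show "L2 (%x::'a. (2 * M) * indicator (cball 0 (M + 1)) x)" by (rule L2_cmult[OF cball_L2])
  show "AE x in lebesgue. (%k. ?v M x - ?h k x) ----> 0"
   using aeN
  proof eventually_elim
   case (elim x)
   have "(%k. ?v M x - ?h k x) ----> ?v M x - ?v M x"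
    unfolding cl_def by (intro tendsto_intros N(3) elim)
   then show ?case by simp
  qed
  show "AE x in lebesgue. \<bar>?v M x - ?h k x\<bar> <= \<bar>(2 * M) * indicator (cball 0 (M + 1)) x\<bar>" for k
  proof (rule AE_I2)
   fix x
   have "\<bar>?v M x - ?h k x\<bar> <= 2 * M" using vb[of x] hb[of x k] by linarith
   then show "\<bar>?v M x - ?h k x\<bar> <= \<bar>(2 * M) * indicator (cball 0 (M + 1)) x\<bar>"
    by (cases "norm x <= M + 1") (simp, simp add: ch_def)
  qed
 qed
 then have "\<forall>\<^sub>F k in sequentially. nrm (%x. ?v M x - ?h k x) < d/2" using d by (intro order_tendstoD) auto
 then obtain k where k: "nrm (%x. ?v M x - ?h k x) < d/2" by (auto simp: eventually_sequentially)
 have "nrm (%x. u x - ?h k x) < d"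
  using nrm_triangle[OF L vL hL[of k]] n k by (simp add: M_def)
 then show ?thesis using that[OF hc h0 hL] by blast
qed

text \<open>An argument in thirds through a continuous h of bounded support: mollification contracts
  the error \<open>u - h\<close>, and h is uniformly continuous.\<close>

lemma conv_tendsto:
 fixes u :: "'a::euclidean_space => real"
 assumes L: "L2 u" and d: "0 < d"
 shows "\<exists>e0>0. \<forall>e. 0 < e & e < e0 --> nrm (%x. conv e u x - u x) <= d"
proof -
 obtain h R where h: "continuous_on UNIV h" "!!x. R <= norm x ==> h x = 0" "L2 h" "nrm (%x. u x - h x) < d/3"
  using L2_dense_Cc[OF L, of "d/3"] d by auto
 define Z where "Z = nrm (%x. indicator (cball (0::'a) (R + 1)) x)"
 have Z0: "0 <= Z" by (simp add: Z_def)
 \<comment> \<open>Makes s times the norm \<open>Z\<close> of the indicator at most d/3; the summand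
   1 keeps the denominator positive.\<close>
 define s where "s = d / (3 * (Z + 1))"
 have s: "0 < s" using d Z0 by (simp add: s_def)
 have "uniformly_continuous_on (cball 0 (R + 2)) h"
  by (intro compact_uniformly_continuous continuous_on_subset[OF h(1)]) auto
 then obtain e1 where e1: "0 < e1" "!!x y. x \<in> cball 0 (R+2) ==> y \<in> cball 0 (R+2) ==> dist y x < e1 ==> dist (h y) (h x) < s"
  using s unfolding uniformly_continuous_on_def by metis
 have sh: "nrm (%x. h (x + z) - h x) <= d/3" if z: "norm z < min e1 1" for z
 proof -
  have "\<bar>h (x + z) - h x\<bar> <= \<bar>s * indicator (cball 0 (R + 1)) x\<bar>" for x
  proof (cases "norm x <= R + 1")
   case True
   have "norm (x + z) <= norm x + norm z" by norm
   then have "x + z \<in> cball 0 (R+2)" "x \<in> cball 0 (R+2)" using True z by auto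
   then have "dist (h (x + z)) (h x) < s" using z by (intro e1(2)) (auto simp: dist_norm)
   then show ?thesis using True s by (simp add: dist_norm)
  next
   case False
   have "norm x <= norm (x + z) + norm z" by norm
   then have "R <= norm (x + z)" "R <= norm x" using False z by auto
   then show ?thesis using h(2) by simp
  qed
  then have "nrm2 (%x. h (x + z) - h x) <= nrm2 (%x::'a. s * indicator (cball 0 (R + 1)) x)"
   by (intro nrm2_mono L2_cmult cball_L2 L2_meas L2_diff L2_shift h AE_I2)
  then have "nrm (%x. h (x + z) - h x) <= nrm (%x::'a. s * indicator (cball 0 (R + 1)) x)"
   unfolding nrm_def by (rule real_sqrt_le_mono)
  also have "... = s * Z" using s by (simp add: nrm_cmult Z_def)
  also have "... <= d / 3" using Z0 d by (simp add: s_def field_simps)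
  finally show ?thesis .
 qed
 have "nrm (%x. conv e u x - u x) <= d" if e: "0 < e" "e < min e1 1" for e
 proof -
  have L1: "L2 (conv e u)" "L2 (conv e h)" using conv_L2 e L h by auto
  have "nrm (%x. conv e u x - conv e h x) = nrm (conv e (%x. u x - h x))"
   by (simp add: conv_diff[OF e(1) L h(3), abs_def])
  also have "... <= nrm (%x. u x - h x)" by (rule conv_L2(2)[OF e(1) L2_diff[OF L h(3)]])
  finally have a: "nrm (%x. conv e u x - conv e h x) <= d/3" using h(4) by linarith
  have b: "nrm (%x. conv e h x - h x) <= d/3"
   by (rule conv_near[OF e(1) h(3)]) (use sh e in auto)
  have c: "nrm (%x. h x - u x) <= d/3" using h(4) nrm_diff_commute[of h u] by simp
  show ?thesis
   using nrm_triangle[OF L1(1,2) L] nrm_triangle[OF L1(2) h(3) L] a b c by linarith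
 qed
 then show ?thesis using e1 by (intro exI[of _ "min e1 1"]) auto
qed

subsection \<open>Weak gradients and difference quotients\<close>

text \<open>The weak derivative in a single direction, so that the theory can proceed coordinate by
  coordinate; \<open>weak_grad_wd\<close> reassembles the gradient.\<close>

definition wd :: "('a::euclidean_space => real) => 'a => ('a => real) => bool" where
 "wd u b g \<longleftrightarrow> L2 g & (\<forall>ph. test_fun ph -->
   (LINT x|lebesgue. u x * partial_deriv ph b x) = - (LINT x|lebesgue. g x * ph x))"

lemma weak_grad_wd: "weak_grad u g \<longleftrightarrow> (\<forall>b\<in>Basis. wd u b (%x. g x \<bullet> b))"
 unfolding weak_grad_def wd_def by blast

lemma wd_conv:
 assumes "wd u b g" "0 < e"
 shows "(LINT y|lebesgue. u y * partial_deriv (%y. eta e (x - y)) b y) = - conv e g x"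
 using assms eta_test_fun[OF assms(2), of x] unfolding wd_def conv_def by (simp add: mult.commute)

text \<open>Testing with translated mollifiers shows that both candidates have the same
  mollification at every scale; letting the scale tend to zero identifies them.\<close>

lemma wd_unique:
 assumes g: "wd u b g" and h: "wd u b h"
 shows "AE x in lebesgue. g x = h x"
proof -
 have L: "L2 g" "L2 h" "L2 (%x. g x - h x)" using g h by (auto simp: wd_def intro: L2_diff)
 have z: "conv e (%x. g x - h x) = (%x. 0)" if "0 < e" for e
  using wd_conv[OF g that] wd_conv[OF h that] by (auto simp: conv_diff that L)
 have "nrm (%x. g x - h x) <= d" if d: "0 < d" for d
 proof -
  obtain e0 where e0: "0 < e0" "!!e. 0 < e ==> e < e0 ==> nrm (%x. conv e (%x. g x - h x) x - (g x - h x)) <= d"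
   using conv_tendsto[OF L(3) d] by blast
  have "nrm (%x. 0 - (g x - h x)) <= d" using e0(2)[of "e0/2"] e0(1) z[of "e0/2"] by simp
  then show ?thesis using nrm_uminus[of "%x. g x - h x"] by simp
 qed
 then have "nrm (%x. g x - h x) <= 0" by (rule field_le_epsilon[of _ 0, simplified])
 then have "nrm2 (%x. g x - h x) = 0" using nrm_sq[of "%x. g x - h x"] nrm_nonneg by (metis antisym power_zero_numeral)
 then have "AE x in lebesgue. g x - h x = 0" using nrm2_eq_0[OF L(3)] by simp
 then show ?thesis by simp
qed

text \<open>Moving the base point by h b shifts the kernel, seen as a test function of y, by -h b.
  The resulting sign cancels the one in the definition of the weak derivative.\<close>

lemma conv_line_deriv:
 assumes e: "0 < e" and u: "L2 u" and g: "wd u b g" and b: "b \<in> Basis"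
 shows "((%t. conv e u (x + t *\<^sub>R b)) has_real_derivative conv e g (x + t *\<^sub>R b)) (at t)"
proof -
 define z where "z = x + t *\<^sub>R b"
 define ph where "ph = (%y. eta e (z - y))"
 have t: "test_fun ph" unfolding ph_def by (rule eta_test_fun[OF e])
 have "((%h. LINT y|lebesgue. u y * ((ph (y + h *\<^sub>R b) - ph y) / h)) \<longlongrightarrow> - conv e g z) (at 0)"
  using difference_quotient_tendsto[OF t b u] wd_conv[OF g e, of z] by (simp add: ph_def)
 moreover have "filterlim uminus (at 0) (at (0::real))" 
  by (rule filterlim_atI) (auto intro!: tendsto_eq_intros simp: eventually_at_filter)
 ultimately have "((%h. LINT y|lebesgue. u y * ((ph (y + (-h) *\<^sub>R b) - ph y) / (-h))) \<longlongrightarrow> - conv e g z) (at 0)"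
  by (rule filterlim_compose)
 then have lim: "((%h. - (LINT y|lebesgue. u y * ((ph (y + (-h) *\<^sub>R b) - ph y) / (-h)))) \<longlongrightarrow> conv e g z) (at 0)"
  by (subst tendsto_minus_cancel_left[symmetric]) simp
 have eq: "- (LINT y|lebesgue. u y * ((ph (y + (-h) *\<^sub>R b) - ph y) / (-h)))
   = (conv e u (x + (t + h) *\<^sub>R b) - conv e u (x + t *\<^sub>R b)) / h" (is "?L h = ?R h") for h
 proof -
  have "conv e u (x + (t + h) *\<^sub>R b) - conv e u (x + t *\<^sub>R b)
    = (LINT y|lebesgue. eta e (x + (t + h) *\<^sub>R b - y) * u y - eta e (z - y) * u y)"
   unfolding conv_def z_def by (intro Bochner_Integration.integral_diff[symmetric] conv_integrable e u)
  also have "... = (LINT y|lebesgue. u y * (ph (y + (-h) *\<^sub>R b) - ph y))"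
   by (intro Bochner_Integration.integral_cong refl) (simp add: ph_def z_def algebra_simps)
  finally show ?thesis by simp
 qed
 have "?R \<midarrow>0\<rightarrow> conv e g z" using lim by (simp only: eq)
 then show ?thesis by (simp add: DERIV_def z_def)
qed

text \<open>By the fundamental theorem the increment is the mean over s in [0,1] of t times the
  mollified derivative at \<open>x + s t b\<close>, and averaging does not increase the
  norm.\<close>

lemma conv_translate_bound:
 fixes u :: "'a::euclidean_space => real"
 assumes e: "0 < e" and u: "L2 u" and g: "wd u b g" and b: "b \<in> Basis"
 shows "nrm (%x. conv e u (x + t *\<^sub>R b) - conv e u x) <= \<bar>t\<bar> * nrm g"
proof -
 have gL: "L2 g" using g by (simp add: wd_def)
 have cc: "continuous_on UNIV (conv e g)" by (rule conv_continuous[OF e gL])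
 define G where "G x s = t * conv e g (x + (s * t) *\<^sub>R b)" for x and s :: real
 have Gc: "continuous_on UNIV (%(x, s). G x s)"
  unfolding G_def case_prod_beta'
  by (intro continuous_intros continuous_on_compose2[OF cc]) auto
 have Gcx: "continuous_on UNIV (G x)" for x
  unfolding G_def by (intro continuous_intros continuous_on_compose2[OF cc]) auto
 have Gcs: "continuous_on UNIV (%x. G x s)" for s
  unfolding G_def by (intro continuous_intros continuous_on_compose2[OF cc]) auto
 have ftc: "conv e u (x + t *\<^sub>R b) - conv e u x = (LINT s|lborel. indicator {0..1} s * G x s)" for x
 proof -
  have "(LINT s|lborel. G x s * indicator {0..1} s) = conv e u (x + (1 * t) *\<^sub>R b) - conv e u (x + (0 * t) *\<^sub>R b)"
  proof (rule integral_FTC_Icc_real)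
   fix s :: real
   show "((%s. conv e u (x + (s * t) *\<^sub>R b)) has_real_derivative G x s) (at s)"
    using DERIV_chain2[where f="%t. conv e u (x + t *\<^sub>R b)" and g="%s. s * t" and x=s and s=UNIV,
      OF conv_line_deriv[OF e u g b], of t] DERIV_cmult_right[OF DERIV_ident, of t s UNIV]
    by (simp add: G_def mult.commute)
   show "isCont (G x) s" using Gcx by (simp add: continuous_on_eq_continuous_at)
  qed simp
  then show ?thesis by (simp add: mult.commute)
 qed
 have cL: "L2 (conv e g)" "nrm (conv e g) <= nrm g" by (rule conv_L2[OF e gL])+
 have GL: "L2 (%x. G x s)" and Gn: "nrm2 (%x. G x s) <= (\<bar>t\<bar> * nrm g)\<^sup>2" for s
 proof -
  show "L2 (%x. G x s)" unfolding G_def by (intro L2_cmult L2_shift cL)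
  have "nrm2 (%x. G x s) = t\<^sup>2 * nrm2 (conv e g)"
   unfolding G_def by (simp add: nrm2_cmult nrm2_shift[OF cL(1)])
  also have "... = t\<^sup>2 * (nrm (conv e g))\<^sup>2" by (simp add: nrm_sq)
  also have "... <= t\<^sup>2 * (nrm g)\<^sup>2" using cL by (intro mult_left_mono power_mono) auto
  finally show "nrm2 (%x. G x s) <= (\<bar>t\<bar> * nrm g)\<^sup>2" by (simp add: power_mult_distrib)
 qed
 have "(\<integral>\<^sup>+x. ennreal ((LINT s|lborel. indicator {0..1} s * G x s)\<^sup>2) \<partial>lborel) <= ennreal ((\<bar>t\<bar> * nrm g)\<^sup>2)"
 proof (rule averaged_nrm2)
  show "(%(x, z). G x z) \<in> borel_measurable borel" using Gc by (rule borel_measurable_continuous_onI)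
  show "(\<integral>\<^sup>+ x. ennreal ((G x z)\<^sup>2) \<partial>lborel) <= ennreal ((\<bar>t\<bar> * nrm g)\<^sup>2)" for z
   using nn_integral_nrm2[OF GL[of z]] Gn[of z] by (simp add: nn_integral_completion ennreal_leI)
 qed auto
 then have "(\<integral>\<^sup>+x. ennreal ((conv e u (x + t *\<^sub>R b) - conv e u x)\<^sup>2) \<partial>lebesgue) <= ennreal ((\<bar>t\<bar> * nrm g)\<^sup>2)"
  by (simp add: nn_integral_completion ftc)
 moreover have "(%x. conv e u (x + t *\<^sub>R b) - conv e u x) \<in> borel_measurable lebesgue"
  by (intro L2_meas L2_diff L2_shift conv_L2 e u)
 ultimately have "nrm2 (%x. conv e u (x + t *\<^sub>R b) - conv e u x) <= (\<bar>t\<bar> * nrm g)\<^sup>2"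
  by (intro L2_nn) auto
 then show ?thesis by (simp add: nrm_def real_le_lsqrt)
qed

lemma translate_bound_basis:
 fixes u :: "'a::euclidean_space => real"
 assumes u: "L2 u" and g: "wd u b g" and b: "b \<in> Basis"
 shows "nrm (%x. u (x + t *\<^sub>R b) - u x) <= \<bar>t\<bar> * nrm g"
proof (rule field_le_epsilon)
 fix d :: real assume d: "0 < d"
 obtain e where e: "0 < e" "nrm (%x. conv e u x - u x) <= d/2"
  using conv_tendsto[OF u, of "d/2"] d by (metis dense half_gt_zero)
 have c: "L2 (conv e u)" by (rule conv_L2(1)[OF e(1) u])
 have e1: "nrm (%x. u (x + t *\<^sub>R b) - conv e u (x + t *\<^sub>R b)) <= d/2"
  using nrm2_shift[OF L2_diff[OF u c], of "t *\<^sub>R b"] e(2) nrm_diff_commute[of u "conv e u"] by (simp add: nrm_def)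
 show "nrm (%x. u (x + t *\<^sub>R b) - u x) <= \<bar>t\<bar> * nrm g + d"
  using nrm_triangle[OF L2_shift[OF u] L2_shift[OF c] u, of "t *\<^sub>R b" "t *\<^sub>R b"]
   nrm_triangle[OF L2_shift[OF c] c u, of "t *\<^sub>R b"] conv_translate_bound[OF e(1) u g b, of t] e e1 by linarith
qed

lemma translate_bound:
 fixes u :: "'a::euclidean_space => real"
 assumes u: "L2 u" and g: "!!b. b \<in> Basis ==> wd u b (g b)"
 shows "nrm (%x. u (x + z) - u x) <= (\<Sum>b\<in>Basis. \<bar>z \<bullet> b\<bar> * nrm (g b))"
proof -
 have "nrm (%x. u (x + (\<Sum>b\<in>B. (z \<bullet> b) *\<^sub>R b)) - u x) <= (\<Sum>b\<in>B. \<bar>z \<bullet> b\<bar> * nrm (g b))" if "finite B" "B \<subseteq> Basis" for B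
  using that
 proof (induction B)
  case empty
  then show ?case by (simp add: nrm_def)
 next
  case (insert a B)
  let ?s = "\<Sum>b\<in>B. (z \<bullet> b) *\<^sub>R b"
  have "nrm (%x. u (x + ((z \<bullet> a) *\<^sub>R a + ?s)) - u x)
    <= nrm (%x. u (x + ((z \<bullet> a) *\<^sub>R a + ?s)) - u (x + ?s)) + nrm (%x. u (x + ?s) - u x)"
   by (intro nrm_triangle L2_shift u)
  also have "nrm (%x. u (x + ((z \<bullet> a) *\<^sub>R a + ?s)) - u (x + ?s)) = nrm (%x. u (x + (z \<bullet> a) *\<^sub>R a) - u x)"
   using nrm2_shift[OF L2_diff[OF L2_shift[OF u, of "(z \<bullet> a) *\<^sub>R a"] u], of ?s] by (simp add: nrm_def add_ac)
  also have "... <= \<bar>z \<bullet> a\<bar> * nrm (g a)" using insert by (intro translate_bound_basis u g) auto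
  also have "nrm (%x. u (x + ?s) - u x) <= (\<Sum>b\<in>B. \<bar>z \<bullet> b\<bar> * nrm (g b))" using insert by auto
  finally show ?case using insert by simp
 qed
 from this[of Basis] show ?thesis by (simp add: euclidean_representation)
qed

section \<open>Midpoint averages in place of weak limits\<close>

inductive mid :: "('a => real) set => ('a => real) => bool" for F where
 mid_base: "f \<in> F ==> mid F f"
| mid_step: "mid F f ==> mid F g ==> mid F (%x. (f x + g x) / 2)"

lemma mid_mono: "mid F f ==> F \<subseteq> G ==> mid G f"
 by (induction rule: mid.induct) (auto intro: mid.intros)

text \<open>Mazur's lemma for any functional q with the parallelogram law. Let \<open>d n\<close> be
  the infimum of q over iterated midpoints of the n-th tail; it increases to a finite limit. Two
  near-minimizers of a late tail have a midpoint in that tail, whose q cannot be much smaller, so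
  the parallelogram law makes their difference small. Iterated midpoints suffice; general convex
  combinations do not have to be formed.\<close>

lemma mazur_midpoint:
 fixes f :: "nat => 'a => real" and q :: "('a => real) => real"
 assumes Vf: "!!n. V (f n)" and Vm: "!!u v. V u ==> V v ==> V (%x. (u x + v x) / 2)"
  and q0: "!!u. 0 <= q u"
  and par: "!!u v. V u ==> V v ==> q (%x. u x - v x) + 4 * q (%x. (u x + v x) / 2) = 2 * q u + 2 * q v"
  and b: "!!n. q (f n) <= C"
 obtains h where "!!n. mid (f ` {n..}) (h n)" "!!e. 0 < e ==> \<exists>N. \<forall>m\<ge>N. \<forall>n\<ge>N. q (%x. h m x - h n x) < e"
proof -
 have Vq: "V h & q h <= C" if "mid (f ` {n..}) h" for h n
  using that
 proof induction
  case (mid_step u v)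
  then have "q (%x. u x - v x) + 4 * q (%x. (u x + v x) / 2) = 2 * q u + 2 * q v" by (intro par) auto
  then have "4 * q (%x. (u x + v x) / 2) <= 4 * C" using mid_step q0[of "%x. u x - v x"] by linarith
  then show ?case using mid_step Vm by auto
 qed (use Vf b in auto)
 define d where "d n = Inf (q ` {h. mid (f ` {n..}) h})" for n
 have ne: "{h. mid (f ` {n..}) h} ~= {}" for n using mid_base[of "f n" "f ` {n..}"] by auto
 have bb: "bdd_below (q ` {h. mid (f ` {n..}) h})" for n using q0 by (intro bdd_belowI[of _ 0]) auto
 have d_le: "d n <= q h" if "mid (f ` {n..}) h" for n h unfolding d_def using that bb by (intro cInf_lower) auto
 have ex: "\<exists>h. mid (f ` {n..}) h & q h < d n + 1 / Suc n" for n
  using cInf_lessD[of "q ` {h. mid (f ` {n..}) h}" "d n + 1 / Suc n"] ne[of n] by (auto simp: d_def)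
 then obtain h where h: "!!n. mid (f ` {n..}) (h n)" "!!n. q (h n) < d n + 1 / Suc n" by metis
 have dmono: "d n <= d m" if "n <= m" for n m
  unfolding d_def by (intro cInf_superset_mono bb image_mono) (use ne that in \<open>auto elim!: mid_mono\<close>)
 have dC: "d n <= C" for n using d_le[OF h(1)] Vq[OF h(1)] by (meson order_trans)
 have bdd: "bdd_above (range d)" using dC by (intro bdd_aboveI) auto
 define D where "D = (SUP n. d n)"
 have dD: "d n <= D" for n unfolding D_def by (intro cSUP_upper bdd) auto
 have "\<exists>N. \<forall>m\<ge>N. \<forall>n\<ge>N. q (%x. h m x - h n x) < e" if e: "0 < e" for e
 proof -
  \<comment> \<open>The parallelogram law will bound the difference by 4 / Suc N + 4 (D - d N); the
    two thresholds make each summand less than e/2.\<close>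
  obtain N1 where N1: "D - e/8 < d N1" unfolding D_def using e less_cSUP_iff[of UNIV d "D - e/8"] bdd by (auto simp: D_def)
  obtain N2 where N2: "4 / Suc N2 < e/2" using e reals_Archimedean[of "e/8"] by (auto simp: field_simps)
  define N where "N = max N1 N2"
  have "q (%x. h m x - h n x) < e" if "m \<ge> N" "n \<ge> N" for m n
  proof -
   have mN: "mid (f ` {N..}) (h m)" "mid (f ` {N..}) (h n)"
    using that by (auto intro!: mid_mono[OF h(1)])
   have "d N <= q (%x. (h m x + h n x) / 2)" by (intro d_le mid_step mN)
   moreover have "q (%x. h m x - h n x) + 4 * q (%x. (h m x + h n x) / 2) = 2 * q (h m) + 2 * q (h n)"
    using Vq[OF mN(1)] Vq[OF mN(2)] by (intro par) auto
   moreover have "q (h m) < D + 1 / Suc N" "q (h n) < D + 1 / Suc N"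
   proof -
    have "1 / Suc m <= 1 / Suc N" "1 / Suc n <= 1 / Suc N" using that by (simp_all add: frac_le)
    then show "q (h m) < D + 1 / Suc N" "q (h n) < D + 1 / Suc N"
     using h(2)[of m] h(2)[of n] dD[of m] dD[of n] by linarith+
   qed
   moreover have "D - e/8 < d N" using N1 dmono[of N1 N] by (simp add: N_def)
   moreover have "1 / Suc N <= 1 / Suc N2" by (simp add: N_def frac_le)
   moreover have "1 / Suc N2 < e / 8" using N2 by simp
   ultimately show ?thesis by linarith
  qed
  then show ?thesis by blast
 qed
 then show ?thesis using that h(1) by blast
qed

lemma nrm2_mid_par:
 assumes "L2 u" "L2 v"
 shows "nrm2 (%x. u x - v x) + 4 * nrm2 (%x. (u x + v x) / 2) = 2 * nrm2 u + 2 * nrm2 v"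
 using nrm2_parallelogram[OF assms] nrm2_cmult[of "1/2" "%x. u x + v x"] by (simp add: power2_eq_square)

lemma L2_mid: "L2 u ==> L2 v ==> L2 (%x. (u x + v x) / 2)"
 using L2_cmult[OF L2_add, of u v "1/2"] by simp

lemma nrm_mid: 
 assumes "L2 u" "L2 v" "nrm u <= c" "nrm v <= c" shows "nrm (%x. (u x + v x) / 2) <= c"
 using nrm_add[OF assms(1,2)] nrm_cmult[of "1/2" "%x. u x + v x"] assms(3,4) by simp

text \<open>The difference quotients are bounded in L2 and their pairings with a test function
  converge. Midpoints of late quotients converge strongly; they keep the norm bound and, since
  intervals are convex, the limit of the pairings.\<close>

lemma weak_derivative_exists:
 fixes u :: "'a::euclidean_space => real"
 assumes u: "L2 u" and b: "b \<in> Basis" and t: "!!n. 0 < t n" "t ----> 0"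
  and C: "!!n. nrm2 (%x. u (x + t n *\<^sub>R b) - u x) <= C * (t n)\<^sup>2"
 shows "\<exists>g. wd u b g & nrm2 g <= C"
proof -
 define A where "A n x = (1 / t n) * (u (x + t n *\<^sub>R b) - u x)" for n x
 have AL: "L2 (A n)" for n unfolding A_def by (intro L2_cmult L2_diff L2_shift u)
 have AC: "nrm2 (A n) <= C" for n
 proof -
  have "nrm2 (A n) = (1 / t n)\<^sup>2 * nrm2 (%x. u (x + t n *\<^sub>R b) - u x)" unfolding A_def by (rule nrm2_cmult)
  also have "... <= (1 / t n)\<^sup>2 * (C * (t n)\<^sup>2)" by (intro mult_left_mono C) simp
  also have "... = C" using t(1)[of n] by (simp add: power2_eq_square)
  finally show ?thesis .
 qed
 obtain h where h: "!!n. mid (A ` {n..}) (h n)"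
  and cau: "!!e. 0 < e ==> \<exists>N. \<forall>m\<ge>N. \<forall>n\<ge>N. nrm2 (%x. h m x - h n x) < e"
  by (rule mazur_midpoint[of L2 A nrm2 C]) (use AL AC nrm2_mid_par L2_mid in auto)
 have hL: "L2 (h n) & nrm2 (h n) <= C" for n
  using h[of n]
 proof induction
  case (mid_step f g)
  then have "4 * nrm2 (%x. (f x + g x) / 2) <= 4 * C"
   using nrm2_mid_par[of f g] nrm2_nonneg[of "%x. f x - g x"] by linarith
  then show ?case using L2_mid[of f g] mid_step by auto
 qed (use AL AC in auto)
 have cau': "\<exists>N. \<forall>m\<ge>N. \<forall>n\<ge>N. nrm (%x. h m x - h n x) < e" if e: "0 < e" for e
 proof -
  obtain N where N: "!!m n. m \<ge> N ==> n \<ge> N ==> nrm2 (%x. h m x - h n x) < e\<^sup>2" using cau[of "e\<^sup>2"] e by auto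
  have "nrm (%x. h m x - h n x) < e" if "m \<ge> N" "n \<ge> N" for m n
   unfolding nrm_def using N[OF that] e by (intro real_less_lsqrt) auto
  then show ?thesis by blast
 qed
 obtain g where g: "L2 g" "nrm2 g <= C" "(%n. nrm (%x. h n x - g x)) ----> 0"
  by (rule L2_complete[of h C]) (use hL cau' in auto)
 have "(LINT x|lebesgue. u x * partial_deriv ph b x) = - (LINT x|lebesgue. g x * ph x)" if ph: "test_fun ph" for ph
 proof -
  define l where "l = - (LINT x|lebesgue. u x * partial_deriv ph b x)"
  have pL: "L2 ph" by (rule test_fun_L2(1)[OF ph b])
  \<comment> \<open>Discrete integration by parts: the shift moves to the test function with the
    opposite sign.\<close>
  have Aip: "ip (A n) ph = - (LINT y|lebesgue. u y * ((ph (y + (- t n) *\<^sub>R b) - ph y) / (- t n)))" for n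
  proof -
   have i1: "integrable lebesgue (%x. u (x + t n *\<^sub>R b) * ph x)" "integrable lebesgue (%x. u x * ph x)"
    by (intro L2_prod_integrable L2_shift u pL)+
   have i2: "integrable lebesgue (%x. u x * ph (x + (- t n) *\<^sub>R b))"
    by (intro L2_prod_integrable u L2_shift pL)
   have "ip (A n) ph = (1 / t n) * ip (%x. u (x + t n *\<^sub>R b) - u x) ph" unfolding A_def by (rule ip_cmult_left)
   also have "ip (%x. u (x + t n *\<^sub>R b) - u x) ph = (LINT x|lebesgue. u (x + t n *\<^sub>R b) * ph x) - (LINT x|lebesgue. u x * ph x)"
    unfolding ip_def using i1 by (simp add: left_diff_distrib)
   also have "(LINT x|lebesgue. u (x + t n *\<^sub>R b) * ph x) = (LINT x|lebesgue. u x * ph (x + (- t n) *\<^sub>R b))"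
    using shift_integral[of "%x. u x * ph (x + (- t n) *\<^sub>R b)" "t n *\<^sub>R b"] i2 by simp
   also have "(LINT x|lebesgue. u x * ph (x + (- t n) *\<^sub>R b)) - (LINT x|lebesgue. u x * ph x)
    = (LINT x|lebesgue. u x * (ph (x + (- t n) *\<^sub>R b) - ph x))"
    using i1 i2 by (simp add: right_diff_distrib)
   finally show ?thesis by simp
  qed
  have "(%n. LINT y|lebesgue. u y * ((ph (y + (- t n) *\<^sub>R b) - ph y) / (- t n))) ----> (LINT y|lebesgue. u y * partial_deriv ph b y)"
   by (rule filterlim_compose[OF difference_quotient_tendsto[OF ph b u]])
    (use t in \<open>auto intro!: filterlim_atI tendsto_eq_intros simp: less_imp_neq[symmetric]\<close>)
  then have Al: "(%n. ip (A n) ph) ----> l"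
   unfolding Aip l_def by (rule tendsto_minus)
  have hl: "(%n. ip (h n) ph) ----> l"
  proof (rule LIMSEQ_I)
   fix r :: real assume r: "0 < r"
   then obtain N where N: "!!n. n \<ge> N ==> \<bar>ip (A n) ph - l\<bar> < r"
    using LIMSEQ_D[OF Al, of r] by auto
   have "\<bar>ip (h n) ph - l\<bar> < r" if "n \<ge> N" for n
   proof -
    from h[of n] have "L2 (h n) & \<bar>ip (h n) ph - l\<bar> < r"
    proof induction
     case (mid_base f)
     then show ?case using N that AL by auto
    next
     case (mid_step f g)
     then have "ip (%x. (f x + g x) / 2) ph = (1/2) * (ip f ph + ip g ph)"
      using ip_cmult_left[of "1/2" "%x. f x + g x" ph] ip_add_left[of f g ph] pL by simp
     then show ?case using mid_step L2_mid by auto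
    qed
    then show ?thesis by simp
   qed
   then show "\<exists>no. \<forall>n\<ge>no. norm (ip (h n) ph - l) < r" by auto
  qed
  have "(%n. ip (h n) ph) ----> ip g ph"
  proof (rule LIM_zero_cancel, rule tendsto_0_le[of _ _ _ "nrm ph"])
   show "(%n. nrm (%x. h n x - g x)) ----> 0" by (rule g(3))
   have "norm (ip (h n) ph - ip g ph) <= norm (nrm (%x. h n x - g x)) * nrm ph" for n
    using cauchy_schwarz[OF L2_diff[of "h n" g] pL] hL g(1) pL by (simp add: ip_diff_left)
   then show "\<forall>\<^sub>F n in sequentially. norm (ip (h n) ph - ip g ph) <= norm (nrm (%x. h n x - g x)) * nrm ph" by simp
  qed
  then have "ip g ph = l" using hl LIMSEQ_unique by blast
  then show ?thesis by (simp add: l_def ip_def)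
 qed
 then show ?thesis using g by (auto simp: wd_def)
qed

section \<open>The Dirichlet energy as a limit of difference quotients\<close>

definition en :: "('a::euclidean_space => real) => real" where
 "en u = (LINT x|lebesgue. (norm (grad u x))\<^sup>2)"

definition S :: "('a::euclidean_space => real) => real => real" where
 "S u t = (\<Sum>b\<in>Basis. nrm2 (%x. u (x + t *\<^sub>R b) - u x))"

lemma H1_L2: "u \<in> H1 ==> L2 u" by (simp add: H1_def)

lemma weak_grad_grad: "u \<in> H1 ==> weak_grad u (grad u)"
 unfolding H1_def grad_def by (auto intro: someI_ex[of "weak_grad u"])

lemma grad_wd: "u \<in> H1 ==> b \<in> Basis ==> wd u b (%x. grad u x \<bullet> b)"
 using weak_grad_grad weak_grad_wd by blast

lemma weak_grad_en:
 assumes "weak_grad u g"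
 shows "(LINT x|lebesgue. (norm (g x))\<^sup>2) = (\<Sum>b\<in>Basis. nrm2 (%x. g x \<bullet> b))"
proof -
 have "(norm (g x))\<^sup>2 = (\<Sum>b\<in>Basis. (g x \<bullet> b)\<^sup>2)" for x
  unfolding power2_norm_eq_inner by (subst euclidean_inner) (simp add: power2_eq_square)
 then have "(LINT x|lebesgue. (norm (g x))\<^sup>2) = (LINT x|lebesgue. (\<Sum>b\<in>Basis. (g x \<bullet> b)\<^sup>2))" by simp
 also have "... = (\<Sum>b\<in>Basis. (LINT x|lebesgue. (g x \<bullet> b)\<^sup>2))"
  using assms by (intro Bochner_Integration.integral_sum) (auto simp: weak_grad_def L2_def)
 finally show ?thesis by (simp add: nrm2_def)
qed

lemma en_sum: "u \<in> H1 ==> en u = (\<Sum>b\<in>Basis. nrm2 (%x. grad u x \<bullet> b))"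
 unfolding en_def by (rule weak_grad_en[OF weak_grad_grad])

lemma en_nonneg [simp]: "0 <= en u" by (simp add: en_def)

lemma en_eq:
 assumes "L2 u" "weak_grad u g"
 shows "u \<in> H1" "en u = (\<Sum>b\<in>Basis. nrm2 (%x. g x \<bullet> b))"
proof -
 show u: "u \<in> H1" using assms by (auto simp: H1_def)
 show "en u = (\<Sum>b\<in>Basis. nrm2 (%x. g x \<bullet> b))"
  unfolding en_sum[OF u]
 proof (rule sum.cong[OF refl])
  fix b :: 'a assume b: "b \<in> Basis"
  have w: "wd u b (%x. g x \<bullet> b)" using assms b weak_grad_wd by blast
  show "nrm2 (%x. grad u x \<bullet> b) = nrm2 (%x. g x \<bullet> b)"
   using wd_unique[OF grad_wd[OF u b] w] grad_wd[OF u b] w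
   by (intro nrm2_cong) (auto simp: wd_def L2_def)
 qed
qed

lemma S_le:
 assumes u: "u \<in> H1" shows "S u t <= t\<^sup>2 * en u"
proof -
 have "S u t <= (\<Sum>b\<in>Basis. t\<^sup>2 * nrm2 (%x. grad u x \<bullet> b))"
  unfolding S_def
 proof (rule sum_mono)
  fix b :: 'a assume b: "b \<in> Basis"
  have "(nrm (%x. u (x + t *\<^sub>R b) - u x))\<^sup>2 <= (\<bar>t\<bar> * nrm (%x. grad u x \<bullet> b))\<^sup>2"
   by (intro power_mono translate_bound_basis H1_L2 grad_wd u b) simp
  then show "nrm2 (%x. u (x + t *\<^sub>R b) - u x) <= t\<^sup>2 * nrm2 (%x. grad u x \<bullet> b)"
   by (simp add: power_mult_distrib nrm_sq)
 qed
 then show ?thesis by (simp add: en_sum[OF u] sum_distrib_left)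
qed

text \<open>If the quotients stayed e below the squared norm of g along a null sequence,
  \<open>weak_derivative_exists\<close> would produce a weak derivative of smaller norm, against
  uniqueness. The matching upper bound holds for every t > 0.\<close>

lemma wd_limit:
 assumes u: "L2 u" and b: "b \<in> Basis" and g: "wd u b g"
 shows "((%t. nrm2 (%x. u (x + t *\<^sub>R b) - u x) / t\<^sup>2) \<longlongrightarrow> nrm2 g) (at_right 0)"
proof (rule tendstoI)
 fix e :: real assume e: "0 < e"
 let ?N = "%t. nrm2 (%x. u (x + t *\<^sub>R b) - u x)"
 have up: "?N t / t\<^sup>2 <= nrm2 g" if "0 < t" for t
 proof -
  have "(nrm (%x. u (x + t *\<^sub>R b) - u x))\<^sup>2 <= (\<bar>t\<bar> * nrm g)\<^sup>2"
   by (intro power_mono translate_bound_basis u g b) simp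
  then show ?thesis using that by (simp add: power_mult_distrib nrm_sq divide_le_eq mult.commute)
 qed
 show "\<forall>\<^sub>F t in at_right 0. dist (?N t / t\<^sup>2) (nrm2 g) < e"
 proof (rule ccontr)
  assume "\<not> ?thesis"
  then have "\<not> (\<exists>d>0. \<forall>t>0. t < d --> dist (?N t / t\<^sup>2) (nrm2 g) < e)"
   by (simp add: eventually_at_right_field)
  then have "\<forall>n::nat. \<exists>t>0. t < 1 / Suc n & \<not> dist (?N t / t\<^sup>2) (nrm2 g) < e"
   by (metis of_nat_0_less_iff zero_less_Suc zero_less_divide_1_iff)
  then obtain t where t: "!!n::nat. 0 < t n" "!!n. t n < 1 / Suc n" "!!n. \<not> dist (?N (t n) / (t n)\<^sup>2) (nrm2 g) < e"
   by metis
  have t0: "t ----> 0"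
  proof (rule real_tendsto_sandwich[of "%_. 0" _ _ "%n. 1 / Suc n"])
   show "\<forall>\<^sub>F n in sequentially. 0 <= t n" "\<forall>\<^sub>F n in sequentially. t n <= 1 / Suc n"
    using t(1,2) by (intro always_eventually allI less_imp_le; simp)+
   show "(%n. 1 / real (Suc n)) ----> 0" using LIMSEQ_inverse_real_of_nat by (simp add: inverse_eq_divide)
  qed simp
  have "?N (t n) <= (nrm2 g - e) * (t n)\<^sup>2" for n
  proof -
   have "?N (t n) / (t n)\<^sup>2 <= nrm2 g - e" using t(3)[of n] up[OF t(1)[of n]] by (auto simp: dist_real_def)
   then show ?thesis using t(1)[of n] by (simp add: divide_le_eq)
  qed
  from weak_derivative_exists[OF u b t(1) t0 this]
  obtain h where h: "wd u b h" "nrm2 h <= nrm2 g - e" by blast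
  have "nrm2 g = nrm2 h" using wd_unique[OF g h(1)] g h(1) by (intro nrm2_cong) (auto simp: wd_def L2_def)
  then show False using h(2) e by simp
 qed
qed

lemma S_limit:
 assumes u: "u \<in> H1" shows "((%t. S u t / t\<^sup>2) \<longlongrightarrow> en u) (at_right 0)"
 unfolding S_def en_sum[OF u] sum_divide_distrib
 by (intro tendsto_sum wd_limit H1_L2 u grad_wd)

text \<open>The criterion from which later memberships in \<open>H1\<close> and energy bounds are
  obtained; one null sequence of shifts suffices.\<close>

lemma H1_by_S:
 assumes u: "L2 u" and t: "!!n. 0 < t n" "t ----> 0" and C: "!!n. S u (t n) <= C * (t n)\<^sup>2"
 shows "u \<in> H1" "en u <= C"
proof -
 have "\<exists>g. wd u b g & nrm2 g <= C" if b: "b \<in> Basis" for b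
 proof (rule weak_derivative_exists[OF u b t])
  fix n
  have "nrm2 (%x. u (x + t n *\<^sub>R b) - u x) <= S u (t n)"
   unfolding S_def using b by (intro member_le_sum) auto
  then show "nrm2 (%x. u (x + t n *\<^sub>R b) - u x) <= C * (t n)\<^sup>2" using C[of n] by linarith
 qed
 then obtain G where G: "!!b. b \<in> Basis ==> wd u b (G b)" by metis
 have "weak_grad u (%x. \<Sum>b\<in>Basis. G b x *\<^sub>R b)"
  unfolding weak_grad_wd using G by simp
 then show H: "u \<in> H1" using u by (auto simp: H1_def)
 have "(%n. S u (t n) / (t n)\<^sup>2) ----> en u"
  by (rule filterlim_compose[OF S_limit[OF H]])
   (use t in \<open>auto simp: filterlim_at less_imp_neq[symmetric]\<close>)
 moreover have "S u (t n) / (t n)\<^sup>2 <= C" for n using C[of n] t(1)[of n] by (simp add: divide_le_eq)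
 ultimately show "en u <= C" by (intro LIMSEQ_le_const2) auto
qed

subsection \<open>Calculus of the Dirichlet energy\<close>

lemma H1_cong:
 assumes u: "u \<in> H1" and v: "v \<in> borel_measurable lebesgue" and ae: "AE x in lebesgue. v x = u x"
 shows "v \<in> H1" "en v = en u"
proof -
 have L: "L2 v" by (rule L2_cong[OF H1_L2[OF u] v ae])
 have um: "u \<in> borel_measurable lebesgue" using u by (simp add: H1_L2 L2_meas)
 have "wd v b (%x. grad u x \<bullet> b)" if b: "b \<in> Basis" for b
  unfolding wd_def
 proof (intro conjI allI impI)
  show "L2 (%x. grad u x \<bullet> b)" using grad_wd[OF u b] by (simp add: wd_def)
  fix ph :: "'a => real" assume t: "test_fun ph"
  have "(LINT x|lebesgue. v x * partial_deriv ph b x) = (LINT x|lebesgue. u x * partial_deriv ph b x)"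
   using ae um v L2_meas[OF test_fun_L2(2)[OF t b]] by (intro integral_cong_AE) auto
  then show "(LINT x|lebesgue. v x * partial_deriv ph b x) = - (LINT x|lebesgue. (grad u x \<bullet> b) * ph x)"
   using grad_wd[OF u b] t by (simp add: wd_def)
 qed
 then have w: "weak_grad v (grad u)" by (simp add: weak_grad_wd)
 show "v \<in> H1" "en v = en u" using en_eq[OF L w] en_sum[OF u] by auto
qed

lemma weak_grad_sum:
 fixes f :: "'i => 'a::euclidean_space => real"
 assumes "!!i. i \<in> I ==> L2 (f i)" "!!i. i \<in> I ==> weak_grad (f i) (g i)"
 shows "weak_grad (%x. \<Sum>i\<in>I. c i * f i x) (%x. \<Sum>i\<in>I. c i *\<^sub>R g i x)"
 unfolding weak_grad_wd
proof
 fix b :: 'a assume b: "b \<in> Basis"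
 have w: "wd (f i) b (%x. g i x \<bullet> b)" if "i \<in> I" for i using assms(2)[OF that] b by (simp add: weak_grad_wd)
 have gL: "L2 (%x. g i x \<bullet> b)" if "i \<in> I" for i using w[OF that] by (simp add: wd_def)
 show "wd (%x. \<Sum>i\<in>I. c i * f i x) b (%x. (\<Sum>i\<in>I. c i *\<^sub>R g i x) \<bullet> b)"
  unfolding wd_def
 proof (intro conjI allI impI)
  show "L2 (%x. (\<Sum>i\<in>I. c i *\<^sub>R g i x) \<bullet> b)"
   unfolding inner_sum_left inner_scaleR_left by (intro L2_sum L2_cmult gL)
  fix ph :: "'a => real" assume t: "test_fun ph"
  note pL = test_fun_L2[OF t b]
  have "(LINT x|lebesgue. (\<Sum>i\<in>I. c i * f i x) * partial_deriv ph b x) = ip (%x. \<Sum>i\<in>I. c i * f i x) (partial_deriv ph b)"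
   by (simp add: ip_def)
  also have "... = (\<Sum>i\<in>I. c i * ip (f i) (partial_deriv ph b))"
   by (subst ip_sum_left) (auto simp: ip_cmult_left intro: L2_cmult assms pL)
  also have "... = (\<Sum>i\<in>I. - (c i * ip (%x. g i x \<bullet> b) ph))"
   using w t by (intro sum.cong) (auto simp: wd_def ip_def)
  also have "... = - ip (%x. \<Sum>i\<in>I. c i * (g i x \<bullet> b)) ph"
   by (subst ip_sum_left) (auto simp: ip_cmult_left sum_negf intro: L2_cmult gL pL)
  finally show "(LINT x|lebesgue. (\<Sum>i\<in>I. c i * f i x) * partial_deriv ph b x) = - (LINT x|lebesgue. ((\<Sum>i\<in>I. c i *\<^sub>R g i x) \<bullet> b) * ph x)"
   by (simp add: ip_def inner_sum_left)
 qed
qed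

definition eb :: "('a::euclidean_space => real) => ('a => real) => real" where
 "eb u v = (\<Sum>b\<in>Basis. ip (%x. grad u x \<bullet> b) (%x. grad v x \<bullet> b))"

lemma eb_commute: "eb u v = eb v u" by (simp add: eb_def ip_commute)

lemma nrm2_sum:
 fixes f :: "'i => 'a::euclidean_space => real"
 assumes "!!i. i \<in> I ==> L2 (f i)"
 shows "nrm2 (%x. \<Sum>i\<in>I. c i * f i x) = (\<Sum>i\<in>I. \<Sum>j\<in>I. c i * c j * ip (f i) (f j))"
proof -
 have L: "L2 (%x. \<Sum>i\<in>I. c i * f i x)" by (intro L2_sum L2_cmult assms)
 have "nrm2 (%x. \<Sum>i\<in>I. c i * f i x) = (\<Sum>i\<in>I. c i * ip (f i) (%x. \<Sum>i\<in>I. c i * f i x))"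
  unfolding ip_self[symmetric] by (subst ip_sum_left) (auto simp: ip_cmult_left intro: L2_cmult assms L)
 also have "... = (\<Sum>i\<in>I. c i * (\<Sum>j\<in>I. c j * ip (f j) (f i)))"
  by (intro sum.cong refl, subst ip_commute, subst ip_sum_left) (auto simp: ip_cmult_left intro: L2_cmult assms)
 finally show ?thesis by (simp add: sum_distrib_left mult.assoc ip_commute)
qed

lemma H1_sum:
 fixes f :: "'i => 'a::euclidean_space => real"
 assumes "!!i. i \<in> I ==> f i \<in> H1"
 shows "(%x. \<Sum>i\<in>I. c i * f i x) \<in> H1"
  "en (%x. \<Sum>i\<in>I. c i * f i x) = (\<Sum>i\<in>I. \<Sum>j\<in>I. c i * c j * eb (f i) (f j))"
proof -
 have L: "L2 (%x. \<Sum>i\<in>I. c i * f i x)" using assms by (intro L2_sum L2_cmult H1_L2)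
 have w: "weak_grad (%x. \<Sum>i\<in>I. c i * f i x) (%x. \<Sum>i\<in>I. c i *\<^sub>R grad (f i) x)"
  using assms by (intro weak_grad_sum H1_L2 weak_grad_grad)
 show "(%x. \<Sum>i\<in>I. c i * f i x) \<in> H1" using en_eq(1)[OF L w] .
 have gL: "L2 (%x. grad (f i) x \<bullet> b)" if "i \<in> I" "b \<in> Basis" for i b
  using grad_wd[OF assms[OF that(1)] that(2)] by (simp add: wd_def)
 have "en (%x. \<Sum>i\<in>I. c i * f i x) = (\<Sum>b\<in>Basis. nrm2 (%x. \<Sum>i\<in>I. c i * (grad (f i) x \<bullet> b)))"
  using en_eq(2)[OF L w] by (simp add: inner_sum_left)
 also have "... = (\<Sum>b\<in>Basis. \<Sum>i\<in>I. \<Sum>j\<in>I. c i * c j * ip (%x. grad (f i) x \<bullet> b) (%x. grad (f j) x \<bullet> b))"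
  by (intro sum.cong refl nrm2_sum gL)
 also have "... = (\<Sum>i\<in>I. \<Sum>b\<in>Basis. \<Sum>j\<in>I. c i * c j * ip (%x. grad (f i) x \<bullet> b) (%x. grad (f j) x \<bullet> b))"
  by (rule sum.swap)
 also have "... = (\<Sum>i\<in>I. \<Sum>j\<in>I. \<Sum>b\<in>Basis. c i * c j * ip (%x. grad (f i) x \<bullet> b) (%x. grad (f j) x \<bullet> b))"
  by (rule sum.cong[OF refl], rule sum.swap)
 also have "... = (\<Sum>i\<in>I. \<Sum>j\<in>I. c i * c j * eb (f i) (f j))"
  by (simp add: eb_def sum_distrib_left)
 finally show "en (%x. \<Sum>i\<in>I. c i * f i x) = (\<Sum>i\<in>I. \<Sum>j\<in>I. c i * c j * eb (f i) (f j))" .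
qed

lemma eb_self: "u \<in> H1 ==> eb u u = en u"
 by (simp add: eb_def en_sum ip_self)

lemma H1_cmult: assumes "u \<in> H1" shows "(%x. c * u x) \<in> H1" "en (%x. c * u x) = c\<^sup>2 * en u"
 using H1_sum[of "{0::nat}" "%_. u" "%_. c"] assms by (auto simp: eb_self power2_eq_square)

lemma H1_lincomb:
 assumes "u \<in> H1" "v \<in> H1"
 shows "(%x. a * u x + b * v x) \<in> H1" "en (%x. a * u x + b * v x) = a\<^sup>2 * en u + 2 * a * b * eb u v + b\<^sup>2 * en v"
proof -
 define f where "f i = (if i = (0::nat) then u else v)" for i
 define c where "c i = (if i = (0::nat) then a else b)" for i
 have "!!i. i \<in> {0,1} ==> f i \<in> H1" using assms by (auto simp: f_def)
 note H1_sum[of "{0,1}" f, OF this, where c=c]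
 then show "(%x. a * u x + b * v x) \<in> H1" "en (%x. a * u x + b * v x) = a\<^sup>2 * en u + 2 * a * b * eb u v + b\<^sup>2 * en v"
  using eb_self[OF assms(1)] eb_self[OF assms(2)] eb_commute[of v u]
  by (auto simp: f_def c_def power2_eq_square algebra_simps)
qed

lemma H1_add: "u \<in> H1 ==> v \<in> H1 ==> (%x. u x + v x) \<in> H1"
 using H1_lincomb(1)[of u v 1 1] by simp

lemma H1_diff: "u \<in> H1 ==> v \<in> H1 ==> (%x. u x - v x) \<in> H1"
 using H1_lincomb(1)[of u v 1 "-1"] by simp

lemma H1_zero: "(%x. 0) \<in> H1" "en (%x. 0) = 0"
 using H1_sum[of "{}::nat set"] by auto

lemma en_mid_par:
 assumes "u \<in> H1" "v \<in> H1"
 shows "en (%x. u x - v x) + 4 * en (%x. (u x + v x) / 2) = 2 * en u + 2 * en v"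
 using H1_lincomb(2)[OF assms, of 1 "-1"] H1_lincomb(2)[OF assms, of "1/2" "1/2"]
 by (simp add: add_divide_distrib power2_eq_square)

section \<open>Energy bounds from pointwise increments\<close>

definition Dq :: "('a::euclidean_space => real) => real => 'a => real" where
 "Dq u t x = (\<Sum>b\<in>Basis. (u (x + t *\<^sub>R b) - u x)\<^sup>2)"

lemma Dq_integral:
 assumes "L2 u" shows "integrable lebesgue (Dq u t)" "S u t = (LINT x|lebesgue. Dq u t x)"
proof -
 have "L2 (%x. u (x + t *\<^sub>R b) - u x)" for b by (intro L2_diff L2_shift assms)
 then have i: "integrable lebesgue (%x. (u (x + t *\<^sub>R b) - u x)\<^sup>2)" for b by (simp add: L2_def)
 then show "integrable lebesgue (Dq u t)" unfolding Dq_def by (intro Bochner_Integration.integrable_sum)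
 show "S u t = (LINT x|lebesgue. Dq u t x)" unfolding S_def Dq_def nrm2_def using i by simp
qed

lemma Dq_nonneg: "0 <= Dq u t x" unfolding Dq_def by (intro sum_nonneg) auto

lemma H1_by_S_near:
 assumes u: "L2 u" and t0: "0 < t0" and C: "!!t. 0 < t ==> t < t0 ==> S u t <= C * t\<^sup>2"
 shows "u \<in> H1" "en u <= C"
proof -
 define t where "t n = t0 / real (Suc (Suc n))" for n
 have t: "0 < t n" "t n < t0" for n using t0 by (auto simp: t_def field_simps add_pos_nonneg)
 have "(%n. t0 * inverse (real (Suc (Suc n)))) ----> t0 * 0"
  by (rule tendsto_mult[OF tendsto_const LIMSEQ_Suc[OF LIMSEQ_inverse_real_of_nat]])
 then have "t ----> 0" by (simp add: t_def[abs_def] divide_inverse)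
 from H1_by_S[OF u t(1) this C[OF t(1,2)]] show "u \<in> H1" "en u <= C" by auto
qed

text \<open>Treating two functions jointly keeps estimates sharp in which only the sum of the
  squared increments is controlled, as for a partition of unity or for a truncation and its
  remainder.\<close>

lemma H1_pair_by_S:
 fixes u v :: "'a::euclidean_space => real"
 assumes u: "L2 u" "L2 v" and t0: "0 < t0" and C: "!!t. 0 < t ==> t < t0 ==> S u t + S v t <= C * t\<^sup>2"
 shows "u \<in> H1" "v \<in> H1" "en u + en v <= C"
proof -
 have S0: "0 <= S w t" for w :: "'a => real" and t unfolding S_def by (intro sum_nonneg) auto
 show H: "u \<in> H1" "v \<in> H1"
 proof -
  show "u \<in> H1"
  proof (rule H1_by_S_near(1)[OF u(1) t0])
   show "S u t <= C * t\<^sup>2" if "0 < t" "t < t0" for t using C[OF that] S0[of v t] by linarith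
  qed
  show "v \<in> H1"
  proof (rule H1_by_S_near(1)[OF u(2) t0])
   show "S v t <= C * t\<^sup>2" if "0 < t" "t < t0" for t using C[OF that] S0[of u t] by linarith
  qed
 qed
 have l: "((%t. S u t / t\<^sup>2 + S v t / t\<^sup>2) \<longlongrightarrow> en u + en v) (at_right 0)"
  by (intro tendsto_add S_limit H)
 have "\<forall>\<^sub>F t in at_right 0. S u t / t\<^sup>2 + S v t / t\<^sup>2 <= C"
  unfolding eventually_at_right_field
 proof (intro exI[of _ t0] conjI allI impI t0)
  fix t assume "0 < t" "t < t0"
  then show "S u t / t\<^sup>2 + S v t / t\<^sup>2 <= C"
   using C[of t] by (simp add: add_divide_distrib[symmetric] divide_le_eq)
 qed
 then show "en u + en v <= C" by (rule tendsto_upperbound[OF l]) simp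
qed

text \<open>Stands in for chain and product rules: an oscillation bound becomes an energy bound.
  Young's inequality with parameter tht splits the square of the sum; tht stays free so that a sharp
  triangle inequality can be recovered later.\<close>

lemma en_contract2:
 assumes v: "L2 v" and u: "u1 \<in> H1" "u2 \<in> H1" and tht: "0 < tht"
  and c: "!!x y. \<bar>v x - v y\<bar> <= \<bar>u1 x - u1 y\<bar> + \<bar>u2 x - u2 y\<bar>"
 shows "v \<in> H1" "en v <= (1 + tht) * en u1 + (1 + 1/tht) * en u2"
proof -
 have pt: "(v x - v y)\<^sup>2 <= (1 + tht) * (u1 x - u1 y)\<^sup>2 + (1 + 1/tht) * (u2 x - u2 y)\<^sup>2" for x y
 proof -
  define p q where "p = \<bar>u1 x - u1 y\<bar>" and "q = \<bar>u2 x - u2 y\<bar>"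
  have "(v x - v y)\<^sup>2 <= (p + q)\<^sup>2" using c[of x y] unfolding p_def q_def by (simp add: abs_le_square_iff[symmetric])
  also have "(p + q)\<^sup>2 <= (1 + tht) * p\<^sup>2 + (1 + 1/tht) * q\<^sup>2"
  proof -
   have "0 <= (tht * p - q)\<^sup>2 / tht" using tht by simp
   also have "... = (1 + tht) * p\<^sup>2 + (1 + 1/tht) * q\<^sup>2 - (p + q)\<^sup>2"
    using tht by (simp add: power2_eq_square field_simps)
   finally show ?thesis by simp
  qed
  finally show ?thesis by (simp add: p_def q_def)
 qed
 have "S v t <= ((1 + tht) * en u1 + (1 + 1/tht) * en u2) * t\<^sup>2" for t
 proof -
  note L = Dq_integral[OF H1_L2[OF u(1)], of t] Dq_integral[OF H1_L2[OF u(2)], of t] Dq_integral[OF v, of t]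
  have "S v t <= (LINT x|lebesgue. (1 + tht) * Dq u1 t x + (1 + 1/tht) * Dq u2 t x)"
   unfolding L(6)
  proof (rule integral_mono)
   show "Dq v t x <= (1 + tht) * Dq u1 t x + (1 + 1/tht) * Dq u2 t x" for x
    unfolding Dq_def sum_distrib_left sum.distrib[symmetric] by (intro sum_mono pt)
  qed (use L in auto)
  also have "... = (1 + tht) * S u1 t + (1 + 1/tht) * S u2 t" using L by simp
  also have "... <= (1 + tht) * (t\<^sup>2 * en u1) + (1 + 1/tht) * (t\<^sup>2 * en u2)"
   using tht by (intro add_mono mult_left_mono S_le u) auto
  finally show ?thesis by (simp add: algebra_simps)
 qed
 from H1_by_S_near[OF v zero_less_one this] show "v \<in> H1" "en v <= (1 + tht) * en u1 + (1 + 1/tht) * en u2" by this+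
qed

text \<open>The second function is taken to be zero and tht tends to zero, which restores the
  constant 1.\<close>

lemma en_contract:
 assumes v: "L2 v" and u: "u \<in> H1" and c: "!!x y. \<bar>v x - v y\<bar> <= \<bar>u x - u y\<bar>"
 shows "v \<in> H1" "en v <= en u"
proof -
 have c': "\<bar>v x - v y\<bar> <= \<bar>u x - u y\<bar> + \<bar>(%x. 0) x - (%x. 0) y\<bar>" for x y using c by simp
 show "v \<in> H1" using en_contract2(1)[OF v u H1_zero(1) _ c', of 1] by simp
 have "en v <= en u + tht * en u" if "0 < tht" for tht
  using en_contract2(2)[OF v u H1_zero(1) that c'] by (simp add: H1_zero algebra_simps)
 then have ev: "\<forall>\<^sub>F tht in at_right 0. en v <= en u + tht * en u"
  using eventually_at_right_less[of "0::real"] by (rule_tac eventually_mono)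
 have l: "((%tht. en u + tht * en u) \<longlongrightarrow> en u + 0 * en u) (at_right 0)"
  by (intro tendsto_intros)
 have "en v <= en u + 0 * en u" by (rule tendsto_lowerbound[OF l ev]) simp
 then show "en v <= en u" by simp
qed

lemma sqrt_subadd_from_theta:
 fixes a b c :: real
 assumes "0 <= a" "0 <= b" "0 <= c" and h: "!!tht. 0 < tht ==> c <= (1 + tht) * a + (1 + 1/tht) * b"
 shows "sqrt c <= sqrt a + sqrt b"
proof (rule field_le_epsilon)
 fix e :: real assume e: "0 < e"
 \<comment> \<open>The shifted roots are positive, so the optimal parameter tht = q/p is admissible
   even when a or b vanishes.\<close>
 define p q where "p = sqrt a + e/2" and "q = sqrt b + e/2"
 have pq: "0 < p" "0 < q" using e assms by (auto simp: p_def q_def intro: add_nonneg_pos)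
 have ab: "a <= p\<^sup>2" "b <= q\<^sup>2" using e assms unfolding p_def q_def by (simp_all add: power2_sum)
 have "c <= (1 + q/p) * a + (1 + 1/(q/p)) * b" using pq by (intro h) simp
 also have "... <= (1 + q/p) * p\<^sup>2 + (1 + 1/(q/p)) * q\<^sup>2" using pq ab by (intro add_mono mult_left_mono) auto
 also have "... = (p + q)\<^sup>2" using pq by (simp add: power2_eq_square field_simps)
 finally have "sqrt c <= p + q" using pq by (intro real_le_lsqrt) auto
 then show "sqrt c <= sqrt a + sqrt b + e" by (simp add: p_def q_def)
qed

lemma sqrt_en_contract2:
 assumes "L2 v" "u1 \<in> H1" "u2 \<in> H1" "!!x y. \<bar>v x - v y\<bar> <= \<bar>u1 x - u1 y\<bar> + \<bar>u2 x - u2 y\<bar>"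
 shows "sqrt (en v) <= sqrt (en u1) + sqrt (en u2)"
 by (intro sqrt_subadd_from_theta en_contract2(2)[OF assms(1-3) _ assms(4)]) auto

lemma sqrt_en_add:
 assumes "u \<in> H1" "v \<in> H1" shows "sqrt (en (%x. u x + v x)) <= sqrt (en u) + sqrt (en v)"
 by (rule sqrt_en_contract2) (use assms in \<open>auto intro: H1_L2 H1_add\<close>)

lemma sqrt_en_cmult: "u \<in> H1 ==> sqrt (en (%x. c * u x)) = \<bar>c\<bar> * sqrt (en u)"
 by (simp add: H1_cmult real_sqrt_mult)

lemma sqrt_en_sum:
 assumes "finite I" "!!i. i \<in> I ==> f i \<in> H1"
 shows "sqrt (en (%x. \<Sum>i\<in>I. c i * f i x)) <= (\<Sum>i\<in>I. \<bar>c i\<bar> * sqrt (en (f i)))"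
 using assms
proof (induction I)
 case (insert a I)
 have "sqrt (en (%x. c a * f a x + (\<Sum>i\<in>I. c i * f i x))) <= sqrt (en (%x. c a * f a x)) + sqrt (en (%x. \<Sum>i\<in>I. c i * f i x))"
  using insert by (intro sqrt_en_add H1_cmult H1_sum) auto
 then show ?case using insert by (simp add: sqrt_en_cmult)
qed (simp add: H1_zero)

section \<open>Semicontinuity, localization and scaling of the energy\<close>

lemma fatou_integral:
 assumes i: "!!n. integrable M (g n)" "!!n x. 0 <= g n x" and f: "f \<in> borel_measurable M" "!!x. 0 <= (f x :: real)"
  and ae: "AE x in M. (%n. g n x) ----> f x" and b: "!!n. (LINT x|M. g n x) <= C n" and C: "C ----> c"
 shows "(LINT x|M. f x) <= c"
proof -
 have Cn: "0 <= C n" for n using b[of n] i(2) Bochner_Integration.integral_nonneg[of M "g n"] by (meson order_trans)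
 have c0: "0 <= c" using Cn C by (meson LIMSEQ_le_const)
 have "(\<integral>\<^sup>+x. ennreal (f x) \<partial>M) = (\<integral>\<^sup>+x. liminf (%n. ennreal (g n x)) \<partial>M)"
 proof (rule nn_integral_cong_AE)
  show "AE x in M. ennreal (f x) = liminf (%n. ennreal (g n x))"
   using ae
  proof eventually_elim
   case (elim x)
   have "(%n. ennreal (g n x)) ----> ennreal (f x)" by (intro tendsto_ennrealI elim)
   then show ?case by (rule lim_imp_Liminf[OF sequentially_bot, symmetric])
  qed
 qed
 also have "... <= liminf (%n. \<integral>\<^sup>+x. ennreal (g n x) \<partial>M)"
  using i by (intro nn_integral_liminf) auto
 also have "... <= liminf (%n. ennreal (C n))"
  using b i by (intro Liminf_mono always_eventually) (auto simp: nn_integral_eq_integral ennreal_leI)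
 also have "... = ennreal c" using C by (intro lim_imp_Liminf tendsto_ennrealI) auto
 finally have *: "(\<integral>\<^sup>+x. ennreal (f x) \<partial>M) <= ennreal c" .
 have "(LINT x|M. f x) = enn2real (\<integral>\<^sup>+x. ennreal (f x) \<partial>M)"
  using f by (intro integral_eq_nn_integral) auto
 also have "... <= c" using * c0 by (intro enn2real_leI) auto
 finally show ?thesis .
qed

text \<open>For fixed t the functional \<open>S\<close> is lower semicontinuous by Fatou, and the
  bound C n * t^2 passes to the limit; then t tends to zero.\<close>

lemma en_lsc:
 assumes H: "!!n. u n \<in> H1" and v: "L2 v" and ae: "AE x in lebesgue. (%n. u n x) ----> v x"
  and b: "!!n. en (u n) <= C n" and C: "C ----> c"
 shows "v \<in> H1" "en v <= c"
proof -
 have "S v t <= c * t\<^sup>2" for t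
  unfolding Dq_integral(2)[OF v]
 proof (rule fatou_integral)
  show "integrable lebesgue (Dq (u n) t)" for n by (rule Dq_integral(1)[OF H1_L2[OF H]])
  show "Dq v t \<in> borel_measurable lebesgue" using Dq_integral(1)[OF v] by auto
  have "AE x in lebesgue. \<forall>b\<in>Basis. (%n. u n (x + t *\<^sub>R b)) ----> v (x + t *\<^sub>R b)"
   by (intro AE_finite_allI shift_AE[OF ae]) simp
  with ae show "AE x in lebesgue. (%n. Dq (u n) t x) ----> Dq v t x"
  proof eventually_elim
   case (elim x)
   then show ?case unfolding Dq_def by (intro tendsto_intros) auto
  qed
  show "(LINT x|lebesgue. Dq (u n) t x) <= C n * t\<^sup>2" for n
  proof -
   have "S (u n) t <= t\<^sup>2 * en (u n)" by (rule S_le[OF H])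
   also have "... <= t\<^sup>2 * C n" by (intro mult_left_mono b) simp
   finally show ?thesis by (simp add: Dq_integral(2)[OF H1_L2[OF H]] mult.commute)
  qed
  show "(%n. C n * t\<^sup>2) ----> c * t\<^sup>2" by (intro tendsto_intros C)
 qed (auto intro: Dq_nonneg)
 from H1_by_S_near[OF v zero_less_one this] show "v \<in> H1" "en v <= c" by this+
qed

lemma en_lsc_L2:
 assumes H: "!!n. u n \<in> H1" and v: "L2 v" and l: "(%n. nrm (%x. u n x - v x)) ----> 0"
  and b: "!!n. en (u n) <= C n" and C: "C ----> c"
 shows "v \<in> H1" "en v <= c"
proof -
 obtain r where r: "strict_mono r" "AE x in lebesgue. (%n. u (r n) x) ----> v x"
  by (rule L2_conv_AE_subseq[of u v]) (use H H1_L2 v l in auto)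
 show "v \<in> H1" "en v <= c"
  using en_lsc[OF H v r(2) b LIMSEQ_subseq_LIMSEQ[OF C r(1), unfolded o_def]] by auto
qed

text \<open>The IMS formula for increments: since the squares of the cut-offs sum to 1, what is left
  beyond the increment of u is the product \<open>u x * u y\<close> weighted by the squared
  increments of the cut-offs. Each of the d coordinate directions costs 2 K^2 times the
  mass.\<close>

lemma en_IMS:
 fixes u :: "'a::euclidean_space => real"
 assumes u: "u \<in> H1" and m: "xir \<in> borel_measurable lebesgue" "et \<in> borel_measurable lebesgue"
  and one: "!!x. (xir x)\<^sup>2 + (et x)\<^sup>2 = 1"
  and lip: "!!x y. \<bar>xir x - xir y\<bar> <= K * norm (x - y)" "!!x y. \<bar>et x - et y\<bar> <= K * norm (x - y)"
 shows "(%x. xir x * u x) \<in> H1" "(%x. et x * u x) \<in> H1"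
  "en (%x. xir x * u x) + en (%x. et x * u x) <= en u + 2 * K\<^sup>2 * real DIM('a) * nrm2 u"
proof -
 have uL: "L2 u" using u by (rule H1_L2)
 have b1: "\<bar>xir x\<bar> <= 1" "\<bar>et x\<bar> <= 1" for x
 proof -
  have "(xir x)\<^sup>2 <= 1" "(et x)\<^sup>2 <= 1" using one[of x] zero_le_power2[of "xir x"] zero_le_power2[of "et x"] by linarith+
  then show "\<bar>xir x\<bar> <= 1" "\<bar>et x\<bar> <= 1" by (simp_all only: abs_square_le_1)
 qed
 have L: "L2 (%x. xir x * u x)" "L2 (%x. et x * u x)" using L2_mult_bdd[OF uL] m b1 by auto
 have id: "(xir x * u x - xir y * u y)\<^sup>2 + (et x * u x - et y * u y)\<^sup>2
   <= (u x - u y)\<^sup>2 + K\<^sup>2 * (norm (x - y))\<^sup>2 * ((u x)\<^sup>2 + (u y)\<^sup>2)" for x y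
 proof -
  have "(xir x * u x - xir y * u y)\<^sup>2 + (et x * u x - et y * u y)\<^sup>2
   = ((xir x)\<^sup>2 + (et x)\<^sup>2) * (u x)\<^sup>2 + ((xir y)\<^sup>2 + (et y)\<^sup>2) * (u y)\<^sup>2 - 2 * (xir x * xir y + et x * et y) * (u x * u y)"
   by (simp add: power2_eq_square algebra_simps)
  also have "... = (u x - u y)\<^sup>2 + (((xir x)\<^sup>2 + (et x)\<^sup>2) + ((xir y)\<^sup>2 + (et y)\<^sup>2) - 2 * (xir x * xir y + et x * et y)) * (u x * u y)"
   unfolding one by (simp add: power2_eq_square algebra_simps)
  also have "... = (u x - u y)\<^sup>2 + ((xir x - xir y)\<^sup>2 + (et x - et y)\<^sup>2) * (u x * u y)"
   by (simp add: power2_eq_square algebra_simps)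
  also have "((xir x - xir y)\<^sup>2 + (et x - et y)\<^sup>2) * (u x * u y) <= K\<^sup>2 * (norm (x - y))\<^sup>2 * ((u x)\<^sup>2 + (u y)\<^sup>2)"
  proof -
   have "(xir x - xir y)\<^sup>2 <= (K * norm (x - y))\<^sup>2" "(et x - et y)\<^sup>2 <= (K * norm (x - y))\<^sup>2"
    using power_mono[OF lip(1)[of x y], of 2] power_mono[OF lip(2)[of x y], of 2] by auto
   then have a: "(xir x - xir y)\<^sup>2 + (et x - et y)\<^sup>2 <= 2 * K\<^sup>2 * (norm (x - y))\<^sup>2" by (simp add: power_mult_distrib)
   have c: "u x * u y <= ((u x)\<^sup>2 + (u y)\<^sup>2) / 2" using sum_squares_bound[of "u x" "u y"] by simp
   have "((xir x - xir y)\<^sup>2 + (et x - et y)\<^sup>2) * (u x * u y) <= ((xir x - xir y)\<^sup>2 + (et x - et y)\<^sup>2) * (((u x)\<^sup>2 + (u y)\<^sup>2) / 2)"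
    using c by (intro mult_left_mono) auto
   also have "... <= (2 * K\<^sup>2 * (norm (x - y))\<^sup>2) * (((u x)\<^sup>2 + (u y)\<^sup>2) / 2)"
    using a by (intro mult_right_mono) auto
   finally show ?thesis by simp
  qed
  finally show ?thesis by simp
 qed
 have "S (%x. xir x * u x) t + S (%x. et x * u x) t <= (en u + 2 * K\<^sup>2 * real DIM('a) * nrm2 u) * t\<^sup>2" if t: "0 < t" for t
 proof -
  define E where "E x = (\<Sum>b\<in>Basis. K\<^sup>2 * t\<^sup>2 * ((u (x + t *\<^sub>R b))\<^sup>2 + (u x)\<^sup>2))" for x
  have si: "integrable lebesgue (%x. (u (x + t *\<^sub>R b))\<^sup>2)" "integrable lebesgue (%x. (u x)\<^sup>2)" for b
   using L2_shift[OF uL] uL by (auto simp: L2_def)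
  have Ei: "integrable lebesgue E" unfolding E_def
   by (intro Bochner_Integration.integrable_sum integrable_mult_right Bochner_Integration.integrable_add si)
  have "(LINT x|lebesgue. E x) = (\<Sum>b::'a\<in>Basis. K\<^sup>2 * t\<^sup>2 * (nrm2 (%x. u (x + t *\<^sub>R b)) + nrm2 u))"
   unfolding E_def nrm2_def using si by simp
  then have EI: "(LINT x|lebesgue. E x) = 2 * K\<^sup>2 * real DIM('a) * nrm2 u * t\<^sup>2"
   by (simp add: nrm2_shift[OF uL] algebra_simps)
  note D = Dq_integral[OF L(1), of t] Dq_integral[OF L(2), of t] Dq_integral[OF uL, of t]
  have "S (%x. xir x * u x) t + S (%x. et x * u x) t = (LINT x|lebesgue. Dq (%x. xir x * u x) t x + Dq (%x. et x * u x) t x)"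
   using D by simp
  also have "... <= (LINT x|lebesgue. Dq u t x + E x)"
  proof (rule integral_mono)
   show "Dq (%x. xir x * u x) t x + Dq (%x. et x * u x) t x <= Dq u t x + E x" for x
    unfolding Dq_def E_def sum.distrib[symmetric]
    by (intro sum_mono order_trans[OF id]) (use t in simp)
  qed (use D Ei in auto)
  also have "... = S u t + 2 * K\<^sup>2 * real DIM('a) * nrm2 u * t\<^sup>2" using D Ei EI by simp
  also have "... <= t\<^sup>2 * en u + 2 * K\<^sup>2 * real DIM('a) * nrm2 u * t\<^sup>2" using S_le[OF u] by simp
  finally show ?thesis by (simp add: algebra_simps)
 qed
 from H1_pair_by_S[OF L zero_less_one this]
 show "(%x. xir x * u x) \<in> H1" "(%x. et x * u x) \<in> H1"
  "en (%x. xir x * u x) + en (%x. et x * u x) <= en u + 2 * K\<^sup>2 * real DIM('a) * nrm2 u" by auto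
qed

lemma en_pair_contract:
 assumes u: "u \<in> H1" and L: "L2 v" "L2 w"
  and c: "!!x y. (v x - v y)\<^sup>2 + (w x - w y)\<^sup>2 <= (u x - u y)\<^sup>2"
 shows "v \<in> H1" "w \<in> H1" "en v + en w <= en u"
proof -
 have uL: "L2 u" using u by (rule H1_L2)
 have "S v t + S w t <= en u * t\<^sup>2" for t
 proof -
  note D = Dq_integral[OF L(1), of t] Dq_integral[OF L(2), of t] Dq_integral[OF uL, of t]
  have "S v t + S w t = (LINT x|lebesgue. Dq v t x + Dq w t x)" using D by simp
  also have "... <= (LINT x|lebesgue. Dq u t x)"
  proof (rule integral_mono)
   show "Dq v t x + Dq w t x <= Dq u t x" for x
    unfolding Dq_def sum.distrib[symmetric] by (intro sum_mono c)
  qed (use D in auto)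
  also have "... <= en u * t\<^sup>2" using S_le[OF u, of t] D by (simp add: mult.commute)
  finally show ?thesis .
 qed
 from H1_pair_by_S[OF L zero_less_one this]
 show "v \<in> H1" "w \<in> H1" "en v + en w <= en u" by auto
qed

lemma en_affine:
 fixes u :: "'a::euclidean_space => real"
 assumes u: "u \<in> H1" and s: "0 < s"
 shows "(%x. u (y + s *\<^sub>R x)) \<in> H1" "en (%x. u (y + s *\<^sub>R x)) <= s\<^sup>2 / s ^ DIM('a) * en u"
proof -
 have uL: "L2 u" using u by (rule H1_L2)
 have L: "L2 (%x. u (y + s *\<^sub>R x))" using s by (intro L2_affine uL) auto
 have "S (%x. u (y + s *\<^sub>R x)) t <= s\<^sup>2 / s ^ DIM('a) * en u * t\<^sup>2" for t
 proof -
  have "nrm2 (%x. u (y + s *\<^sub>R (x + t *\<^sub>R b)) - u (y + s *\<^sub>R x)) = nrm2 (%x. u (x + (s * t) *\<^sub>R b) - u x) / s ^ DIM('a)" for b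
   using nrm2_affine[of s "%x. u (x + (s * t) *\<^sub>R b) - u x" y] s L2_diff[OF L2_shift[OF uL] uL, of "(s * t) *\<^sub>R b"]
   by (simp add: scaleR_add_right add.assoc)
  then have "S (%x. u (y + s *\<^sub>R x)) t = S u (s * t) / s ^ DIM('a)"
   unfolding S_def by (simp add: sum_divide_distrib)
  also have "... <= ((s * t)\<^sup>2 * en u) / s ^ DIM('a)" using s by (intro divide_right_mono S_le u) auto
  finally show ?thesis by (simp add: power_mult_distrib mult.commute mult.left_commute)
 qed
 from H1_by_S_near[OF L zero_less_one this] show "(%x. u (y + s *\<^sub>R x)) \<in> H1" "en (%x. u (y + s *\<^sub>R x)) <= s\<^sup>2 / s ^ DIM('a) * en u" by this+
qed

text \<open>For shifts shorter than d no pair of points x, \<open>x + t b\<close> meets both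
  supports, so the increments never interact; small t determine the energy.\<close>

lemma en_separated:
 fixes f g :: "'a::euclidean_space => real"
 assumes f: "f \<in> H1" and g: "g \<in> H1" and d: "0 < d" and sep: "!!x y. f x ~= 0 ==> g y ~= 0 ==> d <= dist x y"
 shows "en (%x. f x + g x) <= en f + en g" "nrm2 (%x. f x + g x) = nrm2 f + nrm2 g"
proof -
 have fL: "L2 f" "L2 g" "L2 (%x. f x + g x)" using f g by (auto intro: H1_L2 H1_add)
 have z: "f x * g x = 0" for x using sep[of x x] d by auto
 then show "nrm2 (%x. f x + g x) = nrm2 f + nrm2 g" by (simp only: nrm2_add[OF fL(1,2)] ip_def z) simp
 have "S (%x. f x + g x) t <= (en f + en g) * t\<^sup>2" if t: "0 < t" "t < d" for t
 proof -
  note D = Dq_integral[OF fL(1), of t] Dq_integral[OF fL(2), of t] Dq_integral[OF fL(3), of t]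
  have "S (%x. f x + g x) t = (LINT x|lebesgue. Dq f t x + Dq g t x)"
   unfolding D(6)
  proof (rule Bochner_Integration.integral_cong[OF refl])
   fix x
   have "(f (x + t *\<^sub>R b) + g (x + t *\<^sub>R b) - (f x + g x))\<^sup>2 = (f (x + t *\<^sub>R b) - f x)\<^sup>2 + (g (x + t *\<^sub>R b) - g x)\<^sup>2" if b: "b \<in> Basis" for b
   proof -
    have "dist (x + t *\<^sub>R b) x < d" "dist x (x + t *\<^sub>R b) < d" "dist x x < d" "dist (x + t *\<^sub>R b) (x + t *\<^sub>R b) < d"
     using t b d by (auto simp: dist_norm)
    then have "(f (x + t *\<^sub>R b) - f x) * (g (x + t *\<^sub>R b) - g x) = 0"
     using sep[of "x + t *\<^sub>R b" x] sep[of x "x + t *\<^sub>R b"] sep[of x x] sep[of "x + t *\<^sub>R b" "x + t *\<^sub>R b"]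
     by (cases "f (x + t *\<^sub>R b) = 0"; cases "f x = 0"; cases "g (x + t *\<^sub>R b) = 0"; cases "g x = 0") force+
    moreover have "(f (x + t *\<^sub>R b) + g (x + t *\<^sub>R b) - (f x + g x))\<^sup>2
     = (f (x + t *\<^sub>R b) - f x)\<^sup>2 + (g (x + t *\<^sub>R b) - g x)\<^sup>2 + 2 * ((f (x + t *\<^sub>R b) - f x) * (g (x + t *\<^sub>R b) - g x))"
     by (simp add: power2_eq_square algebra_simps)
    ultimately show ?thesis by simp
   qed
   then show "Dq (%x. f x + g x) t x = Dq f t x + Dq g t x"
    unfolding Dq_def sum.distrib[symmetric] by (intro sum.cong) auto
  qed
  also have "... = S f t + S g t" using D by simp
  also have "... <= t\<^sup>2 * en f + t\<^sup>2 * en g" by (intro add_mono S_le f g)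
  finally show ?thesis by (simp add: algebra_simps)
 qed
 then show "en (%x. f x + g x) <= en f + en g" by (rule H1_by_S_near(2)[OF fL(3) d])
qed

lemma H1_lipschitz:
 fixes ps :: "'a::euclidean_space => real"
 assumes K: "!!x y. \<bar>ps x - ps y\<bar> <= K * norm (x - y)" and R: "!!x. R <= norm x ==> ps x = 0"
 shows "ps \<in> H1"
proof -
 have K0: "0 <= K"
 proof -
  obtain b :: 'a where "b \<in> Basis" using nonempty_Basis by blast
  then show ?thesis using order_trans[OF abs_ge_zero K[of b 0]] by simp
 qed
 have lip: "K-lipschitz_on UNIV ps" using K K0 by (auto simp: lipschitz_on_def dist_norm)
 have c: "continuous_on UNIV ps" using lip by (rule lipschitz_on_continuous_on)
 have "\<bar>ps x\<bar> <= K * (\<bar>R\<bar> + \<bar>R\<bar> + 1)" for x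
 proof -
  obtain b :: 'a where b: "b \<in> Basis" using nonempty_Basis by blast
  have "ps ((\<bar>R\<bar> + 1) *\<^sub>R b) = 0" using b by (intro R) simp
  show ?thesis
  proof (cases "R <= norm x")
   case False
   have "\<bar>ps x - ps ((\<bar>R\<bar> + 1) *\<^sub>R b)\<bar> <= K * norm (x - (\<bar>R\<bar> + 1) *\<^sub>R b)" by (rule K)
   also have "... <= K * (\<bar>R\<bar> + \<bar>R\<bar> + 1)"
    using False b norm_triangle_ineq4[of x "(\<bar>R\<bar> + 1) *\<^sub>R b"] by (intro mult_left_mono K0) auto
   finally show ?thesis using \<open>ps ((\<bar>R\<bar> + 1) *\<^sub>R b) = 0\<close> by simp
  qed (use R[of x] K0 in auto)
 qed
 then have L: "L2 ps" by (rule bounded_support_L2[OF continuous_borel_lebesgue[OF c], of _ R]) (use R in auto)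
 define W where "W = nrm2 (%x. indicator (cball (0::'a) (R + 1)) x)"
 have "S ps t <= (real DIM('a) * (K\<^sup>2 * W)) * t\<^sup>2" if t: "0 < t" "t < 1" for t
 proof -
  have "nrm2 (%x. ps (x + t *\<^sub>R b) - ps x) <= nrm2 (%x::'a. (K * t) * indicator (cball 0 (R + 1)) x)" if b: "b \<in> Basis" for b
  proof (rule nrm2_mono[OF L2_cmult[OF cball_L2] L2_meas[OF L2_diff[OF L2_shift[OF L] L]]], rule AE_I2)
   fix x
   show "\<bar>ps (x + t *\<^sub>R b) - ps x\<bar> <= \<bar>K * t * indicator (cball 0 (R + 1)) x\<bar>"
   proof (cases "norm x <= R + 1")
    case True
    then show ?thesis using K[of "x + t *\<^sub>R b" x] b t K0 by (simp add: abs_mult)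
   next
    case False
    have "norm x <= norm (x + t *\<^sub>R b) + norm (t *\<^sub>R b)" using norm_triangle_ineq4[of "x + t *\<^sub>R b" "t *\<^sub>R b"] by simp
    then have "R <= norm (x + t *\<^sub>R b)" "R <= norm x" using False b t by auto
    then show ?thesis using R by simp
   qed
  qed
  also have "nrm2 (%x::'a. (K * t) * indicator (cball 0 (R + 1)) x) = K\<^sup>2 * W * t\<^sup>2"
   by (simp add: nrm2_cmult W_def power_mult_distrib)
  finally have "S ps t <= (\<Sum>b\<in>(Basis::'a set). K\<^sup>2 * W * t\<^sup>2)" unfolding S_def by (intro sum_mono)
  then show ?thesis by simp
 qed
 then show ?thesis by (rule H1_by_S_near(1)[OF L zero_less_one])
qed

section \<open>Truncation\<close>

definition trunc :: "real => real => real" where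
 "trunc M s = max (- M) (min M s)"

text \<open>For the last inequality: truncation and remainder are both nondecreasing, so their
  increments a and b have a nonnegative product and a^2 + b^2 is at most (a + b)^2.\<close>

lemma trunc_props:
 assumes "0 <= M"
 shows "\<bar>trunc M s\<bar> <= M" "\<bar>trunc M s\<bar> <= \<bar>s\<bar>" "trunc M s = 0 \<longleftrightarrow> M = 0 \<or> s = 0"
  "\<bar>s\<bar> <= M ==> trunc M s = s" "\<bar>s - trunc M s\<bar> <= \<bar>s\<bar>"
  "(trunc M s - trunc M t)\<^sup>2 + ((s - trunc M s) - (t - trunc M t))\<^sup>2 <= (s - t)\<^sup>2"
proof -
 define a b where "a = trunc M s - trunc M t" and "b = (s - trunc M s) - (t - trunc M t)"
 have "0 <= a * b"
 proof (cases "s <= t")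
  case True
  then have "a <= 0" "b <= 0" by (auto simp: a_def b_def trunc_def max_def min_def)
  then show ?thesis by (rule mult_nonpos_nonpos)
 next
  case False
  then have "0 <= a" "0 <= b" by (auto simp: a_def b_def trunc_def max_def min_def)
  then show ?thesis by (rule mult_nonneg_nonneg)
 qed
 moreover have "s - t = a + b" by (simp add: a_def b_def)
 ultimately have "a\<^sup>2 + b\<^sup>2 <= (s - t)\<^sup>2" by (simp add: power2_sum)
 then show "(trunc M s - trunc M t)\<^sup>2 + ((s - trunc M s) - (t - trunc M t))\<^sup>2 <= (s - t)\<^sup>2"
  by (simp add: a_def b_def)
qed (use assms in \<open>auto simp: trunc_def max_def min_def\<close>)

lemma trunc_measurable: "u \<in> borel_measurable M ==> (%x. trunc c (u x)) \<in> borel_measurable M"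
 unfolding trunc_def by simp

lemma trunc_H1:
 assumes u: "u \<in> H1" and M: "0 <= M"
 shows "(%x. trunc M (u x)) \<in> H1" "(%x. u x - trunc M (u x)) \<in> H1"
  "en (%x. trunc M (u x)) + en (%x. u x - trunc M (u x)) <= en u"
proof -
 have uL: "L2 u" using u by (rule H1_L2)
 have L: "L2 (%x. trunc M (u x))"
  by (rule L2_bound[OF uL trunc_measurable[OF L2_meas[OF uL]], where C=1]) (use trunc_props(2)[OF M] in auto)
 note en_pair_contract[OF u L L2_diff[OF uL L]] trunc_props(6)[OF M]
 then show "(%x. trunc M (u x)) \<in> H1" "(%x. u x - trunc M (u x)) \<in> H1"
  "en (%x. trunc M (u x)) + en (%x. u x - trunc M (u x)) <= en u" by auto
qed

text \<open>The norm of the remainder is a matter of dominated convergence. If its energy were at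
  least e along a subsequence, the truncations there would have energy at most
  \<open>en u - e\<close>, against lower semicontinuity.\<close>

lemma trunc_tendsto:
 assumes u: "u \<in> H1"
 shows "(%n. nrm (%x. u x - trunc (real n) (u x))) ----> 0" "(%n. en (%x. u x - trunc (real n) (u x))) ----> 0"
proof -
 have uL: "L2 u" using u by (rule H1_L2)
 have pt: "\<forall>\<^sub>F n in sequentially. trunc (real n) s = s" for s
 proof -
  have "\<forall>\<^sub>F n in sequentially. \<bar>s\<bar> <= real n" using filterlim_real_sequentially[unfolded filterlim_at_top] by blast
  then show ?thesis by eventually_elim (auto simp: trunc_props)
 qed
 show n0: "(%n. nrm (%x. u x - trunc (real n) (u x))) ----> 0"
 proof (rule dominated_nrm[OF _ uL])
  show "(%x. u x - trunc (real n) (u x)) \<in> borel_measurable lebesgue" for n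
   using trunc_measurable[OF L2_meas[OF uL]] L2_meas[OF uL] by simp
  show "AE x in lebesgue. (%n. u x - trunc (real n) (u x)) ----> 0"
  proof (intro AE_I2 tendsto_eventually)
   fix x
   show "\<forall>\<^sub>F n in sequentially. u x - trunc (real n) (u x) = 0"
    using pt[of "u x"] by eventually_elim simp
  qed
  show "AE x in lebesgue. \<bar>u x - trunc (real n) (u x)\<bar> <= \<bar>u x\<bar>" for n
   by (intro AE_I2 trunc_props) simp
 qed
 show "(%n. en (%x. u x - trunc (real n) (u x))) ----> 0"
 proof (rule LIMSEQ_I, rule ccontr)
  fix e :: real assume e: "0 < e"
  let ?a = "%n. en (%x. u x - trunc (real n) (u x))"
  assume "\<not> (\<exists>no. \<forall>n\<ge>no. norm (?a n - 0) < e)"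
  then have "\<forall>no. \<exists>n\<ge>no. e <= ?a n" by (auto simp: not_less)
  then have "infinite {n. e <= ?a n}" unfolding infinite_nat_iff_unbounded_le by blast
  then obtain r :: "nat => nat" where r: "strict_mono r" "!!n. e <= ?a (r n)"
   using infinite_enumerate[of "{n. e <= ?a n}"] by auto
  have "en u <= en u - e"
  proof (rule en_lsc_L2(2)[OF _ uL _ _ tendsto_const])
   show "(%x. trunc (real (r n)) (u x)) \<in> H1" for n by (rule trunc_H1(1)[OF u]) simp
   show "(%n. nrm (%x. trunc (real (r n)) (u x) - u x)) ----> 0"
    using LIMSEQ_subseq_LIMSEQ[OF n0 r(1)] by (simp add: o_def nrm_diff_commute[of u])
   show "en (%x. trunc (real (r n)) (u x)) <= en u - e" for n
    using trunc_H1(3)[OF u, of "real (r n)"] r(2)[of n] by simp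
  qed
  then show False using e by simp
 qed
qed

subsection \<open>Capacity and quasi-open sets\<close>

definition h1 :: "('a::euclidean_space => real) => real" where
 "h1 u = nrm2 u + en u"

definition hn :: "('a::euclidean_space => real) => real" where
 "hn u = sqrt (h1 u)"

lemma H1_norm_sq_h1: "H1_norm_sq u = h1 u"
 by (simp add: H1_norm_sq_def h1_def nrm2_def en_def)

lemma h1_nonneg [simp]: "0 <= h1 u" by (simp add: h1_def)

lemma hn_nonneg [simp]: "0 <= hn u" by (simp add: hn_def)

lemma hn_sq: "(hn u)\<^sup>2 = h1 u" by (simp add: hn_def)

lemma hn_eq: "hn u = sqrt ((nrm u)\<^sup>2 + (sqrt (en u))\<^sup>2)"
 by (simp add: hn_def h1_def nrm_sq)

lemma nrm_le_hn: "nrm u <= hn u"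
 unfolding nrm_def hn_def h1_def by simp

lemma en_le_h1: "en u <= h1 u" by (simp add: h1_def)

lemma hn_add:
 assumes "u \<in> H1" "v \<in> H1" shows "hn (%x. u x + v x) <= hn u + hn v"
proof -
 have a: "(nrm (%x. u x + v x))\<^sup>2 <= (nrm u + nrm v)\<^sup>2"
  by (rule power_mono[OF nrm_add[OF assms[THEN H1_L2]] nrm_nonneg])
 have b: "(sqrt (en (%x. u x + v x)))\<^sup>2 <= (sqrt (en u) + sqrt (en v))\<^sup>2"
  by (rule power_mono[OF sqrt_en_add[OF assms]]) simp
 have "hn (%x. u x + v x) <= sqrt ((nrm u + nrm v)\<^sup>2 + (sqrt (en u) + sqrt (en v))\<^sup>2)"
  unfolding hn_eq by (rule real_sqrt_le_mono[OF add_mono[OF a b]])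
 also have "... <= hn u + hn v" unfolding hn_eq by (rule real_sqrt_sum_squares_triangle_ineq)
 finally show ?thesis .
qed

lemma hn_cmult: "u \<in> H1 ==> hn (%x. c * u x) = \<bar>c\<bar> * hn u"
 by (simp add: hn_def h1_def nrm2_cmult H1_cmult(2) distrib_left[symmetric] real_sqrt_mult)

lemma hn_diff:
 assumes "u \<in> H1" "v \<in> H1" shows "hn (%x. u x - v x) <= hn u + hn v"
 using hn_add[OF assms(1) H1_cmult(1)[OF assms(2), of "-1"]] hn_cmult[OF assms(2), of "-1"] by simp

lemma abs_H1:
 assumes u: "u \<in> H1" shows "(%x. \<bar>u x\<bar>) \<in> H1" "hn (%x. \<bar>u x\<bar>) <= hn u"
proof -
 note c = en_contract[OF L2_abs[OF H1_L2[OF u]] u]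
 show "(%x. \<bar>u x\<bar>) \<in> H1" by (rule c(1)) auto
 have "en (%x. \<bar>u x\<bar>) <= en u" by (rule c(2)) auto
 moreover have "nrm2 (%x. \<bar>u x\<bar>) = nrm2 u" by (simp add: nrm2_def)
 ultimately show "hn (%x. \<bar>u x\<bar>) <= hn u" by (simp add: hn_def h1_def)
qed

lemma abs_sum_H1:
 assumes "!!n. u n \<in> H1"
 shows "(%x. \<Sum>n<N. \<bar>u n x\<bar>) \<in> H1" "hn (%x. \<Sum>n<N. \<bar>u n x\<bar>) <= (\<Sum>n<(N::nat). hn (u n))"
proof (induction N)
 case 0
 { case 1 then show ?case by (simp add: H1_zero) }
 { case 2 then show ?case by (simp add: hn_def h1_def H1_zero) }
next
 case (Suc N)
 { case 1 then show ?case using H1_add[OF Suc.IH(1) abs_H1(1)[OF assms]] by simp }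
 { case 2 then show ?case using hn_add[OF Suc.IH(1) abs_H1(1)[OF assms]] Suc.IH(2) abs_H1(2)[OF assms, of N]
   by (simp) (meson add_mono order_trans) }
qed

section \<open>Subadditivity of capacity and sets of capacity zero\<close>

lemma cap_less: "cap E < ereal c \<longleftrightarrow>
 (\<exists>u\<in>H1. \<exists>U. open U & E \<subseteq> U & (AE x in lebesgue. x \<in> U --> 1 <= u x) & h1 u < c)"
 unfolding cap_def INF_less_iff by (auto simp: H1_norm_sq_h1)

lemma cap_le:
 assumes "u \<in> H1" "open U" "E \<subseteq> U" "AE x in lebesgue. x \<in> U --> 1 <= u x"
 shows "cap E <= ereal (h1 u)"
 unfolding cap_def H1_norm_sq_h1 by (rule INF_lower) (use assms in auto)

lemma cap_nonneg: "0 <= cap E"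
 unfolding cap_def by (rule INF_greatest) (simp add: H1_norm_sq_h1)

lemma cap_mono: "E \<subseteq> F ==> cap E <= cap F"
 unfolding cap_def by (rule INF_superset_mono) auto

lemma cap_zeroI:
 assumes "!!e. 0 < e ==> cap E <= ereal e" shows "cap E = 0"
proof (rule antisym[OF _ cap_nonneg])
 show "cap E <= 0" by (rule ereal_le_epsilon2) (use assms in \<open>auto simp: zero_ereal_def[symmetric]\<close>)
qed

lemma cap_empty: "cap {} = 0"
 by (rule antisym[OF order_trans[OF cap_le[OF H1_zero(1) open_empty]] cap_nonneg]) (auto simp: h1_def H1_zero)

text \<open>Subadditivity at the level of norms, that is, of square roots of capacities: competitors
  with norms summing to at most de are added in absolute value. The partial sums converge in L2, and
  semicontinuity bounds the energy of the limit, which is at least 1 near the whole union.\<close>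

lemma cap_countable:
 fixes E :: "nat => 'a::euclidean_space set"
 assumes de: "0 < de" and c: "!!n. cap (E n) < ereal ((de * (1/2) ^ Suc n)\<^sup>2)"
 shows "cap (\<Union>n. E n) <= ereal (de\<^sup>2)"
proof -
 let ?P = "%n p. fst p \<in> H1 & open (snd p) & E n \<subseteq> snd p & (AE x in lebesgue. x \<in> snd p --> 1 <= fst p x) & h1 (fst p) < (de * (1/2) ^ Suc n)\<^sup>2"
 have "\<exists>p. ?P n p" for n
  using c[of n, unfolded cap_less] by auto
 then have "\<forall>n. \<exists>p. ?P n p" by blast
 from choice[OF this] obtain p where p: "\<forall>n. ?P n (p n)" ..
 define u U where "u n = fst (p n)" and "U n = snd (p n)" for n
 have u: "u n \<in> H1" "open (U n)" "E n \<subseteq> U n"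
  "AE x in lebesgue. x \<in> U n --> 1 <= u n x" "h1 (u n) < (de * (1/2) ^ Suc n)\<^sup>2" for n
  using p[rule_format, of n] unfolding u_def U_def by blast+
 have hu: "hn (u n) <= de * (1/2) ^ Suc n" for n
  unfolding hn_def using u(5)[of n] de by (intro real_le_lsqrt) auto
 define s where "s N x = (\<Sum>n<N. \<bar>u n x\<bar>)" for N x
 have sH: "s N \<in> H1" for N unfolding s_def by (rule abs_sum_H1(1)[OF u(1)])
 have geo: "(\<Sum>n<N. de * (1/2) ^ Suc n) = de * (1 - (1/2) ^ N)" for N
  by (induction N) (auto simp: field_simps)
 have sn: "hn (s N) <= de" for N
 proof -
  have "hn (s N) <= (\<Sum>n<N. de * (1/2) ^ Suc n)" unfolding s_def
   by (rule order_trans[OF abs_sum_H1(2)[OF u(1)] sum_mono[OF hu]])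
  also have "... <= de" unfolding geo using de by (simp add: mult_le_cancel_left1)
  finally show ?thesis .
 qed
 have sb: "h1 (s N) <= de\<^sup>2" for N using power_mono[OF sn[of N], of 2] by (simp add: hn_sq)
 have cau1: "nrm (%x. s (N + k) x - s N x) <= de * (1/2) ^ N" for N k
 proof -
  have "s (N + k) x - s N x = (\<Sum>n\<in>{N..<N+k}. \<bar>u n x\<bar>)" for x
   unfolding s_def by (simp add: lessThan_atLeast0 sum_diff_nat_ivl)
  then have "nrm (%x. s (N + k) x - s N x) <= (\<Sum>n\<in>{N..<N+k}. nrm (%x. \<bar>u n x\<bar>))"
   by (simp add: nrm_sum L2_abs H1_L2 u(1))
  also have "... <= (\<Sum>n\<in>{N..<N+k}. de * (1/2) ^ Suc n)"
  proof (rule sum_mono)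
   fix n
   have "nrm (%x. \<bar>u n x\<bar>) = nrm (u n)" by (simp add: nrm_def nrm2_def)
   then show "nrm (%x. \<bar>u n x\<bar>) <= de * (1/2) ^ Suc n" using nrm_le_hn[of "u n"] hu[of n] by simp
  qed
  also have "... = (\<Sum>n<N+k. de * (1/2) ^ Suc n) - (\<Sum>n<N. de * (1/2) ^ Suc n)"
   by (simp add: lessThan_atLeast0 sum_diff_nat_ivl)
  also have "... <= de * (1/2) ^ N" unfolding geo using de by (simp add: algebra_simps)
  finally show ?thesis .
 qed
 have cau: "\<exists>N. \<forall>m\<ge>N. \<forall>n\<ge>N. nrm (%x. s m x - s n x) < e" if e: "0 < e" for e
 proof -
  have "(%N. de * (1/2) ^ N) ----> de * 0" by (intro tendsto_intros) auto
  then obtain N where N: "de * (1/2) ^ N < e/2"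
   using e order_tendstoD(2)[of "%N. de * (1/2) ^ N" "de * 0" sequentially "e/2"] by (auto simp: eventually_sequentially)
  have "nrm (%x. s m x - s n x) < e" if mn: "m \<ge> N" "n \<ge> N" for m n
  proof -
   obtain k where k1: "m = N + k" using le_Suc_ex[OF mn(1)] by blast
   obtain l where k2: "n = N + l" using le_Suc_ex[OF mn(2)] by blast
   note k = k1 k2
   have "nrm (%x. s m x - s n x) <= nrm (%x. s m x - s N x) + nrm (%x. s N x - s n x)"
    by (intro nrm_triangle H1_L2 sH)
   then show ?thesis using cau1[of N k] cau1[of N l] N nrm_diff_commute[of "s N" "s n"] k by simp
  qed
  then show ?thesis by blast
 qed
 have nb: "nrm2 (s N) <= de\<^sup>2" for N using sb[of N] en_nonneg[of "s N"] unfolding h1_def by linarith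
 obtain r g where g: "strict_mono r" "L2 g" "AE x in lebesgue. (%n. s (r n) x) ----> g x"
  "(%n. nrm (%x. s n x - g x)) ----> 0"
  by (rule L2_complete[of s "de\<^sup>2"]) (use sH H1_L2 nb cau in auto)
 have nl: "(%n. nrm (s n)) ----> nrm g"
 proof (rule LIM_zero_cancel, rule tendsto_0_le[of _ _ _ 1])
  show "(%n. nrm (%x. s n x - g x)) ----> 0" by (rule g)
  show "\<forall>\<^sub>F n in sequentially. norm (nrm (s n) - nrm g) <= norm (nrm (%x. s n x - g x)) * 1"
   using nrm_diff_rev[OF H1_L2[OF sH] g(2)] by simp
 qed
 \<comment> \<open>Since the L2 norms converge, the joint bound by de^2 turns into convergent upper
   bounds for the energies, the form in which semicontinuity is stated.\<close>
 have nl2: "(%n. de\<^sup>2 - nrm2 (s n)) ----> de\<^sup>2 - nrm2 g"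
  using tendsto_diff[OF tendsto_const tendsto_power[OF nl, of 2]] by (simp add: nrm_sq)
 have "en (s n) <= de\<^sup>2 - nrm2 (s n)" for n using sb[of n] by (simp add: h1_def)
 note l = en_lsc_L2[OF sH g(2,4) this nl2]
 have h: "h1 g <= de\<^sup>2" using l(2) by (simp add: h1_def)
 have "cap (\<Union>n. E n) <= ereal (h1 g)"
 proof (rule cap_le[OF l(1), of "\<Union>n. U n"])
  show "open (\<Union>n. U n)" using u(2) by auto
  show "(\<Union>n. E n) \<subseteq> (\<Union>n. U n)" using u(3) by blast
  have "AE x in lebesgue. \<forall>n. x \<in> U n --> 1 <= u n x" using u(4) by (simp add: AE_all_countable)
  with g(3) show "AE x in lebesgue. x \<in> (\<Union>n. U n) --> 1 <= g x"
  proof eventually_elim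
   case (elim x)
   show ?case
   proof
    assume "x \<in> (\<Union>n. U n)"
    then obtain n where n: "x \<in> U n" by blast
    show "1 <= g x"
    proof (rule LIMSEQ_le_const[OF elim(1)], intro exI allI impI)
     fix k assume k: "k \<ge> Suc n"
     have "1 <= \<bar>u n x\<bar>" using elim(2) n by force
     also have "... <= s (r k) x" unfolding s_def
      using k seq_suble[OF g(1), of k] by (intro member_le_sum) auto
     finally show "1 <= s (r k) x" .
    qed
   qed
  qed
 qed
 then show ?thesis using h by (meson ereal_less_eq(3) order_trans)
qed

lemma cap_Un_small:
 assumes "0 < de" "cap A < ereal (de\<^sup>2 / 16)" "cap B < ereal (de\<^sup>2 / 16)"
 shows "cap (A \<union> B) <= ereal (de\<^sup>2)"
proof -
 \<comment> \<open>The pair is padded with empty sets. Index 1 must meet the bound (de/4)^2, whence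
   the 16.\<close>
 define E where "E n = (if n = 0 then A else if n = (1::nat) then B else {})" for n
 have "cap (\<Union>n. E n) <= ereal (de\<^sup>2)"
 proof (rule cap_countable[OF assms(1)])
  fix n
  have "cap A < ereal (de\<^sup>2 / 4)" by (rule less_le_trans[OF assms(2)]) simp
  then show "cap (E n) < ereal ((de * (1/2) ^ Suc n)\<^sup>2)"
   using assms by (auto simp: E_def cap_empty power_mult_distrib power2_eq_square)
 qed
 moreover have "(\<Union>n. E n) = A \<union> B"
 proof
  show "A \<union> B \<subseteq> (\<Union>n. E n)" using UN_upper[of 0 UNIV E] UN_upper[of 1 UNIV E] by (simp add: E_def)
 qed (auto simp: E_def split: if_splits)
 ultimately show ?thesis by simp
qed

lemma cap_null_Union:
 assumes "!!n::nat. cap (E n) = 0" shows "cap (\<Union>n. E n) = 0"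
proof (rule cap_zeroI)
 fix e :: real assume e: "0 < e"
 have "cap (\<Union>n. E n) <= ereal ((sqrt e)\<^sup>2)"
  by (rule cap_countable) (use e assms in auto)
 then show "cap (\<Union>n. E n) <= ereal e" using e by simp
qed

lemma cap_null_subset: "cap F = 0 ==> E \<subseteq> F ==> cap E = 0"
 using cap_mono[of E F] cap_nonneg[of E] by auto

lemma cap_null_Un: 
 assumes "cap A = 0" "cap B = 0" shows "cap (A \<union> B) = 0"
proof (rule cap_null_subset)
 show "cap (\<Union>n. if n = (0::nat) then A else B) = 0" by (rule cap_null_Union) (use assms in auto)
 show "A \<union> B \<subseteq> (\<Union>n. if n = (0::nat) then A else B)"
  using UN_upper[of 0 UNIV "%n. if n = (0::nat) then A else B"] UN_upper[of 1 UNIV "%n. if n = (0::nat) then A else B"] by simp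
qed

lemma cap_null_UN_countable:
 assumes "countable I" "!!i. i \<in> I ==> cap (E i) = 0" shows "cap (\<Union>i\<in>I. E i) = 0"
proof (cases "I = {}")
 case False
 then have r: "range (from_nat_into I) = I" using assms(1) by (simp add: range_from_nat_into)
 have "cap (\<Union>n. E (from_nat_into I n)) = 0"
  by (rule cap_null_Union) (use assms(2) r in auto)
 moreover have "(\<Union>i\<in>I. E i) = (\<Union>n. E (from_nat_into I n))" by (subst r[symmetric]) blast
 ultimately show ?thesis by simp
qed (simp add: cap_empty)

text \<open>Chebyshev: a competitor is at least 1 on an open neighbourhood, whose measure is thus at
  most its squared L2 norm.\<close>

lemma cap_measure:
 assumes "cap E < ereal c"
 obtains U where "open U" "E \<subseteq> U" "emeasure lebesgue U <= ennreal c"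
proof -
 obtain u U where u: "u \<in> H1" "open U" "E \<subseteq> U" "AE x in lebesgue. x \<in> U --> 1 <= u x" "h1 u < c"
  using assms unfolding cap_less by blast
 have "emeasure lebesgue U = (\<integral>\<^sup>+x. indicator U x \<partial>lebesgue)" using u(2) by simp
 also have "... <= (\<integral>\<^sup>+x. ennreal ((u x)\<^sup>2) \<partial>lebesgue)"
 proof (rule nn_integral_mono_AE)
  show "AE x in lebesgue. indicator U x <= ennreal ((u x)\<^sup>2)"
   using u(4)
  proof eventually_elim
   case (elim x)
   show ?case
   proof (cases "x \<in> U")
    case True
    then have "1 <= (u x)\<^sup>2" using elim by (simp add: one_le_power)
    then show ?thesis using True by (simp add: ennreal_leI flip: ennreal_1)
   qed simp
  qed
 qed
 also have "... = ennreal (nrm2 u)" by (rule nn_integral_nrm2[OF H1_L2[OF u(1)]])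
 also have "... <= ennreal c" using u(5) en_nonneg[of u] unfolding h1_def by (intro ennreal_leI) linarith
 finally show ?thesis using that u by blast
qed

lemma small_outer_null:
 assumes "!!n::nat. \<exists>U. open U & Z \<subseteq> U & emeasure lebesgue U <= ennreal (1 / Suc n)"
 shows "Z \<in> null_sets lebesgue"
proof -
 obtain U where U: "!!n::nat. open (U n)" "!!n. Z \<subseteq> U n" "!!n. emeasure lebesgue (U n) <= ennreal (1 / Suc n)"
  using assms by metis
 have m: "(\<Inter>n. U n) \<in> sets lebesgue" using U(1) by auto
 have "emeasure lebesgue (\<Inter>n. U n) = 0"
 proof -
  have b: "emeasure lebesgue (\<Inter>n. U n) <= ennreal (1 / Suc n)" for n
   using emeasure_mono[of "\<Inter>n. U n" "U n" lebesgue] U(1,3)[of n] by (auto intro: order_trans)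
  have "(%n. ennreal (1 / Suc n)) ----> ennreal 0"
   using LIMSEQ_inverse_real_of_nat by (intro tendsto_ennrealI) (simp add: inverse_eq_divide)
  then have "emeasure lebesgue (\<Inter>n. U n) <= ennreal 0"
   by (rule LIMSEQ_le_const) (use b in auto)
  then show ?thesis by simp
 qed
 then have "(\<Inter>n. U n) \<in> null_sets lebesgue" using m by auto
 moreover have "Z \<subseteq> (\<Inter>n. U n)" using U(2) by blast
 ultimately show ?thesis by (meson null_sets_completion_subset)
qed

lemma cap_zero_null:
 assumes "cap Z = 0" shows "Z \<in> null_sets lebesgue"
proof (rule small_outer_null)
 fix n :: nat
 have "cap Z < ereal (1 / Suc n)" using assms by simp
 then show "\<exists>U. open U & Z \<subseteq> U & emeasure lebesgue U <= ennreal (1 / Suc n)"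
  by (rule cap_measure) auto
qed

lemma cap_zero_AE: "cap Z = 0 ==> AE x in lebesgue. x \<notin> Z"
 using cap_zero_null AE_not_in by blast

text \<open>The intersection of the approximating open sets exceeds the set by a part of arbitrarily
  small capacity, hence by a null set; Lebesgue measure is complete.\<close>

lemma quasi_open_sets:
 assumes "quasi_open Om" shows "Om \<in> sets lebesgue"
proof -
 have "\<forall>n::nat. \<exists>U. open U & Om \<subseteq> U & cap (U - Om) < ereal (1 / Suc n)"
  using assms unfolding quasi_open_def by auto
 then obtain U where U: "!!n::nat. open (U n)" "!!n. Om \<subseteq> U n" "!!n. cap (U n - Om) < ereal (1 / Suc n)" by metis
 have "(\<Inter>n. U n) - Om \<in> null_sets lebesgue"
 proof (rule small_outer_null)
  fix n :: nat
  obtain V where "open V" "U n - Om \<subseteq> V" "emeasure lebesgue V <= ennreal (1 / Suc n)"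
   by (rule cap_measure[OF U(3)])
  then show "\<exists>V. open V & (\<Inter>n. U n) - Om \<subseteq> V & emeasure lebesgue V <= ennreal (1 / Suc n)" by blast
 qed
 then have "(\<Inter>n. U n) - ((\<Inter>n. U n) - Om) \<in> sets lebesgue" using U(1) by (intro sets.Diff[OF _ null_setsD2]) auto
 moreover have "(\<Inter>n. U n) - ((\<Inter>n. U n) - Om) = Om" using U(2) by blast
 ultimately show ?thesis by simp
qed

section \<open>Quasi-continuous functions\<close>

lemma qc_continuous: "continuous_on UNIV v ==> quasi_continuous v"
 unfolding quasi_continuous_def by (auto intro!: exI[of _ "{}"] simp: cap_empty continuous_on_subset)

lemma qc_common:
 assumes "quasi_continuous u" "quasi_continuous v" "0 < e"
 obtains U where "open U" "cap U < ereal e" "continuous_on (- U) u" "continuous_on (- U) v"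
proof -
 define de where "de = sqrt (e/2)"
 have d: "0 < de" "de\<^sup>2 = e/2" using assms(3) by (auto simp: de_def)
 have "0 < de\<^sup>2/16" using d by simp
 then obtain U V where U: "open U" "cap U < ereal (de\<^sup>2/16)" "continuous_on (- U) u"
  and V: "open V" "cap V < ereal (de\<^sup>2/16)" "continuous_on (- V) v"
  using assms(1,2) unfolding quasi_continuous_def by meson
 have "cap (U \<union> V) <= ereal (e/2)" using cap_Un_small[OF d(1) U(2) V(2)] d(2) by simp
 also have "... < ereal e" using assms(3) by simp
 finally have "cap (U \<union> V) < ereal e" .
 moreover have "continuous_on (- (U \<union> V)) u" "continuous_on (- (U \<union> V)) v"
  using U(3) V(3) by (auto intro: continuous_on_subset)
 ultimately show ?thesis using that[of "U \<union> V"] U V by blast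
qed

lemma qc_add: assumes "quasi_continuous u" "quasi_continuous v" shows "quasi_continuous (%x. u x + v x)"
 unfolding quasi_continuous_def
proof (intro allI impI)
 fix e :: real assume "0 < e"
 with assms obtain U where "open U" "cap U < ereal e" "continuous_on (- U) u" "continuous_on (- U) v" by (rule qc_common)
 then show "\<exists>U. open U & cap U < ereal e & continuous_on (- U) (%x. u x + v x)"
  by (intro exI[of _ U]) (auto intro: continuous_intros)
qed

lemma qc_mult: assumes "quasi_continuous u" "quasi_continuous v" shows "quasi_continuous (%x. u x * v x)"
 unfolding quasi_continuous_def
proof (intro allI impI)
 fix e :: real assume "0 < e"
 with assms obtain U where "open U" "cap U < ereal e" "continuous_on (- U) u" "continuous_on (- U) v" by (rule qc_common)
 then show "\<exists>U. open U & cap U < ereal e & continuous_on (- U) (%x. u x * v x)"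
  by (intro exI[of _ U]) (auto intro: continuous_intros)
qed

lemma qc_compose:
 assumes "quasi_continuous u" "continuous_on UNIV (f :: real => real)" shows "quasi_continuous (%x. f (u x))"
 unfolding quasi_continuous_def
proof (intro allI impI)
 fix e :: real assume "0 < e"
 then obtain U where "open U" "cap U < ereal e" "continuous_on (- U) u"
  using assms(1) unfolding quasi_continuous_def by blast
 then show "\<exists>U. open U & cap U < ereal e & continuous_on (- U) (%x. f (u x))"
  by (intro exI[of _ U]) (auto intro: continuous_on_compose2[OF assms(2)])
qed

lemma nonzero_open_mod:
 fixes v :: "'a::euclidean_space => real"
 assumes "continuous_on (- U) v" "open T"
 obtains W where "open W" "W \<inter> - U = {x. v x \<in> T} \<inter> - U"
proof -
 obtain W where "open W" "W \<inter> - U = v -` T \<inter> - U"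
  using assms continuous_on_open_invariant[of "-U" v] by blast
 then show ?thesis using that[of W] by (auto simp: vimage_def)
qed

text \<open>Off an open U of small capacity the nonzero set is the trace of an open Q. Up to measure
  zero, the part of Q in G lies where the competitor for U is at least 1, so this competitor serves
  for all nonzero points in G as well.\<close>

lemma qc_AE_zero:
 assumes v: "quasi_continuous v" and G: "open G" and ae: "AE x in lebesgue. x \<in> G --> v x = 0"
 shows "cap {x \<in> G. v x ~= 0} = 0"
proof (rule cap_zeroI)
 fix e :: real assume e: "0 < e"
 obtain U where U: "open U" "cap U < ereal e" "continuous_on (- U) v"
  using v e unfolding quasi_continuous_def by blast
 obtain w W where w: "w \<in> H1" "open W" "U \<subseteq> W" "AE x in lebesgue. x \<in> W --> 1 <= w x" "h1 w < e"
  using U(2) unfolding cap_less by blast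
 obtain Q where Q: "open Q" "Q \<inter> - U = {x. v x \<in> -{0}} \<inter> - U"
  by (rule nonzero_open_mod[OF U(3), of "-{0}"]) auto
 have "cap {x \<in> G. v x ~= 0} <= ereal (h1 w)"
 proof (rule cap_le[OF w(1), of "(Q \<inter> G) \<union> W"])
  show "open ((Q \<inter> G) \<union> W)" using Q G w by auto
  show "{x \<in> G. v x ~= 0} \<subseteq> Q \<inter> G \<union> W" using Q(2) w(3) by auto
  show "AE x in lebesgue. x \<in> Q \<inter> G \<union> W --> 1 <= w x"
   using w(4) ae by eventually_elim (use Q(2) w(3) in auto)
 qed
 then show "cap {x \<in> G. v x ~= 0} <= ereal e" using w(5) by (meson ereal_less_eq(3) less_imp_le order_trans)
qed

lemma qc_AE_eq:
 assumes "quasi_continuous u" "quasi_continuous v" "AE x in lebesgue. u x = v x"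
 shows "cap {x. u x ~= v x} = 0"
proof -
 have "quasi_continuous (%x. (-1) * v x)" by (rule qc_mult[OF qc_continuous assms(2)]) simp
 then have q: "quasi_continuous (%x. u x + (-1) * v x)" by (rule qc_add[OF assms(1)])
 have "cap {x \<in> UNIV. u x + (-1) * v x ~= 0} = 0"
  by (rule qc_AE_zero[OF q]) (use assms(3) in auto)
 then show ?thesis by simp
qed

lemma quasi_open_nonzero:
 assumes v: "quasi_continuous v" shows "quasi_open {x. v x ~= 0}"
 unfolding quasi_open_def
proof (intro allI impI)
 fix e :: real assume e: "0 < e"
 obtain U where U: "open U" "cap U < ereal e" "continuous_on (- U) v"
  using v e unfolding quasi_continuous_def by blast
 obtain Q where Q: "open Q" "Q \<inter> - U = {x. v x \<in> -{0}} \<inter> - U"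
  by (rule nonzero_open_mod[OF U(3), of "-{0}"]) auto
 have "(Q \<union> U) - {x. v x ~= 0} \<subseteq> U" using Q(2) by auto
 then have "cap ((Q \<union> U) - {x. v x ~= 0}) < ereal e" using cap_mono U(2) by (meson le_less_trans)
 then show "\<exists>W. open W & {x. v x ~= 0} \<subseteq> W & cap (W - {x. v x ~= 0}) < ereal e"
  using Q U by (intro exI[of _ "Q \<union> U"]) auto
qed

lemma quasi_open_Un:
 assumes "quasi_open A" "quasi_open B" shows "quasi_open (A \<union> B)"
 unfolding quasi_open_def
proof (intro allI impI)
 fix e :: real assume e: "0 < e"
 define de where "de = sqrt (e/2)"
 have d: "0 < de" "de\<^sup>2 = e/2" using e by (auto simp: de_def)
 have "0 < de\<^sup>2/16" using d by simp
 then obtain U V where U: "open U" "A \<subseteq> U" "cap (U - A) < ereal (de\<^sup>2/16)"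
  and V: "open V" "B \<subseteq> V" "cap (V - B) < ereal (de\<^sup>2/16)"
  using assms unfolding quasi_open_def by meson
 have "cap ((U \<union> V) - (A \<union> B)) <= cap ((U - A) \<union> (V - B))" by (rule cap_mono) blast
 also have "... <= ereal (e/2)" using cap_Un_small[OF d(1) U(3) V(3)] d(2) by simp
 also have "... < ereal e" using e by simp
 finally show "\<exists>W. open W & A \<union> B \<subseteq> W & cap (W - (A \<union> B)) < ereal e"
  using U V by (intro exI[of _ "U \<union> V"]) auto
qed

lemma quasi_open_empty: "quasi_open {}"
 unfolding quasi_open_def by (auto intro!: exI[of _ "{}"] simp: cap_empty)

lemma quasi_open_UN:
 assumes "finite I" "!!i. i \<in> I ==> quasi_open (A i)" shows "quasi_open (\<Union>i\<in>I. A i)"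
 using assms by (induction I) (auto intro: quasi_open_empty quasi_open_Un)

text \<open>Lebesgue measure is complete. Quasi-continuous representatives are tied to their
  functions only by almost everywhere equality, so their measurability has to come from
  here.\<close>

lemma AE_eq_measurable:
 fixes u v :: "'a::euclidean_space => real"
 assumes "u \<in> borel_measurable lebesgue" "AE x in lebesgue. v x = u x"
 shows "v \<in> borel_measurable lebesgue"
proof (rule measurableI)
 fix A :: "real set" assume A: "A \<in> sets borel"
 obtain N where N: "N \<in> null_sets lebesgue" "{x. v x ~= u x} \<subseteq> N"
 proof -
  obtain N where "N \<in> null_sets lebesgue" "!!x. x \<in> space lebesgue - N ==> v x = u x" using AE_E3[OF assms(2)] by blast
  then show ?thesis using that[of N] by auto
 qed
 have "v -` A \<inter> space lebesgue = ((u -` A \<inter> space lebesgue) - N) \<union> (v -` A \<inter> N)" using N(2) by auto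
 moreover have "u -` A \<inter> space lebesgue \<in> sets lebesgue" using assms(1) A by (rule measurable_sets)
 moreover have "v -` A \<inter> N \<in> null_sets lebesgue" using N(1) by (rule null_sets_completion_subset[rotated]) auto
 ultimately show "v -` A \<inter> space lebesgue \<in> sets lebesgue"
  using null_setsD2[OF N(1)] null_setsD2 by (simp only:) (intro sets.Un sets.Diff)
qed simp

text \<open>The set where the n-th step exceeds 2^-n has small capacity, and outside the tail unions
  \<open>B N\<close> convergence is uniform. The rate 16^-(n+1) of the norms leaves room for the
  factor 2^n that scales a step up to a competitor for its superlevel set.\<close>

lemma qc_limit:
 fixes v :: "nat => 'a::euclidean_space => real"
 assumes q: "!!n. quasi_continuous (v n)" and H: "!!n. v n \<in> H1"
  and c: "!!n. hn (%x. v n x - v (Suc n) x) < (1/16) ^ Suc n"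
 obtains w Z where "quasi_continuous w" "cap Z = 0" "!!x. x \<notin> Z ==> (%n. v n x) ----> w x"
proof -
 define D where "D n x = v n x - v (Suc n) x" for n x
 have DH: "D n \<in> H1" for n unfolding D_def by (intro H1_diff H)
 have "\<exists>T. open T & cap T < ereal (((1/4) ^ Suc n)\<^sup>2) & continuous_on (- T) (v n) & (\<forall>x. x \<notin> T --> \<bar>D n x\<bar> <= (1/2) ^ n)" for n
 proof -
  define e :: real where "e = ((1/16) ^ Suc n)\<^sup>2"
  have e: "0 < e" "sqrt e = (1/16) ^ Suc n" by (auto simp: e_def)
  obtain U where U: "open U" "cap U < ereal e" "continuous_on (- U) (v n)" "continuous_on (- U) (v (Suc n))"
   by (rule qc_common[OF q[of n] q[of "Suc n"] e(1)])
  obtain w W where w: "w \<in> H1" "open W" "U \<subseteq> W" "AE x in lebesgue. x \<in> W --> 1 <= w x" "h1 w < e"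
   using U(2) unfolding cap_less by blast
  have hw: "hn w <= (1/16) ^ Suc n" using w(5) e(2) unfolding hn_def by (metis less_imp_le real_sqrt_le_iff)
  have cD: "continuous_on (- U) (D n)" unfolding D_def by (intro continuous_intros U)
  obtain Q where Q: "open Q" "Q \<inter> - U = {x. D n x \<in> {t. (1/2)^n < \<bar>t\<bar>}} \<inter> - U"
   by (rule nonzero_open_mod[OF cD, of "{t. (1/2)^n < \<bar>t\<bar>}"]) (auto intro!: open_Collect_less continuous_intros)
  \<comment> \<open>The step is only quasi-continuous, so its superlevel set is open only up to U;
    the summand with w makes z at least 1 near U too.\<close>
  define z where "z x = 2^n * \<bar>D n x\<bar> + \<bar>w x\<bar>" for x
  have zH: "z \<in> H1" unfolding z_def by (intro H1_add H1_cmult abs_H1 DH w)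
  have "hn z <= 2^n * hn (D n) + hn w"
  proof -
   have "hn z <= hn (%x. 2^n * \<bar>D n x\<bar>) + hn (%x. \<bar>w x\<bar>)"
    unfolding z_def by (rule hn_add[OF H1_cmult(1)[OF abs_H1(1)[OF DH]] abs_H1(1)[OF w(1)]])
   also have "hn (%x. 2^n * \<bar>D n x\<bar>) = 2^n * hn (%x. \<bar>D n x\<bar>)"
    using hn_cmult[OF abs_H1(1)[OF DH[of n]], of "2^n"] by simp
   also have "2^n * hn (%x. \<bar>D n x\<bar>) <= 2^n * hn (D n)"
    by (intro mult_left_mono abs_H1(2)[OF DH]) simp
   finally show ?thesis using abs_H1(2)[OF w(1)] by linarith
  qed
  also have "... <= 2^n * (1/16) ^ Suc n + (1/16) ^ Suc n"
   using c[of n] hw unfolding D_def by (intro add_mono mult_left_mono) auto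
  also have "... <= 2 * (2^n * (1/16) ^ Suc n)"
  proof -
   have "1 * (1/16) ^ Suc n <= (2::real)^n * (1/16) ^ Suc n" by (intro mult_right_mono) auto
   then show ?thesis by linarith
  qed
  also have "... = (1/8) ^ Suc n"
  proof -
   have "(2::real)^n * (1/16)^n = (1/8)^n" unfolding power_mult_distrib[symmetric] by simp
   then show ?thesis by simp
  qed
  also have "... < (1/4) ^ Suc n" by (intro power_strict_mono) auto
  finally have "(hn z)\<^sup>2 < ((1/4) ^ Suc n)\<^sup>2" by (intro power_strict_mono) auto
  then have hz: "h1 z < ((1/4) ^ Suc n)\<^sup>2" by (simp only: hn_sq)
  have "cap (Q \<union> U) < ereal (((1/4) ^ Suc n)\<^sup>2)"
   unfolding cap_less
  proof (intro bexI[OF _ zH] exI conjI)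
   show "open (Q \<union> W)" "Q \<union> U \<subseteq> Q \<union> W" using Q w by auto
   show "AE x in lebesgue. x \<in> Q \<union> W --> 1 <= z x"
    using w(4)
   proof eventually_elim
    case (elim x)
    show ?case
    proof
     assume x: "x \<in> Q \<union> W"
     show "1 <= z x"
     proof (cases "x \<in> W")
      case True
      then have "1 <= \<bar>w x\<bar>" using elim by force
      then show ?thesis by (simp add: z_def add_increasing)
     next
      case False
      then have "x \<in> Q \<inter> - U" using x w(3) by blast
      then have "(1/2)^n < \<bar>D n x\<bar>" unfolding Q(2) by simp
      then have "2^n * (1/2)^n <= 2^n * \<bar>D n x\<bar>" by (intro mult_left_mono) auto
      moreover have "2^n * (1/2)^n = (1::real)" by (simp add: power_mult_distrib[symmetric])
      ultimately show ?thesis by (simp add: z_def add_increasing2)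
     qed
    qed
   qed
  qed (rule hz)
  moreover have "\<bar>D n x\<bar> <= (1/2) ^ n" if "x \<notin> Q \<union> U" for x
  proof -
   have "x \<notin> Q \<inter> - U" "x \<in> - U" using that by auto
   then show ?thesis unfolding Q(2) by simp
  qed
  ultimately show ?thesis
   using Q(1) U(1) by (intro exI[of _ "Q \<union> U"]) (auto intro: continuous_on_subset[OF U(3)])
 qed
 then have "\<forall>n. \<exists>T. open T & cap T < ereal (((1/4) ^ Suc n)\<^sup>2) & continuous_on (- T) (v n) & (\<forall>x. x \<notin> T --> \<bar>D n x\<bar> <= (1/2) ^ n)" by blast
 from choice[OF this] obtain T where T: "!!n. open (T n)" "!!n. cap (T n) < ereal (((1/4) ^ Suc n)\<^sup>2)"
  "!!n. continuous_on (- T n) (v n)" "!!n x. x \<notin> T n ==> \<bar>D n x\<bar> <= (1/2) ^ n" by blast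
 define B where "B N = (\<Union>n. T (N + n))" for N
 have Bcap: "cap (B N) <= ereal (((1/2)^N)\<^sup>2)" for N
  unfolding B_def
 proof (rule cap_countable)
  fix n
  have "(1/4::real) ^ Suc (N + n) <= (1/2) ^ Suc (N + n)" by (intro power_mono) auto
  also have "... = (1/2) ^ N * (1/2) ^ Suc n" by (simp add: power_add)
  finally have "((1/4::real) ^ Suc (N + n))\<^sup>2 <= ((1/2) ^ N * (1/2) ^ Suc n)\<^sup>2" by (intro power_mono) auto
  then show "cap (T (N + n)) < ereal (((1/2) ^ N * (1/2) ^ Suc n)\<^sup>2)"
   using T(2)[of "N + n"] by (meson ereal_less_eq(3) less_le_trans)
 qed simp
 have Bopen: "open (B N)" for N unfolding B_def using T(1) by auto
 define w where "w x = lim (%n. v n x)" for x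
 have bnd: "\<bar>D n x\<bar> <= (1/2)^n" if xn: "x \<notin> B N" "N <= n" for N n x
 proof -
  obtain k where "n = N + k" using le_Suc_ex[OF xn(2)] by blast
  then show ?thesis using xn(1) by (intro T(4)) (auto simp: B_def)
 qed
 have tail: "\<bar>v n x - v (n + k) x\<bar> <= 2 * (1/2)^n" if x: "x \<notin> B N" "N <= n" for N n k x
 proof -
  have "\<bar>v n x - v (n + k) x\<bar> <= 2 * (1/2)^n - 2 * (1/2)^(n+k)"
  proof (induction k)
   case (Suc k)
   have "\<bar>D (n + k) x\<bar> <= (1/2)^(n+k)" by (rule bnd) (use x in auto)
   then show ?case using Suc by (simp add: D_def abs_if split: if_splits)
  qed simp
  then show ?thesis by (smt (verit) zero_le_power divide_nonneg_nonneg)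
 qed
 have conv: "(%n. v n x) ----> w x" if x: "x \<notin> B N" for N x
 proof -
  have "Cauchy (%n. v n x)"
  proof (rule CauchyI')
   fix e :: real assume e: "0 < e"
   have "(%n. 2 * (1/2::real)^n) ----> 2 * 0" by (intro tendsto_intros) auto
   then have "\<forall>\<^sub>F n in sequentially. 2 * (1/2::real)^n < e" using e by (intro order_tendstoD(2)[of _ "2*0"]) auto
   then obtain M where M: "!!n. n \<ge> M ==> 2 * (1/2::real)^n < e" by (auto simp: eventually_sequentially)
   have "dist (v m x) (v n x) < e" if mn: "m \<ge> max M N" "m < n" for m n
   proof -
    obtain k where "n = m + k" using le_Suc_ex[OF less_imp_le[OF mn(2)]] by blast
    then show ?thesis using tail[OF x, of m k] M[of m] mn by (simp add: dist_real_def)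
   qed
   then show "\<exists>M. \<forall>m\<ge>M. \<forall>n>m. dist (v m x) (v n x) < e" by blast
  qed
  then show ?thesis by (simp add: w_def Cauchy_convergent_iff convergent_LIMSEQ_iff)
 qed
 have "continuous_on (- B N) w" for N
 proof (rule uniform_limit_theorem[where f=v and F=sequentially])
  show "\<forall>\<^sub>F n in sequentially. continuous_on (- B N) (v n)"
   unfolding eventually_sequentially
  proof (intro exI allI impI)
   fix n assume "N <= n"
   then obtain k where "n = N + k" using le_Suc_ex by blast
   then show "continuous_on (- B N) (v n)"
    by (intro continuous_on_subset[OF T(3)]) (auto simp: B_def)
  qed
  show "uniform_limit (- B N) v w sequentially"
  proof (rule uniform_limitI)
   fix e :: real assume e: "0 < e"
   have "(%n. 2 * (1/2::real)^n) ----> 2 * 0" by (intro tendsto_intros) auto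
   then have "\<forall>\<^sub>F n in sequentially. 2 * (1/2::real)^n < e" using e by (intro order_tendstoD(2)[of _ "2*0"]) auto
   then show "\<forall>\<^sub>F n in sequentially. \<forall>x\<in>- B N. dist (v n x) (w x) < e"
    using eventually_ge_at_top[of N]
   proof eventually_elim
    case (elim n)
    show ?case
    proof
     fix x assume "x \<in> - B N"
     then have x: "x \<notin> B N" by simp
     have "(%k. \<bar>v n x - v (k + n) x\<bar>) ----> \<bar>v n x - w x\<bar>"
      by (intro tendsto_intros LIMSEQ_ignore_initial_segment conv[OF x])
     then have "\<bar>v n x - w x\<bar> <= 2 * (1/2)^n"
      by (rule LIMSEQ_le_const2) (use tail[OF x elim(2)] in \<open>auto simp: add.commute\<close>)
     then show "dist (v n x) (w x) < e" using elim(1) by (simp add: dist_real_def)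
    qed
   qed
  qed
 qed simp
 moreover have small: "\<exists>N. ((1/2)^N)\<^sup>2 < e" if "0 < e" for e :: real
 proof -
  have "(%n. ((1/2::real)^n)\<^sup>2) ----> 0\<^sup>2" by (intro tendsto_intros) auto
  then have "\<forall>\<^sub>F n in sequentially. ((1/2::real)^n)\<^sup>2 < e" using that by (intro order_tendstoD(2)[of _ "0\<^sup>2"]) auto
  then show ?thesis by (auto simp: eventually_sequentially)
 qed
 ultimately have qw: "quasi_continuous w"
  unfolding quasi_continuous_def using Bcap Bopen by (meson ereal_less_eq(3) le_less_trans less_ereal.simps(1))
 have "cap (\<Inter>N. B N) = 0"
 proof (rule cap_zeroI)
  fix e :: real assume "0 < e"
  then obtain N where "((1/2)^N)\<^sup>2 < e" using small by blast
  moreover have "cap (\<Inter>N. B N) <= cap (B N)" by (rule cap_mono) auto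
  ultimately show "cap (\<Inter>N. B N) <= ereal e" using Bcap[of N] by (meson ereal_less_eq(3) less_imp_le order_trans)
 qed
 then show ?thesis using that[OF qw] conv by blast
qed

subsection \<open>Functions vanishing outside a set\<close>

lemma conv_shift:
 fixes u :: "'a::euclidean_space => real"
 assumes "0 < e" "L2 u"
 shows "conv e (%x. u (x + z)) x = conv e u (x + z)"
proof -
 have "(%y. eta e (x + z - y) * u y) \<in> borel_measurable lebesgue"
  using conv_integrable[OF assms, of "x + z"] by auto
 from shift_integral[OF this, of z] show ?thesis by (simp add: conv_def)
qed

text \<open>Mollification commutes with translations and contracts L2, hence it does not increase
  \<open>S\<close> at any t.\<close>

lemma conv_H1:
 fixes u :: "'a::euclidean_space => real"
 assumes e: "0 < e" and u: "u \<in> H1"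
 shows "conv e u \<in> H1" "en (conv e u) <= en u"
proof -
 have L: "L2 u" using u by (rule H1_L2)
 have cL: "L2 (conv e u)" by (rule conv_L2(1)[OF e L])
 have "S (conv e u) t <= en u * t\<^sup>2" for t
 proof -
  have "S (conv e u) t <= S u t"
   unfolding S_def
  proof (rule sum_mono)
   fix b :: 'a
   have Ld: "L2 (%x. u (x + t *\<^sub>R b) - u x)" by (intro L2_diff L2_shift L)
   have "(%x. conv e u (x + t *\<^sub>R b) - conv e u x) = conv e (%x. u (x + t *\<^sub>R b) - u x)"
    by (simp add: conv_diff[OF e L2_shift[OF L] L, abs_def] conv_shift[OF e L])
   then have "nrm (%x. conv e u (x + t *\<^sub>R b) - conv e u x) <= nrm (%x. u (x + t *\<^sub>R b) - u x)"
    using conv_L2(2)[OF e Ld] by simp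
   then show "nrm2 (%x. conv e u (x + t *\<^sub>R b) - conv e u x) <= nrm2 (%x. u (x + t *\<^sub>R b) - u x)"
    by (simp add: nrm_def)
  qed
  then show ?thesis using S_le[OF u, of t] by (simp add: mult.commute)
 qed
 from H1_by_S_near[OF cL zero_less_one this] show "conv e u \<in> H1" "en (conv e u) <= en u" by this+
qed

lemma h1_mid_par:
 assumes "u \<in> H1" "v \<in> H1"
 shows "h1 (%x. u x - v x) + 4 * h1 (%x. (u x + v x) / 2) = 2 * h1 u + 2 * h1 v"
 using nrm2_mid_par[OF H1_L2[OF assms(1)] H1_L2[OF assms(2)]] en_mid_par[OF assms] by (simp add: h1_def)

lemma H1_mid: "u \<in> H1 ==> v \<in> H1 ==> (%x. (u x + v x) / 2) \<in> H1"
 using H1_lincomb(1)[of u v "1/2" "1/2"] by (simp add: add_divide_distrib)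

lemma L2_conv_bounded:
 assumes "!!n. L2 (f n)" "L2 u" "(%n. nrm (%x. f n x - u x)) ----> 0"
 obtains K where "!!n. nrm (f n) <= K"
proof -
 have "Bseq (%n. nrm (%x. f n x - u x))" using assms(3) by (simp add: convergentI convergent_imp_Bseq)
 then obtain K where K: "!!n. nrm (%x. f n x - u x) <= K" by (auto simp: Bseq_def)
 have "nrm (f n) <= K + nrm u" for n
  using nrm_diff_rev[OF assms(1)[of n] assms(2)] K[of n] by linarith
 then show ?thesis using that by blast
qed

text \<open>Mazur's midpoints are Cauchy for the Sobolev norm. Closeness to u in L2 is stable under
  midpoints and identifies the limit; the energy of \<open>h n - u\<close> is then bounded by
  semicontinuity along \<open>h n - h (m + N)\<close>. The relation \<open>mid\<close> is kept in
  the conclusion so that further properties of the sequence can be transferred.\<close>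

lemma strong_from_weak:
 assumes f: "!!n. f n \<in> H1" "!!n. en (f n) <= C" and u: "L2 u" and l: "(%n. nrm (%x. f n x - u x)) ----> 0"
 shows "\<exists>h. (\<forall>n. mid (f ` {n..}) (h n) & h n \<in> H1) & u \<in> H1 & (%n. hn (%x. h n x - u x)) ----> 0"
proof -
 have uH: "u \<in> H1" by (rule en_lsc_L2(1)[OF f(1) u l f(2) tendsto_const])
 obtain K where K: "!!n. nrm (f n) <= K" using L2_conv_bounded[OF H1_L2[OF f(1)] u l] by blast
 have hb: "h1 (f n) <= K\<^sup>2 + C" for n
  using power_mono[OF K[of n], of 2] f(2)[of n] by (simp add: h1_def nrm_sq)
 obtain h where h: "!!n. mid (f ` {n..}) (h n)"
  and cau: "!!e. 0 < e ==> \<exists>N. \<forall>m\<ge>N. \<forall>n\<ge>N. h1 (%x. h m x - h n x) < e"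
  by (rule mazur_midpoint[of "%u. u \<in> H1" f h1 "K\<^sup>2 + C"]) (use f hb h1_mid_par H1_mid in auto)
 have hH: "h n \<in> H1" for n
  using h[of n] by induction (use f H1_mid in auto)
 have hl: "(%n. nrm (%x. h n x - u x)) ----> 0"
 proof (rule LIMSEQ_I)
  fix e :: real assume e: "0 < e"
  obtain N where N: "!!n. n \<ge> N ==> nrm (%x. f n x - u x) < e/2" using LIMSEQ_D[OF l, of "e/2"] e by auto
  have "nrm (%x. h n x - u x) <= e/2" if "n \<ge> N" for n
  proof -
   from h[of n] have "h n \<in> H1 & nrm (%x. h n x - u x) <= e/2"
   proof induction
    case (mid_base g)
    then show ?case using N that f by (auto intro: less_imp_le)
   next
    case (mid_step a b)
    have "(%x. (a x + b x) / 2 - u x) = (%x. ((a x - u x) + (b x - u x)) / 2)" by (auto simp: field_simps)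
    moreover have "nrm (%x. ((a x - u x) + (b x - u x)) / 2) <= e/2"
     using mid_step.IH by (intro nrm_mid L2_diff H1_L2[of a] H1_L2[of b] u) auto
    ultimately show ?case using mid_step.IH by (simp add: H1_mid)
   qed
   then show ?thesis by simp
  qed
  then show "\<exists>no. \<forall>n\<ge>no. norm (nrm (%x. h n x - u x) - 0) < e"
   using e by (intro exI[of _ N]) (auto intro: order.strict_trans1[of _ "e/2"])
 qed
 have el: "(%n. en (%x. h n x - u x)) ----> 0"
 proof (rule LIMSEQ_I)
  fix e :: real assume e: "0 < e"
  obtain N where N: "!!m n. m \<ge> N ==> n \<ge> N ==> h1 (%x. h m x - h n x) < e/2" using cau[of "e/2"] e by auto
  have "en (%x. h n x - u x) <= e/2" if n: "n \<ge> N" for n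
  proof (rule en_lsc_L2(2)[of "%m x. h n x - h (m + N) x" _ "%_. e/2"])
   show "(%x. h n x - h (m + N) x) \<in> H1" for m by (intro H1_diff hH)
   show "L2 (%x. h n x - u x)" by (intro L2_diff H1_L2 hH u)
   have "(%x. (h n x - h m x) - (h n x - u x)) = (%x. u x - h m x)" for m by auto
   then show "(%m. nrm (%x. h n x - h (m + N) x - (h n x - u x))) ----> 0"
    using LIMSEQ_ignore_initial_segment[OF hl, of N] by (simp add: nrm_diff_commute[of u])
   show "en (%x. h n x - h (m + N) x) <= e/2" for m
    using N[of n "m + N"] n en_le_h1[of "%x. h n x - h (m + N) x"] by simp
  qed simp
  then show "\<exists>no. \<forall>n\<ge>no. norm (en (%x. h n x - u x) - 0) < e"
   using e by (intro exI[of _ N]) (auto intro: order.strict_trans1[of _ "e/2"])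
 qed
 have "(%n. sqrt ((nrm (%x. h n x - u x))\<^sup>2 + en (%x. h n x - u x))) ----> sqrt (0\<^sup>2 + 0)"
  by (intro tendsto_intros hl el)
 then have "(%n. hn (%x. h n x - u x)) ----> 0" by (simp add: hn_def h1_def nrm_sq)
 then show ?thesis using h hH uH by (intro exI[of _ h]) simp
qed

lemma H1_AE_cong:
 assumes "u \<in> H1" "AE x in lebesgue. v x = u x"
 shows "v \<in> H1" "en v = en u" "nrm2 v = nrm2 u" "hn v = hn u"
proof -
 have m: "v \<in> borel_measurable lebesgue" by (rule AE_eq_measurable[OF L2_meas[OF H1_L2[OF assms(1)]] assms(2)])
 show "v \<in> H1" and e: "en v = en u" using H1_cong[OF assms(1) m assms(2)] by auto
 show n: "nrm2 v = nrm2 u" by (rule nrm2_cong[OF L2_meas[OF H1_L2[OF assms(1)]] m assms(2)])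
 show "hn v = hn u" by (simp add: hn_def h1_def e n)
qed

section \<open>The spaces \<open>H10\<close>: linearity, representatives, closedness\<close>

lemma H10_H1: "u \<in> H10 Om ==> u \<in> H1" by (simp add: H10_def)

lemma H10_I:
 assumes "u \<in> H1" "quasi_continuous v" "AE x in lebesgue. v x = u x" "cap {x. x \<notin> Om & v x ~= 0} = 0"
 shows "u \<in> H10 Om"
 using assms by (auto simp: H10_def)

lemma H10_E:
 assumes "u \<in> H10 Om"
 obtains v where "quasi_continuous v" "AE x in lebesgue. v x = u x" "cap {x. x \<notin> Om & v x ~= 0} = 0"
 using assms by (auto simp: H10_def)

lemma H10_mono_qe:
 assumes "u \<in> H10 A" "cap (A - B) = 0" shows "u \<in> H10 B"
proof -
 obtain v where v: "quasi_continuous v" "AE x in lebesgue. v x = u x" "cap {x. x \<notin> A & v x ~= 0} = 0"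
  using assms(1) by (rule H10_E)
 have "cap {x. x \<notin> B & v x ~= 0} = 0"
  by (rule cap_null_subset[OF cap_null_Un[OF v(3) assms(2)]]) auto
 then show ?thesis using v H10_H1[OF assms(1)] by (intro H10_I[of u v])
qed

lemma H10_mono:
 assumes "u \<in> H10 A" "A \<subseteq> B" shows "u \<in> H10 B"
proof (rule H10_mono_qe[OF assms(1)])
 have "A - B = {}" using assms(2) by blast
 then show "cap (A - B) = 0" by (simp only: cap_empty)
qed

lemma H10_AE_zero:
 assumes "u \<in> H10 Om" shows "AE x in lebesgue. x \<notin> Om --> u x = 0"
proof -
 obtain v where v: "quasi_continuous v" "AE x in lebesgue. v x = u x" "cap {x. x \<notin> Om & v x ~= 0} = 0"
  using assms by (rule H10_E)
 show ?thesis using v(2) cap_zero_AE[OF v(3)] by eventually_elim auto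
qed

text \<open>Two quasi-continuous representatives agree quasi-everywhere, so the choice of
  representative does not matter.\<close>

lemma H10_rep:
 assumes "u \<in> H10 Om" "quasi_continuous v" "AE x in lebesgue. v x = u x"
 shows "cap {x. x \<notin> Om & v x ~= 0} = 0"
proof -
 obtain w where w: "quasi_continuous w" "AE x in lebesgue. w x = u x" "cap {x. x \<notin> Om & w x ~= 0} = 0"
  using assms(1) by (rule H10_E)
 have "AE x in lebesgue. v x = w x" using assms(3) w(2) by eventually_elim simp
 from cap_null_Un[OF qc_AE_eq[OF assms(2) w(1) this] w(3)]
 show ?thesis by (rule cap_null_subset) auto
qed

lemma qc_cmult: "quasi_continuous v ==> quasi_continuous (%x. c * v x)"
 by (rule qc_mult[OF qc_continuous]) auto

lemma H10_lincomb:
 assumes "u \<in> H10 Om" "v \<in> H10 Om" shows "(%x. a * u x + b * v x) \<in> H10 Om"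
proof -
 obtain u' where u': "quasi_continuous u'" "AE x in lebesgue. u' x = u x" "cap {x. x \<notin> Om & u' x ~= 0} = 0"
  using assms(1) by (rule H10_E)
 obtain v' where v': "quasi_continuous v'" "AE x in lebesgue. v' x = v x" "cap {x. x \<notin> Om & v' x ~= 0} = 0"
  using assms(2) by (rule H10_E)
 show ?thesis
 proof (rule H10_I)
  show "(%x. a * u x + b * v x) \<in> H1" by (intro H1_lincomb H10_H1[OF assms(1)] H10_H1[OF assms(2)])
  show "quasi_continuous (%x. a * u' x + b * v' x)" by (intro qc_add qc_cmult u' v')
  show "AE x in lebesgue. a * u' x + b * v' x = a * u x + b * v x" using u'(2) v'(2) by eventually_elim simp
  show "cap {x. x \<notin> Om & a * u' x + b * v' x ~= 0} = 0"
   by (rule cap_null_subset[OF cap_null_Un[OF u'(3) v'(3)]]) auto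
 qed
qed

lemma H10_zero: "(%x. 0) \<in> H10 Om"
 by (rule H10_I[of _ "%x. 0"]) (auto simp: H1_zero qc_continuous cap_empty)

lemma H10_sum:
 assumes "!!i. i \<in> I ==> f i \<in> H10 Om" shows "(%x. \<Sum>i\<in>I. c i * f i x) \<in> H10 Om"
 using assms
proof (induction I rule: infinite_finite_induct)
 case (insert a I)
 then show ?case using H10_lincomb[of "f a" Om "%x. \<Sum>i\<in>I. c i * f i x" "c a" 1] by simp
qed (auto simp: H10_zero)

text \<open>Midpoints stay in the linear space and converge in the Sobolev norm. A rapid subsequence
  of their quasi-continuous representatives converges quasi-everywhere, so the limit inherits
  vanishing quasi-everywhere off the set.\<close>

lemma H10_closed:
 assumes f: "!!n. f n \<in> H10 Om" "!!n. en (f n) <= C" and u: "L2 u" and l: "(%n. nrm (%x. f n x - u x)) ----> 0"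
 shows "u \<in> H10 Om"
proof -
 obtain h where h: "!!n. mid (f ` {n..}) (h n)" "!!n. h n \<in> H1" "u \<in> H1" "(%n. hn (%x. h n x - u x)) ----> 0"
  using strong_from_weak[OF H10_H1[OF f(1)] f(2) u l] by auto
 have h0: "h n \<in> H10 Om" for n
  using h(1)[of n]
 proof induction
  case (mid_step a b)
  then show ?case using H10_lincomb[of a Om b "1/2" "1/2"] by (simp add: add_divide_distrib)
 qed (use f in auto)
 \<comment> \<open>The half lets two consecutive deviations from u add up to the rate required by
   \<open>qc_limit\<close>.\<close>
 have "\<exists>N. \<forall>m\<ge>N. \<forall>n\<ge>N. hn (%x. h m x - u x) < (1/16) ^ Suc i / 2" for i
 proof -
  have "\<forall>\<^sub>F n in sequentially. hn (%x. h n x - u x) < (1/16) ^ Suc i / 2"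
   by (rule order_tendstoD(2)[OF h(4)]) simp
  then show ?thesis by (auto simp: eventually_sequentially)
 qed
 then obtain r where r: "strict_mono r" "!!i m n. m \<ge> r i ==> n \<ge> r i ==> hn (%x. h m x - u x) < (1/16) ^ Suc i / 2"
  using rapid_subseq[of "%i m n. hn (%x. h m x - u x) < (1/16) ^ Suc i / 2"] by blast
 have "\<exists>v. quasi_continuous v & (AE x in lebesgue. v x = h (r n) x) & cap {x. x \<notin> Om & v x ~= 0} = 0" for n
  using H10_E[OF h0[of "r n"]] by blast
 then have "\<forall>n. \<exists>v. quasi_continuous v & (AE x in lebesgue. v x = h (r n) x) & cap {x. x \<notin> Om & v x ~= 0} = 0" by blast
 from choice[OF this] obtain v where v: "!!n. quasi_continuous (v n)" "!!n. AE x in lebesgue. v n x = h (r n) x"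
  "!!n. cap {x. x \<notin> Om & v n x ~= 0} = 0" by blast
 have vH: "v n \<in> H1" for n by (rule H1_AE_cong(1)[OF h(2) v(2)])
 have vc: "hn (%x. v n x - v (Suc n) x) < (1/16) ^ Suc n" for n
 proof -
  have "AE x in lebesgue. v n x - v (Suc n) x = h (r n) x - h (r (Suc n)) x"
   using v(2)[of n] v(2)[of "Suc n"] by eventually_elim simp
  from H1_AE_cong(4)[OF H1_diff[OF h(2) h(2)] this]
  have "hn (%x. v n x - v (Suc n) x) = hn (%x. (h (r n) x - u x) - (h (r (Suc n)) x - u x))" by simp
  also have "... <= hn (%x. h (r n) x - u x) + hn (%x. h (r (Suc n)) x - u x)"
   by (intro hn_diff H1_diff h)
  also have "... < (1/16) ^ Suc n"
   using r(2)[of n "r n" "r n"] r(2)[of n "r (Suc n)" "r (Suc n)"] strict_mono_less_eq[OF r(1), of n "Suc n"] by simp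
  finally show ?thesis .
 qed
 obtain w Z where w: "quasi_continuous w" "cap Z = 0" "!!x. x \<notin> Z ==> (%n. v n x) ----> w x"
  using qc_limit[OF v(1) vH vc] by blast
 have hl: "(%n. nrm (%x. h (r n) x - u x)) ----> 0"
 proof (rule tendsto_0_le[of _ _ _ 1])
  show "(%n. hn (%x. h (r n) x - u x)) ----> 0" using LIMSEQ_subseq_LIMSEQ[OF h(4) r(1)] by (simp add: o_def)
  show "\<forall>\<^sub>F n in sequentially. norm (nrm (%x. h (r n) x - u x)) <= norm (hn (%x. h (r n) x - u x)) * 1"
   by (simp add: nrm_le_hn)
 qed
 obtain s where s: "strict_mono s" "AE x in lebesgue. (%n. h (r (s n)) x) ----> u x"
  using L2_conv_AE_subseq[of "%n. h (r n)" u, OF H1_L2[OF h(2)] u hl] by blast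
 have "AE x in lebesgue. \<forall>n. v n x = h (r n) x" using v(2) by (simp add: AE_all_countable)
 with s(2) cap_zero_AE[OF w(2)] have ae: "AE x in lebesgue. w x = u x"
 proof eventually_elim
  case (elim x)
  have "(%n. v (s n) x) ----> w x" using LIMSEQ_subseq_LIMSEQ[OF w(3)[OF elim(2)] s(1)] by (simp add: o_def)
  moreover have "(%n. v (s n) x) ----> u x" using elim(1,3) by simp
  ultimately show ?case by (rule LIMSEQ_unique)
 qed
 show ?thesis
 proof (rule H10_I[OF h(3) w(1) ae])
  show "cap {x. x \<notin> Om & w x ~= 0} = 0"
  proof (rule cap_null_subset[OF cap_null_Un[OF w(2) cap_null_Union[OF v(3)]]], safe)
   fix x assume x: "x \<notin> Om" "w x ~= 0" "x \<notin> (\<Union>n. {x. x \<notin> Om & v n x ~= 0})"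
   then have "v n x = 0" for n by auto
   then show "x \<in> Z" using w(3)[of x] x(2) by (auto simp: LIMSEQ_const_iff)
  qed
 qed
qed

text \<open>Mollifications are continuous, and closedness carries this over to their limit. For the
  whole space the content is the existence of a quasi-continuous representative.\<close>

lemma H1_H10_UNIV:
 fixes u :: "'a::euclidean_space => real"
 assumes u: "u \<in> H1" shows "u \<in> H10 UNIV"
proof -
 have L: "L2 u" using u by (rule H1_L2)
 have "\<forall>n. \<exists>e>0. nrm (%x. conv e u x - u x) <= 1 / real (Suc n)"
 proof
  fix n :: nat
  obtain e0 where "0 < e0" "!!e. 0 < e ==> e < e0 ==> nrm (%x. conv e u x - u x) <= 1 / real (Suc n)"
   using conv_tendsto[OF L, of "1 / real (Suc n)"] by auto
  then show "\<exists>e>0. nrm (%x. conv e u x - u x) <= 1 / real (Suc n)" by (intro exI[of _ "e0/2"]) auto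
 qed
 from choice[OF this] obtain e where e: "!!n. 0 < e n" "!!n. nrm (%x. conv (e n) u x - u x) <= 1 / real (Suc n)" by blast
 show ?thesis
 proof (rule H10_closed[of "%n. conv (e n) u" _ "en u"])
  show "conv (e n) u \<in> H10 UNIV" for n
   by (rule H10_I[OF conv_H1(1)[OF e(1) u] qc_continuous[OF conv_continuous[OF e(1) L]]]) (auto simp: cap_empty)
  show "en (conv (e n) u) <= en u" for n by (rule conv_H1(2)[OF e(1) u])
  show "L2 u" by (rule L)
  show "(%n. nrm (%x. conv (e n) u x - u x)) ----> 0"
  proof (rule real_tendsto_sandwich[of "%_. 0" _ _ "%n. 1 / Suc n"])
   show "(%n. 1 / real (Suc n)) ----> 0" using LIMSEQ_inverse_real_of_nat by (simp add: inverse_eq_divide)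
  qed (use e in auto)
 qed
qed

lemma qc_rep:
 assumes "u \<in> H1"
 obtains v where "quasi_continuous v" "AE x in lebesgue. v x = u x" "v \<in> H1"
 using H10_E[OF H1_H10_UNIV[OF assms]] H1_AE_cong(1)[OF assms] by blast

lemma H10_nonzero_set:
 assumes "u \<in> H1" "quasi_continuous v" "AE x in lebesgue. v x = u x" "{x. v x ~= 0} \<subseteq> Om"
 shows "u \<in> H10 Om"
proof (rule H10_I[OF assms(1-3)])
 have "{x. x \<notin> Om & v x ~= 0} = {}" using assms(4) by auto
 then show "cap {x. x \<notin> Om & v x ~= 0} = 0" by (simp only: cap_empty)
qed

section \<open>Bumps of small norm and nontrivial functions on quasi-open sets\<close>

lemma clamp_lip: "\<bar>max 0 (min 1 a) - max 0 (min 1 b)\<bar> <= \<bar>a - b\<bar>" for a b :: real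
 by (simp add: max_def min_def abs_if)

text \<open>Points have capacity zero for d >= 2. Concentrating a fixed bump by the factor 2^n does
  not raise the energy and drives the L2 norm to zero. For d = 2 the energy bound does not decay, so
  midpoints are taken: they tend to zero in the Sobolev norm and still equal 1 near x0.\<close>

lemma small_bump:
 fixes x0 :: "'a::euclidean_space"
 assumes dim: "DIM('a) \<ge> 2" and e: "0 < e"
 obtains ps r where "0 < r" "ps \<in> H1" "continuous_on UNIV ps" "!!x. 0 <= ps x" "!!x. ps x <= 1"
  "!!x. x \<in> ball x0 r ==> ps x = 1" "hn ps < e"
proof -
 define ph where "ph x = max 0 (min 1 (2 - norm x))" for x :: 'a
 have pl: "\<bar>ph x - ph y\<bar> <= 1 * norm (x - y)" for x y
 proof -
  have "\<bar>ph x - ph y\<bar> <= \<bar>norm x - norm y\<bar>"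
   using clamp_lip[of "2 - norm x" "2 - norm y"] by (simp add: ph_def abs_minus_commute)
  then show ?thesis using norm_triangle_ineq3[of x y] by simp
 qed
 have pH: "ph \<in> H1" by (rule H1_lipschitz[OF pl, of 2]) (auto simp: ph_def)
 define f where "f n x = ph (- (2 ^ n *\<^sub>R x0) + 2 ^ n *\<^sub>R x)" for n x
 have fH: "f n \<in> H1" for n unfolding f_def by (rule en_affine(1)[OF pH]) simp
 have fe: "en (f n) <= en ph" for n
 proof -
  have "en (f n) <= (2^n)\<^sup>2 / (2^n) ^ DIM('a) * en ph" unfolding f_def by (rule en_affine(2)[OF pH]) simp
  also have "... <= 1 * en ph"
  proof (intro mult_right_mono)
   have "(2^n)\<^sup>2 <= (2^n :: real) ^ DIM('a)" using dim by (intro power_increasing) auto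
   then show "(2^n)\<^sup>2 / (2^n) ^ DIM('a) <= (1::real)" by simp
  qed simp
  finally show ?thesis by simp
 qed
 have fn: "nrm (f n) <= (1/2)^n * nrm ph" for n
 proof -
  have "nrm2 (f n) = nrm2 ph / (2^n) ^ DIM('a)"
   unfolding f_def using nrm2_affine[of "2^n" ph "- (2 ^ n *\<^sub>R x0)"] H1_L2[OF pH] by simp
  also have "... <= nrm2 ph / (2^n)\<^sup>2"
   using dim by (intro divide_left_mono power_increasing) auto
  finally have "nrm2 (f n) <= ((1/2)^n * nrm ph)\<^sup>2" by (simp add: power_mult_distrib nrm_sq power_divide)
  then show ?thesis unfolding nrm_def[of "f n"] by (intro real_le_lsqrt) auto
 qed
 have fl: "(%n. nrm (%x. f n x - 0)) ----> 0"
 proof (rule real_tendsto_sandwich[of "%_. 0" _ _ "%n. (1/2)^n * nrm ph"])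
  have "(%n. (1/2)^n * nrm ph) ----> 0 * nrm ph" by (intro tendsto_intros) auto
  then show "(%n. (1/2)^n * nrm ph) ----> 0" by simp
 qed (use fn in auto)
 obtain h where h: "!!n. mid (f ` {n..}) (h n)" "!!n. h n \<in> H1" "(%x::'a. 0) \<in> H1" "(%n. hn (%x. h n x - 0)) ----> 0"
  using strong_from_weak[OF fH fe L2_zero fl] by auto
 have "\<forall>\<^sub>F n in sequentially. hn (%x. h n x - 0) < e" using h(4) e by (rule order_tendstoD)
 then obtain n where n: "hn (h n) < e" by (auto simp: eventually_sequentially)
 have "continuous_on UNIV (h n) & (\<forall>x. 0 <= h n x & h n x <= 1) & (\<exists>r>0. \<forall>x\<in>ball x0 r. h n x = 1)"
  using h(1)[of n]
 proof induction
  case (mid_base g)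
  then obtain m where g: "g = f m" by auto
  have "continuous_on UNIV (f m)" unfolding f_def ph_def by (intro continuous_intros)
  moreover have "f m x = 1" if "x \<in> ball x0 ((1/2)^m)" for x
  proof -
   have "norm (- (2 ^ m *\<^sub>R x0) + 2 ^ m *\<^sub>R x) = 2^m * norm (x - x0)"
   proof -
    have "- (2 ^ m *\<^sub>R x0) + 2 ^ m *\<^sub>R x = 2^m *\<^sub>R (x - x0)" by (simp add: algebra_simps)
    then show ?thesis by simp
   qed
   also have "... < 2^m * (1/2)^m" using that by (intro mult_strict_left_mono) (auto simp: dist_norm norm_minus_commute)
   also have "... = 1" by (simp add: power_mult_distrib[symmetric])
   finally show ?thesis by (simp add: f_def ph_def)
  qed
  moreover have "0 <= f m x & f m x <= 1" for x by (simp add: f_def ph_def)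
  moreover have "0 < (1/2::real)^m" by simp
  ultimately show ?case unfolding g by blast
 next
  case (mid_step a b)
  then obtain r s where r: "0 < r" "\<forall>x\<in>ball x0 r. a x = 1" and s: "0 < s" "\<forall>x\<in>ball x0 s. b x = 1" by blast
  show ?case
  proof (intro conjI exI[of _ "min r s"])
   show "continuous_on UNIV (%x. (a x + b x) / 2)" using mid_step by (intro continuous_intros) auto
   show "\<forall>x. 0 <= (a x + b x) / 2 & (a x + b x) / 2 <= 1"
   proof
    fix x
    have "0 <= a x" "a x <= 1" "0 <= b x" "b x <= 1" using mid_step.IH by auto
    then show "0 <= (a x + b x) / 2 & (a x + b x) / 2 <= 1" by simp
   qed
   show "\<forall>x\<in>ball x0 (min r s). (a x + b x) / 2 = 1" using r s by auto
  qed (use r s in auto)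
 qed
 then obtain r where r: "continuous_on UNIV (h n)" "\<forall>x. 0 <= h n x & h n x <= 1" "0 < r" "\<forall>x\<in>ball x0 r. h n x = 1"
  by (elim conjE exE bexE) (rule that)
 show ?thesis by (rule that[of r "h n"]) (use r h(2)[of n] n in simp_all)
qed

text \<open>Truncation at M bounds the second factor, so the increment of the product is at most
  that of the truncation plus M times that of ps.\<close>

lemma H10_cut:
 assumes u: "u \<in> H10 Om" and ps: "continuous_on UNIV ps" "ps \<in> H1" "!!x. 0 <= ps x" "!!x. ps x <= 1"
  and B: "!!x. x \<in> B ==> ps x = 1" and M: "0 <= M"
 shows "(%x. (1 - ps x) * trunc M (u x)) \<in> H10 (Om - B)"
proof -
 obtain v where v: "quasi_continuous v" "AE x in lebesgue. v x = u x" "cap {x. x \<notin> Om & v x ~= 0} = 0"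
  using u by (rule H10_E)
 have uH: "u \<in> H1" by (rule H10_H1[OF u])
 have tH: "(%x. trunc M (u x)) \<in> H1" by (rule trunc_H1(1)[OF uH M])
 have L: "L2 (%x. (1 - ps x) * trunc M (u x))"
  by (rule L2_mult_bdd[OF H1_L2[OF tH], where C=1]) (use ps L2_meas[OF H1_L2[OF ps(2)]] in auto)
 have H: "(%x. (1 - ps x) * trunc M (u x)) \<in> H1"
 proof (rule en_contract2(1)[OF L tH H1_cmult(1)[OF ps(2), of M] zero_less_one])
  fix x y
  let ?a = "trunc M (u x)" and ?b = "trunc M (u y)"
  have "(1 - ps x) * ?a - (1 - ps y) * ?b = (1 - ps x) * (?a - ?b) + ?b * (ps y - ps x)" by (simp add: algebra_simps)
  also have "\<bar>...\<bar> <= \<bar>1 - ps x\<bar> * \<bar>?a - ?b\<bar> + \<bar>?b\<bar> * \<bar>ps y - ps x\<bar>"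
   by (rule order_trans[OF abs_triangle_ineq]) (simp only: abs_mult order_refl)
  also have "... <= 1 * \<bar>?a - ?b\<bar> + M * \<bar>ps y - ps x\<bar>"
   using ps(3,4)[of x] trunc_props(1)[OF M] by (intro add_mono mult_right_mono) auto
  finally show "\<bar>(1 - ps x) * ?a - (1 - ps y) * ?b\<bar> <= \<bar>?a - ?b\<bar> + \<bar>M * ps x - M * ps y\<bar>"
   using M by (simp add: right_diff_distrib[symmetric] abs_mult abs_minus_commute)
 qed
 show ?thesis
 proof (rule H10_I[OF H])
  have tc: "continuous_on UNIV (trunc M)" unfolding trunc_def by (intro continuous_intros)
  show "quasi_continuous (%x. (1 - ps x) * trunc M (v x))"
   by (intro qc_mult qc_continuous qc_compose[OF v(1) tc] continuous_intros ps)
  show "AE x in lebesgue. (1 - ps x) * trunc M (v x) = (1 - ps x) * trunc M (u x)" using v(2) by eventually_elim simp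
  show "cap {x. x \<notin> Om - B & (1 - ps x) * trunc M (v x) ~= 0} = 0"
   by (rule cap_null_subset[OF v(3)]) (use B trunc_props(3)[OF M] in auto)
 qed
qed

text \<open>Choose an open U around D such that \<open>U - D\<close> has capacity below the measure
  m0 of D in a ball, and multiply the distance to the complement of U within that ball by 1 minus
  the clamped potential w'. The product vanishes quasi-everywhere off D. Were it zero, w' would be
  at least 1 on a set of measure m0, which its norm forbids. This settles the case in which D
  exceeds the volume bound.\<close>

lemma H10_nontrivial:
 fixes D :: "'a::euclidean_space set"
 assumes D: "quasi_open D" and pos: "emeasure lebesgue D > 0"
 obtains u where "u \<in> H10 D" "\<not> (AE x in lebesgue. u x = 0)"
proof -
 have Dm: "D \<in> sets lebesgue" by (rule quasi_open_sets[OF D])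
 have "\<exists>R>0. emeasure lebesgue (D \<inter> ball 0 R) > 0"
 proof (rule ccontr)
  assume "\<not> ?thesis"
  then have z: "D \<inter> ball 0 R \<in> null_sets lebesgue" if "0 < R" for R using that Dm by (intro null_setsI) auto
  have "(\<Union>n::nat. D \<inter> ball 0 (real (Suc n))) \<in> null_sets lebesgue" by (intro null_sets_UN z) simp
  moreover have "D \<subseteq> (\<Union>n::nat. D \<inter> ball 0 (real (Suc n)))"
  proof
   fix x assume "x \<in> D"
   obtain n :: nat where "norm x < real n" using reals_Archimedean2 by blast
   then have "x \<in> ball 0 (real (Suc n))" by simp
   then show "x \<in> (\<Union>n::nat. D \<inter> ball 0 (real (Suc n)))" using \<open>x \<in> D\<close> by blast
  qed
  ultimately have "emeasure lebesgue D = 0" using null_sets_subset[OF _ Dm] by blast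
  then show False using pos by simp
 qed
 then obtain R where R: "0 < R" "emeasure lebesgue (D \<inter> ball 0 R) > 0" by blast
 have "emeasure lebesgue (D \<inter> ball 0 R) <= emeasure lebesgue (ball (0::'a) R)" by (rule emeasure_mono) auto
 also have "... < \<infinity>" using emeasure_lborel_ball_finite[of "0::'a" R] by simp
 finally have fin: "emeasure lebesgue (D \<inter> ball 0 R) ~= \<infinity>" by (simp only: less_irrefl not_False_eq_True neq_iff simp_thms)
 define m0 where "m0 = measure lebesgue (D \<inter> ball 0 R)"
 have m0: "emeasure lebesgue (D \<inter> ball 0 R) = ennreal m0"
  unfolding m0_def by (rule emeasure_eq_ennreal_measure) (use fin in \<open>simp only: infinity_ennreal_def not_False_eq_True\<close>)
 have "0 < m0" using R(2) unfolding m0 by simp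
 note m0 = m0 this
 obtain U where U: "open U" "D \<subseteq> U" "cap (U - D) < ereal m0" using D m0(2) unfolding quasi_open_def by blast
 obtain w G where w: "w \<in> H1" "open G" "U - D \<subseteq> G" "AE x in lebesgue. x \<in> G --> 1 <= w x" "h1 w < m0"
  using U(3) unfolding cap_less by blast
 obtain w' where w': "quasi_continuous w'" "AE x in lebesgue. w' x = w x" "w' \<in> H1" by (rule qc_rep[OF w(1)])
 define F where "F = - (U \<inter> ball 0 R)"
 have Fne: "F ~= {}" "closed F"
 proof -
  obtain b :: 'a where "b \<in> Basis" using nonempty_Basis by blast
  then have "R *\<^sub>R b \<in> F" using R(1) by (simp add: F_def)
  then show "F ~= {}" by blast
  show "closed F" unfolding F_def by (intro closed_Compl open_Int U open_ball)
 qed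
 define ph where "ph x = infdist x F" for x
 have pl: "\<bar>ph x - ph y\<bar> <= 1 * norm (x - y)" for x y
  unfolding ph_def using infdist_triangle_abs[of x F y] by (simp add: dist_norm)
 have p0: "ph x = 0 \<longleftrightarrow> x \<in> F" for x unfolding ph_def using in_closed_iff_infdist_zero[OF Fne(2,1)] by blast
 have pR: "ph x = 0" if "R <= norm x" for x using that p0 by (simp add: F_def)
 have pH: "ph \<in> H1" by (rule H1_lipschitz[OF pl pR])
 have pnn: "0 <= ph x" for x by (simp add: ph_def infdist_nonneg)
 have pc: "continuous_on UNIV ph" unfolding ph_def by (intro continuous_intros)
 have "bounded (range ph)"
 proof -
  have "compact (ph ` cball 0 R)" by (intro compact_continuous_image continuous_on_subset[OF pc]) auto
  then have "bounded (insert 0 (ph ` cball 0 R))" by (simp add: compact_imp_bounded)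
  moreover have "range ph \<subseteq> insert 0 (ph ` cball 0 R)"
  proof
   fix y assume "y \<in> range ph"
   then obtain x where "y = ph x" by blast
   then show "y \<in> insert 0 (ph ` cball 0 R)" using pR[of x] by (cases "norm x <= R") auto
  qed
  ultimately show ?thesis by (rule bounded_subset)
 qed
 then obtain B where B: "!!x. \<bar>ph x\<bar> <= B" "0 < B" by (auto simp: bounded_pos)
 define f where "f t = 1 - max 0 (min 1 t)" for t :: real
 have fc: "continuous_on UNIV f" unfolding f_def by (intro continuous_intros)
 have fb: "0 <= f t" "f t <= 1" "f t = 0 \<longleftrightarrow> 1 <= t" "\<bar>f s - f t\<bar> <= \<bar>s - t\<bar>" for s t
  using clamp_lip[of t s] by (auto simp: f_def abs_minus_commute[of t s])
 define u where "u x = ph x * f (w' x)" for x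
 have fm: "(%x. f (w' x)) \<in> borel_measurable lebesgue"
  using L2_meas[OF H1_L2[OF w'(3)]] unfolding f_def by simp
 have uL: "L2 u"
  unfolding u_def
 proof (rule L2_bound[OF H1_L2[OF pH], where C=1])
  show "(%x. ph x * f (w' x)) \<in> borel_measurable lebesgue" using fm L2_meas[OF H1_L2[OF pH]] by simp
  show "AE x in lebesgue. \<bar>ph x * f (w' x)\<bar> <= 1 * \<bar>ph x\<bar>"
   by (intro AE_I2) (simp add: abs_mult mult_left_le fb)
 qed
 have uH: "u \<in> H1"
 proof (rule en_contract2(1)[OF uL pH H1_cmult(1)[OF w'(3), of B] zero_less_one])
  fix x y
  have "u x - u y = f (w' x) * (ph x - ph y) + ph y * (f (w' x) - f (w' y))" by (simp add: u_def algebra_simps)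
  also have "\<bar>...\<bar> <= \<bar>f (w' x)\<bar> * \<bar>ph x - ph y\<bar> + \<bar>ph y\<bar> * \<bar>f (w' x) - f (w' y)\<bar>"
   by (rule order_trans[OF abs_triangle_ineq]) (simp only: abs_mult order_refl)
  also have "... <= 1 * \<bar>ph x - ph y\<bar> + B * \<bar>w' x - w' y\<bar>"
   using fb B by (intro add_mono mult_mono) auto
  finally show "\<bar>u x - u y\<bar> <= \<bar>ph x - ph y\<bar> + \<bar>B * w' x - B * w' y\<bar>"
   using B(2) by (simp add: right_diff_distrib[symmetric] abs_mult)
 qed
 have gc: "continuous_on UNIV (%t::real. min 0 (t - 1))" by (intro continuous_intros)
 have "cap {x \<in> G. min 0 (w' x - 1) ~= 0} = 0"
 proof (rule qc_AE_zero[OF qc_compose[OF w'(1) gc] w(2)])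
  show "AE x in lebesgue. x \<in> G --> min 0 (w' x - 1) = 0" using w(4) w'(2) by eventually_elim auto
 qed
 then have "cap {x. x \<notin> D & u x ~= 0} = 0"
 proof (rule cap_null_subset, safe)
  fix x assume x: "x \<notin> D" "u x ~= 0"
  then have "x \<in> U" "\<not> 1 <= w' x" using p0[of x] fb(3)[of "w' x"] by (auto simp: u_def F_def)
  then show "x \<in> G" "min 0 (w' x - 1) = 0 ==> False" using w(3) x(1) by auto
 qed
 moreover have "quasi_continuous u"
  unfolding u_def by (intro qc_mult qc_continuous[OF pc] qc_compose[OF w'(1) fc])
 ultimately have "u \<in> H10 D" by (intro H10_I[OF uH, of u]) auto
 moreover have "\<not> (AE x in lebesgue. u x = 0)"
 proof
  assume ae: "AE x in lebesgue. u x = 0"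
  have "D \<inter> ball 0 R \<in> sets lebesgue" by (rule sets.Int[OF Dm]) auto
  then have "ennreal m0 = (\<integral>\<^sup>+x. indicator (D \<inter> ball 0 R) x \<partial>lebesgue)"
   unfolding m0(1)[symmetric] by (rule nn_integral_indicator[symmetric])
  also have "... <= (\<integral>\<^sup>+x. ennreal ((w' x)\<^sup>2) \<partial>lebesgue)"
  proof (rule nn_integral_mono_AE)
   show "AE x in lebesgue. indicator (D \<inter> ball 0 R) x <= ennreal ((w' x)\<^sup>2)"
    using ae
   proof eventually_elim
    case (elim x)
    show ?case
    proof (cases "x \<in> D \<inter> ball 0 R")
     case True
     then have "ph x ~= 0" using p0[of x] U(2) by (auto simp: F_def)
     then have "1 <= w' x" using elim fb(3)[of "w' x"] by (auto simp: u_def)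
     then have "1 <= (w' x)\<^sup>2" by (simp add: one_le_power)
     then show ?thesis using True by (simp add: ennreal_leI flip: ennreal_1)
    qed simp
   qed
  qed
  also have "... = ennreal (nrm2 w')" by (rule nn_integral_nrm2[OF H1_L2[OF w'(3)]])
  finally have "m0 <= nrm2 w'" by simp
  also have "nrm2 w' = nrm2 w" by (rule H1_AE_cong(3)[OF w(1) w'(2)])
  also have "... <= h1 w" by (simp add: h1_def)
  finally show False using w(5) by simp
 qed
 ultimately show ?thesis using that by blast
qed

subsection \<open>Compactness, Poincare and nonvanishing estimates\<close>

lemma eta_L2_0:
 assumes "0 < e" shows "L2 (eta e :: 'a::euclidean_space => real)"
proof -
 have "(%y::'a. eta e (0 - y)) = eta e" by (rule ext) (simp add: eta_props(2)[OF assms])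
 then show ?thesis using eta_L2[OF assms, of "0::'a"] by simp
qed

lemma eta_reflect:
 fixes x :: "'a::euclidean_space"
 assumes "0 < e"
 shows "nrm2 (%y. eta e (x - y)) = nrm2 (eta e :: 'a => real)"
proof -
 have "L2 (eta e :: 'a => real)" by (rule eta_L2_0[OF assms])
 from nrm2_affine[OF _ this, of "-1" x] show ?thesis by simp
qed

lemma conv_pointwise:
 fixes u :: "'a::euclidean_space => real"
 assumes e: "0 < e" and u: "L2 u"
 shows "(conv e u x)\<^sup>2 <= nrm2 (%y. indicator (cball x e) y * u y) * nrm2 (eta e :: 'a => real)"
proof -
 have L: "L2 (%y. indicator (cball x e) y * u y)" by (rule L2_indicator_mult[OF u]) simp
 have "eta e (x - y) * u y = (indicator (cball x e) y * u y) * eta e (x - y)" for y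
  using eta_props(3)[OF e, of "x - y"] by (cases "y \<in> cball x e") (auto simp: dist_norm)
 then have "conv e u x = ip (%y. indicator (cball x e) y * u y) (%y. eta e (x - y))"
  unfolding conv_def ip_def by (intro Bochner_Integration.integral_cong refl)
 then show ?thesis using cauchy_schwarz2[OF L eta_L2[OF e, of x]] eta_reflect[OF e, of x] by simp
qed

lemma conv_H1_near:
 fixes u :: "'a::euclidean_space => real"
 assumes e: "0 < e" and u: "u \<in> H1"
 shows "nrm (%x. conv e u x - u x) <= e * DIM('a) * sqrt (en u)"
proof (rule conv_near[OF e H1_L2[OF u]])
 fix z :: 'a assume z: "norm z < e"
 have "nrm (%x. u (x + z) - u x) <= (\<Sum>b\<in>Basis. \<bar>z \<bullet> b\<bar> * nrm (%x. grad u x \<bullet> b))"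
  by (rule translate_bound[OF H1_L2[OF u] grad_wd[OF u]])
 also have "... <= (\<Sum>b\<in>(Basis::'a set). e * sqrt (en u))"
 proof (intro sum_mono mult_mono)
  fix b :: 'a assume b: "b \<in> Basis"
  show "\<bar>z \<bullet> b\<bar> <= e" using Basis_le_norm[OF b, of z] z by simp
  show "nrm (%x. grad u x \<bullet> b) <= sqrt (en u)"
   unfolding nrm_def en_sum[OF u] using b by (intro real_sqrt_le_mono member_le_sum) auto
 qed (use e in auto)
 finally show "nrm (%x. u (x + z) - u x) <= e * DIM('a) * sqrt (en u)" by (simp add: mult_ac)
qed

text \<open>Common source of the Poincare and the nonvanishing estimate: u is close in L2 to its
  mollification at scale e, and the mollification is bounded pointwise by the local mass, hence
  small in L2 on a set of small or finite measure.\<close>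

lemma support_estimate:
 fixes u :: "'a::euclidean_space => real"
 assumes e: "0 < e" and u: "u \<in> H1" and A: "A \<in> sets lebesgue" "emeasure lebesgue A <= ennreal a" "0 <= a"
  and z: "AE x in lebesgue. x \<notin> A --> u x = 0" and de: "!!x. nrm2 (%y. indicator (cball x e) y * u y) <= de" "0 <= de"
 shows "nrm u <= e * DIM('a) * sqrt (en u) + sqrt (de * nrm2 (eta e :: 'a => real) * a)"
proof -
 have L: "L2 u" "L2 (conv e u)" using u e by (auto intro: H1_L2 conv_L2)
 have fin: "emeasure lebesgue A < \<infinity>" using A(2) by (simp add: order.strict_trans1)
 have I: "L2 (%x. indicator A x)" by (rule indicator_L2[OF A(1) fin])
 have AC: "L2 (%x. indicator A x * conv e u x)" by (rule L2_indicator_mult[OF L(2) A(1)])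
 have "nrm (%x. u x - indicator A x * conv e u x) <= nrm (%x. conv e u x - u x)"
  unfolding nrm_def
 proof (intro real_sqrt_le_mono nrm2_mono L2_diff L L2_meas[OF L2_diff[OF L(1) AC]])
  show "AE x in lebesgue. \<bar>u x - indicator A x * conv e u x\<bar> <= \<bar>conv e u x - u x\<bar>"
   using z by eventually_elim (auto split: split_indicator)
 qed
 also have "... <= e * DIM('a) * sqrt (en u)" by (rule conv_H1_near[OF e u])
 finally have 1: "nrm (%x. u x - indicator A x * conv e u x) <= e * DIM('a) * sqrt (en u)" .
 define ka where "ka = nrm2 (eta e :: 'a => real)"
 have k0: "0 <= ka" by (simp add: ka_def)
 have c: "\<bar>conv e u x\<bar> <= sqrt (de * ka)" for x
 proof -
  have "(conv e u x)\<^sup>2 <= de * ka"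
   using conv_pointwise[OF e L(1), of x] mult_right_mono[OF de(1)[of x] k0] unfolding ka_def by linarith
  then show ?thesis by (metis real_sqrt_abs real_sqrt_le_iff)
 qed
 have "nrm (%x. indicator A x * conv e u x) <= nrm (%x. sqrt (de * ka) * indicator A x)"
  unfolding nrm_def
 proof (rule real_sqrt_le_mono, rule nrm2_mono[OF L2_cmult[OF I] L2_meas[OF AC]], rule AE_I2)
  fix x show "\<bar>indicator A x * conv e u x\<bar> <= \<bar>sqrt (de * ka) * indicator A x\<bar>"
   using c[of x] de(2) k0 by (auto split: split_indicator)
 qed
 also have "... = sqrt (de * ka) * nrm (%x. indicator A x :: real)" using de(2) k0 by (simp add: nrm_cmult)
 also have "... <= sqrt (de * ka) * sqrt a"
 proof (rule mult_left_mono)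
  have "ennreal (nrm2 (%x. indicator A x :: real)) = (\<integral>\<^sup>+x. indicator A x \<partial>lebesgue)"
   unfolding nn_integral_nrm2[OF I, symmetric] by (intro nn_integral_cong) (auto split: split_indicator)
  also have "... = emeasure lebesgue A" using A(1) by simp
  finally have "ennreal (nrm2 (%x. indicator A x :: real)) <= ennreal a" using A(2) by simp
  then have "nrm2 (%x. indicator A x :: real) <= a" using A(3) by (simp add: ennreal_le_iff)
  then show "nrm (%x. indicator A x :: real) <= sqrt a" unfolding nrm_def by (rule real_sqrt_le_mono)
 qed (use de(2) k0 in auto)
 finally have 2: "nrm (%x. indicator A x * conv e u x) <= sqrt (de * ka * a)" by (simp add: real_sqrt_mult)
 have "nrm (%x. (u x - indicator A x * conv e u x) + indicator A x * conv e u x)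
  <= nrm (%x. u x - indicator A x * conv e u x) + nrm (%x. indicator A x * conv e u x)"
  by (rule nrm_add[OF L2_diff[OF L(1) AC] AC])
 then show ?thesis using 1 2 by (simp add: ka_def)
qed

lemma eta_nrm2_pos:
 fixes e :: real
 assumes e: "0 < e" shows "0 < nrm2 (eta e :: 'a::euclidean_space => real)"
proof -
 have L: "L2 (eta e :: 'a => real)" by (rule eta_L2_0[OF e])
 have "nrm2 (eta e :: 'a => real) ~= 0"
 proof
  assume "nrm2 (eta e :: 'a => real) = 0"
  then have "AE x in lebesgue. eta e (x::'a) = 0" using nrm2_eq_0[OF L] by simp
  then have "(LINT x|lebesgue. eta e (x::'a)) = (\<integral>x. 0 \<partial>(lebesgue :: 'a measure))"
   using L2_meas[OF L] by (intro integral_cong_AE) auto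
  then show False using eta_props(6)[OF e, where 'a='a] by simp
 qed
 then show ?thesis using nrm2_nonneg[of "eta e :: 'a => real"] by linarith
qed

lemma poincare:
 fixes e :: real
 assumes e: "0 < e"
 obtains a where "0 < a" "!!(u::'a::euclidean_space => real) A. u \<in> H1 ==> A \<in> sets lebesgue ==> emeasure lebesgue A <= ennreal a ==>
  (AE x in lebesgue. x \<notin> A --> u x = 0) ==> nrm u <= 2 * e * DIM('a) * sqrt (en u)"
proof -
 define ka where "ka = nrm2 (eta e :: 'a => real)"
 have k: "0 < ka" unfolding ka_def by (rule eta_nrm2_pos[OF e])
 \<comment> \<open>With the trivial local bound de = |u|^2 this makes the second term of the
   estimate half the norm of u, which is absorbed on the left.\<close>
 define a where "a = 1 / (4 * ka)"
 have a: "0 < a" using k by (simp add: a_def)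
 show ?thesis
 proof (rule that[OF a])
  fix u :: "'a => real" and A
  assume u: "u \<in> H1" and A: "A \<in> sets lebesgue" "emeasure lebesgue A <= ennreal a" and z: "AE x in lebesgue. x \<notin> A --> u x = 0"
  have L: "L2 u" using u by (rule H1_L2)
  have "nrm2 (%y. indicator (cball x e) y * u y) <= nrm2 u" for x
   by (rule nrm2_mono[OF L L2_meas[OF L2_indicator_mult[OF L]]]) (auto split: split_indicator)
  from support_estimate[OF e u A _ z this]
  have "nrm u <= e * DIM('a) * sqrt (en u) + sqrt (nrm2 u * ka * a)" using a by (simp add: ka_def)
  also have "nrm2 u * ka * a = (nrm u / 2)\<^sup>2" using k by (simp add: a_def nrm_sq power_divide)
  also have "sqrt ... = nrm u / 2" by simp
  finally show "nrm u <= 2 * e * DIM('a) * sqrt (en u)" by simp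
 qed
qed

text \<open>Lieb's nonvanishing lemma: e and c are chosen so that, without local mass c, the two
  terms of \<open>support_estimate\<close> are at most 1/4 each, against norm 1. It provides the
  points at which a minimizing sequence is recentred.\<close>

lemma nonvanishing:
 assumes "0 <= a" "0 <= C"
 obtains e c where "0 < e" "0 < c" "!!(u::'a::euclidean_space => real) A. u \<in> H1 ==> A \<in> sets lebesgue ==> emeasure lebesgue A <= ennreal a ==>
  (AE x in lebesgue. x \<notin> A --> u x = 0) ==> en u <= C ==> nrm2 u = 1 ==> \<exists>x. c <= nrm2 (%y. indicator (cball x e) y * u y)"
proof -
 define e where "e = 1 / (4 * DIM('a) * (sqrt C + 1))"
 have s: "0 < sqrt C + 1" using assms(2) by (simp add: add_nonneg_pos)
 have e: "0 < e" using s by (simp add: e_def)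
 define ka where "ka = nrm2 (eta e :: 'a => real)"
 have k: "0 < ka" unfolding ka_def by (rule eta_nrm2_pos[OF e])
 define c where "c = 1 / (16 * ka * (a + 1))"
 have c: "0 < c" using k assms by (simp add: c_def)
 show ?thesis
 proof (rule that[OF e c])
  fix u :: "'a => real" and A
  assume u: "u \<in> H1" and A: "A \<in> sets lebesgue" "emeasure lebesgue A <= ennreal a" and z: "AE x in lebesgue. x \<notin> A --> u x = 0"
   and C: "en u <= C" and n: "nrm2 u = 1"
  show "\<exists>x. c <= nrm2 (%y. indicator (cball x e) y * u y)"
  proof (rule ccontr)
   assume "\<not> ?thesis"
   then have "nrm2 (%y. indicator (cball x e) y * u y) <= c" for x by (auto simp: not_le intro: less_imp_le)
   from support_estimate[OF e u A assms(1) z this]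
   have "nrm u <= e * DIM('a) * sqrt (en u) + sqrt (c * ka * a)" using c by (simp add: ka_def)
   also have "e * DIM('a) * sqrt (en u) <= e * DIM('a) * (sqrt C + 1)"
    using e C by (intro mult_left_mono) (auto intro: order_trans[OF real_sqrt_le_mono])
   also have "... = 1/4" using s by (simp add: e_def)
   also have "sqrt (c * ka * a) <= sqrt ((1/4)\<^sup>2)"
   proof (rule real_sqrt_le_mono)
    have "c * ka = 1 / (16 * (a + 1))" using k by (simp add: c_def)
    then have "c * ka * a = (1/16) * (a / (a + 1))" by simp
    also have "... <= (1/16) * 1" using assms(1) by (intro mult_left_mono) auto
    finally show "c * ka * a <= (1/4)\<^sup>2" by (simp add: power2_eq_square)
   qed
   finally show False using n by (simp add: nrm_def)
  qed
 qed
qed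

section \<open>Local compactness\<close>

lemma diag_real:
 fixes X :: "nat => nat => real"
 assumes b: "!!i. \<exists>C. \<forall>n. \<bar>X i n\<bar> <= C"
 obtains r :: "nat => nat" where "strict_mono r" "!!i. convergent (%n. X i (r n))"
proof -
 interpret subseqs "%i s. convergent (%n. X i (s n))"
 proof
  fix i :: nat and s :: "nat => nat" assume "strict_mono s"
  obtain C where C: "\<forall>n. \<bar>X i n\<bar> <= C" using b by blast
  have "bounded (range (%n. X i (s n)))" using C by (auto simp: bounded_iff)
  then obtain l r where "strict_mono r" "((%n. X i (s n)) \<circ> r) ----> l"
   using bounded_imp_convergent_subsequence by blast
  then show "\<exists>r. strict_mono r & convergent (%n. X i ((s \<circ> r) n))"
   by (intro exI[of _ r]) (auto simp: convergent_def o_def)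
 qed
 have "convergent (%n. X i (diagseq n))" for i
 proof -
  have "convergent (%n. X i ((diagseq \<circ> (+) (Suc i)) n))"
  proof (rule diagseq_holds)
   fix s r :: "nat => nat" and n assume "strict_mono r" "convergent (%k. X n (s k))"
   then show "convergent (%k. X n ((s \<circ> r) k))"
    using convergent_subseq_convergent[of "%k. X n (s k)" r] by (simp add: o_def)
  qed
  then show ?thesis using convergent_ignore_initial_segment[of "%n. X i (diagseq n)" "Suc i"] by (simp add: o_def add.commute)
 qed
 then show ?thesis using that[OF subseq_diagseq] by blast
qed

lemma eta_L2_continuous:
 fixes X :: "nat => 'a::euclidean_space"
 assumes e: "0 < e" and X: "X ----> x"
 shows "(%n. nrm (%y. eta e (X n - y) - eta e (x - y))) ----> 0"
proof -
 have "Bseq X" using X by (simp add: convergentI convergent_imp_Bseq)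
 then obtain B where B: "!!n. norm (X n) <= B" by (auto simp: Bseq_def)
 have xB: "norm x <= B" by (rule Lim_bounded[OF tendsto_norm[OF X]]) (use B in auto)
 define K where "K = 1 / (LINT y|lebesgue. eta0 e (y::'a))"
 have K: "\<bar>eta e z\<bar> <= K" for z :: 'a using eta_props(7)[OF e] by (simp add: K_def)
 have K0: "0 <= K" using K[of 0] by linarith
 show ?thesis
 proof (rule dominated_nrm[where w="%y. (2 * K) * indicator (cball 0 (B + e)) y"])
  show "(%y. eta e (X n - y) - eta e (x - y)) \<in> borel_measurable lebesgue" for n
   by (intro L2_meas L2_diff eta_L2 e)
  show "L2 (%y::'a. (2 * K) * indicator (cball 0 (B + e)) y)" by (rule L2_cmult[OF cball_L2])
  show "AE y in lebesgue. (%n. eta e (X n - y) - eta e (x - y)) ----> 0"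
  proof (rule AE_I2)
   fix y
   have "isCont (eta e) (x - y)" using eta_props(4)[OF e, where 'a='a] by (simp add: continuous_on_eq_continuous_at)
   then have "(%n. eta e (X n - y)) ----> eta e (x - y)"
    by (rule isCont_tendsto_compose) (intro tendsto_intros X)
   then show "(%n. eta e (X n - y) - eta e (x - y)) ----> 0" by (simp add: LIM_zero)
  qed
  show "AE y in lebesgue. \<bar>eta e (X n - y) - eta e (x - y)\<bar> <= \<bar>(2 * K) * indicator (cball 0 (B + e)) y\<bar>" for n
  proof (rule AE_I2)
   fix y
   show "\<bar>eta e (X n - y) - eta e (x - y)\<bar> <= \<bar>(2 * K) * indicator (cball 0 (B + e)) y\<bar>"
   proof (cases "norm y <= B + e")
    case True
    then show ?thesis using K[of "X n - y"] K[of "x - y"] K0 by simp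
   next
    case False
    have "norm y <= norm (X n - y) + norm (X n)" "norm y <= norm (x - y) + norm x" by norm+
    then have "e <= norm (X n - y)" "e <= norm (x - y)" using False B[of n] xB by linarith+
    then have "eta e (X n - y) = 0" "eta e (x - y) = 0" using eta_props(3)[OF e] by blast+
    then show ?thesis by simp
   qed
  qed
 qed
qed

text \<open>At each scale \<open>ep j\<close> the mollifications are equicontinuous, so a diagonal
  choice over scales and a dense countable set makes them converge everywhere, and in L2 on balls by
  domination. The energy bound keeps all functions uniformly close to their mollifications. Nothing
  controls the mass at infinity, hence the local form.\<close>

lemma rellich:
 fixes f :: "nat => 'a::euclidean_space => real"
 assumes H: "!!n. f n \<in> H1" and C: "!!n. nrm (f n) <= C" "!!n. en (f n) <= E"
 obtains r u where "strict_mono r" "L2 u" "AE x in lebesgue. (%n. f (r n) x) ----> u x"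
  "!!R::nat. (%n. nrm (%x. indicator (cball 0 (real R)) x * (f (r n) x - u x))) ----> 0"
proof -
 have L: "L2 (f n)" for n using H by (rule H1_L2)
 have C0: "0 <= C" using C(1)[of 0] nrm_nonneg[of "f 0"] by linarith
 obtain Q :: "'a set" where Q: "countable Q" "!!X. open X ==> X ~= {} ==> \<exists>d\<in>Q. d \<in> X"
  by (rule countable_dense_setE) blast
 define I where "I = (UNIV :: nat set) \<times> Q"
 have Ine: "I ~= {}" "countable I" using Q(2)[of UNIV] Q(1) by (auto simp: I_def)
 define g where "g = from_nat_into I"
 have rg: "range g = I" unfolding g_def using Ine by (simp add: range_from_nat_into)
 define ep where "ep j = 1 / real (Suc j)" for j
 have ep: "0 < ep j" for j by (simp add: ep_def)
 define X where "X i n = conv (ep (fst (g i))) (f n) (snd (g i))" for i n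
 have ipb: "\<bar>conv e (f n) x - conv e (f n) y\<bar> <= C * nrm (%z. eta e (x - z) - eta e (y - z))" if e: "0 < e" for e n x y
 proof -
  have "conv e (f n) x - conv e (f n) y = ip (%z. eta e (x - z) - eta e (y - z)) (f n)"
   unfolding conv_ip by (simp add: ip_diff_left eta_L2 e L ip_commute[of "f n"])
  also have "\<bar>...\<bar> <= nrm (%z. eta e (x - z) - eta e (y - z)) * nrm (f n)"
   by (intro cauchy_schwarz L2_diff eta_L2 e L)
  also have "... <= nrm (%z. eta e (x - z) - eta e (y - z)) * C" by (intro mult_left_mono C) simp
  finally show ?thesis by (simp add: mult.commute)
 qed
 have cb: "\<bar>conv e (f n) x\<bar> <= C * nrm (eta e :: 'a => real)" if e: "0 < e" for e n x
 proof -
  have "\<bar>conv e (f n) x\<bar> <= nrm (f n) * nrm (%y. eta e (x - y))" unfolding conv_ip by (intro cauchy_schwarz eta_L2 e L)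
  also have "... <= C * nrm (%y. eta e (x - y))" by (intro mult_right_mono C) simp
  finally show ?thesis using eta_reflect[OF e, of x] by (simp add: nrm_def)
 qed
 have "\<exists>B. \<forall>n. \<bar>X i n\<bar> <= B" for i unfolding X_def using cb[OF ep] by blast
 then obtain s where s: "strict_mono s" "!!i. convergent (%n. X i (s n))" using diag_real[of X] by blast
 have cq: "convergent (%n. conv (ep j) (f (s n)) q)" if "q \<in> Q" for j q
 proof -
  have "(j, q) \<in> range g" unfolding rg I_def using that by simp
  then obtain i where "g i = (j, q)" by (metis imageE)
  then show ?thesis using s(2)[of i] by (simp add: X_def)
 qed
 have cx: "convergent (%n. conv (ep j) (f (s n)) x)" for j x
 proof -
  have "Cauchy (%n. conv (ep j) (f (s n)) x)"
  proof (rule CauchyI)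
   fix e :: real assume e: "0 < e"
   have "\<exists>q\<in>Q. q \<in> ball x (1 / real (Suc n))" for n by (intro Q) auto
   then have "\<forall>n. \<exists>q. q \<in> Q & q \<in> ball x (1 / real (Suc n))" by blast
   from choice[OF this] obtain q where q: "!!n. q n \<in> Q" "!!n. q n \<in> ball x (1 / real (Suc n))" by blast
   have "q ----> x"
   proof (rule metric_tendsto_imp_tendsto[of "%n. 1 / real (Suc n)" 0])
    show "(%n. 1 / real (Suc n)) ----> 0" using LIMSEQ_inverse_real_of_nat by (simp add: inverse_eq_divide)
    show "\<forall>\<^sub>F n in sequentially. dist (q n) x <= dist (1 / real (Suc n)) 0"
     using q(2) by (intro always_eventually allI) (simp add: dist_commute less_imp_le)
   qed
   then have "(%n. C * nrm (%y. eta (ep j) (q n - y) - eta (ep j) (x - y))) ----> C * 0"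
    by (intro tendsto_mult tendsto_const eta_L2_continuous ep)
   then have "\<forall>\<^sub>F n in sequentially. C * nrm (%y. eta (ep j) (q n - y) - eta (ep j) (x - y)) < e/3"
    using e by (intro order_tendstoD(2)[of _ "C * 0"]) auto
   then obtain m where m: "C * nrm (%y. eta (ep j) (q m - y) - eta (ep j) (x - y)) < e/3"
    by (auto simp: eventually_sequentially)
   have qx: "\<bar>conv (ep j) (f n) (q m) - conv (ep j) (f n) x\<bar> < e/3" for n
    using ipb[OF ep, of j n "q m" x] m by linarith
   have "Cauchy (%n. conv (ep j) (f (s n)) (q m))" using cq[OF q(1)] by (simp add: Cauchy_convergent_iff)
   then obtain N where N: "!!a b. a \<ge> N ==> b \<ge> N ==> norm (conv (ep j) (f (s a)) (q m) - conv (ep j) (f (s b)) (q m)) < e/3"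
    using CauchyD[of "%n. conv (ep j) (f (s n)) (q m)" "e/3"] e by auto
   have "norm (conv (ep j) (f (s a)) x - conv (ep j) (f (s b)) x) < e" if "a \<ge> N" "b \<ge> N" for a b
    using N[OF that] qx[of "s a"] qx[of "s b"] by (simp add: abs_if split: if_splits)
   then show "\<exists>M. \<forall>m\<ge>M. \<forall>n\<ge>M. norm (conv (ep j) (f (s m)) x - conv (ep j) (f (s n)) x) < e" by blast
  qed
  then show ?thesis by (simp add: Cauchy_convergent_iff)
 qed
 define G where "G j x = lim (%n. conv (ep j) (f (s n)) x)" for j x
 have Gl: "(%n. conv (ep j) (f (s n)) x) ----> G j x" for j x
  using cx unfolding G_def by (simp add: convergent_LIMSEQ_iff)
 have cm: "conv (ep j) (f n) \<in> borel_measurable lebesgue" for j n by (rule L2_meas[OF conv_L2(1)[OF ep L]])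
 have Gm: "G j \<in> borel_measurable lebesgue" for j
  by (rule borel_measurable_LIMSEQ_real[OF Gl cm])
 have Gb: "\<bar>G j x\<bar> <= C * nrm (eta (ep j) :: 'a => real)" for j x
  by (rule Lim_bounded[OF tendsto_rabs[OF Gl]]) (use cb[OF ep] in auto)
 define B where "B R = cball (0::'a) (real R)" for R :: nat
 have dc: "(%n. nrm (%x. indicator (B R) x * (conv (ep j) (f (s n)) x - G j x))) ----> 0" for j R
 proof (rule dominated_nrm[where w="%x. (2 * (C * nrm (eta (ep j) :: 'a => real))) * indicator (B R) x"])
  show "(%x. indicator (B R) x * (conv (ep j) (f (s n)) x - G j x)) \<in> borel_measurable lebesgue" for n
   using cm[of j "s n"] Gm[of j]
   by (intro borel_measurable_times borel_measurable_diff borel_measurable_indicator) (auto simp: B_def)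
  show "L2 (%x. (2 * (C * nrm (eta (ep j) :: 'a => real))) * indicator (B R) x)"
   unfolding B_def by (rule L2_cmult[OF cball_L2])
  show "AE x in lebesgue. (%n. indicator (B R) x * (conv (ep j) (f (s n)) x - G j x)) ----> 0"
   by (intro AE_I2 tendsto_mult_right_zero LIM_zero Gl)
  show "AE x in lebesgue. \<bar>indicator (B R) x * (conv (ep j) (f (s n)) x - G j x)\<bar> <= \<bar>(2 * (C * nrm (eta (ep j) :: 'a => real))) * indicator (B R) x\<bar>" for n
  proof (rule AE_I2)
   fix x
   have "\<bar>conv (ep j) (f (s n)) x - G j x\<bar> <= 2 * (C * nrm (eta (ep j) :: 'a => real))"
    using cb[OF ep, of j "s n" x] Gb[of j x] by linarith
   then show "\<bar>indicator (B R) x * (conv (ep j) (f (s n)) x - G j x)\<bar> <= \<bar>(2 * (C * nrm (eta (ep j) :: 'a => real))) * indicator (B R) x\<bar>"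
    by (auto split: split_indicator)
  qed
 qed
 have imono: "nrm (%x. indicator (B R) x * w x) <= nrm w" if "L2 w" for w R
  unfolding nrm_def
  by (intro real_sqrt_le_mono nrm2_mono[OF that L2_meas[OF L2_indicator_mult[OF that]]]) (auto simp: B_def split: split_indicator)
 have GL: "L2 (%x. indicator (B R) x * G j x)" for R j
 proof (rule bounded_support_L2[of _ "C * nrm (eta (ep j) :: 'a => real)" "real R"])
  show "(%x. indicator (B R) x * G j x) \<in> borel_measurable lebesgue"
   using Gm[of j] by (intro borel_measurable_times borel_measurable_indicator) (auto simp: B_def)
  show "\<bar>indicator (B R) x * G j x\<bar> <= C * nrm (eta (ep j) :: 'a => real)" for x
   using Gb[of j x] C0 by (auto split: split_indicator)
 qed (simp add: B_def)
 \<comment> \<open>At a fine scale the mollification error is below e/8 for all members at once,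
   which reduces the claim to the mollifications on the ball.\<close>
 have cau: "\<exists>N. \<forall>m\<ge>N. \<forall>n\<ge>N. nrm (%x. indicator (B R) x * (f (s m) x - f (s n) x)) < e" if e: "0 < e" for R e
 proof -
  have "(%j. ep j * (DIM('a) * sqrt E)) ----> 0 * (DIM('a) * sqrt E)"
   unfolding ep_def using LIMSEQ_inverse_real_of_nat by (intro tendsto_mult tendsto_const) (simp add: inverse_eq_divide)
  then have "\<forall>\<^sub>F j in sequentially. ep j * (DIM('a) * sqrt E) < e/8" using e by (intro order_tendstoD(2)[of _ "0 * (DIM('a) * sqrt E)"]) auto
  then obtain j where j: "ep j * (DIM('a) * sqrt E) < e/8" by (auto simp: eventually_sequentially)
  have near: "nrm (%x. f n x - conv (ep j) (f n) x) < e/8" for n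
  proof -
   have "nrm (%x. conv (ep j) (f n) x - f n x) <= ep j * DIM('a) * sqrt (en (f n))" by (rule conv_H1_near[OF ep H])
   also have "... <= ep j * DIM('a) * sqrt E" using ep[of j] C(2)[of n] by (intro mult_left_mono) auto
   finally show ?thesis using j by (simp add: nrm_diff_commute[of "f n"] mult.assoc)
  qed
  have "\<forall>\<^sub>F n in sequentially. nrm (%x. indicator (B R) x * (conv (ep j) (f (s n)) x - G j x)) < e/8"
   using dc e by (intro order_tendstoD) auto
  then obtain N where N: "!!n. n \<ge> N ==> nrm (%x. indicator (B R) x * (conv (ep j) (f (s n)) x - G j x)) < e/8"
   by (auto simp: eventually_sequentially)
  have c1: "nrm (%x. indicator (B R) x * f (s n) x - indicator (B R) x * G j x) < e/4" if "n \<ge> N" for n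
  proof -
   have IL: "L2 (%x. indicator (B R) x * f (s n) x)" "L2 (%x. indicator (B R) x * conv (ep j) (f (s n)) x)"
    by (intro L2_indicator_mult L conv_L2 ep; simp add: B_def)+
   have "nrm (%x. indicator (B R) x * f (s n) x - indicator (B R) x * G j x)
    <= nrm (%x. indicator (B R) x * f (s n) x - indicator (B R) x * conv (ep j) (f (s n)) x)
     + nrm (%x. indicator (B R) x * conv (ep j) (f (s n)) x - indicator (B R) x * G j x)"
    by (intro nrm_triangle IL GL)
   also have "nrm (%x. indicator (B R) x * f (s n) x - indicator (B R) x * conv (ep j) (f (s n)) x) < e/8"
    using order.strict_trans1[OF imono[OF L2_diff[OF L conv_L2(1)[OF ep L]]] near[of "s n"], of R] by (simp add: right_diff_distrib)
   also have "nrm (%x. indicator (B R) x * conv (ep j) (f (s n)) x - indicator (B R) x * G j x) < e/8"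
    using N[OF that] by (simp add: right_diff_distrib)
   finally show ?thesis by simp
  qed
  have "nrm (%x. indicator (B R) x * (f (s m) x - f (s n) x)) < e" if "m \<ge> N" "n \<ge> N" for m n
  proof -
   have IL: "L2 (%x. indicator (B R) x * f (s n) x)" for n by (intro L2_indicator_mult L) (simp add: B_def)
   have "nrm (%x. indicator (B R) x * f (s m) x - indicator (B R) x * f (s n) x)
    <= nrm (%x. indicator (B R) x * f (s m) x - indicator (B R) x * G j x) + nrm (%x. indicator (B R) x * G j x - indicator (B R) x * f (s n) x)"
    by (intro nrm_triangle IL GL)
   also have "... < e" using c1[OF that(1)] c1[OF that(2)] e nrm_diff_commute[of "%x. indicator (B R) x * G j x" "%x. indicator (B R) x * f (s n) x"] by simp
   finally show ?thesis by (simp add: right_diff_distrib)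
  qed
  then show ?thesis by blast
 qed
 have nb: "nrm2 (f (s n)) <= C\<^sup>2" for n using power_mono[OF C(1)[of "s n"], of 2] by (simp add: nrm_sq)
 obtain r u where r: "strict_mono r" "L2 u" "AE x in lebesgue. (%n. f (s (r n)) x) ----> u x"
  "!!R. (%n. nrm (%x. indicator (B R) x * (f (s n) x - u x))) ----> 0"
 proof (rule L2loc_complete[of "%n. f (s n)" B "C\<^sup>2"])
  show "incseq B" by (auto simp: incseq_def B_def)
  show "(\<Union>n. B n) = UNIV"
  proof (intro equalityI subsetI)
   fix x :: 'a assume "x \<in> UNIV"
   obtain n :: nat where "norm x < real n" using reals_Archimedean2 by blast
   then show "x \<in> (\<Union>n. B n)" by (auto simp: B_def intro!: exI[of _ n])
  qed simp
 qed (use L nb cau in \<open>auto simp: B_def\<close>)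
 have sr: "strict_mono (s \<circ> r)" by (rule strict_mono_o[OF s(1) r(1)])
 have l: "(%n. nrm (%x. indicator (cball 0 (real R)) x * (f ((s \<circ> r) n) x - u x))) ----> 0" for R
  using LIMSEQ_subseq_LIMSEQ[OF r(4) r(1), of R] by (simp add: B_def o_def)
 show ?thesis
  by (rule that[OF sr r(2) _ l]) (use r(3) in simp)
qed

subsection \<open>Rayleigh bounds and quadratic forms\<close>

definition cmb :: "nat => (nat => real) => (nat => 'a => real) => 'a => real" where
 "cmb k c u x = (\<Sum>i<k. c i * u i x)"

definition indep :: "nat => (nat => 'a::euclidean_space => real) => bool" where
 "indep k u \<longleftrightarrow> (\<forall>c. (AE x in lebesgue. cmb k c u x = 0) --> (\<forall>i<k. c i = 0))"

definition rb :: "nat => real => (nat => 'a::euclidean_space => real) => bool" where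
 "rb k Lar u \<longleftrightarrow> (\<forall>i<k. u i \<in> H1) & indep k u & (\<forall>c. en (cmb k c u) <= Lar * nrm2 (cmb k c u))"

lemma cmb_H1: "(!!i. i < k ==> u i \<in> H1) ==> cmb k c u \<in> H1"
 unfolding cmb_def[abs_def] by (intro H1_sum) auto

lemma cmb_L2: "(!!i. i < k ==> L2 (u i)) ==> L2 (cmb k c u)"
 unfolding cmb_def[abs_def] by (intro L2_sum L2_cmult) auto

lemma cmb_H10: "(!!i. i < k ==> u i \<in> H10 Om) ==> cmb k c u \<in> H10 Om"
 unfolding cmb_def[abs_def] by (intro H10_sum) auto

lemma rb_H1: "rb k Lar u ==> i < k ==> u i \<in> H1"
 by (simp add: rb_def)

lemma rb_mono: "rb k Lar u ==> Lar <= Lar' ==> rb k Lar' u"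
 unfolding rb_def by (meson mult_right_mono nrm2_nonneg order_trans)

lemma cmb_diff: "cmb k c u x - cmb k d u x = cmb k (%i. c i - d i) u x"
 by (simp add: cmb_def left_diff_distrib sum_subtractf)

lemma nrm_cmb_le:
 assumes "!!i. i < k ==> L2 (u i)"
 shows "nrm (cmb k c u) <= (\<Sum>i<k. \<bar>c i\<bar> * nrm (u i))"
proof -
 have "nrm (%x. \<Sum>i<k. c i * u i x) <= (\<Sum>i<k. nrm (%x. c i * u i x))"
  using assms by (intro nrm_sum L2_cmult) auto
 then show ?thesis by (simp add: cmb_def[abs_def] nrm_cmult)
qed

lemma bounded_coeff_subseq:
 fixes c :: "nat => nat => real"
 assumes "!!n i. i < k ==> \<bar>c n i\<bar> <= B"
 obtains r d where "strict_mono (r :: nat => nat)" "!!i. i < k ==> (%n. c (r n) i) ----> d i"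
proof -
 have "\<exists>C. \<forall>n. \<bar>if i < k then c n i else 0\<bar> <= C" for i
  by (rule exI[of _ "\<bar>B\<bar>"]) (auto intro: order_trans[OF assms abs_ge_self])
 then obtain r :: "nat => nat" where r: "strict_mono r" "!!i. convergent (%n. if i < k then c (r n) i else 0)"
  by (rule diag_real[of "%i n. if i < k then c n i else 0"]) blast
 have "(%n. c (r n) i) ----> lim (%n. c (r n) i)" if "i < k" for i
  using r(2)[of i] that by (simp add: convergent_LIMSEQ_iff)
 then show ?thesis using that[OF r(1), of "%i. lim (%n. c (r n) i)"] by blast
qed

text \<open>Compactness in coefficient space: a sequence violating the bound, normalized in the l1
  norm, has a limit whose combination is zero although its coefficients still have l1 norm
  1.\<close>

lemma indep_coercive:
 assumes L: "!!i. i < k ==> L2 (u i)" and ind: "indep k u"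
 obtains ka where "0 < ka" "!!c. ka * (\<Sum>i<k. \<bar>c i\<bar>) <= nrm (cmb k c u)"
proof -
 have "\<exists>ka>0. \<forall>c. ka * (\<Sum>i<k. \<bar>c i\<bar>) <= nrm (cmb k c u)"
 proof (rule ccontr)
  assume "\<not> ?thesis"
  then have n: "\<not> (\<forall>c. ka * (\<Sum>i<k. \<bar>c i\<bar>) <= nrm (cmb k c u))" if "0 < ka" for ka using that by blast
  have "\<exists>c. nrm (cmb k c u) < (1 / Suc n) * (\<Sum>i<k. \<bar>c i\<bar>)" for n :: nat
   using n[of "1 / Suc n"] unfolding not_all not_le by simp
  then have "\<forall>n::nat. \<exists>c. nrm (cmb k c u) < (1 / Suc n) * (\<Sum>i<k. \<bar>c i\<bar>)" by blast
  from choice[OF this] obtain c where c: "!!n. nrm (cmb k (c n) u) < (1 / Suc n) * (\<Sum>i<k. \<bar>c n i\<bar>)" by blast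
  define s where "s n = (\<Sum>i<k. \<bar>c n i\<bar>)" for n
  have s0: "0 < s n" for n
  proof -
   have "0 < (1 / Suc n) * s n" using c[of n] nrm_nonneg[of "cmb k (c n) u"] unfolding s_def by linarith
   then show ?thesis by (simp add: zero_less_mult_iff zero_less_divide_iff)
  qed
  define d where "d n i = c n i / s n" for n i
  have ds: "(\<Sum>i<k. \<bar>d n i\<bar>) = 1" for n
   using s0[of n] by (simp add: d_def abs_divide sum_divide_distrib[symmetric] s_def[symmetric])
  have dn: "nrm (cmb k (d n) u) <= 1 / Suc n" for n
  proof -
   have "cmb k (d n) u = (%x. (1 / s n) * cmb k (c n) u x)"
    by (auto simp: cmb_def d_def sum_distrib_left)
   then have "nrm (cmb k (d n) u) = (1 / s n) * nrm (cmb k (c n) u)"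
    using s0[of n] by (simp only: nrm_cmult) simp
   also have "... <= (1 / s n) * ((1 / Suc n) * s n)"
    using c[of n] s0[of n] by (intro mult_left_mono) (auto simp: s_def)
   finally show ?thesis using s0[of n] by simp
  qed
  have db: "\<bar>d n i\<bar> <= 1" if "i < k" for n i
   using member_le_sum[of i "{..<k}" "%i. \<bar>d n i\<bar>"] ds[of n] that by simp
  obtain r e where r: "strict_mono (r :: nat => nat)" "!!i. i < k ==> (%n. d (r n) i) ----> e i"
   by (rule bounded_coeff_subseq[of k d 1]) (use db in auto)
  have eL: "L2 (cmb k c u)" for c by (rule cmb_L2[OF L])
  have "(%n. (\<Sum>i<k. \<bar>e i - d (r n) i\<bar> * nrm (u i)) + 1 / Suc (r n)) ----> (\<Sum>i<k. \<bar>e i - e i\<bar> * nrm (u i)) + 0"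
  proof (intro tendsto_add tendsto_sum tendsto_mult tendsto_rabs tendsto_diff tendsto_const)
   show "(%n. d (r n) i) ----> e i" if "i \<in> {..<k}" for i using r(2) that by simp
   show "(%n. 1 / real (Suc (r n))) ----> 0"
    using LIMSEQ_subseq_LIMSEQ[OF LIMSEQ_inverse_real_of_nat r(1)] by (simp add: inverse_eq_divide o_def)
  qed
  moreover have "nrm (cmb k e u) <= (\<Sum>i<k. \<bar>e i - d (r n) i\<bar> * nrm (u i)) + 1 / Suc (r n)" for n
  proof -
   have "nrm (%x. (cmb k e u x - cmb k (d (r n)) u x) + cmb k (d (r n)) u x)
    <= nrm (%x. cmb k e u x - cmb k (d (r n)) u x) + nrm (cmb k (d (r n)) u)"
    by (intro nrm_add L2_diff eL)
   also have "nrm (%x. cmb k e u x - cmb k (d (r n)) u x) <= (\<Sum>i<k. \<bar>e i - d (r n) i\<bar> * nrm (u i))"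
    unfolding cmb_diff using nrm_cmb_le[OF L, of k] by simp
   finally show ?thesis using dn[of "r n"] by simp
  qed
  ultimately have "nrm (cmb k e u) <= 0" by (intro LIMSEQ_le_const) auto
  then have "nrm2 (cmb k e u) = 0" using nrm_sq[of "cmb k e u"] nrm_nonneg by (metis antisym power_zero_numeral)
  then have "AE x in lebesgue. cmb k e u x = 0" using nrm2_eq_0[OF eL] by simp
  then have e0: "e i = 0" if "i < k" for i using ind that unfolding indep_def by blast
  have "(%n. \<Sum>i<k. \<bar>d (r n) i\<bar>) ----> (\<Sum>i<k. \<bar>e i\<bar>)"
   by (intro tendsto_sum tendsto_rabs r(2)) simp
  then have "(\<Sum>i<k. \<bar>e i\<bar>) = 1" unfolding ds by (simp add: LIMSEQ_const_iff)
  then show False using e0 by simp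
 qed
 then show ?thesis using that by blast
qed

text \<open>Errors proportional to the l1 norm of the coefficients are, by coercivity, a small
  multiple of the L2 norm of the combination; the gap between Lar and Lar' absorbs them uniformly in
  c.\<close>

lemma rb_perturb:
 fixes u :: "nat => 'a::euclidean_space => real" and v :: "nat => nat => 'a => real"
 assumes u: "rb k Lar u" and l: "0 <= Lar" "Lar < Lar'" and v: "!!n i. i < k ==> v n i \<in> H1"
  and e: "e ----> 0"
  and en: "!!n c. sqrt (en (cmb k c (v n))) <= sqrt (en (cmb k c u)) + e n * (\<Sum>i<k. \<bar>c i\<bar>)"
  and nr: "!!n c. nrm (cmb k c u) - e n * (\<Sum>i<k. \<bar>c i\<bar>) <= nrm (cmb k c (v n))"
 shows "\<forall>\<^sub>F n in sequentially. rb k Lar' (v n)"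
proof -
 have uL: "L2 (u i)" if "i < k" for i using rb_H1[OF u that] by (rule H1_L2)
 obtain ka where k: "0 < ka" "!!c. ka * (\<Sum>i<k. \<bar>c i\<bar>) <= nrm (cmb k c u)"
  by (rule indep_coercive[of k u]) (use uL u in \<open>auto simp: rb_def\<close>)
 have "(%n. sqrt Lar' * (1 - \<bar>e n\<bar> / ka) - (sqrt Lar + \<bar>e n\<bar> / ka)) ----> sqrt Lar' * (1 - \<bar>0\<bar> / ka) - (sqrt Lar + \<bar>0\<bar> / ka)"
  using k(1) by (intro tendsto_intros e) auto
 moreover have "0 < sqrt Lar' * (1 - \<bar>0\<bar> / ka) - (sqrt Lar + \<bar>0\<bar> / ka)" using l by simp
 ultimately have ev1: "\<forall>\<^sub>F n in sequentially. 0 < sqrt Lar' * (1 - \<bar>e n\<bar> / ka) - (sqrt Lar + \<bar>e n\<bar> / ka)"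
  by (rule order_tendstoD)
 have "(%n. 1 - \<bar>e n\<bar> / ka) ----> 1 - \<bar>0\<bar> / ka" using k(1) by (intro tendsto_intros e) auto
 then have ev2: "\<forall>\<^sub>F n in sequentially. 0 < 1 - \<bar>e n\<bar> / ka" by (rule order_tendstoD) simp
 from ev1 ev2 show ?thesis
 proof eventually_elim
  case (elim n)
  define epsr where "epsr = \<bar>e n\<bar> / ka"
  have eps: "e n * (\<Sum>i<k. \<bar>c i\<bar>) <= epsr * nrm (cmb k c u)" for c
  proof -
   have "e n * (\<Sum>i<k. \<bar>c i\<bar>) <= \<bar>e n\<bar> * (\<Sum>i<k. \<bar>c i\<bar>)" by (intro mult_right_mono) (auto intro: sum_nonneg)
   also have "... = epsr * (ka * (\<Sum>i<k. \<bar>c i\<bar>))" using k(1) by (simp add: epsr_def)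
   also have "... <= epsr * nrm (cmb k c u)" using k(1) by (intro mult_left_mono k(2)) (simp add: epsr_def)
   finally show ?thesis .
  qed
  have lo: "(1 - epsr) * nrm (cmb k c u) <= nrm (cmb k c (v n))" for c
   using nr[of c n] eps[of c] by (simp add: left_diff_distrib)
  have up: "sqrt (en (cmb k c (v n))) <= (sqrt Lar + epsr) * nrm (cmb k c u)" for c
  proof -
   have "en (cmb k c u) <= Lar * nrm2 (cmb k c u)" using u by (simp add: rb_def)
   then have "sqrt (en (cmb k c u)) <= sqrt Lar * nrm (cmb k c u)"
    unfolding nrm_def real_sqrt_mult[symmetric] by (rule real_sqrt_le_mono)
   then show ?thesis using en[of c n] eps[of c] by (simp add: distrib_right)
  qed
  have vH: "cmb k c (v n) \<in> H1" for c by (rule cmb_H1[OF v])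
  show ?case
   unfolding rb_def
  proof (intro conjI allI impI)
   show "v n i \<in> H1" if "i < k" for i by (rule v[OF that])
   show "indep k (v n)"
    unfolding indep_def
   proof (intro allI impI)
    fix c i assume z: "AE x in lebesgue. cmb k c (v n) x = 0" and i: "i < k"
    have "nrm (cmb k c (v n)) = 0" using z nrm2_eq_0[OF H1_L2[OF vH]] by (simp add: nrm_def)
    then have "(1 - epsr) * nrm (cmb k c u) <= 0" using lo[of c] by simp
    then have "nrm (cmb k c u) <= 0" using elim(2) by (simp add: epsr_def mult_le_0_iff)
    then have "nrm2 (cmb k c u) = 0" using nrm_sq[of "cmb k c u"] nrm_nonneg by (metis antisym power_zero_numeral)
    then have "AE x in lebesgue. cmb k c u x = 0" using nrm2_eq_0[OF cmb_L2[OF uL]] by simp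
    then show "c i = 0" using u i unfolding rb_def indep_def by blast
   qed
   fix c
   have "sqrt (en (cmb k c (v n))) <= (sqrt Lar + epsr) * nrm (cmb k c u)" by (rule up)
   also have "... <= (sqrt Lar' * (1 - epsr)) * nrm (cmb k c u)"
    using elim(1) by (intro mult_right_mono) (auto simp: epsr_def)
   also have "... = sqrt Lar' * ((1 - epsr) * nrm (cmb k c u))" by simp
   also have "... <= sqrt Lar' * nrm (cmb k c (v n))" using l by (intro mult_left_mono lo) auto
   finally have "(sqrt (en (cmb k c (v n))))\<^sup>2 <= (sqrt Lar' * nrm (cmb k c (v n)))\<^sup>2" by (intro power_mono) auto
   then show "en (cmb k c (v n)) <= Lar' * nrm2 (cmb k c (v n))" using l by (simp add: power_mult_distrib nrm_sq)
  qed
 qed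
qed

section \<open>Linear algebra in coefficient space\<close>

definition lin :: "nat => (nat => real) => (nat => nat => real) => nat => real" where
 "lin k d v j = (\<Sum>i<k. d i * v i j)"

text \<open>Linear independence of k vectors in R^K. Vectors are functions on \<open>nat\<close> of
  which only the entries below K matter.\<close>

definition lind :: "nat => nat => (nat => nat => real) => bool" where
 "lind K k v \<longleftrightarrow> (\<forall>d. (\<forall>j<K. lin k d v j = 0) --> (\<forall>i<k. d i = 0))"

definition Bf :: "nat => (nat => nat => real) => (nat => real) => (nat => real) => real" where
 "Bf K B c d = (\<Sum>i<K. \<Sum>j<K. c i * d j * B i j)"

lemma cmb_lin: "cmb k d (%i. cmb K (w i) u) = cmb K (lin k d w) u"
proof
 fix x
 have "cmb k d (%i. cmb K (w i) u) x = (\<Sum>i<k. \<Sum>j<K. d i * w i j * u j x)"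
  by (simp add: cmb_def sum_distrib_left mult.assoc)
 also have "... = (\<Sum>j<K. \<Sum>i<k. d i * w i j * u j x)" by (rule sum.swap)
 finally show "cmb k d (%i. cmb K (w i) u) x = cmb K (lin k d w) u x"
  by (simp add: cmb_def lin_def sum_distrib_right)
qed

lemma Bf_lin_left: "Bf K B (lin k d v) c = (\<Sum>i<k. d i * Bf K B (v i) c)"
proof -
 have "Bf K B (lin k d v) c = (\<Sum>i<K. \<Sum>j<K. \<Sum>l<k. d l * v l i * c j * B i j)"
  by (simp add: Bf_def lin_def sum_distrib_right)
 also have "... = (\<Sum>i<K. \<Sum>l<k. \<Sum>j<K. d l * v l i * c j * B i j)"
  by (rule sum.cong[OF refl], rule sum.swap)
 also have "... = (\<Sum>l<k. \<Sum>i<K. \<Sum>j<K. d l * v l i * c j * B i j)" by (rule sum.swap)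
 finally show ?thesis by (simp add: Bf_def sum_distrib_left mult.assoc)
qed

lemma Bf_commute:
 assumes "!!i j. B i j = B j i" shows "Bf K B c d = Bf K B d c"
 unfolding Bf_def by (subst sum.swap, intro sum.cong refl) (simp add: assms[of _ _] mult.commute mult.left_commute)

lemma Bf_cong: "(!!j. j < K ==> c j = c' j) ==> Bf K B c d = Bf K B c' d"
 unfolding Bf_def by (intro sum.cong refl) auto

lemma Bf_sub: "Bf K B (%j. a j - t * b j) d = Bf K B a d - t * Bf K B b d"
 unfolding Bf_def by (simp add: left_diff_distrib sum_subtractf sum_distrib_left mult.assoc)

lemma Bf_add2: "Bf K B (%j. t * a j + b j) d = t * Bf K B a d + Bf K B b d"
 unfolding Bf_def by (simp add: distrib_right sum.distrib sum_distrib_left mult.assoc)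

lemma lin_Suc: "lin (Suc k) d (case_nat x w) j = d 0 * x j + lin k (%i. d (Suc i)) w j"
 unfolding lin_def by (simp only: sum.lessThan_Suc_shift) simp

text \<open>The exchange step of both orthogonalizations below. A relation among the reduced vectors
  is a relation among all k + 1; its last coefficient is -\<open>ga\<close> times the nonzero number
  \<open>d0 k\<close>, so the weight \<open>ga\<close> of x vanishes, and the rest follows.\<close>

lemma lind_reduce:
 assumes v: "lind K (Suc k) v" and x: "!!j. x j = lin (Suc k) d0 v j" and nz: "d0 k ~= 0"
 shows "lind K k (%i j. v i j - a i * x j)"
 unfolding lind_def
proof (intro allI impI)
 fix d i assume z: "\<forall>j<K. lin k d (%i j. v i j - a i * x j) j = 0" and i: "i < k"
 define ga where "ga = (\<Sum>i<k. d i * a i)"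
 define e where "e i = (if i < k then d i else 0) - ga * d0 i" for i
 have "lin (Suc k) e v j = 0" if j: "j < K" for j
 proof -
  have "lin k d (%i j. v i j - a i * x j) j = lin k d v j - ga * x j"
   by (simp add: lin_def ga_def right_diff_distrib sum_subtractf sum_distrib_right mult.assoc)
  moreover have "lin (Suc k) e v j = lin k d v j - ga * x j"
   by (simp add: lin_def e_def x left_diff_distrib sum_subtractf sum_distrib_left distrib_left mult.assoc)
  ultimately show ?thesis using z j by simp
 qed
 then have e0: "e i = 0" if "i < Suc k" for i using v that unfolding lind_def by blast
 have "ga = 0" using e0[of k] nz by (simp add: e_def)
 then show "d i = 0" using e0[of i] i by (simp add: e_def)
qed

lemma lind_extend:
 assumes w: "lind K k w" and q: "Bf K B x x ~= 0" and o: "!!i. i < k ==> Bf K B (w i) x = 0"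
 shows "lind K (Suc k) (case_nat x w)"
 unfolding lind_def
proof (intro allI impI)
 fix d i assume z: "\<forall>j<K. lin (Suc k) d (case_nat x w) j = 0" and i: "i < Suc k"
 have "Bf K B (lin (Suc k) d (case_nat x w)) x = Bf K B (%j. 0) x" using z by (intro Bf_cong) auto
 also have "... = 0" by (simp add: Bf_def)
 finally have "d 0 * Bf K B x x = 0"
  unfolding Bf_lin_left by (simp only: sum.lessThan_Suc_shift) (simp add: o)
 then have d0: "d 0 = 0" using q by simp
 then have "\<forall>j<K. lin k (%i. d (Suc i)) w j = 0" using z by (simp add: lin_Suc)
 then have "!!i. i < k ==> d (Suc i) = 0" using w unfolding lind_def by blast
 then show "d i = 0" using d0 i by (cases i) auto
qed

lemma lind_swap:
 assumes v: "lind K k v" and p: "p permutes {..<k}" shows "lind K k (v \<circ> p)"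
 unfolding lind_def
proof (intro allI impI)
 fix d i assume z: "\<forall>j<K. lin k d (v \<circ> p) j = 0" and i: "i < k"
 have ip: "inv p permutes {..<k}" using p by (rule permutes_inv)
 have "lin k (d \<circ> inv p) v j = lin k d (v \<circ> p) j" for j
 proof -
  have "lin k (d \<circ> inv p) v j = (\<Sum>i<k. ((%i. (d \<circ> inv p) i * v i j) \<circ> p) i)"
   unfolding lin_def by (rule sum.permute[OF p])
  then show ?thesis by (simp add: lin_def permutes_inverses(2)[OF p])
 qed
 then have "\<forall>j<K. lin k (d \<circ> inv p) v j = 0" using z by simp
 then have "\<forall>i<k. (d \<circ> inv p) i = 0" using v unfolding lind_def by blast
 moreover have "p i < k" using permutes_in_image[OF p, of i] i by simp
 ultimately have "(d \<circ> inv p) (p i) = 0" by blast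
 then show "d i = 0" by (simp add: permutes_inverses(2)[OF p])
qed

text \<open>Sylvester's splitting by induction: a vector x on which the form is negative is split
  off, and the others are made orthogonal to it. The last conjunct is the invariant of the
  induction: vectors orthogonal to the given family stay orthogonal to the new one, so x is
  orthogonal to everything the induction hypothesis delivers.\<close>

lemma inertia:
 fixes B :: "nat => nat => real" and v :: "nat => nat => real"
 assumes sym: "!!i j. B i j = B j i" and v: "lind K k v"
 shows "\<exists>w p. p <= k & lind K k w &
  (\<forall>d. (\<forall>i<k. p <= i --> d i = 0) --> (\<exists>i<p. d i ~= 0) --> Bf K B (lin k d w) (lin k d w) < 0) &
  (\<forall>d. (\<forall>i<p. d i = 0) --> 0 <= Bf K B (lin k d w) (lin k d w)) &
  (\<forall>y. (\<forall>i<k. Bf K B (v i) y = 0) --> (\<forall>i<k. Bf K B (w i) y = 0))"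
proof -
 have comm: "Bf K B c d = Bf K B d c" for c d by (rule Bf_commute) (rule sym)
 show ?thesis
 using v
proof (induction k arbitrary: v)
 case 0
 then show ?case by (intro exI[of _ v] exI[of _ 0]) (auto simp: lin_def Bf_def)
next
 case (Suc k v)
 show ?case
 proof (cases "\<forall>d. 0 <= Bf K B (lin (Suc k) d v) (lin (Suc k) d v)")
  case True
  then show ?thesis using Suc.prems by (intro exI[of _ v] exI[of _ 0]) auto
 next
  case False
  then obtain d0 where d0: "Bf K B (lin (Suc k) d0 v) (lin (Suc k) d0 v) < 0" by (auto simp: not_le)
  have "\<exists>q<Suc k. d0 q ~= 0"
  proof (rule ccontr)
   assume "\<not> ?thesis"
   then have "lin (Suc k) d0 v = (%j. 0)" by (auto simp: lin_def)
   then show False using d0 by (simp add: Bf_def)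
  qed
  then obtain q where q: "q < Suc k" "d0 q ~= 0" by blast
  \<comment> \<open>A transposition moves an index with nonzero coefficient to the last place, as
    the exchange step requires.\<close>
  define p0 where "p0 = Transposition.transpose q k"
  have p0: "p0 permutes {..<Suc k}" unfolding p0_def using q by (intro permutes_swap_id) auto
  define v1 where "v1 = v \<circ> p0"
  define d1 where "d1 = d0 \<circ> p0"
  have v1: "lind K (Suc k) v1" unfolding v1_def by (rule lind_swap[OF Suc.prems p0])
  define x where "x = lin (Suc k) d0 v"
  have x1: "x j = lin (Suc k) d1 v1 j" for j
   unfolding x_def lin_def by (subst sum.permute[OF p0]) (simp add: d1_def v1_def)
  have d1: "d1 k ~= 0" using q by (simp add: d1_def p0_def)
  have Q: "Bf K B x x < 0" using d0 by (simp add: x_def)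
  define a where "a i = Bf K B (v1 i) x / Bf K B x x" for i
  define v2 where "v2 i j = v1 i j - a i * x j" for i j
  have v2: "lind K k v2" unfolding v2_def[abs_def] by (rule lind_reduce[OF v1 x1 d1])
  have v2x: "Bf K B (v2 i) x = 0" for i
  proof -
   have "Bf K B (v2 i) x = Bf K B (v1 i) x - a i * Bf K B x x" unfolding v2_def[abs_def] by (rule Bf_sub)
   then show ?thesis using Q by (simp add: a_def)
  qed
  obtain w p where w: "p <= k" "lind K k w"
   "!!d. (\<forall>i<k. p <= i --> d i = 0) ==> (\<exists>i<p. d i ~= 0) ==> Bf K B (lin k d w) (lin k d w) < 0"
   "!!d. (\<forall>i<p. d i = 0) ==> 0 <= Bf K B (lin k d w) (lin k d w)"
   "!!y. (\<forall>i<k. Bf K B (v2 i) y = 0) ==> (\<forall>i<k. Bf K B (w i) y = 0)"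
   using Suc.IH[OF v2] by auto
  have wx: "Bf K B (w i) x = 0" if "i < k" for i using w(5)[of x] v2x that by blast
  let ?w = "case_nat x w"
  have split: "Bf K B (lin (Suc k) d ?w) (lin (Suc k) d ?w)
    = (d 0)\<^sup>2 * Bf K B x x + Bf K B (lin k (%i. d (Suc i)) w) (lin k (%i. d (Suc i)) w)" for d
  proof -
   let ?l = "lin k (%i. d (Suc i)) w"
   have e: "lin (Suc k) d ?w = (%j. d 0 * x j + ?l j)" by (auto simp: lin_Suc)
   have lx: "Bf K B ?l x = 0" unfolding Bf_lin_left using wx by simp
   have xl: "Bf K B x ?l = 0" using lx comm by metis
   have "Bf K B (%j. d 0 * x j + ?l j) y = d 0 * Bf K B x y + Bf K B ?l y" for y by (rule Bf_add2)
   moreover have "Bf K B x (%j. d 0 * x j + ?l j) = d 0 * Bf K B x x"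
    using Bf_add2[of K B "d 0" x ?l x] lx comm[of x "%j. d 0 * x j + ?l j"] by simp
   moreover have "Bf K B ?l (%j. d 0 * x j + ?l j) = Bf K B ?l ?l"
    using Bf_add2[of K B "d 0" x ?l ?l] xl comm[of ?l "%j. d 0 * x j + ?l j"] by simp
   ultimately show ?thesis unfolding e by (simp add: power2_eq_square)
  qed
  show ?thesis
  proof (intro exI[of _ ?w] exI[of _ "Suc p"] conjI allI impI)
   show "Suc p <= Suc k" using w(1) by simp
   show "lind K (Suc k) ?w" using lind_extend[OF w(2) _ wx] Q by simp
  next
   fix d assume d: "\<forall>i<Suc k. Suc p <= i --> d i = 0" "\<exists>i<Suc p. d i ~= (0::real)"
   have dd: "\<forall>i<k. p <= i --> d (Suc i) = 0" using d(1) by auto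
   show "Bf K B (lin (Suc k) d ?w) (lin (Suc k) d ?w) < 0"
   proof (cases "\<exists>i<p. d (Suc i) ~= 0")
    case True
    then have "Bf K B (lin k (%i. d (Suc i)) w) (lin k (%i. d (Suc i)) w) < 0" using w(3)[OF dd] by blast
    moreover have "(d 0)\<^sup>2 * Bf K B x x <= 0" using Q by (intro mult_nonneg_nonpos) auto
    ultimately show ?thesis unfolding split by simp
   next
    case False
    then have z: "d (Suc i) = 0" if "i < k" for i using dd that by (cases "i < p") auto
    have "d 0 ~= 0"
    proof
     assume "d 0 = 0"
     moreover obtain i where "i < Suc p" "d i ~= 0" using d(2) by blast
     ultimately show False using False by (cases i) auto
    qed
    then have "(d 0)\<^sup>2 * Bf K B x x < 0" using Q by (intro mult_pos_neg) auto
    moreover have "lin k (%i. d (Suc i)) w = (%j. 0)" using z by (auto simp: lin_def)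
    ultimately show ?thesis unfolding split by (simp add: Bf_def)
   qed
  next
   fix d assume d: "\<forall>i<Suc p. d i = (0::real)"
   then have "0 <= Bf K B (lin k (%i. d (Suc i)) w) (lin k (%i. d (Suc i)) w)" by (intro w(4)) auto
   then show "0 <= Bf K B (lin (Suc k) d ?w) (lin (Suc k) d ?w)" unfolding split using d by simp
  next
   fix y i assume y: "\<forall>i<Suc k. Bf K B (v i) y = 0" and i: "i < Suc k"
   have xy: "Bf K B x y = 0" unfolding x_def Bf_lin_left using y by simp
   have "Bf K B (v2 l) y = 0" if "l < k" for l
   proof -
    have "p0 l < Suc k" using permutes_in_image[OF p0, of l] that by simp
    then show ?thesis using y xy by (simp add: v2_def[abs_def] Bf_sub v1_def)
   qed
   then have "\<forall>i<k. Bf K B (w i) y = 0" by (intro w(5)) auto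
   then show "Bf K B (?w i) y = 0" using xy i by (cases i) auto
  qed
 qed
qed
qed

text \<open>Gram-Schmidt, with the same invariant about orthogonality as in
  \<open>inertia\<close>.\<close>

lemma orthonormal:
 fixes B :: "nat => nat => real" and v :: "nat => nat => real"
 assumes sym: "!!i j. B i j = B j i" and pos: "!!c. (\<exists>j<K. c j ~= 0) ==> 0 < Bf K B c c" and v: "lind K k v"
 shows "\<exists>w. lind K k w & (\<forall>i<k. \<forall>j<k. Bf K B (w i) (w j) = (if i = j then 1 else 0)) &
  (\<forall>y. (\<forall>i<k. Bf K B (v i) y = 0) --> (\<forall>i<k. Bf K B (w i) y = 0))"
proof -
 have comm: "Bf K B c d = Bf K B d c" for c d by (rule Bf_commute) (rule sym)
 show ?thesis
 using v
proof (induction k arbitrary: v)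
 case 0
 then show ?case by auto
next
 case (Suc k v)
 define d00 :: "nat => real" where "d00 i = (if i = k then 1 else 0)" for i
 have vk: "lin (Suc k) d00 v j = v k j" for j by (simp add: lin_def d00_def)
 have "\<exists>j<K. v k j ~= 0"
 proof (rule ccontr)
  assume "\<not> ?thesis"
  then have "\<forall>j<K. lin (Suc k) d00 v j = 0" by (simp add: vk)
  then have "d00 k = 0" using Suc.prems unfolding lind_def by blast
  then show False by (simp add: d00_def)
 qed
 then have qp: "0 < Bf K B (v k) (v k)" by (rule pos)
 define s where "s = sqrt (Bf K B (v k) (v k))"
 have s: "0 < s" "s * s = Bf K B (v k) (v k)" using qp by (auto simp: s_def)
 define x where "x j = (1/s) * v k j" for j
 have xB: "Bf K B x y = (1/s) * Bf K B (v k) y" for y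
  using Bf_add2[of K B "1/s" "v k" "%j. 0" y] by (simp add: x_def[abs_def] Bf_def)
 have xx: "Bf K B x x = 1"
 proof -
  have "Bf K B (v k) x = (1/s) * Bf K B (v k) (v k)" using xB[of "v k"] comm[of "v k" x] by simp
  then show ?thesis using xB[of x] s(1) unfolding s(2)[symmetric] by simp
 qed
 define d0 where "d0 i = (1/s) * d00 i" for i
 have x1: "x j = lin (Suc k) d0 v j" for j
  by (simp add: x_def d0_def lin_def d00_def)
 have d0: "d0 k ~= 0" using s by (simp add: d0_def d00_def)
 define v2 where "v2 i j = v i j - Bf K B (v i) x * x j" for i j
 have v2: "lind K k v2" unfolding v2_def[abs_def] by (rule lind_reduce[OF Suc.prems x1 d0])
 have v2x: "Bf K B (v2 i) x = 0" for i by (simp add: v2_def[abs_def] Bf_sub xx)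
 obtain w where w: "lind K k w" "!!i j. i < k ==> j < k ==> Bf K B (w i) (w j) = (if i = j then 1 else 0)"
  "!!y. (\<forall>i<k. Bf K B (v2 i) y = 0) ==> (\<forall>i<k. Bf K B (w i) y = 0)"
  using Suc.IH[OF v2] by auto
 have wx: "Bf K B (w i) x = 0" if "i < k" for i using w(3)[of x] v2x that by blast
 have xw: "Bf K B x (w i) = 0" if "i < k" for i using wx[OF that] comm[of x "w i"] by simp
 show ?case
 proof (intro exI[of _ "case_nat x w"] conjI allI impI)
  show "lind K (Suc k) (case_nat x w)" using lind_extend[OF w(1) _ wx] xx by simp
  show "Bf K B (case_nat x w i) (case_nat x w j) = (if i = j then 1 else 0)" if "i < Suc k" "j < Suc k" for i j
   using that xx wx xw w(2) by (cases i; cases j) auto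
  show "Bf K B (case_nat x w i) y = 0" if y: "\<forall>i<Suc k. Bf K B (v i) y = 0" and i: "i < Suc k" for y i
  proof -
   have xy: "Bf K B x y = 0" using xB[of y] y by simp
   have "\<forall>i<k. Bf K B (v2 i) y = 0" using y xy by (simp add: v2_def[abs_def] Bf_sub)
   then have "\<forall>i<k. Bf K B (w i) y = 0" by (rule w(3))
   then show ?thesis using xy i by (cases i) auto
  qed
 qed
qed
qed

definition unitv :: "nat => nat => real" where "unitv i j = (if i = j then 1 else 0)"

lemma lin_unitv: "j < k ==> lin k d unitv j = d j"
 by (simp add: lin_def unitv_def if_distrib cong: if_cong)

lemma lind_unitv: "lind k k unitv"
 unfolding lind_def by (simp add: lin_unitv)

lemma nrm2_cmb:
 assumes "!!i. i < k ==> L2 (u i)"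
 shows "nrm2 (cmb k c u) = Bf k (%i j. ip (u i) (u j)) c c"
 unfolding cmb_def[abs_def] Bf_def using assms by (intro nrm2_sum) auto

lemma en_cmb:
 assumes "!!i. i < k ==> u i \<in> H1"
 shows "en (cmb k c u) = Bf k (%i j. eb (u i) (u j)) c c"
 unfolding cmb_def[abs_def] Bf_def using assms by (intro H1_sum) auto

lemma indep_lind:
 assumes "indep K u" "lind K k w" shows "indep k (%i. cmb K (w i) u)"
 using assms unfolding indep_def lind_def cmb_lin by blast

lemma rb_lind:
 assumes "rb K Lar u" "lind K k w" shows "rb k Lar (%i. cmb K (w i) u)"
 using assms indep_lind[of K u k w] unfolding rb_def cmb_lin by (auto intro: cmb_H1)

lemma gram_schmidt_L2:
 assumes L: "!!i. i < k ==> L2 (u i)" and ind: "indep k u"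
 obtains w where "lind k k w" "!!c. nrm2 (cmb k c (%i. cmb k (w i) u)) = (\<Sum>i<k. (c i)\<^sup>2)"
proof -
 let ?B = "%i j. ip (u i) (u j)"
 have pos: "0 < Bf k ?B c c" if "\<exists>j<k. c j ~= 0" for c
 proof -
  have "nrm2 (cmb k c u) ~= 0"
  proof
   assume "nrm2 (cmb k c u) = 0"
   then have "AE x in lebesgue. cmb k c u x = 0" using nrm2_eq_0[OF cmb_L2[OF L]] by simp
   then show False using ind that unfolding indep_def by blast
  qed
  moreover have "nrm2 (cmb k c u) = Bf k ?B c c" by (rule nrm2_cmb[OF L])
  ultimately show ?thesis using nrm2_nonneg[of "cmb k c u"] by linarith
 qed
 have "\<exists>w. lind k k w & (\<forall>i<k. \<forall>j<k. Bf k ?B (w i) (w j) = (if i = j then 1 else 0)) &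
  (\<forall>y. (\<forall>i<k. Bf k ?B (unitv i) y = 0) --> (\<forall>i<k. Bf k ?B (w i) y = 0))"
  by (rule orthonormal, rule ip_commute, erule pos, rule lind_unitv)
 then obtain w where w: "lind k k w" "!!i j. i < k ==> j < k ==> Bf k ?B (w i) (w j) = (if i = j then 1 else 0)"
  by auto
 have "nrm2 (cmb k c (%i. cmb k (w i) u)) = (\<Sum>i<k. (c i)\<^sup>2)" for c
 proof -
  have s: "ip (u i) (u j) = ip (u j) (u i)" for i j by (rule ip_commute)
  have "nrm2 (cmb k c (%i. cmb k (w i) u)) = Bf k ?B (lin k c w) (lin k c w)" unfolding cmb_lin by (rule nrm2_cmb[OF L])
  also have "... = (\<Sum>i<k. c i * Bf k ?B (lin k c w) (w i))"
   unfolding Bf_lin_left[of k ?B k c w "lin k c w"] using Bf_commute[of ?B k, OF s] by simp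
  also have "... = (\<Sum>i<k. c i * (\<Sum>j<k. c j * (if j = i then 1 else 0)))"
   unfolding Bf_lin_left using w(2) by (intro sum.cong refl) auto
  also have "... = (\<Sum>i<k. (c i)\<^sup>2)" by (intro sum.cong refl) (simp add: power2_eq_square if_distrib cong: if_cong)
  finally show ?thesis .
 qed
 then show ?thesis using that[OF w(1)] by blast
qed

lemma rellich_tuple:
 fixes f :: "nat => nat => 'a::euclidean_space => real"
 assumes "!!n i. i < k ==> f n i \<in> H1" "!!n i. i < k ==> nrm (f n i) <= C" "!!n i. i < k ==> en (f n i) <= E"
 shows "\<exists>r u. strict_mono (r :: nat => nat) & (\<forall>i<k. L2 (u i) & (AE x in lebesgue. (%n. f (r n) i x) ----> u i x) &
  (\<forall>R::nat. (%n. nrm (%x. indicator (cball 0 (real R)) x * (f (r n) i x - u i x))) ----> 0))"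
 using assms
proof (induction k)
 case 0
 then show ?case by (intro exI[of _ id]) (auto simp: strict_mono_def)
next
 case (Suc k)
 have "\<exists>r u. strict_mono (r :: nat => nat) & (\<forall>i<k. L2 (u i) & (AE x in lebesgue. (%n. f (r n) i x) ----> u i x) &
  (\<forall>R::nat. (%n. nrm (%x. indicator (cball 0 (real R)) x * (f (r n) i x - u i x))) ----> 0))"
  by (rule Suc.IH) (use Suc.prems in \<open>simp_all add: less_SucI\<close>)
 then obtain r u where r: "strict_mono (r :: nat => nat)"
  and u: "!!i. i < k ==> L2 (u i)" "!!i. i < k ==> AE x in lebesgue. (%n. f (r n) i x) ----> u i x"
   "!!i R. i < k ==> (%n. nrm (%x. indicator (cball 0 (real R)) x * (f (r n) i x - u i x))) ----> 0"
  by auto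
 obtain s g where s: "strict_mono s" "L2 g" "AE x in lebesgue. (%n. f (r (s n)) k x) ----> g x"
  "!!R::nat. (%n. nrm (%x. indicator (cball 0 (real R)) x * (f (r (s n)) k x - g x))) ----> 0"
  by (rule rellich[of "%n. f (r n) k" C E]) (use Suc.prems in auto)
 show ?case
 proof (intro exI[of _ "r \<circ> s"] exI[of _ "u(k := g)"] conjI allI impI)
  show "strict_mono (r \<circ> s)" by (rule strict_mono_o[OF r s(1)])
  fix i assume i: "i < Suc k"
  show "L2 ((u(k := g)) i)" using u(1) s(2) i by (cases "i = k") auto
  show "AE x in lebesgue. (%n. f ((r \<circ> s) n) i x) ----> (u(k := g)) i x"
  proof (cases "i = k")
   case False
   then have "AE x in lebesgue. (%n. f (r n) i x) ----> u i x" using u(2) i by simp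
   then show ?thesis
   proof eventually_elim
    case (elim x)
    then show ?case using LIMSEQ_subseq_LIMSEQ[OF elim s(1)] False by (simp add: o_def)
   qed
  qed (use s in simp)
  show "(%n. nrm (%x. indicator (cball 0 (real R)) x * (f ((r \<circ> s) n) i x - (u(k := g)) i x))) ----> 0" for R :: nat
  proof (cases "i = k")
   case False
   then show ?thesis using LIMSEQ_subseq_LIMSEQ[OF u(3) s(1), of i R] i by (simp add: o_def)
  qed (use s in simp)
 qed
qed

subsection \<open>Cut-offs and gluing\<close>

lemma rb_iff: "rb k Lar u \<longleftrightarrow> (\<forall>i<k. u i \<in> H1) & (\<forall>c. nrm2 (cmb k c u) = 0 --> (\<forall>i<k. c i = 0)) &
  (\<forall>c. en (cmb k c u) <= Lar * nrm2 (cmb k c u))"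
proof (cases "\<forall>i<k. u i \<in> H1")
 case True
 then have "nrm2 (cmb k c u) = 0 \<longleftrightarrow> (AE x in lebesgue. cmb k c u x = 0)" for c
  by (intro nrm2_eq_0 cmb_L2 H1_L2) auto
 then show ?thesis by (simp add: rb_def indep_def)
qed (auto simp: rb_def)

lemma rbI:
 assumes "!!i. i < k ==> u i \<in> H1" "!!c i. nrm2 (cmb k c u) = 0 ==> i < k ==> c i = 0"
  "!!c. en (cmb k c u) <= Lar * nrm2 (cmb k c u)"
 shows "rb k Lar u"
 using assms unfolding rb_iff by blast

lemma rb_bound: "rb k Lar u ==> en (cmb k c u) <= Lar * nrm2 (cmb k c u)"
 by (simp add: rb_def)

lemma rb_zero: "rb k Lar u ==> nrm2 (cmb k c u) = 0 ==> i < k ==> c i = 0"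
 unfolding rb_iff by blast

lemma cmb_unitv: "i < k ==> cmb k (unitv i) u = u i"
 by (rule ext) (simp add: cmb_def unitv_def if_distribR if_distrib[of "%t. t * _"] cong: if_cong)

lemma rb_cong:
 assumes "rb k Lar u" "!!i. i < k ==> AE x in lebesgue. v i x = u i x"
 shows "rb k Lar v"
proof -
 have H: "cmb k c u \<in> H1" for c by (rule cmb_H1[OF rb_H1[OF assms(1)]])
 have ae: "AE x in lebesgue. cmb k c v x = cmb k c u x" for c
 proof -
  have "AE x in lebesgue. \<forall>i\<in>{..<k}. v i x = u i x" using assms(2) by (intro AE_finite_allI) auto
  then show ?thesis by eventually_elim (simp add: cmb_def)
 qed
 note e = H1_AE_cong[OF H ae]
 show ?thesis
  unfolding rb_iff e using assms(1) H1_AE_cong(1)[OF rb_H1[OF assms(1)] assms(2)] unfolding rb_iff by blast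
qed

lemma sqrt_en_le_hn: "sqrt (en u) <= hn u"
 unfolding hn_def by (intro real_sqrt_le_mono en_le_h1)

text \<open>Q is any property found arbitrarily close to each \<open>u i\<close> in the Sobolev
  norm; it is instantiated with bounded support and with vanishing on a ball around a given point.
  The price is the passage from Lar to Lar'.\<close>

lemma rb_approx:
 fixes u :: "nat => 'a::euclidean_space => real"
 assumes u: "rb k Lar u" and l: "0 <= Lar" "Lar < Lar'"
  and ap: "!!i e. i < k ==> 0 < e ==> \<exists>h. h \<in> H1 & Q i h & hn (%x. h x - u i x) < e"
 shows "\<exists>v. rb k Lar' v & (\<forall>i<k. Q i (v i))"
proof -
 have "\<exists>h. i < k --> h \<in> H1 & Q i h & hn (%x. h x - u i x) < 1 / real (Suc n)" for n i
  using ap[of i "1 / real (Suc n)"] by auto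
 then have "\<forall>n. \<exists>v. \<forall>i. i < k --> v i \<in> H1 & Q i (v i) & hn (%x. v i x - u i x) < 1 / real (Suc n)"
  by (intro allI choice)
 from choice[OF this] obtain v where v: "!!n i. i < k ==> v n i \<in> H1" "!!n i. i < k ==> Q i (v n i)"
  "!!n i. i < k ==> hn (%x. v n i x - u i x) < 1 / real (Suc n)" by auto
 have uH: "u i \<in> H1" if "i < k" for i by (rule rb_H1[OF u that])
 have dH: "(%x. v n i x - u i x) \<in> H1" if "i < k" for n i using v(1) uH that by (intro H1_diff) auto
 have eq: "cmb k c (v n) x = cmb k c u x + (\<Sum>i<k. c i * (v n i x - u i x))" for n c x
  by (simp add: cmb_def right_diff_distrib sum_subtractf)
 have dS: "(%x. \<Sum>i<k. c i * (v n i x - u i x)) \<in> H1" for n c by (intro H1_sum(1) dH) auto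
 have "\<forall>\<^sub>F n in sequentially. rb k Lar' (v n)"
 proof (rule rb_perturb[OF u l v(1)])
  show "(%n. 1 / real (Suc n)) ----> 0" using LIMSEQ_inverse_real_of_nat by (simp add: inverse_eq_divide)
  fix n c
  have "sqrt (en (%x. \<Sum>i<k. c i * (v n i x - u i x))) <= (\<Sum>i<k. \<bar>c i\<bar> * sqrt (en (%x. v n i x - u i x)))"
   by (intro sqrt_en_sum dH) auto
  also have "... <= (\<Sum>i<k. \<bar>c i\<bar> * (1 / real (Suc n)))"
   using v(3) by (intro sum_mono mult_left_mono) (auto intro: order_trans[OF sqrt_en_le_hn] less_imp_le simp del: of_nat_Suc)
  also have "... = 1 / real (Suc n) * (\<Sum>i<k. \<bar>c i\<bar>)" by (simp add: sum_distrib_left sum_divide_distrib)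
  finally have a: "sqrt (en (%x. \<Sum>i<k. c i * (v n i x - u i x))) <= 1 / real (Suc n) * (\<Sum>i<k. \<bar>c i\<bar>)" .
  have "sqrt (en (cmb k c (v n))) <= sqrt (en (cmb k c u)) + sqrt (en (%x. \<Sum>i<k. c i * (v n i x - u i x)))"
   unfolding eq[abs_def] by (intro sqrt_en_add cmb_H1 uH dS)
  then show "sqrt (en (cmb k c (v n))) <= sqrt (en (cmb k c u)) + 1 / real (Suc n) * (\<Sum>i<k. \<bar>c i\<bar>)" using a by simp
  have "nrm (%x. \<Sum>i<k. c i * (v n i x - u i x)) <= (\<Sum>i<k. nrm (%x. c i * (v n i x - u i x)))"
   by (intro nrm_sum L2_cmult H1_L2 dH) auto
  also have "... = (\<Sum>i<k. \<bar>c i\<bar> * nrm (%x. v n i x - u i x))" by (simp only: nrm_cmult)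
  also have "... <= (\<Sum>i<k. \<bar>c i\<bar> * (1 / real (Suc n)))"
   using v(3) by (intro sum_mono mult_left_mono) (auto intro: order_trans[OF nrm_le_hn] less_imp_le simp del: of_nat_Suc)
  also have "... = 1 / real (Suc n) * (\<Sum>i<k. \<bar>c i\<bar>)" by (simp add: sum_distrib_left sum_divide_distrib)
  finally have b: "nrm (%x. \<Sum>i<k. c i * (v n i x - u i x)) <= 1 / real (Suc n) * (\<Sum>i<k. \<bar>c i\<bar>)" .
  have "nrm (%x. cmb k c (v n) x - (\<Sum>i<k. c i * (v n i x - u i x))) <= nrm (cmb k c (v n)) + nrm (%x. \<Sum>i<k. c i * (v n i x - u i x))"
   by (intro nrm_diff cmb_L2 H1_L2 dS v(1))
  then have "nrm (cmb k c u) <= nrm (cmb k c (v n)) + nrm (%x. \<Sum>i<k. c i * (v n i x - u i x))"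
   by (simp add: eq)
  then show "nrm (cmb k c u) - 1 / real (Suc n) * (\<Sum>i<k. \<bar>c i\<bar>) <= nrm (cmb k c (v n))" using b by simp
 qed
 then obtain n where "rb k Lar' (v n)" by (auto simp: eventually_sequentially)
 then show ?thesis using v(2) by blast
qed

section \<open>Supports and the trigonometric cut-off\<close>

definition supp :: "nat => (nat => 'a => real) => 'a set" where
 "supp k u = {x. \<exists>i<k. u i x ~= 0}"

lemma supp_eq: "supp k u = (\<Union>i<k. {x. u i x ~= 0})"
 by (auto simp: supp_def)

lemma L2_nonzero_sets: "L2 u ==> {x. u x ~= 0} \<in> sets lebesgue"
proof -
 assume "L2 u"
 then have "u \<in> borel_measurable lebesgue" by (simp add: L2_def)
 then have "u -` (- {0}) \<inter> space lebesgue \<in> sets lebesgue" by (rule measurable_sets) auto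
 moreover have "u -` (- {0}) \<inter> space lebesgue = {x. u x ~= 0}" by auto
 ultimately show ?thesis by simp
qed

lemma supp_sets: "(!!i. i < k ==> L2 (u i)) ==> supp k u \<in> sets lebesgue"
 unfolding supp_eq by (intro sets.finite_UN L2_nonzero_sets) auto

lemma rb_supp_sets: "rb k Lar u ==> supp k u \<in> sets lebesgue"
 by (intro supp_sets H1_L2 rb_H1)

lemma cmb_supp: "x \<notin> supp k u ==> cmb k c u x = 0"
 by (auto simp: cmb_def supp_def intro!: sum.neutral)

text \<open>An angle: 0 on the ball of radius R, pi/2 outside the ball of radius 2R. Its cosine and
  sine form the quadratic partition of unity into a near and a far part, both Lipschitz with
  constant pi/(2R).\<close>

definition cut :: "real => 'a::real_normed_vector => real" where
 "cut R x = pi / 2 * max 0 (min 1 (norm x / R - 1))"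

lemma cut_inner: "0 < R ==> norm x <= R ==> cut R x = 0"
 by (simp add: cut_def divide_le_eq)

lemma cut_outer: "0 < R ==> 2 * R <= norm x ==> cut R x = pi / 2"
 by (simp add: cut_def le_divide_eq)

lemma cut_lip:
 assumes "0 < R" shows "\<bar>cut R x - cut R y\<bar> <= pi / 2 / R * norm (x - y)"
proof -
 have "\<bar>max 0 (min 1 (norm x / R - 1)) - max 0 (min 1 (norm y / R - 1))\<bar> <= \<bar>(norm x / R - 1) - (norm y / R - 1)\<bar>" by (rule clamp_lip)
 also have "... = \<bar>norm x - norm y\<bar> / R" using assms by (simp add: diff_divide_distrib[symmetric] abs_divide)
 also have "... <= norm (x - y) / R" using assms by (intro divide_right_mono norm_triangle_ineq3) auto
 finally have "pi / 2 * \<bar>max 0 (min 1 (norm x / R - 1)) - max 0 (min 1 (norm y / R - 1))\<bar> <= pi / 2 * (norm (x - y) / R)"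
  by (intro mult_left_mono) auto
 moreover have "\<bar>cut R x - cut R y\<bar> = pi / 2 * \<bar>max 0 (min 1 (norm x / R - 1)) - max 0 (min 1 (norm y / R - 1))\<bar>"
  unfolding cut_def right_diff_distrib[symmetric] abs_mult by simp
 ultimately show ?thesis by simp
qed

lemma abs_sin_diff: "\<bar>sin a - sin b\<bar> <= \<bar>a - b :: real\<bar>"
proof -
 have "\<bar>sin a - sin b\<bar> = 2 * \<bar>sin ((a - b) / 2)\<bar> * \<bar>cos ((a + b) / 2)\<bar>" by (simp add: sin_diff_sin abs_mult)
 also have "... <= 2 * \<bar>(a - b) / 2\<bar> * 1" using abs_sin_x_le_abs_x[of "(a - b) / 2"] by (intro mult_mono) simp_all
 finally show ?thesis by simp
qed

lemma abs_cos_diff: "\<bar>cos a - cos b\<bar> <= \<bar>a - b :: real\<bar>"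
proof -
 have "\<bar>cos a - cos b\<bar> = \<bar>sin (pi / 2 - a) - sin (pi / 2 - b)\<bar>" by (simp add: cos_sin_eq)
 also have "... <= \<bar>(pi / 2 - a) - (pi / 2 - b)\<bar>" by (rule abs_sin_diff)
 finally show ?thesis by (simp add: abs_minus_commute)
qed

lemma cut_continuous: "0 < R ==> continuous_on UNIV (cut R :: 'a::real_normed_vector => real)"
 unfolding cut_def[abs_def] by (intro continuous_intros) auto

lemma cut_measurable:
 assumes "0 < R" shows "(%x::'a::euclidean_space. cos (cut R x)) \<in> borel_measurable lebesgue"
  "(%x::'a. sin (cut R x)) \<in> borel_measurable lebesgue"
 by (intro continuous_borel_lebesgue continuous_intros cut_continuous assms)+

text \<open>The error constant of \<open>en_IMS\<close> for Lipschitz constant pi/2; localization at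
  radius R thus costs \<open>kap / R^2\<close> times the mass.\<close>

definition kap :: "'a::euclidean_space itself => real" where
 "kap _ = 2 * (pi / 2)\<^sup>2 * real DIM('a)"

lemma cut_IMS:
 fixes u :: "'a::euclidean_space => real"
 assumes u: "u \<in> H1" and R: "0 < R"
 shows "(%x. cos (cut R x) * u x) \<in> H1" "(%x. sin (cut R x) * u x) \<in> H1"
  "en (%x. cos (cut R x) * u x) + en (%x. sin (cut R x) * u x) <= en u + kap TYPE('a) / R\<^sup>2 * nrm2 u"
  "nrm2 (%x. cos (cut R x) * u x) + nrm2 (%x. sin (cut R x) * u x) = nrm2 u"
proof -
 have lc: "\<bar>cos (cut R x) - cos (cut R y)\<bar> <= pi / 2 / R * norm (x - y)" for x y :: 'a
  by (rule order_trans[OF abs_cos_diff cut_lip[OF R]])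
 have ls: "\<bar>sin (cut R x) - sin (cut R y)\<bar> <= pi / 2 / R * norm (x - y)" for x y :: 'a
  by (rule order_trans[OF abs_sin_diff cut_lip[OF R]])
 have one: "(cos (cut R x))\<^sup>2 + (sin (cut R x))\<^sup>2 = 1" for x :: 'a by simp
 note I = en_IMS[OF u cut_measurable[OF R] one lc ls]
 show "(%x. cos (cut R x) * u x) \<in> H1" "(%x. sin (cut R x) * u x) \<in> H1" by (rule I)+
 show "en (%x. cos (cut R x) * u x) + en (%x. sin (cut R x) * u x) <= en u + kap TYPE('a) / R\<^sup>2 * nrm2 u"
  using I(3) by (simp add: kap_def power_divide mult.assoc)
 have "L2 (%x. cos (cut R x) * u x)" "L2 (%x. sin (cut R x) * u x)" using I(1,2) by (simp_all add: H1_L2)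
 then have "nrm2 (%x. cos (cut R x) * u x) + nrm2 (%x. sin (cut R x) * u x)
   = (LINT x|lebesgue. (cos (cut R x) * u x)\<^sup>2 + (sin (cut R x) * u x)\<^sup>2)"
  unfolding nrm2_def by (intro Bochner_Integration.integral_add[symmetric]) (auto simp: L2_def)
 also have "... = nrm2 u"
  unfolding nrm2_def by (simp only: power_mult_distrib distrib_right[symmetric] one mult_1)
 finally show "nrm2 (%x. cos (cut R x) * u x) + nrm2 (%x. sin (cut R x) * u x) = nrm2 u" .
qed

lemma nrm_cut_tendsto:
 fixes u :: "'a::euclidean_space => real"
 assumes u: "L2 u" and R: "filterlim R at_top sequentially" "!!n. 0 < R n"
 shows "(%n. nrm (%x. cos (cut (R n) x) * u x - u x)) ----> 0"
proof (rule dominated_nrm)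
 show "L2 (%x. 2 * u x)" using u by (rule L2_cmult)
 have "L2 (%x. cos (cut (R n) x) * u x)" for n by (rule L2_mult_bdd[OF u cut_measurable(1)[OF R(2)], of n 1]) simp
 then show "(%x. cos (cut (R n) x) * u x - u x) \<in> borel_measurable lebesgue" for n
  using L2_diff[OF _ u] by (auto simp: L2_def)
 show "AE x in lebesgue. \<bar>cos (cut (R n) x) * u x - u x\<bar> <= \<bar>2 * u x\<bar>" for n
 proof (rule AE_I2)
  fix x :: 'a
  have "\<bar>cos (cut (R n) x) * u x\<bar> <= 1 * \<bar>u x\<bar>" unfolding abs_mult by (intro mult_right_mono) auto
  then show "\<bar>cos (cut (R n) x) * u x - u x\<bar> <= \<bar>2 * u x\<bar>"
   using abs_triangle_ineq4[of "cos (cut (R n) x) * u x" "u x"] unfolding abs_mult[of 2] by linarith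
 qed
 show "AE x in lebesgue. (%n. cos (cut (R n) x) * u x - u x) ----> 0"
 proof (rule AE_I2)
  fix x :: 'a
  have "\<forall>\<^sub>F n in sequentially. norm x <= R n" using R(1) by (simp add: filterlim_at_top)
  then have "\<forall>\<^sub>F n in sequentially. cos (cut (R n) x) * u x - u x = 0"
   by eventually_elim (simp add: cut_inner R(2))
  then show "(%n. cos (cut (R n) x) * u x - u x) ----> 0" by (rule tendsto_eventually)
 qed
qed

lemma mid_induct_pred:
 assumes "mid F h" "!!f. f \<in> F ==> P f" "!!f g. P f ==> P g ==> P (%x. (f x + g x) / 2)"
 shows "P h"
 using assms(1) by (induction rule: mid.induct) (use assms in auto)

text \<open>The near parts have bounded energy and converge in L2. Midpoints upgrade this to the
  Sobolev norm and preserve both bounded support and vanishing where u vanishes.\<close>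

lemma bounded_support_dense:
 fixes u :: "'a::euclidean_space => real"
 assumes u: "u \<in> H1" and e: "0 < e"
 shows "\<exists>h. h \<in> H1 & (\<exists>R. \<forall>x. h x ~= 0 --> u x ~= 0 & norm x <= R) & hn (%x. h x - u x) < e"
proof -
 define f where "f n x = cos (cut (real (Suc n)) x) * u x" for n x
 have f: "f n \<in> H1" for n unfolding f_def[abs_def] by (rule cut_IMS(1)[OF u]) simp
 have fe: "en (f n) <= en u + kap TYPE('a) * nrm2 u" for n
 proof -
  have "0 <= kap TYPE('a)" by (simp add: kap_def)
  moreover have "1 <= (real (Suc n))\<^sup>2" by (intro one_le_power) simp
  ultimately have "kap TYPE('a) / (real (Suc n))\<^sup>2 <= kap TYPE('a)"
   by (simp add: divide_le_eq mult_left_le_one_le mult_le_cancel_left1 del: of_nat_Suc)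
  then have "kap TYPE('a) / (real (Suc n))\<^sup>2 * nrm2 u <= kap TYPE('a) * nrm2 u" by (intro mult_right_mono) auto
  moreover have "en (f n) <= en u + kap TYPE('a) / (real (Suc n))\<^sup>2 * nrm2 u"
   unfolding f_def[abs_def] using cut_IMS(3)[OF u, of "real (Suc n)"] en_nonneg[of "%x. sin (cut (real (Suc n)) x) * u x"] by linarith
  ultimately show ?thesis by simp
 qed
 have fl: "(%n. nrm (%x. f n x - u x)) ----> 0"
  unfolding f_def
  by (rule nrm_cut_tendsto[OF H1_L2[OF u] filterlim_compose[OF filterlim_real_sequentially filterlim_Suc]]) simp
 obtain h where h: "!!n. mid (f ` {n..}) (h n)" "!!n. h n \<in> H1" "(%n. hn (%x. h n x - u x)) ----> 0"
  using strong_from_weak[OF f fe H1_L2[OF u] fl] by auto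
 have "\<forall>\<^sub>F n in sequentially. hn (%x. h n x - u x) < e" using h(3) e by (rule order_tendstoD)
 then obtain n where n: "hn (%x. h n x - u x) < e" by (auto simp: eventually_sequentially)
 have "\<exists>R. \<forall>x. h n x ~= 0 --> u x ~= 0 & norm x <= R"
 proof (rule mid_induct_pred[OF h(1)])
  fix g assume "g \<in> f ` {n..}"
  then obtain m where g: "g = f m" by blast
  show "\<exists>R. \<forall>x. g x ~= 0 --> u x ~= 0 & norm x <= R"
  proof (intro exI[of _ "2 * real (Suc m)"] allI impI)
   fix x assume gx: "g x ~= 0"
   have "norm x <= 2 * real (Suc m)"
   proof (rule ccontr)
    assume "\<not> ?thesis"
    then have "cut (real (Suc m)) x = pi / 2" by (intro cut_outer) auto
    then have "cos (cut (real (Suc m)) x) = 0" by (simp only: cos_pi_half)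
    then show False using gx unfolding g f_def by simp
   qed
   then show "u x ~= 0 & norm x <= 2 * real (Suc m)" using gx by (auto simp: g f_def)
  qed
 next
  fix f g :: "'a => real"
  assume "\<exists>R. \<forall>x. f x ~= 0 --> u x ~= 0 & norm x <= R" "\<exists>R. \<forall>x. g x ~= 0 --> u x ~= 0 & norm x <= R"
  then obtain R S where RS: "!!x. f x ~= 0 ==> u x ~= 0 & norm x <= R" "!!x. g x ~= 0 ==> u x ~= 0 & norm x <= S" by blast
  show "\<exists>R. \<forall>x. (f x + g x) / 2 ~= 0 --> u x ~= 0 & norm x <= R"
  proof (intro exI[of _ "max R S"] allI impI)
   fix x assume "(f x + g x) / 2 ~= 0"
   then have "f x ~= 0 \<or> g x ~= 0" by auto
   then show "u x ~= 0 & norm x <= max R S" using RS(1)[of x] RS(2)[of x] by auto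
  qed
 qed
 then show ?thesis using h(2) n by blast
qed

section \<open>Dilations, gluing and the relation \<open>ST\<close>\<close>

lemma emeasure_affine:
 fixes A :: "'a::euclidean_space set"
 assumes c: "c ~= 0" and A: "A \<in> sets lebesgue"
 shows "{x. t + c *\<^sub>R x \<in> A} \<in> sets lebesgue"
  "emeasure lebesgue A = ennreal (\<bar>c\<bar> ^ DIM('a)) * emeasure lebesgue {x. t + c *\<^sub>R x \<in> A}"
proof -
 have e: "(%x. t + c *\<^sub>R x) -` A \<inter> space lebesgue = {x. t + c *\<^sub>R x \<in> A}" by auto
 show "{x. t + c *\<^sub>R x \<in> A} \<in> sets lebesgue"
  using measurable_sets[OF affine_measurable[OF c, of t] A] unfolding e .
 have "emeasure (density (distr lebesgue lebesgue (%x. t + c *\<^sub>R x)) (%_. ennreal (\<bar>c\<bar> ^ DIM('a)))) A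
   = ennreal (\<bar>c\<bar> ^ DIM('a)) * emeasure (distr lebesgue lebesgue (%x. t + c *\<^sub>R x)) A"
  using A by (subst emeasure_density_const) auto
 also have "emeasure (distr lebesgue lebesgue (%x. t + c *\<^sub>R x)) A = emeasure lebesgue {x. t + c *\<^sub>R x \<in> A}"
  using emeasure_distr[OF affine_measurable[OF c, of t] A] unfolding e .
 finally show "emeasure lebesgue A = ennreal (\<bar>c\<bar> ^ DIM('a)) * emeasure lebesgue {x. t + c *\<^sub>R x \<in> A}"
  unfolding affine_density[OF c, of t, symmetric] .
qed

lemma rb_affine:
 fixes u :: "nat => 'a::euclidean_space => real"
 assumes u: "rb k Lar u" and s: "0 < s"
 shows "rb k (s\<^sup>2 * Lar) (%i x. u i (t + s *\<^sub>R x))"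
proof (rule rbI)
 have e: "cmb k c (%i x. u i (t + s *\<^sub>R x)) = (%x. cmb k c u (t + s *\<^sub>R x))" for c by (simp add: cmb_def[abs_def])
 have H: "cmb k c u \<in> H1" for c by (rule cmb_H1[OF rb_H1[OF u]])
 have n: "nrm2 (cmb k c (%i x. u i (t + s *\<^sub>R x))) = nrm2 (cmb k c u) / s ^ DIM('a)" for c
  unfolding e using nrm2_affine[OF _ H1_L2[OF H], of s c t] s by simp
 show "(%x. u i (t + s *\<^sub>R x)) \<in> H1" if "i < k" for i using rb_H1[OF u that] s by (rule en_affine(1))
 show "c i = 0" if "nrm2 (cmb k c (%i x. u i (t + s *\<^sub>R x))) = 0" "i < k" for c i
  using that rb_zero[OF u, of c i] s by (simp add: n)
 fix c
 have "en (cmb k c (%i x. u i (t + s *\<^sub>R x))) <= s\<^sup>2 / s ^ DIM('a) * en (cmb k c u)"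
  unfolding e by (rule en_affine(2)[OF H s])
 also have "... <= s\<^sup>2 / s ^ DIM('a) * (Lar * nrm2 (cmb k c u))"
  using s by (intro mult_left_mono rb_bound[OF u]) auto
 finally show "en (cmb k c (%i x. u i (t + s *\<^sub>R x))) <= s\<^sup>2 * Lar * nrm2 (cmb k c (%i x. u i (t + s *\<^sub>R x)))"
  by (simp add: n)
qed

lemma supp_affine: "supp k (%i x. u i (t + s *\<^sub>R x)) = {x. t + s *\<^sub>R x \<in> supp k u}"
 by (simp add: supp_def)

text \<open>After approximation by bounded supports, paid for by Lar < Lar', the second tuple is
  translated far away; masses add and energies at most add, so the direct sum keeps the bound. The
  first tuple stays in place, since its support will have to share volume with D.\<close>

lemma glue:
 fixes v w :: "nat => 'a::euclidean_space => real"
 assumes v: "rb j Lar v" and w: "rb l Lar w" and L: "0 <= Lar" "Lar < Lar'"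
 shows "\<exists>z T. rb (j + l) Lar' z & supp (j + l) z \<subseteq> supp j v \<union> T & T \<in> sets lebesgue &
  emeasure lebesgue T <= emeasure lebesgue (supp l w)"
proof -
 have tr: "\<exists>v'. rb k Lar' v' & (\<forall>i<k. \<exists>R. \<forall>x. v' i x ~= 0 --> v i x ~= 0 & norm x <= R)"
  if "rb k Lar v" for k and v :: "nat => 'a => real"
  using that L
  by (rule rb_approx[where Q="%i h. \<exists>R. \<forall>x. h x ~= 0 --> v i x ~= 0 & norm x <= R"])
    (intro bounded_support_dense rb_H1[OF that])
 have bd: "\<exists>R. \<forall>x\<in>supp k v'. x \<in> supp k v & norm x <= R"
  if "\<forall>i<k. \<exists>R. \<forall>x. v' i x ~= 0 --> v i x ~= 0 & norm x <= R" for k and v v' :: "nat => 'a => real"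
 proof -
  have "\<forall>i. \<exists>R. i < k --> (\<forall>x. v' i x ~= 0 --> v i x ~= 0 & norm x <= R)" using that by blast
  from choice[OF this] obtain R where R: "!!i x. i < k ==> v' i x ~= 0 ==> v i x ~= 0 & norm x <= R i" by blast
  show ?thesis
  proof (intro exI[of _ "\<Sum>i<k. \<bar>R i\<bar>"] ballI)
   fix x assume "x \<in> supp k v'"
   then obtain i where i: "i < k" "v' i x ~= 0" by (auto simp: supp_def)
   have "R i <= \<bar>R i\<bar>" by simp
   also have "... <= (\<Sum>i<k. \<bar>R i\<bar>)" using i(1) by (intro member_le_sum) auto
   finally show "x \<in> supp k v & norm x <= (\<Sum>i<k. \<bar>R i\<bar>)" using R[OF i] i(1) by (auto simp: supp_def)
  qed
 qed
 obtain v' where v': "rb j Lar' v'" "\<forall>i<j. \<exists>R. \<forall>x. v' i x ~= 0 --> v i x ~= 0 & norm x <= R" using tr[OF v] by blast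
 obtain w' where w': "rb l Lar' w'" "\<forall>i<l. \<exists>R. \<forall>x. w' i x ~= 0 --> w i x ~= 0 & norm x <= R" using tr[OF w] by blast
 obtain R1 where R1: "!!x. x \<in> supp j v' ==> x \<in> supp j v & norm x <= R1" using bd[OF v'(2)] by blast
 obtain R2 where R2: "!!x. x \<in> supp l w' ==> x \<in> supp l w & norm x <= R2" using bd[OF w'(2)] by blast
 obtain b :: 'a where b: "b \<in> Basis" using nonempty_Basis by blast
 \<comment> \<open>Longer by 1 than both radii together, which puts distance at least 1 between the
   supports.\<close>
 define t where "t = - (\<bar>R1\<bar> + \<bar>R2\<bar> + 1) *\<^sub>R b"
 have nt: "norm t = \<bar>R1\<bar> + \<bar>R2\<bar> + 1" using b by (simp add: t_def)
 define w2 where "w2 i x = w' i (t + 1 *\<^sub>R x)" for i x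
 have w2: "rb l Lar' w2" using rb_affine[OF w'(1), of 1 t] by (simp add: w2_def[abs_def])
 have s2: "supp l w2 = {x. t + 1 *\<^sub>R x \<in> supp l w'}" by (simp add: w2_def[abs_def] supp_def)
 have sep: "1 <= dist x y" if "x \<in> supp j v'" "y \<in> supp l w2" for x y
 proof -
  have 1: "norm x <= R1" "norm (t + y) <= R2" using R1 R2 that by (auto simp: s2)
  have "norm t <= norm (t + y) + norm y" using norm_triangle_ineq4[of "t + y" y] by simp
  moreover have "norm y <= norm x + dist x y" using norm_triangle_ineq2[of y x] by (simp add: dist_norm norm_minus_commute)
  ultimately show ?thesis using 1 nt by linarith
 qed
 define z where "z i = (if i < j then v' i else w2 (i - j))" for i
 have cz: "cmb (j + l) c z = (%x. cmb j c v' x + cmb l (%i. c (j + i)) w2 x)" for c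
 proof
  fix x
  have "cmb (j + l) c z x = (\<Sum>i\<in>{..<j}. c i * z i x) + (\<Sum>i\<in>{j..<j+l}. c i * z i x)"
   unfolding cmb_def lessThan_atLeast0 by (simp add: sum.atLeastLessThan_concat)
  also have "(\<Sum>i\<in>{j..<j+l}. c i * z i x) = (\<Sum>i<l. c (j + i) * z (j + i) x)"
   using sum.shift_bounds_nat_ivl[of "%i. c i * z i x" 0 j l] by (simp add: lessThan_atLeast0 add.commute)
  finally show "cmb (j + l) c z x = cmb j c v' x + cmb l (%i. c (j + i)) w2 x" by (simp add: cmb_def z_def)
 qed
 have Hv: "cmb j c v' \<in> H1" for c by (rule cmb_H1[OF rb_H1[OF v'(1)]])
 have Hw: "cmb l c w2 \<in> H1" for c by (rule cmb_H1[OF rb_H1[OF w2]])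
 have sp: "1 <= dist x y" if "cmb j c v' x ~= 0" "cmb l d w2 y ~= 0" for c d x y
  using that cmb_supp[of x j v' c] cmb_supp[of y l w2 d] sep by blast
 have E: "en (%x. cmb j c v' x + cmb l d w2 x) <= en (cmb j c v') + en (cmb l d w2)"
  "nrm2 (%x. cmb j c v' x + cmb l d w2 x) = nrm2 (cmb j c v') + nrm2 (cmb l d w2)" for c d
  by (rule en_separated[OF Hv Hw zero_less_one], erule (1) sp)+
 have rz: "rb (j + l) Lar' z"
 proof (rule rbI)
  show "z i \<in> H1" if "i < j + l" for i using that rb_H1[OF v'(1)] rb_H1[OF w2] by (auto simp: z_def)
  fix c
  show "c i = 0" if n: "nrm2 (cmb (j + l) c z) = 0" and i: "i < j + l" for i
  proof -
   have n2: "nrm2 (cmb j c v') = 0" "nrm2 (cmb l (%i. c (j + i)) w2) = 0"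
    using n unfolding cz E(2) by (simp_all add: add_nonneg_eq_0_iff)
   show ?thesis
   proof (cases "i < j")
    case False
    then show ?thesis using rb_zero[OF w2 n2(2), of "i - j"] i by simp
   qed (rule rb_zero[OF v'(1) n2(1)])
  qed
  have "en (cmb (j + l) c z) <= en (cmb j c v') + en (cmb l (%i. c (j + i)) w2)" unfolding cz by (rule E(1))
  also have "... <= Lar' * nrm2 (cmb j c v') + Lar' * nrm2 (cmb l (%i. c (j + i)) w2)"
   by (intro add_mono rb_bound v'(1) w2)
  finally show "en (cmb (j + l) c z) <= Lar' * nrm2 (cmb (j + l) c z)" unfolding cz E(2) by (simp add: distrib_left)
 qed
 define T where "T = {x. t + 1 *\<^sub>R x \<in> supp l w}"
 have T: "T \<in> sets lebesgue" "emeasure lebesgue T = emeasure lebesgue (supp l w)"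
  using emeasure_affine[OF _ rb_supp_sets[OF w], of 1 t] by (simp_all add: T_def)
 have "supp (j + l) z \<subseteq> supp j v \<union> T"
 proof
  fix x assume "x \<in> supp (j + l) z"
  then obtain i where i: "i < j + l" "z i x ~= 0" by (auto simp: supp_def)
  show "x \<in> supp j v \<union> T"
  proof (cases "i < j")
   case True
   then have "x \<in> supp j v'" using i by (auto simp: supp_def z_def)
   then show ?thesis using R1 by blast
  next
   case False
   then have "w2 (i - j) x ~= 0" "i - j < l" using i by (auto simp: z_def)
   then have "x \<in> supp l w2" by (auto simp: supp_def)
   then show ?thesis using R2 by (auto simp: s2 T_def)
  qed
 qed
 then show ?thesis using rz T(1) T(2)[THEN eq_refl] by blast
qed

text \<open>A witnessed form of "\<open>lambda_star\<close> at volume a is at most Lar". Working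
  with tuples and their supports keeps capacities out of the splitting argument.\<close>

definition ST :: "'a::euclidean_space itself => nat => ennreal => real => bool" where
 "ST _ l a Lar \<longleftrightarrow> (\<exists>w :: nat => 'a => real. rb l Lar w & emeasure lebesgue (supp l w) <= a)"

lemma ST_mono: "ST TYPE('a::euclidean_space) l a Lar ==> a <= b ==> Lar <= Lar' ==> ST TYPE('a) l b Lar'"
 unfolding ST_def by (meson order_trans rb_mono)

text \<open>Composition with multiplication by s divides volumes by s^d and multiplies Rayleigh
  bounds by s^2.\<close>

lemma ST_scale:
 assumes st: "ST TYPE('a::euclidean_space) l (ennreal a) Lar" and s: "0 < s" and a: "a <= s ^ DIM('a) * b"
 shows "ST TYPE('a) l (ennreal b) (s\<^sup>2 * Lar)"
proof -
 obtain w :: "nat => 'a => real" where w: "rb l Lar w" "emeasure lebesgue (supp l w) <= ennreal a"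
  using st by (auto simp: ST_def)
 let ?w = "%i x. w i (0 + s *\<^sub>R x)"
 have "ennreal (s ^ DIM('a)) * emeasure lebesgue (supp l ?w) = emeasure lebesgue (supp l w)"
  unfolding supp_affine using emeasure_affine(2)[OF _ rb_supp_sets[OF w(1)], of s 0] s by simp
 also have "... <= ennreal (s ^ DIM('a) * b)" using w(2) a by (meson ennreal_leI order_trans)
 also have "... = ennreal (s ^ DIM('a)) * ennreal b" using s by (intro ennreal_mult') auto
 finally have "emeasure lebesgue (supp l ?w) <= ennreal b"
  using s by (subst (asm) ennreal_mult_le_mult_iff) auto
 then show ?thesis unfolding ST_def using rb_affine[OF w(1) s, of 0] by blast
qed

text \<open>A weak Faber-Krahn inequality: on small volume the Poincare constant is so small that
  the Rayleigh bound forces the first member of the tuple to vanish.\<close>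

lemma ST_small:
 assumes l: "1 <= l"
 obtains a where "0 < a" "\<not> ST TYPE('a::euclidean_space) l (ennreal a) Lar"
proof -
 define Lar' where "Lar' = max Lar 0"
 have L: "0 <= Lar'" "Lar <= Lar'" by (auto simp: Lar'_def)
 define e :: real where "e = 1 / (4 * DIM('a) * (sqrt Lar' + 1))"
 have e: "0 < e" using L by (simp add: e_def add_nonneg_pos)
 obtain a where a: "0 < a" "!!(u::'a => real) A. u \<in> H1 ==> A \<in> sets lebesgue ==> emeasure lebesgue A <= ennreal a ==>
  (AE x in lebesgue. x \<notin> A --> u x = 0) ==> nrm u <= 2 * e * DIM('a) * sqrt (en u)"
  by (rule poincare[OF e]) blast
 have "\<not> ST TYPE('a) l (ennreal a) Lar"
 proof
  assume "ST TYPE('a) l (ennreal a) Lar"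
  then obtain w :: "nat => 'a => real" where w: "rb l Lar w" "emeasure lebesgue (supp l w) <= ennreal a"
   by (auto simp: ST_def)
  have w0: "w 0 = cmb l (unitv 0) w" using cmb_unitv[of 0 l w] l by simp
  have "nrm (w 0) <= 2 * e * DIM('a) * sqrt (en (w 0))"
  proof (rule a(2)[OF _ rb_supp_sets[OF w(1)] w(2)])
   show "w 0 \<in> H1" using rb_H1[OF w(1)] l by simp
   show "AE x in lebesgue. x \<notin> supp l w --> w 0 x = 0" using l by (auto simp: supp_def)
  qed
  also have "sqrt (en (w 0)) <= sqrt (Lar' * nrm2 (w 0))"
   unfolding w0 by (intro real_sqrt_le_mono rb_bound[OF rb_mono[OF w(1) L(2)]])
  also have "... = sqrt Lar' * nrm (w 0)" by (simp add: real_sqrt_mult nrm_def)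
  also have "2 * e * DIM('a) * (sqrt Lar' * nrm (w 0)) = (2 * e * DIM('a) * sqrt Lar') * nrm (w 0)" by simp
  also have "... <= (1/2) * nrm (w 0)"
  proof (intro mult_right_mono)
   have "2 * e * DIM('a) * sqrt Lar' = (1/2) * (sqrt Lar' / (sqrt Lar' + 1))" by (simp add: e_def)
   also have "... <= (1/2) * 1" using L by (intro mult_left_mono) (auto simp: divide_le_eq add_nonneg_pos)
   finally show "2 * e * DIM('a) * sqrt Lar' <= 1/2" by simp
  qed simp
  finally have "nrm (w 0) <= 1/2 * nrm (w 0)" using e by simp
  then have "nrm (w 0) = 0" using nrm_nonneg[of "w 0"] by linarith
  then have "nrm2 (cmb l (unitv 0) w) = 0" using w0 nrm_sq[of "w 0"] by simp
  then have "unitv 0 0 = 0" using rb_zero[OF w(1), of "unitv 0" 0] l by simp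
  then show False by (simp add: unitv_def)
 qed
 then show ?thesis using that a(1) by blast
qed

subsection \<open>Splitting of minimizing sequences\<close>

text \<open>Where a limit function is nonzero, its approximants are eventually nonzero; Fatou is
  applied to the indicators. The set B permits the comparison on balls.\<close>

lemma supp_liminf:
 fixes u :: "nat => 'a::euclidean_space => real" and U :: "nat => nat => 'a => real"
 assumes D: "D \<in> sets lebesgue" and B: "B \<in> sets lebesgue"
  and L: "!!i. i < k ==> L2 (u i)" "!!n i. i < k ==> L2 (U n i)"
  and ae: "!!i. i < k ==> AE x in lebesgue. (%n. U n i x) ----> u i x"
 shows "emeasure lebesgue ((D \<union> supp k u) \<inter> B) <= liminf (%n. emeasure lebesgue ((D \<union> supp k (U n)) \<inter> B))"
proof -
 have m: "(D \<union> supp k u) \<inter> B \<in> sets lebesgue" "(D \<union> supp k (U n)) \<inter> B \<in> sets lebesgue" for n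
  using D B supp_sets[of k u] supp_sets[of k "U n"] L by auto
 have "AE x in lebesgue. \<forall>i\<in>{..<k}. (%n. U n i x) ----> u i x" using ae by (intro AE_finite_allI) auto
 then have "AE x in lebesgue. indicator ((D \<union> supp k u) \<inter> B) x <= liminf (%n. indicator ((D \<union> supp k (U n)) \<inter> B) x :: ennreal)"
 proof eventually_elim
  case (elim x)
  show ?case
  proof (cases "x \<in> (D \<union> supp k u) \<inter> B")
   case True
   have "\<forall>\<^sub>F n in sequentially. x \<in> (D \<union> supp k (U n)) \<inter> B"
   proof (cases "x \<in> D")
    case False
    then obtain i where i: "i < k" "u i x ~= 0" using True by (auto simp: supp_def)
    then have "(%n. U n i x) ----> u i x" using elim by auto
    then have "\<forall>\<^sub>F n in sequentially. U n i x ~= 0" using i(2) by (rule tendsto_imp_eventually_ne)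
    then show ?thesis by (rule eventually_mono) (use True i(1) in \<open>auto simp: supp_def\<close>)
   qed (use True in auto)
   then have "\<forall>\<^sub>F n in sequentially. (1::ennreal) <= indicator ((D \<union> supp k (U n)) \<inter> B) x"
    by eventually_elim simp
   then have "(1::ennreal) <= liminf (%n. indicator ((D \<union> supp k (U n)) \<inter> B) x)" by (rule Liminf_bounded)
   then show ?thesis using True by simp
  qed simp
 qed
 then have "(\<integral>\<^sup>+x. indicator ((D \<union> supp k u) \<inter> B) x \<partial>lebesgue) <=
   (\<integral>\<^sup>+x. liminf (%n. indicator ((D \<union> supp k (U n)) \<inter> B) x :: ennreal) \<partial>lebesgue)" by (rule nn_integral_mono_AE)
 also have "... <= liminf (%n. \<integral>\<^sup>+x. indicator ((D \<union> supp k (U n)) \<inter> B) x \<partial>lebesgue)"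
  using m by (intro nn_integral_liminf) auto
 finally show ?thesis using m by simp
qed

lemma nrm2_conv:
 assumes "!!n. L2 (f n)" "L2 u" "(%n. nrm (%x. f n x - u x)) ----> 0"
 shows "(%n. nrm2 (f n)) ----> nrm2 u"
proof -
 have "(%n. nrm (f n)) ----> nrm u"
 proof (rule LIM_zero_cancel, rule tendsto_norm_zero_cancel)
  show "(%n. norm (nrm (f n) - nrm u)) ----> 0"
   by (rule tendsto_sandwich[OF _ _ tendsto_const assms(3)])
     (auto intro!: always_eventually nrm_diff_rev assms)
 qed
 then have "(%n. (nrm (f n))\<^sup>2) ----> (nrm u)\<^sup>2" by (rule tendsto_power)
 then show ?thesis by (simp add: nrm_sq)
qed

lemma Bf_diff_scale: "Bf k (%i j. A i j - t * B i j) c d = Bf k A c d - t * Bf k B c d"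
 unfolding Bf_def by (simp add: right_diff_distrib sum_subtractf sum_distrib_left mult.left_commute)

lemma Bf_tendsto:
 assumes "!!i. i < k ==> (%n. c n i) ----> d i"
 shows "(%n. Bf k B (c n) (c n)) ----> Bf k B d d"
 unfolding Bf_def using assms by (intro tendsto_sum tendsto_mult tendsto_const) auto

text \<open>Energy that escapes to infinity along an almost minimizing sequence: the far parts
  of all combinations on which the limit form \<open>en - (al + eps) nrm2\<close> is nonnegative obey
  the bound \<open>al + 2 eps\<close>.\<close>

lemma escaping_part:
 fixes u :: "nat => 'a::euclidean_space => real" and U :: "nat => nat => 'a => real" and w :: "nat => nat => real"
 assumes on: "!!n c. nrm2 (cmb k c (U n)) = (\<Sum>i<k. (c i)\<^sup>2)" and rb: "!!n. rb k (L n) (U n)" and La: "L ----> alp"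
  and uH: "!!i. i < k ==> u i \<in> H1"
  and loc: "!!n i. i < k ==> nrm (%x. indicator (cball 0 (2 * real (Suc n))) x * (U n i x - u i x)) <= 1 / real (Suc n)"
  and e: "0 < epsr" and a: "0 <= alp" and w: "lind k l w"
  and pos: "!!c. 0 <= en (cmb k (lin l c w) u) - (alp + epsr) * nrm2 (cmb k (lin l c w) u)"
 shows "\<forall>\<^sub>F n in sequentially. rb l (alp + 2 * epsr) (%i x. sin (cut (real (Suc n)) x) * cmb k (w i) (U n) x)"
proof (rule ccontr)
 assume "\<not> ?thesis"
 from not_eventually_sequentiallyD[OF this] obtain r :: "nat => nat" where r: "strict_mono r"
  and nr: "!!n. \<not> rb l (alp + 2 * epsr) (%i x. sin (cut (real (Suc (r n))) x) * cmb k (w i) (U (r n)) x)" by auto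
 have UH: "cmb k c (U n) \<in> H1" for n c by (rule cmb_H1[OF rb_H1[OF rb]])
 define F where "F n c x = sin (cut (real (Suc n)) x) * cmb k c (U n) x" for n c x
 define G where "G n c x = cos (cut (real (Suc n)) x) * cmb k c (U n) x" for n c x
 have FH: "F n c \<in> H1" and GH: "G n c \<in> H1" for n c
  unfolding F_def[abs_def] G_def[abs_def] by (rule cut_IMS[OF UH], simp)+
 have FG: "en (G n c) + en (F n c) <= en (cmb k c (U n)) + kap TYPE('a) / (real (Suc n))\<^sup>2 * nrm2 (cmb k c (U n))"
  "nrm2 (G n c) + nrm2 (F n c) = nrm2 (cmb k c (U n))" for n c
  unfolding F_def[abs_def] G_def[abs_def] by (rule cut_IMS[OF UH], simp)+
 have cF: "cmb l c (%i x. sin (cut (real (Suc n)) x) * cmb k (w i) (U n) x) = F n (lin l c w)" for n c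
 proof
  fix x
  have "cmb l c (%i x. sin (cut (real (Suc n)) x) * cmb k (w i) (U n) x) x = sin (cut (real (Suc n)) x) * cmb l c (%i. cmb k (w i) (U n)) x"
   by (simp add: cmb_def[of l] sum_distrib_left mult.left_commute)
  then show "cmb l c (%i x. sin (cut (real (Suc n)) x) * cmb k (w i) (U n) x) x = F n (lin l c w) x" by (simp add: F_def cmb_lin)
 qed
 \<comment> \<open>Failure of the bound is witnessed by nonzero coefficients; scaling them to
   Euclidean length 1 makes them precompact.\<close>
 have bad: "\<exists>c. (\<Sum>i<k. (lin l c w i)\<^sup>2) = 1 & (alp + 2 * epsr) * nrm2 (F (r n) (lin l c w)) <= en (F (r n) (lin l c w))" for n
 proof -
  have "\<exists>c. (\<exists>i<l. c i ~= 0) & (alp + 2 * epsr) * nrm2 (F (r n) (lin l c w)) <= en (F (r n) (lin l c w))"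
  proof (rule ccontr)
   assume no: "\<not> ?thesis"
   have "rb l (alp + 2 * epsr) (%i x. sin (cut (real (Suc (r n))) x) * cmb k (w i) (U (r n)) x)"
   proof (rule rbI)
    show "(%x. sin (cut (real (Suc (r n))) x) * cmb k (w i) (U (r n)) x) \<in> H1" if "i < l" for i
     by (rule cut_IMS(2)[OF UH]) simp
    show "c i = 0" if z: "nrm2 (cmb l c (%i x. sin (cut (real (Suc (r n))) x) * cmb k (w i) (U (r n)) x)) = 0" and i: "i < l" for c i
    proof (rule ccontr)
     assume "c i ~= 0"
     then show False using no z i unfolding cF by auto
    qed
    fix c
    show "en (cmb l c (%i x. sin (cut (real (Suc (r n))) x) * cmb k (w i) (U (r n)) x))
     <= (alp + 2 * epsr) * nrm2 (cmb l c (%i x. sin (cut (real (Suc (r n))) x) * cmb k (w i) (U (r n)) x))"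
    proof (cases "\<exists>i<l. c i ~= 0")
     case True
     then have "\<not> (alp + 2 * epsr) * nrm2 (F (r n) (lin l c w)) <= en (F (r n) (lin l c w))" using no by blast
     then show ?thesis unfolding cF by simp
    next
     case False
     then have "F (r n) (lin l c w) = (%x. 0)" by (auto simp: F_def lin_def cmb_def)
     then show ?thesis unfolding cF by (simp add: nrm2_def H1_zero(2))
    qed
   qed
   then show False using nr by blast
  qed
  then obtain c where c: "\<exists>i<l. c i ~= 0" "(alp + 2 * epsr) * nrm2 (F (r n) (lin l c w)) <= en (F (r n) (lin l c w))" by blast
  define s where "s = (\<Sum>i<k. (lin l c w i)\<^sup>2)"
  have "s ~= 0"
  proof
   assume "s = 0"
   then have "\<forall>i<k. lin l c w i = 0" unfolding s_def by (subst (asm) sum_nonneg_eq_0_iff) auto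
   then show False using w c(1) unfolding lind_def by blast
  qed
  then have s: "0 < s" unfolding s_def using sum_nonneg[of "{..<k}" "%i. (lin l c w i)\<^sup>2"] by (simp add: less_le)
  define c' where "c' i = c i / sqrt s" for i
  have l': "lin l c' w i = (1 / sqrt s) * lin l c w i" for i
   by (simp add: lin_def c'_def sum_divide_distrib)
  have "F (r n) (lin l c' w) = (%x. (1 / sqrt s) * F (r n) (lin l c w) x)"
   by (auto simp: F_def cmb_def l' sum_divide_distrib sum_distrib_left)
  then have sc: "nrm2 (F (r n) (lin l c' w)) = (1 / sqrt s)\<^sup>2 * nrm2 (F (r n) (lin l c w))"
   "en (F (r n) (lin l c' w)) = (1 / sqrt s)\<^sup>2 * en (F (r n) (lin l c w))"
   by (simp_all only: nrm2_cmult H1_cmult(2)[OF FH])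
  show ?thesis
  proof (intro exI[of _ c'] conjI)
   have "(\<Sum>i<k. (lin l c' w i)\<^sup>2) = (1 / sqrt s)\<^sup>2 * s"
    unfolding l' power_mult_distrib s_def by (rule sum_distrib_left[symmetric])
   then show "(\<Sum>i<k. (lin l c' w i)\<^sup>2) = 1" using s by (simp add: power_divide)
   show "(alp + 2 * epsr) * nrm2 (F (r n) (lin l c' w)) <= en (F (r n) (lin l c' w))"
    unfolding sc using mult_left_mono[OF c(2), of "(1 / sqrt s)\<^sup>2"] by (simp add: mult.left_commute)
  qed
 qed
 then have "\<forall>n. \<exists>c. (\<Sum>i<k. (lin l c w i)\<^sup>2) = 1 & (alp + 2 * epsr) * nrm2 (F (r n) (lin l c w)) <= en (F (r n) (lin l c w))" by blast
 from choice[OF this] obtain c where c: "!!n. (\<Sum>i<k. (lin l (c n) w i)\<^sup>2) = 1"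
  "!!n. (alp + 2 * epsr) * nrm2 (F (r n) (lin l (c n) w)) <= en (F (r n) (lin l (c n) w))" by blast
 define d where "d n = lin l (c n) w" for n
 have d1: "\<bar>d n i\<bar> <= 1" if "i < k" for n i
 proof -
  have "(d n i)\<^sup>2 <= (\<Sum>i<k. (d n i)\<^sup>2)" using that by (intro member_le_sum) auto
  then show ?thesis using c(1)[of n] by (simp add: d_def abs_square_le_1)
 qed
 obtain q de where q: "strict_mono (q :: nat => nat)" "!!i. i < k ==> (%n. d (q n) i) ----> de i"
  by (rule bounded_coeff_subseq[of k d 1]) (use d1 in auto)
 define s where "s n = r (q n)" for n
 have s: "strict_mono s" using strict_mono_o[OF r q(1)] by (simp add: s_def[abs_def] o_def)
 define tht where "tht n = d (q n)" for n
 have th: "\<bar>tht n i\<bar> <= 1" if "i < k" for n i using d1[OF that] by (simp add: tht_def)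
 have thl: "(%n. tht n i) ----> de i" if "i < k" for i using q(2)[OF that] by (simp add: tht_def)
 have n1: "nrm2 (cmb k (tht n) (U (s n))) = 1" for n using on[of "tht n"] c(1)[of "q n"] by (simp add: tht_def d_def)
 define V where "V = cmb k de u"
 have VH: "V \<in> H1" unfolding V_def by (rule cmb_H1[OF uH])
 define h where "h n = G (s n) (tht n)" for n
 have hH: "h n \<in> H1" for n by (simp add: h_def GH)
 have Rinf: "filterlim (%n. real (Suc (s n))) at_top sequentially"
  by (rule filterlim_compose[OF filterlim_real_sequentially filterlim_compose[OF filterlim_Suc filterlim_subseq[OF s]]])
 have R0: "(%n. 1 / real (Suc (s n))) ----> 0"
  using tendsto_inverse_0_at_top[OF Rinf] by (simp add: inverse_eq_divide)
 have uL: "L2 (u i)" if "i < k" for i by (rule H1_L2[OF uH[OF that]])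
 \<comment> \<open>The cosine lives in the ball of twice the cut-off radius, where
   \<open>loc\<close> gives closeness to the limit functions. The near parts therefore converge in
   L2 on the whole space.\<close>
 have hV: "(%n. nrm (%x. h n x - V x)) ----> 0"
 proof (rule tendsto_sandwich[OF _ _ tendsto_const])
  show "\<forall>\<^sub>F n in sequentially. 0 <= nrm (%x. h n x - V x)" by simp
  let ?g = "%n. (\<Sum>i<k. 1 / real (Suc (s n)) + \<bar>tht n i - de i\<bar> * nrm (u i)) + nrm (%x. cos (cut (real (Suc (s n))) x) * V x - V x)"
  have "?g ----> (\<Sum>i<k. 0 + \<bar>de i - de i\<bar> * nrm (u i)) + 0"
   by (intro tendsto_add tendsto_sum tendsto_mult tendsto_rabs tendsto_diff tendsto_const R0 thl nrm_cut_tendsto H1_L2 VH Rinf) auto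
  then show "?g ----> 0" by simp
  show "\<forall>\<^sub>F n in sequentially. nrm (%x. h n x - V x) <= ?g n"
  proof (rule always_eventually, rule allI)
   fix n
   let ?R = "real (Suc (s n))"
   define A where "A i x = tht n i * (cos (cut ?R x) * (U (s n) i x - u i x))" for i x
   define B where "B i x = (tht n i - de i) * (cos (cut ?R x) * u i x)" for i x
   have UL: "L2 (%x. U (s n) i x - u i x)" if "i < k" for i using that by (intro L2_diff uL H1_L2 rb_H1[OF rb])
   have cL: "L2 (%x. cos (cut ?R x) * f x)" if "L2 f" for f :: "'a => real"
    by (rule L2_mult_bdd[OF that cut_measurable(1), of _ 1]) simp_all
   have AL: "L2 (A i)" "L2 (B i)" if "i < k" for i
    unfolding A_def[abs_def] B_def[abs_def] using that by (intro L2_cmult cL UL uL; simp)+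
   have eq: "h n x - V x = (\<Sum>i<k. A i x + B i x) + (cos (cut ?R x) * V x - V x)" for x
   proof -
    have "(\<Sum>i<k. A i x + B i x) = (\<Sum>i<k. cos (cut ?R x) * (tht n i * U (s n) i x) - cos (cut ?R x) * (de i * u i x))"
     by (intro sum.cong refl) (simp add: A_def B_def algebra_simps)
    also have "... = h n x - cos (cut ?R x) * V x"
     by (simp add: sum_subtractf h_def G_def V_def cmb_def sum_distrib_left)
    finally show ?thesis by simp
   qed
   have VL: "L2 (%x. cos (cut ?R x) * V x - V x)" by (intro L2_diff cL H1_L2 VH)
   have "nrm (%x. h n x - V x) <= nrm (%x. \<Sum>i<k. A i x + B i x) + nrm (%x. cos (cut ?R x) * V x - V x)"
    unfolding eq using AL by (intro nrm_add L2_sum L2_add VL) auto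
   also have "nrm (%x. \<Sum>i<k. A i x + B i x) <= (\<Sum>i<k. nrm (%x. A i x + B i x))"
    using AL by (intro nrm_sum L2_add) auto
   also have "... <= (\<Sum>i<k. 1 / ?R + \<bar>tht n i - de i\<bar> * nrm (u i))"
   proof (rule sum_mono)
    fix i assume "i \<in> {..<k}"
    then have i: "i < k" by simp
    have "nrm (%x. A i x + B i x) <= nrm (A i) + nrm (B i)" using AL[OF i] by (rule nrm_add)
    moreover have "nrm (A i) <= 1 / ?R"
    proof -
     have "nrm2 (A i) <= nrm2 (%x. indicator (cball 0 (2 * ?R)) x * (U (s n) i x - u i x))"
     proof (rule nrm2_mono)
      show "L2 (%x. indicator (cball 0 (2 * ?R)) x * (U (s n) i x - u i x))" by (intro L2_indicator_mult UL i) simp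
      show "A i \<in> borel_measurable lebesgue" using AL(1)[OF i] by (simp add: L2_def)
      show "AE x in lebesgue. \<bar>A i x\<bar> <= \<bar>indicator (cball 0 (2 * ?R)) x * (U (s n) i x - u i x)\<bar>"
      proof (rule AE_I2)
       fix x
       show "\<bar>A i x\<bar> <= \<bar>indicator (cball 0 (2 * ?R)) x * (U (s n) i x - u i x)\<bar>"
       proof (cases "x \<in> cball 0 (2 * ?R)")
        case True
        have "\<bar>tht n i\<bar> * (\<bar>cos (cut ?R x)\<bar> * \<bar>U (s n) i x - u i x\<bar>) <= 1 * (1 * \<bar>U (s n) i x - u i x\<bar>)"
         by (intro mult_mono th[OF i]) auto
        then show ?thesis using True by (simp add: A_def abs_mult)
       next
        case False
        then have "cut ?R x = pi / 2" by (intro cut_outer) auto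
        then have "cos (cut ?R x) = 0" by (simp only: cos_pi_half)
        then show ?thesis by (simp add: A_def)
       qed
      qed
     qed
     then have "nrm (A i) <= nrm (%x. indicator (cball 0 (2 * ?R)) x * (U (s n) i x - u i x))" by (simp add: nrm_def)
     then show ?thesis using loc[OF i, of "s n"] by linarith
    qed
    moreover have "nrm (B i) <= \<bar>tht n i - de i\<bar> * nrm (u i)"
    proof -
     have "nrm2 (%x. cos (cut ?R x) * u i x) <= nrm2 (u i)"
     proof (rule nrm2_mono[OF uL[OF i]])
      show "(%x. cos (cut ?R x) * u i x) \<in> borel_measurable lebesgue" using cL[OF uL[OF i]] by (simp add: L2_def)
      have "\<bar>cos (cut ?R x)\<bar> * \<bar>u i x\<bar> <= 1 * \<bar>u i x\<bar>" for x by (intro mult_right_mono) auto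
      then show "AE x in lebesgue. \<bar>cos (cut ?R x) * u i x\<bar> <= \<bar>u i x\<bar>" by (intro AE_I2) (simp only: abs_mult mult_1)
     qed
     then have "nrm (%x. cos (cut ?R x) * u i x) <= nrm (u i)" by (simp add: nrm_def)
     then show ?thesis unfolding B_def[abs_def] nrm_cmult by (intro mult_left_mono) auto
    qed
    ultimately show "nrm (%x. A i x + B i x) <= 1 / ?R + \<bar>tht n i - de i\<bar> * nrm (u i)" by linarith
   qed
   finally show "nrm (%x. h n x - V x) <= ?g n" by simp
  qed
 qed
 have hn2: "(%n. nrm2 (h n)) ----> nrm2 V" by (rule nrm2_conv[OF H1_L2[OF hH] H1_L2[OF VH] hV])
 have h1: "nrm2 (h n) <= 1" for n
  using FG(2)[of "s n" "tht n"] n1[of n] nrm2_nonneg[of "F (s n) (tht n)"] unfolding h_def by linarith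
 have V1: "nrm2 V <= 1" by (rule LIMSEQ_le_const2[OF hn2]) (use h1 in auto)
 \<comment> \<open>Near and far energy together are bounded by IMS; the far part uses at least
   \<open>alp + 2 * epsr\<close> times its mass \<open>1 - nrm2 (h n)\<close>, and this is what
   remains for the near part.\<close>
 let ?C = "%n. L (s n) + kap TYPE('a) * (1 / real (Suc (s n)))\<^sup>2 - (alp + 2 * epsr) * (1 - nrm2 (h n))"
 have he: "en (h n) <= ?C n" for n
 proof -
  have "(alp + 2 * epsr) * nrm2 (F (s n) (tht n)) <= en (F (s n) (tht n))" using c(2)[of "q n"] by (simp add: s_def tht_def d_def)
  moreover have "nrm2 (F (s n) (tht n)) = 1 - nrm2 (h n)" using FG(2)[of "s n" "tht n"] n1[of n] by (simp add: h_def)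
  moreover have "en (cmb k (tht n) (U (s n))) <= L (s n)" using rb_bound[OF rb, of "tht n" "s n"] n1[of n] by simp
  ultimately show ?thesis using FG(1)[of "s n" "tht n"] n1[of n] by (simp add: h_def power_divide)
 qed
 have "?C ----> alp + kap TYPE('a) * 0\<^sup>2 - (alp + 2 * epsr) * (1 - nrm2 V)"
  by (intro tendsto_add tendsto_diff tendsto_mult tendsto_power tendsto_const R0 hn2
    LIMSEQ_subseq_LIMSEQ[OF La s, unfolded o_def])
 from en_lsc_L2(2)[OF hH H1_L2[OF VH] hV he this]
 have "en V <= (alp + 2 * epsr) * nrm2 V - 2 * epsr" by (simp add: algebra_simps)
 moreover have "epsr * nrm2 V <= epsr" using V1 e by (simp add: mult_left_le)
 moreover have "(alp + 2 * epsr) * nrm2 V = alp * nrm2 V + 2 * (epsr * nrm2 V)" "(alp + epsr) * nrm2 V = alp * nrm2 V + epsr * nrm2 V"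
  by (simp_all add: algebra_simps)
 \<comment> \<open>V has mass at most 1, so the deficit \<open>2 * epsr\<close> outweighs
   \<open>epsr * nrm2 V\<close>. The form at level \<open>alp + epsr\<close> is thus negative at V,
   although it is nonnegative along the converging coefficients.\<close>
 ultimately have neg: "en V - (alp + epsr) * nrm2 V < 0" using e by linarith
 let ?B = "%i j. eb (u i) (u j) - (alp + epsr) * ip (u i) (u j)"
 have B: "en (cmb k c u) - (alp + epsr) * nrm2 (cmb k c u) = Bf k ?B c c" for c
  unfolding Bf_diff_scale using en_cmb[of k u c, OF uH] nrm2_cmb[of k u c, OF uL] by simp
 have "(%n. Bf k ?B (tht n) (tht n)) ----> Bf k ?B de de" by (rule Bf_tendsto[OF thl])
 moreover have "0 <= Bf k ?B (tht n) (tht n)" for n using pos[of "c (q n)"] unfolding B by (simp add: tht_def d_def)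
 ultimately have "0 <= Bf k ?B de de" by (intro LIMSEQ_le_const) auto
 then show False using neg unfolding B[symmetric] V_def by simp
qed

lemma measure_le_real: "A \<in> sets M ==> 0 <= m ==> emeasure M A <= ennreal m ==> measure M A <= m"
 unfolding measure_def by (rule enn2real_leI)

lemma emeasure_finite_eq: "emeasure M A <= ennreal m ==> emeasure M A = ennreal (measure M A)"
 using ennreal_less_top[of m] by (intro emeasure_eq_ennreal_measure) (auto simp: top_unique)

lemma nrm2_unitv:
 assumes "!!c. nrm2 (cmb k c u) = (\<Sum>i<k. (c i)\<^sup>2)" "i < k" shows "nrm2 (u i) = 1"
proof -
 have "nrm2 (u i) = (\<Sum>j<k. (unitv i j)\<^sup>2)" using assms(1)[of "unitv i"] cmb_unitv[OF assms(2), of u] by simp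
 also have "... = (\<Sum>j<k. if i = j then 1 else 0)" by (intro sum.cong) (auto simp: unitv_def)
 finally show ?thesis using assms(2) by simp
qed

text \<open>The inertia of the form at level \<open>alp + epsr\<close> decides: negative directions
  are realized by the limit tuple, and each remaining direction is replaced by far parts of the
  sequence. Volume is lower semicontinuous on balls, so the far supports fit into what the limit set
  leaves of m, up to de.\<close>

lemma splitting:
 fixes u :: "nat => 'a::euclidean_space => real" and U :: "nat => nat => 'a => real"
 assumes D: "D \<in> sets lebesgue" and m: "0 <= m" and meas: "!!n. emeasure lebesgue (D \<union> supp k (U n)) <= ennreal m"
  and on: "!!n c. nrm2 (cmb k c (U n)) = (\<Sum>i<k. (c i)\<^sup>2)" and rb: "!!n. rb k (L n) (U n)" and La: "L ----> alp"
  and a: "0 <= alp" and uL: "!!i. i < k ==> L2 (u i)" and ae: "!!i. i < k ==> AE x in lebesgue. (%n. U n i x) ----> u i x"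
  and loc: "!!i R. i < k ==> (%n. nrm (%x. indicator (cball 0 (real R)) x * (U n i x - u i x))) ----> 0"
 shows "(\<forall>i<k. u i \<in> H1) & emeasure lebesgue (D \<union> supp k u) <= ennreal m &
  (\<exists>l\<le>k. \<forall>epsr>0. (\<exists>w. rb (k - l) (alp + epsr) (%i. cmb k (w i) u)) &
   (\<forall>de>0. ST TYPE('a) l (ennreal (m - measure lebesgue (D \<union> supp k u) + de)) (alp + epsr)))"
proof -
 define A where "A = D \<union> supp k u"
 define E where "E n = D \<union> supp k (U n)" for n
 have UL: "L2 (U n i)" if "i < k" for n i by (rule H1_L2[OF rb_H1[OF rb that]])
 have sets: "A \<in> sets lebesgue" "E n \<in> sets lebesgue" for n
  using D supp_sets[of k u, OF uL] rb_supp_sets[OF rb, of n] by (auto simp: A_def E_def)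
 have lim: "emeasure lebesgue (A \<inter> B) <= liminf (%n. emeasure lebesgue (E n \<inter> B))" if "B \<in> sets lebesgue" for B
  unfolding A_def E_def by (rule supp_liminf[OF D that uL UL ae])
 have En: "en (U n i) <= L n" if "i < k" for n i
  using rb_bound[OF rb, of "unitv i" n] nrm2_unitv[OF on that, of n] cmb_unitv[OF that, of "U n"] by simp
 have uH: "u i \<in> H1" if "i < k" for i
  using en_lsc(1)[of "%n. U n i", OF rb_H1[OF rb that] uL[OF that] ae[OF that] En[OF that] La] .
 have mA: "emeasure lebesgue A <= ennreal m"
 proof -
  have "emeasure lebesgue (A \<inter> UNIV) <= liminf (%n. emeasure lebesgue (E n \<inter> UNIV))" by (rule lim) auto
  also have "... <= liminf (%n. ennreal m)" using meas by (intro Liminf_mono always_eventually) (auto simp: E_def)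
  finally show ?thesis by (simp add: Liminf_const)
 qed
 have fin: "emeasure lebesgue (A \<inter> B) <= ennreal m" "emeasure lebesgue (E n \<inter> B) <= ennreal m" if "B \<in> sets lebesgue" for B n
  using emeasure_mono[of "A \<inter> B" A lebesgue] emeasure_mono[of "E n \<inter> B" "E n" lebesgue] sets mA meas[of n] that
  by (auto simp: E_def intro: order_trans)
 \<comment> \<open>Selects one index for each radius: closeness on the ball of radius 2(j+1), which
   holds the support of the near cut-off, and nearly the full volume of the limit set inside the
   ball of radius j+1.\<close>
 have "\<exists>n\<ge>j. (\<forall>i\<in>{..<k}. nrm (%x. indicator (cball 0 (2 * real (Suc j))) x * (U n i x - u i x)) <= 1 / real (Suc j)) &
   measure lebesgue (A \<inter> ball 0 (real (Suc j))) - 1 / real (Suc j) <= measure lebesgue (E n \<inter> ball 0 (real (Suc j)))" for j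
 proof -
  let ?b = "ball (0::'a) (real (Suc j))"
  have e1: "\<forall>\<^sub>F n in sequentially. \<forall>i\<in>{..<k}. nrm (%x. indicator (cball 0 (2 * real (Suc j))) x * (U n i x - u i x)) <= 1 / real (Suc j)"
  proof (intro eventually_ball_finite ballI)
   fix i assume "i \<in> {..<k}"
   then have "(%n. nrm (%x. indicator (cball 0 (real (2 * Suc j))) x * (U n i x - u i x))) ----> 0" by (intro loc) auto
   then have "\<forall>\<^sub>F n in sequentially. nrm (%x. indicator (cball 0 (real (2 * Suc j))) x * (U n i x - u i x)) < 1 / real (Suc j)"
    by (rule order_tendstoD) simp
   then show "\<forall>\<^sub>F n in sequentially. nrm (%x. indicator (cball 0 (2 * real (Suc j))) x * (U n i x - u i x)) <= 1 / real (Suc j)"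
    by (rule eventually_mono) (simp only: of_nat_mult of_nat_numeral less_imp_le)
  qed simp
  have e2: "\<forall>\<^sub>F n in sequentially. measure lebesgue (A \<inter> ?b) - 1 / real (Suc j) <= measure lebesgue (E n \<inter> ?b)"
  proof (cases "measure lebesgue (A \<inter> ?b) - 1 / real (Suc j) < 0")
   case True
   then show ?thesis by (intro always_eventually allI) (meson less_imp_le measure_nonneg order_trans)
  next
   case False
   have "ennreal (measure lebesgue (A \<inter> ?b) - 1 / real (Suc j)) < ennreal (measure lebesgue (A \<inter> ?b))"
    using False by (subst ennreal_less_iff) (auto simp: not_less)
   also have "... = emeasure lebesgue (A \<inter> ?b)" using fin(1)[of ?b] by (intro emeasure_finite_eq[symmetric]) auto
   also have "... <= liminf (%n. emeasure lebesgue (E n \<inter> ?b))" by (rule lim) auto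
   finally have "\<forall>\<^sub>F n in sequentially. ennreal (measure lebesgue (A \<inter> ?b) - 1 / real (Suc j)) < emeasure lebesgue (E n \<inter> ?b)"
    by (rule less_LiminfD)
   then show ?thesis
   proof (rule eventually_mono)
    fix n assume n: "ennreal (measure lebesgue (A \<inter> ?b) - 1 / real (Suc j)) < emeasure lebesgue (E n \<inter> ?b)"
    have "emeasure lebesgue (E n \<inter> ?b) = ennreal (measure lebesgue (E n \<inter> ?b))" using fin(2)[of ?b n] by (intro emeasure_finite_eq) auto
    then show "measure lebesgue (A \<inter> ?b) - 1 / real (Suc j) <= measure lebesgue (E n \<inter> ?b)"
     using n False by (simp add: ennreal_less_iff not_less)
   qed
  qed
  show ?thesis
   using eventually_conj[OF eventually_ge_at_top[of j] eventually_conj[OF e1 e2]]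
   by (rule eventually_happens'[OF sequentially_bot, THEN exE]) blast
 qed
 then have "\<forall>j. \<exists>n\<ge>j. (\<forall>i\<in>{..<k}. nrm (%x. indicator (cball 0 (2 * real (Suc j))) x * (U n i x - u i x)) <= 1 / real (Suc j)) &
   measure lebesgue (A \<inter> ball 0 (real (Suc j))) - 1 / real (Suc j) <= measure lebesgue (E n \<inter> ball 0 (real (Suc j)))" by blast
 from choice[OF this] obtain N where N: "!!j. j <= N j"
  "!!j i. i < k ==> nrm (%x. indicator (cball 0 (2 * real (Suc j))) x * (U (N j) i x - u i x)) <= 1 / real (Suc j)"
  "!!j. measure lebesgue (A \<inter> ball 0 (real (Suc j))) - 1 / real (Suc j) <= measure lebesgue (E (N j) \<inter> ball 0 (real (Suc j)))"
  by auto
 have "filterlim N at_top sequentially"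
  by (rule filterlim_at_top_mono[OF filterlim_ident]) (use N(1) in auto)
 then have LN: "(%j. L (N j)) ----> alp" by (rule filterlim_compose[OF La])
 have mlim: "(%j. measure lebesgue (A \<inter> ball 0 (real (Suc j))) - 1 / real (Suc j)) ----> measure lebesgue A"
 proof -
  have "(\<Union>j. A \<inter> ball 0 (real (Suc j))) = A"
  proof -
   have "\<exists>j. norm x < real (Suc j)" for x :: 'a using reals_Archimedean2[of "norm x"] by (meson less_Suc_eq of_nat_less_iff order_less_trans lessI)
   then show ?thesis by auto
  qed
  then have U: "emeasure lebesgue (\<Union>j. A \<inter> ball 0 (real (Suc j))) ~= \<infinity>" using mA by (auto simp: top_unique)
  have "(%j. measure lebesgue (A \<inter> ball 0 (real (Suc j)))) ----> measure lebesgue (\<Union>j. A \<inter> ball 0 (real (Suc j)))"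
   by (rule Lim_measure_incseq[OF _ _ U]) (use sets in \<open>auto simp: incseq_def\<close>)
  then have "(%j. measure lebesgue (A \<inter> ball 0 (real (Suc j))) - 1 / real (Suc j)) ----> measure lebesgue A - 0"
   unfolding \<open>(\<Union>j. A \<inter> ball 0 (real (Suc j))) = A\<close>
   using LIMSEQ_inverse_real_of_nat by (intro tendsto_diff) (simp_all add: inverse_eq_divide)
  then show ?thesis by simp
 qed
 let ?P = "%l epsr. (\<exists>w. rb (k - l) (alp + epsr) (%i. cmb k (w i) u)) &
   (\<forall>de>0. ST TYPE('a) l (ennreal (m - measure lebesgue A + de)) (alp + epsr))"
 \<comment> \<open>The far part reaches the level \<open>alp + 2 * epsr\<close>, whence the argument
   2 * epsr. Here l counts the nonnegative directions and may vary with epsr.\<close>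
 have P: "\<exists>l\<in>{..k}. ?P l (2 * epsr)" if e: "0 < epsr" for epsr
 proof -
  let ?B = "%i j. eb (u i) (u j) - (alp + epsr) * ip (u i) (u j)"
  have B: "Bf k ?B c c = en (cmb k c u) - (alp + epsr) * nrm2 (cmb k c u)" for c
   unfolding Bf_diff_scale using en_cmb[of k u c, OF uH] nrm2_cmb[of k u c, OF uL] by simp
  have "\<exists>w p. p <= k & lind k k w &
   (\<forall>d. (\<forall>i<k. p <= i --> d i = 0) --> (\<exists>i<p. d i ~= 0) --> Bf k ?B (lin k d w) (lin k d w) < 0) &
   (\<forall>d. (\<forall>i<p. d i = 0) --> 0 <= Bf k ?B (lin k d w) (lin k d w)) &
   (\<forall>y. (\<forall>i<k. Bf k ?B (unitv i) y = 0) --> (\<forall>i<k. Bf k ?B (w i) y = 0))"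
   by (rule inertia[OF _ lind_unitv]) (simp only: ip_commute eb_commute)
  then obtain w p where w: "p <= k" "lind k k w"
   "!!d. \<forall>i<k. p <= i --> d i = 0 ==> \<exists>i<p. d i ~= 0 ==> Bf k ?B (lin k d w) (lin k d w) < 0"
   "!!d. \<forall>i<p. d i = 0 ==> 0 <= Bf k ?B (lin k d w) (lin k d w)" by auto
  define l where "l = k - p"
  have kl: "k - l = p" "l <= k" using w(1) by (auto simp: l_def)
  have neg: "Bf k ?B (lin p c w) (lin p c w) < 0" if "\<exists>i<p. c i ~= 0" for c
  proof -
   have "lin p c w = lin k (%i. if i < p then c i else 0) w"
   proof
    fix j
    have "lin k (%i. if i < p then c i else 0) w j = (\<Sum>i\<in>{..<p}. (if i < p then c i else 0) * w i j)"
     unfolding lin_def using w(1) by (intro sum.mono_neutral_right) auto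
    then show "lin p c w j = lin k (%i. if i < p then c i else 0) w j" by (simp add: lin_def)
   qed
   moreover have "\<exists>i<p. (if i < p then c i else 0) ~= 0" using that by force
   ultimately show ?thesis using w(3)[of "%i. if i < p then c i else 0"] by simp
  qed
  have "rb p (alp + epsr) (%i. cmb k (w i) u)"
  proof (rule rbI)
   show "cmb k (w i) u \<in> H1" for i by (rule cmb_H1[OF uH])
   show "c i = 0" if "nrm2 (cmb p c (%i. cmb k (w i) u)) = 0" "i < p" for c i
   proof (rule ccontr)
    assume "c i ~= 0"
    then have "Bf k ?B (lin p c w) (lin p c w) < 0" using neg that(2) by blast
    then have "en (cmb k (lin p c w) u) < 0" unfolding B using that(1) by (simp add: cmb_lin)
    then show False using en_nonneg[of "cmb k (lin p c w) u"] by linarith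
   qed
   fix c
   show "en (cmb p c (%i. cmb k (w i) u)) <= (alp + epsr) * nrm2 (cmb p c (%i. cmb k (w i) u))"
   proof (cases "\<exists>i<p. c i ~= 0")
    case True
    then show ?thesis using neg[OF True] unfolding B by (simp add: cmb_lin)
   next
    case False
    then have "cmb p c (%i. cmb k (w i) u) = (%x. 0)" by (auto simp: cmb_def[of p])
    then show ?thesis by (simp add: nrm2_def H1_zero(2))
   qed
  qed
  then have "rb (k - l) (alp + 2 * epsr) (%i. cmb k (w i) u)" unfolding kl by (rule rb_mono) (use e in simp)
  moreover have "ST TYPE('a) l (ennreal (m - measure lebesgue A + de)) (alp + 2 * epsr)" if d: "0 < de" for de
  proof -
   define w' where "w' i = w (p + i)" for i
   have l': "lin l c w' = lin k (%i. if i < p then 0 else c (i - p)) w" for c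
   proof
    fix j
    have "lin k (%i. if i < p then 0 else c (i - p)) w j = (\<Sum>i\<in>{p..<p+l}. (if i < p then 0 else c (i - p)) * w i j)"
     unfolding lin_def using w(1) by (intro sum.mono_neutral_right) (auto simp: l_def)
    also have "... = (\<Sum>i<l. c i * w (p + i) j)"
     using sum.shift_bounds_nat_ivl[of "%i. (if i < p then 0 else c (i - p)) * w i j" 0 p l] by (simp add: lessThan_atLeast0 add.commute)
    finally show "lin l c w' j = lin k (%i. if i < p then 0 else c (i - p)) w j" by (simp add: lin_def w'_def)
   qed
   have "lind k l w'"
    unfolding lind_def
   proof (intro allI impI)
    fix c i assume z: "\<forall>j<k. lin l c w' j = 0" and i: "i < l"
    have "\<forall>i<k. (if i < p then 0 else c (i - p)) = 0" using w(2) z unfolding lind_def l' by blast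
    moreover have "p + i < k" using i w(1) by (simp add: l_def)
    ultimately have "(if p + i < p then 0 else c (p + i - p)) = 0" by blast
    then show "c i = 0" by simp
   qed
   moreover have "0 <= en (cmb k (lin l c w') u) - (alp + epsr) * nrm2 (cmb k (lin l c w') u)" for c
    using w(4)[of "%i. if i < p then 0 else c (i - p)"] unfolding l'[symmetric] B by simp
   ultimately have e1: "\<forall>\<^sub>F j in sequentially. rb l (alp + 2 * epsr) (%i x. sin (cut (real (Suc j)) x) * cmb k (w' i) (U (N j)) x)"
    by (intro escaping_part[of k "%j. U (N j)" "%j. L (N j)", OF on rb LN uH N(2) e a]) auto
   have e2: "\<forall>\<^sub>F j in sequentially. measure lebesgue A - de < measure lebesgue (A \<inter> ball 0 (real (Suc j))) - 1 / real (Suc j)"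
    using mlim by (rule order_tendstoD) (use d in simp)
   obtain j where j: "rb l (alp + 2 * epsr) (%i x. sin (cut (real (Suc j)) x) * cmb k (w' i) (U (N j)) x)"
    "measure lebesgue A - de < measure lebesgue (A \<inter> ball 0 (real (Suc j))) - 1 / real (Suc j)"
    using eventually_happens'[OF sequentially_bot eventually_conj[OF e1 e2]] by blast
   let ?b = "ball (0::'a) (real (Suc j))" and ?E = "E (N j)"
   let ?z = "%i x. sin (cut (real (Suc j)) x) * cmb k (w' i) (U (N j)) x"
   \<comment> \<open>The sine vanishes on the ball, where the approximating set already has nearly
     the volume of A; only the rest of m remains for the far tuple.\<close>
   have "supp l ?z \<subseteq> ?E - ?b"
   proof
    fix x assume "x \<in> supp l ?z"
    then obtain i where i: "sin (cut (real (Suc j)) x) ~= 0" "cmb k (w' i) (U (N j)) x ~= 0" by (auto simp: supp_def)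
    have "x \<in> supp k (U (N j))" using cmb_supp[of x k "U (N j)"] i(2) by blast
    moreover have "x \<notin> ?b"
    proof
     assume "x \<in> ?b"
     then have "cut (real (Suc j)) x = 0" by (intro cut_inner) auto
     then show False using i(1) by simp
    qed
    ultimately show "x \<in> ?E - ?b" by (simp add: E_def)
   qed
   then have "emeasure lebesgue (supp l ?z) <= emeasure lebesgue (?E - ?b)" using sets by (intro emeasure_mono) auto
   also have "... = ennreal (measure lebesgue (?E - ?b))"
    using fin(2)[of "- ?b" "N j"] by (intro emeasure_finite_eq[of _ _ m]) (simp add: Diff_eq)
   also have "measure lebesgue (?E - ?b) <= m - measure lebesgue A + de"
   proof -
    have f: "emeasure lebesgue (?E \<inter> ?b) ~= \<infinity>" "emeasure lebesgue (?E - ?b) ~= \<infinity>"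
     using fin(2)[of ?b "N j"] fin(2)[of "- ?b" "N j"] by (auto simp: Diff_eq top_unique)
    have "measure lebesgue ((?E \<inter> ?b) \<union> (?E - ?b)) = measure lebesgue (?E \<inter> ?b) + measure lebesgue (?E - ?b)"
     using sets by (intro measure_Union f) auto
    moreover have "(?E \<inter> ?b) \<union> (?E - ?b) = ?E" by auto
    moreover have "measure lebesgue ?E <= m" using meas[of "N j"] by (intro measure_le_real sets m) (simp add: E_def)
    ultimately show ?thesis using N(3)[of j] j(2) by simp
   qed
   finally have "emeasure lebesgue (supp l ?z) <= ennreal (m - measure lebesgue A + de)" by (simp add: ennreal_leI)
   then show ?thesis using j(1) unfolding ST_def by blast
  qed
  ultimately show ?thesis using kl(2) by blast
 qed
 \<comment> \<open>Finitely many values of l serve infinitely many levels, so one l works along a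
   null sequence of levels and then, by monotonicity, at every level.\<close>
 have "\<forall>n\<in>(UNIV::nat set). \<exists>l\<in>{..k}. ?P l (2 * (1 / real (Suc n)))" by (intro ballI P) simp
 from pigeonhole_infinite_rel[OF infinite_UNIV_nat finite_atMost this]
 obtain l where l: "l <= k" "infinite {n \<in> UNIV. ?P l (2 * (1 / real (Suc n)))}" by auto
 have "?P l epsr" if e: "0 < epsr" for epsr
 proof -
  obtain n0 where n0: "2 / epsr < real n0" using reals_Archimedean2 by blast
  define S where "S = {n \<in> UNIV. ?P l (2 * (1 / real (Suc n)))}"
  have "\<forall>m. \<exists>n\<ge>m. n \<in> S" using l(2) unfolding S_def[symmetric] infinite_nat_iff_unbounded_le .
  then obtain n where n': "n0 <= n" "n \<in> S" by blast
  have n: "n0 <= n" "?P l (2 * (1 / real (Suc n)))" using n' unfolding S_def by simp_all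
  have "2 / epsr < real (Suc n)" using n0 n(1) by linarith
  then have "2 * (1 / real (Suc n)) <= epsr" using e by (simp add: field_simps)
  then have le: "alp + 2 * (1 / real (Suc n)) <= alp + epsr" by simp
  show ?thesis using n(2) rb_mono[OF _ le] ST_mono[OF _ order_refl le] by blast
 qed
 then show ?thesis using uH mA l(1) unfolding A_def by blast
qed

subsection \<open>Minimal sets\<close>

text \<open>A witnessed form of the eigenvalue bound: a subspace satisfying it exists, so attainment
  is part of the assertion.\<close>

definition ev :: "'a::euclidean_space set => nat => real => bool" where
 "ev Om k Lar \<longleftrightarrow> (\<exists>u. (\<forall>i<k. u i \<in> H10 Om) & rb k Lar u)"

lemma ev_mono: "ev Om k Lar ==> Lar <= Lar' ==> ev Om k Lar'"
 unfolding ev_def by (blast intro: rb_mono)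

lemma ev_mono_qe: "ev A k Lar ==> cap (A - B) = 0 ==> ev B k Lar"
 unfolding ev_def by (blast intro: H10_mono_qe)

lemma ev_mono_set: "ev A k Lar ==> A \<subseteq> B ==> ev B k Lar"
 unfolding ev_def by (blast intro: H10_mono)

lemma rb_normalize:
 assumes u: "rb k Lar u"
 shows "\<exists>w. rb k Lar (%i. cmb k (w i) u) & (\<forall>c. nrm2 (cmb k c (%i. cmb k (w i) u)) = (\<Sum>i<k. (c i)\<^sup>2))"
proof -
 obtain w where w: "lind k k w" "!!c. nrm2 (cmb k c (%i. cmb k (w i) u)) = (\<Sum>i<k. (c i)\<^sup>2)"
  by (rule gram_schmidt_L2[of k u]) (use u rb_H1[OF u] H1_L2 in \<open>auto simp: rb_def\<close>)
 then show ?thesis using rb_lind[OF u w(1)] by blast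
qed

section \<open>Compactness on a set of finite volume\<close>

lemma tail_measure:
 fixes A :: "'a::euclidean_space set"
 assumes A: "A \<in> sets lebesgue" "emeasure lebesgue A < \<infinity>" and a: "0 < a"
 shows "\<exists>n. emeasure lebesgue (A - ball 0 (real (Suc n))) < ennreal a"
proof -
 let ?F = "%n. A - ball 0 (real (Suc n))"
 have "(%n. emeasure lebesgue (?F n)) ----> emeasure lebesgue (\<Inter>n. ?F n)"
 proof (rule Lim_emeasure_decseq)
  show "range ?F \<subseteq> sets lebesgue" using A by auto
  show "decseq ?F" by (auto simp: decseq_def)
  show "emeasure lebesgue (?F n) ~= \<infinity>" for n
   using emeasure_mono[of "?F n" A lebesgue] A by (auto simp: top_unique)
 qed
 moreover have "(\<Inter>n. ?F n) = {}"
 proof -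
  have "\<exists>n. norm x < real (Suc n)" for x :: 'a
   using reals_Archimedean2[of "norm x"] by (meson less_Suc_eq of_nat_less_iff order_less_trans lessI)
  then show ?thesis by auto
 qed
 ultimately have "(%n. emeasure lebesgue (?F n)) ----> 0" by (simp only: emeasure_empty)
 then have "\<forall>\<^sub>F n in sequentially. emeasure lebesgue (?F n) < ennreal a" using a by (intro order_tendstoD) auto
 then show ?thesis by (auto simp: eventually_sequentially)
qed

text \<open>The far part of u lives on A outside a large ball, a set of small volume, where Poincare
  holds with a small constant; this is uniform in u.\<close>

lemma tight:
 fixes A :: "'a::euclidean_space set"
 assumes A: "A \<in> sets lebesgue" "emeasure lebesgue A < \<infinity>" and epsr: "0 < epsr" and C: "0 <= C"
 shows "\<exists>R::nat. \<forall>u\<in>H1. (AE x in lebesgue. x \<notin> A --> u x = 0) --> en u <= C --> nrm2 u <= 1 -->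
  nrm (%x. indicator (- cball 0 (real R)) x * u x) <= epsr"
proof -
 define K where "K = C + kap TYPE('a)"
 have K: "0 <= K" using C by (simp add: K_def kap_def)
 \<comment> \<open>K bounds the energy of the far part, and this e makes the Poincare factor
   \<open>2 * e * d\<close> times sqrt K at most epsr.\<close>
 define e where "e = epsr / (2 * DIM('a) * (sqrt K + 1))"
 have e: "0 < e" using epsr K by (simp add: e_def add_nonneg_pos)
 obtain a where a: "0 < a" "!!(u::'a => real) A. u \<in> H1 ==> A \<in> sets lebesgue ==> emeasure lebesgue A <= ennreal a ==>
  (AE x in lebesgue. x \<notin> A --> u x = 0) ==> nrm u <= 2 * e * DIM('a) * sqrt (en u)"
  by (rule poincare[OF e]) blast
 obtain n where n: "emeasure lebesgue (A - ball 0 (real (Suc n))) < ennreal a" using tail_measure[OF A a(1)] by blast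
 let ?r = "real (Suc n)"
 show ?thesis
 proof (intro exI[of _ "2 * Suc n"] ballI impI)
  fix u :: "'a => real"
  assume u: "u \<in> H1" and z: "AE x in lebesgue. x \<notin> A --> u x = 0" and b: "en u <= C" "nrm2 u <= 1"
  let ?f = "%x. sin (cut ?r x) * u x"
  have f: "?f \<in> H1" by (rule cut_IMS(2)[OF u]) simp
  have fe: "en ?f <= K"
  proof -
   have "1 <= ?r\<^sup>2" by (intro one_le_power) simp
   then have "kap TYPE('a) / ?r\<^sup>2 <= kap TYPE('a) / 1" by (intro divide_left_mono) (auto simp: kap_def)
   then have "kap TYPE('a) / ?r\<^sup>2 * nrm2 u <= kap TYPE('a) * 1" using b by (intro mult_mono) (auto simp: kap_def)
   moreover have "en (%x. cos (cut ?r x) * u x) + en ?f <= en u + kap TYPE('a) / ?r\<^sup>2 * nrm2 u"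
    by (rule cut_IMS(3)[OF u]) simp
   ultimately show ?thesis using b en_nonneg[of "%x. cos (cut ?r x) * u x"] unfolding K_def by linarith
  qed
  have "nrm ?f <= 2 * e * DIM('a) * sqrt (en ?f)"
  proof (rule a(2)[OF f _ less_imp_le[OF n]])
   show "A - ball 0 ?r \<in> sets lebesgue" using A by auto
   show "AE x in lebesgue. x \<notin> A - ball 0 ?r --> ?f x = 0"
    using z
   proof eventually_elim
    case (elim x)
    show ?case
    proof (cases "x \<in> ball 0 ?r")
     case True
     then have "cut ?r x = 0" by (intro cut_inner) auto
     then show ?thesis by simp
    qed (use elim in auto)
   qed
  qed
  also have "... <= 2 * e * DIM('a) * sqrt K" using e fe by (intro mult_left_mono real_sqrt_le_mono) auto
  also have "... = epsr * (sqrt K / (sqrt K + 1))" by (simp add: e_def)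
  also have "... <= epsr * 1" using K epsr by (intro mult_left_mono) (auto simp: divide_le_eq add_nonneg_pos)
  finally have fn: "nrm ?f <= epsr" by simp
  have "nrm2 (%x. indicator (- cball 0 (real (2 * Suc n))) x * u x) <= nrm2 ?f"
  proof (rule nrm2_mono[OF H1_L2[OF f]])
   show "(%x. indicator (- cball 0 (real (2 * Suc n))) x * u x) \<in> borel_measurable lebesgue"
    using L2_indicator_mult[OF H1_L2[OF u], of "- cball 0 (real (2 * Suc n))"] by (simp add: L2_def)
   show "AE x in lebesgue. \<bar>indicator (- cball 0 (real (2 * Suc n))) x * u x\<bar> <= \<bar>?f x\<bar>"
   proof (rule AE_I2)
    fix x :: 'a
    show "\<bar>indicator (- cball 0 (real (2 * Suc n))) x * u x\<bar> <= \<bar>?f x\<bar>"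
    proof (cases "x \<in> cball 0 (real (2 * Suc n))")
     case False
     then have "2 * ?r <= norm x" by simp
     then have "cut ?r x = pi / 2" by (intro cut_outer) simp_all
     then have "sin (cut ?r x) = 1" by (simp only: sin_pi_half)
     then show ?thesis using False by simp
    qed simp
   qed
  qed
  then have "nrm (%x. indicator (- cball 0 (real (2 * Suc n))) x * u x) <= nrm ?f" by (simp add: nrm_def)
  then show "nrm (%x. indicator (- cball 0 (real (2 * Suc n))) x * u x) <= epsr" using fn by linarith
 qed
qed

lemma cmb_conv:
 assumes "!!n i. i < k ==> L2 (U n i)" "!!i. i < k ==> L2 (u i)" "!!i. i < k ==> (%n. nrm (%x. U n i x - u i x)) ----> 0"
 shows "(%n. nrm (%x. cmb k c (U n) x - cmb k c u x)) ----> 0"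
proof (rule tendsto_sandwich[OF _ _ tendsto_const])
 have "(%n. \<Sum>i<k. \<bar>c i\<bar> * nrm (%x. U n i x - u i x)) ----> (\<Sum>i<k. \<bar>c i\<bar> * 0)"
  using assms by (intro tendsto_intros) auto
 then show "(%n. \<Sum>i<k. \<bar>c i\<bar> * nrm (%x. U n i x - u i x)) ----> 0" by simp
 have "nrm (%x. cmb k c (U n) x - cmb k c u x) <= (\<Sum>i<k. \<bar>c i\<bar> * nrm (%x. U n i x - u i x))" for n
 proof -
  have "cmb k c (U n) x - cmb k c u x = cmb k c (%i x. U n i x - u i x) x" for x
   by (simp add: cmb_def right_diff_distrib sum_subtractf)
  moreover have "L2 (%x. U n i x - u i x)" if "i < k" for i using assms(1,2) that by (intro L2_diff)
  ultimately show ?thesis using nrm_cmb_le[of k "%i x. U n i x - u i x" c] by simp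
 qed
 then show "\<forall>\<^sub>F n in sequentially. nrm (%x. cmb k c (U n) x - cmb k c u x) <= (\<Sum>i<k. \<bar>c i\<bar> * nrm (%x. U n i x - u i x))"
  by simp
qed simp

text \<open>All functions live on the same set A, so no mass escapes and local convergence becomes
  global. Orthonormality then passes to the limit, and semicontinuity of the energy gives the
  Rayleigh bound.\<close>

lemma compact_tuple:
 fixes U :: "nat => nat => 'a::euclidean_space => real"
 assumes A: "A \<in> sets lebesgue" "emeasure lebesgue A < \<infinity>"
  and on: "!!n c. nrm2 (cmb k c (U n)) = (\<Sum>i<k. (c i)\<^sup>2)" and rb: "!!n. rb k (L n) (U n)" and La: "L ----> Lar"
  and z: "!!n i. i < k ==> AE x in lebesgue. x \<notin> A --> U n i x = 0"
 shows "\<exists>r u. strict_mono (r :: nat => nat) & rb k Lar u & (\<forall>i<k. (%n. nrm (%x. U (r n) i x - u i x)) ----> 0)"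
proof -
 have "Bseq L" using La by (intro convergent_imp_Bseq convergentI)
 then obtain K where K: "!!n. \<bar>L n\<bar> <= K" by (auto simp: Bseq_def)
 have K0: "0 <= K" using K[of 0] by linarith
 have UH: "U n i \<in> H1" if "i < k" for n i by (rule rb_H1[OF rb that])
 have U1: "nrm2 (U n i) = 1" if "i < k" for n i by (rule nrm2_unitv[OF on that])
 have Ue: "en (U n i) <= L n" if "i < k" for n i
  using rb_bound[OF rb, of "unitv i" n] U1[OF that, of n] cmb_unitv[OF that, of "U n"] by simp
 have UK: "en (U n i) <= K" if "i < k" for n i using Ue[OF that, of n] K[of n] by linarith
 have "\<exists>r u. strict_mono (r :: nat => nat) & (\<forall>i<k. L2 (u i) & (AE x in lebesgue. (%n. U (r n) i x) ----> u i x) &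
  (\<forall>R::nat. (%n. nrm (%x. indicator (cball 0 (real R)) x * (U (r n) i x - u i x))) ----> 0))"
  by (rule rellich_tuple[of k U 1 K, OF UH _ UK]) (simp_all add: nrm_def U1)
 then obtain r u where r: "strict_mono (r :: nat => nat)" and u: "!!i. i < k ==> L2 (u i)"
  "!!i. i < k ==> AE x in lebesgue. (%n. U (r n) i x) ----> u i x"
  "!!i R. i < k ==> (%n. nrm (%x. indicator (cball 0 (real R)) x * (U (r n) i x - u i x))) ----> 0" by auto
 have uH: "u i \<in> H1" "en (u i) <= K" if "i < k" for i
  using en_lsc[of "%n. U (r n) i" "u i" "%n. K" K, OF UH[OF that] u(1)[OF that] u(2)[OF that] UK[OF that] tendsto_const] by auto
 have u1: "nrm2 (u i) <= 1" if "i < k" for i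
 proof (rule fatou_nrm2(2))
  show "L2 (U (r n) i)" for n by (rule H1_L2[OF UH[OF that]])
  show "u i \<in> borel_measurable lebesgue" using u(1)[OF that] by (simp add: L2_def)
  show "AE x in lebesgue. (%n. U (r n) i x) ----> u i x" by (rule u(2)[OF that])
  show "nrm2 (U (r n) i) <= 1" for n using U1[OF that] by simp
 qed (rule tendsto_const)
 have uz: "AE x in lebesgue. x \<notin> A --> u i x = 0" if "i < k" for i
 proof -
  have "AE x in lebesgue. \<forall>n. x \<notin> A --> U (r n) i x = 0" using z[OF that] unfolding AE_all_countable by blast
  with u(2)[OF that] show ?thesis
  proof eventually_elim
   case (elim x)
   show ?case
   proof
    assume "x \<notin> A"
    then have "(%n. U (r n) i x) = (%n. 0)" using elim by auto
    then show "u i x = 0" using elim(1) LIMSEQ_const_iff[of 0 "u i x"] by simp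
   qed
  qed
 qed
 have conv: "(%n. nrm (%x. U (r n) i x - u i x)) ----> 0" if i: "i < k" for i
 proof (rule tendstoI)
  fix e :: real assume e: "0 < e"
  obtain R :: nat where R: "!!v. v \<in> H1 ==> (AE x in lebesgue. x \<notin> A --> v x = 0) ==> en v <= K ==> nrm2 v <= 1 ==>
   nrm (%x. indicator (- cball 0 (real R)) x * v x) <= e / 4" using tight[OF A, of "e/4" K] e K0 by auto
  have "\<forall>\<^sub>F n in sequentially. nrm (%x. indicator (cball 0 (real R)) x * (U (r n) i x - u i x)) < e / 4"
   using u(3)[OF i, of R] by (rule order_tendstoD) (use e in simp)
  then show "\<forall>\<^sub>F n in sequentially. dist (nrm (%x. U (r n) i x - u i x)) 0 < e"
  proof (rule eventually_mono)
   fix n assume n: "nrm (%x. indicator (cball 0 (real R)) x * (U (r n) i x - u i x)) < e / 4"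
   let ?o = "indicator (- cball (0::'a) (real R)) :: 'a => real"
   have UL: "L2 (U (r n) i)" by (rule H1_L2[OF UH[OF i]])
   have L: "L2 (%x. indicator (cball 0 (real R)) x * (U (r n) i x - u i x))" "L2 (%x. ?o x * U (r n) i x)" "L2 (%x. ?o x * u i x)"
    by (intro L2_indicator_mult L2_diff UL u(1)[OF i]; simp)+
   have "nrm (%x. U (r n) i x - u i x) = nrm (%x. indicator (cball 0 (real R)) x * (U (r n) i x - u i x) + (?o x * U (r n) i x - ?o x * u i x))"
    by (rule arg_cong[of _ _ nrm]) (auto simp: indicator_def)
   also have "... <= nrm (%x. indicator (cball 0 (real R)) x * (U (r n) i x - u i x)) + nrm (%x. ?o x * U (r n) i x - ?o x * u i x)"
    by (intro nrm_add L2_diff L)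
   also have "nrm (%x. ?o x * U (r n) i x - ?o x * u i x) <= nrm (%x. ?o x * U (r n) i x) + nrm (%x. ?o x * u i x)"
    by (intro nrm_diff L)
   also have "nrm (%x. ?o x * U (r n) i x) <= e / 4" by (rule R[OF UH[OF i] z[OF i] UK[OF i]]) (simp add: U1[OF i])
   also have "nrm (%x. ?o x * u i x) <= e / 4" by (rule R[OF uH(1)[OF i] uz[OF i] uH(2)[OF i] u1[OF i]])
   finally show "dist (nrm (%x. U (r n) i x - u i x)) 0 < e" using n e by (simp add: dist_real_def)
  qed
 qed
 have cH: "cmb k c (U n) \<in> H1" for c n by (rule cmb_H1[OF UH])
 have cL: "L2 (cmb k c u)" for c by (rule cmb_L2[OF u(1)])
 have cc: "(%n. nrm (%x. cmb k c (U (r n)) x - cmb k c u x)) ----> 0" for c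
  by (rule cmb_conv[OF H1_L2[OF UH] u(1) conv])
 have n2: "nrm2 (cmb k c u) = (\<Sum>i<k. (c i)\<^sup>2)" for c
  using nrm2_conv[OF H1_L2[OF cH] cL cc, of c] unfolding on by (simp add: LIMSEQ_const_iff)
 have "rb k Lar u"
 proof (rule rbI)
  show "u i \<in> H1" if "i < k" for i by (rule uH(1)[OF that])
  show "c i = 0" if "nrm2 (cmb k c u) = 0" "i < k" for c i
   using that unfolding n2 by (subst (asm) sum_nonneg_eq_0_iff) auto
  fix c
  have lim: "(%n. L (r n) * (\<Sum>i<k. (c i)\<^sup>2)) ----> Lar * (\<Sum>i<k. (c i)\<^sup>2)"
   by (intro tendsto_mult tendsto_const LIMSEQ_subseq_LIMSEQ[OF La r, unfolded o_def])
  have le: "en (cmb k c (U (r n))) <= L (r n) * (\<Sum>i<k. (c i)\<^sup>2)" for n using rb_bound[OF rb, of c "r n"] unfolding on .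
  show "en (cmb k c u) <= Lar * nrm2 (cmb k c u)" unfolding n2 by (rule en_lsc_L2(2)[OF cH cL cc le lim])
 qed
 then show ?thesis using r conv by blast
qed

text \<open>Truncate u and multiply by 1 minus bumps around x whose Sobolev norms tend to zero.
  Energies stay bounded and the products converge in L2, so midpoints approximate the truncation in
  the Sobolev norm; each of them still vanishes on some ball.\<close>

lemma H10_remove_ball:
 fixes u :: "'a::euclidean_space => real"
 assumes dim: "DIM('a) \<ge> 2" and u: "u \<in> H10 Om" and e: "0 < e"
 shows "\<exists>h. h \<in> H1 & (\<exists>r>0. h \<in> H10 (Om - ball x r)) & hn (%x. h x - u x) < e"
proof -
 have uH: "u \<in> H1" by (rule H10_H1[OF u])
 let ?d = "%n x. u x - trunc (real n) (u x)"
 have "(%n. sqrt ((nrm (?d n))\<^sup>2 + en (?d n))) ----> sqrt (0\<^sup>2 + 0)"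
  by (intro tendsto_real_sqrt tendsto_add tendsto_power trunc_tendsto[OF uH])
 then have "(%n. hn (?d n)) ----> 0" by (simp add: hn_def h1_def nrm_sq)
 then have "\<forall>\<^sub>F n in sequentially. hn (?d n) < e / 2" by (rule order_tendstoD) (use e in simp)
 then obtain n0 where n0: "hn (?d n0) < e / 2" by (auto simp: eventually_sequentially)
 define M where "M = real n0"
 have M: "0 <= M" by (simp add: M_def)
 define t where "t x = trunc M (u x)" for x
 have tH: "t \<in> H1" and dH: "(%x. u x - t x) \<in> H1" using trunc_H1(1,2)[OF uH M] by (simp_all add: t_def[abs_def])
 have tL: "L2 t" by (rule H1_L2[OF tH])
 have tM: "\<bar>t x\<bar> <= M" for x using trunc_props(1)[OF M] by (simp add: t_def)
 have "\<exists>ps r. 0 < r & ps \<in> H1 & continuous_on UNIV ps & (\<forall>x. 0 <= ps x) & (\<forall>x. ps x <= 1) & (\<forall>y\<in>ball x r. ps y = 1) & hn ps < 1 / real (Suc n)" for n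
  by (rule small_bump[OF dim, of "1 / real (Suc n)" x]) (simp, blast)
 then have "\<forall>n. \<exists>p. 0 < snd p & fst p \<in> H1 & continuous_on UNIV (fst p) & (\<forall>x. 0 <= fst p x) & (\<forall>x. fst p x <= 1) & (\<forall>y\<in>ball x (snd p). fst p y = 1) & hn (fst p) < 1 / real (Suc n)"
  by (simp only: split_paired_Ex fst_conv snd_conv) blast
 from choice[OF this] obtain p where pp: "!!n. 0 < snd (p n) & fst (p n) \<in> H1 & continuous_on UNIV (fst (p n)) & (\<forall>x. 0 <= fst (p n) x) & (\<forall>x. fst (p n) x <= 1) &
   (\<forall>y\<in>ball x (snd (p n)). fst (p n) y = 1) & hn (fst (p n)) < 1 / real (Suc n)" by blast
 have p: "0 < snd (p n)" "fst (p n) \<in> H1" "continuous_on UNIV (fst (p n))"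
  "0 <= fst (p n) z" "fst (p n) z <= 1" "y \<in> ball x (snd (p n)) ==> fst (p n) y = 1" "hn (fst (p n)) < 1 / real (Suc n)" for n z y
  using pp[of n] by blast+
 define f where "f n y = (1 - fst (p n) y) * t y" for n y
 have fH10: "f n \<in> H10 (Om - ball x (snd (p n)))" for n
  unfolding f_def[abs_def] t_def by (rule H10_cut[OF u p(3) p(2) p(4) p(5) p(6) M])
 have fH: "f n \<in> H1" for n by (rule H10_H1[OF fH10])
 have MpH: "(%y. M * fst (p n) y) \<in> H1" for n by (rule H1_cmult(1)[OF p(2)])
 have fe: "en (f n) <= (sqrt (en t) + M)\<^sup>2" for n
 proof -
  have "sqrt (en (f n)) <= sqrt (en t) + sqrt (en (%y. M * fst (p n) y))"
  proof (rule sqrt_en_contract2[OF H1_L2[OF fH] tH MpH])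
   fix y z
   have "f n y - f n z = (1 - fst (p n) y) * (t y - t z) + t z * (fst (p n) z - fst (p n) y)" by (simp add: f_def algebra_simps)
   also have "\<bar>...\<bar> <= \<bar>1 - fst (p n) y\<bar> * \<bar>t y - t z\<bar> + \<bar>t z\<bar> * \<bar>fst (p n) z - fst (p n) y\<bar>"
    unfolding abs_mult[symmetric] by (rule abs_triangle_ineq)
   also have "... <= 1 * \<bar>t y - t z\<bar> + M * \<bar>fst (p n) z - fst (p n) y\<bar>"
    using p(4)[of n y] p(5)[of n y] tM by (intro add_mono mult_right_mono) auto
   also have "M * \<bar>fst (p n) z - fst (p n) y\<bar> = \<bar>M * fst (p n) y - M * fst (p n) z\<bar>"
    using M by (simp add: right_diff_distrib[symmetric] abs_mult abs_minus_commute)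
   finally show "\<bar>f n y - f n z\<bar> <= \<bar>t y - t z\<bar> + \<bar>M * fst (p n) y - M * fst (p n) z\<bar>" by simp
  qed
  also have "sqrt (en (%y. M * fst (p n) y)) = M * sqrt (en (fst (p n)))" using sqrt_en_cmult[OF p(2), of M n] M by simp
  also have "M * sqrt (en (fst (p n))) <= M * 1"
  proof (rule mult_left_mono[OF _ M])
   have "1 / real (Suc n) <= 1" by simp
   then show "sqrt (en (fst (p n))) <= 1" using sqrt_en_le_hn[of "fst (p n)"] p(7)[of n] by linarith
  qed
  finally have "sqrt (en (f n)) <= sqrt (en t) + M" by simp
  then have "(sqrt (en (f n)))\<^sup>2 <= (sqrt (en t) + M)\<^sup>2" by (intro power_mono) auto
  then show ?thesis by simp
 qed
 have fl: "(%n. nrm (%y. f n y - t y)) ----> 0"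
 proof (rule tendsto_sandwich[OF _ _ tendsto_const])
  show "(%n. M * (1 / real (Suc n))) ----> 0"
   using tendsto_mult_right_zero[OF LIMSEQ_inverse_real_of_nat, of M] by (simp add: inverse_eq_divide)
  have "nrm (%y. f n y - t y) <= M * (1 / real (Suc n))" for n
  proof -
   have "nrm2 (%y. f n y - t y) <= nrm2 (%y. M * fst (p n) y)"
   proof (rule nrm2_mono[OF H1_L2[OF MpH]])
    show "(%y. f n y - t y) \<in> borel_measurable lebesgue" using L2_diff[OF H1_L2[OF fH] tL] by (simp add: L2_def)
    have "\<bar>f n y - t y\<bar> <= \<bar>M * fst (p n) y\<bar>" for y
    proof -
     have "f n y - t y = - (t y * fst (p n) y)" by (simp add: f_def algebra_simps)
     then show ?thesis using tM[of y] M p(4)[of n y] by (simp add: abs_mult mult_right_mono)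
    qed
    then show "AE y in lebesgue. \<bar>f n y - t y\<bar> <= \<bar>M * fst (p n) y\<bar>" by simp
   qed
   then have "nrm (%y. f n y - t y) <= nrm (%y. M * fst (p n) y)" by (simp add: nrm_def)
   also have "... = M * nrm (fst (p n))" using M by (simp only: nrm_cmult abs_of_nonneg)
   also have "... <= M * (1 / real (Suc n))"
    using nrm_le_hn[of "fst (p n)"] p(7)[of n] M by (intro mult_left_mono) auto
   finally show ?thesis .
  qed
  then show "\<forall>\<^sub>F n in sequentially. nrm (%y. f n y - t y) <= M * (1 / real (Suc n))" by (simp del: of_nat_Suc)
 qed simp
 obtain h where h: "!!n. mid (f ` {n..}) (h n)" "!!n. h n \<in> H1" "(%n. hn (%y. h n y - t y)) ----> 0"
  using strong_from_weak[OF fH fe tL fl] by auto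
 have "\<forall>\<^sub>F n in sequentially. hn (%y. h n y - t y) < e / 2" using h(3) by (rule order_tendstoD) (use e in simp)
 then obtain n where n: "hn (%y. h n y - t y) < e / 2" by (auto simp: eventually_sequentially)
 have "\<exists>r>0. h n \<in> H10 (Om - ball x r)"
 proof (rule mid_induct_pred[OF h(1)])
  show "\<exists>r>0. g \<in> H10 (Om - ball x r)" if "g \<in> f ` {n..}" for g using that fH10 p(1) by blast
  fix f g :: "'a => real"
  assume "\<exists>r>0. f \<in> H10 (Om - ball x r)" "\<exists>r>0. g \<in> H10 (Om - ball x r)"
  then obtain r s where rs: "0 < r" "f \<in> H10 (Om - ball x r)" "0 < s" "g \<in> H10 (Om - ball x s)" by blast
  have "f \<in> H10 (Om - ball x (min r s))" "g \<in> H10 (Om - ball x (min r s))"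
   using rs by (auto intro: H10_mono)
  from H10_lincomb[OF this, of "1/2" "1/2"] have "(%y. (f y + g y) / 2) \<in> H10 (Om - ball x (min r s))"
   by (simp add: add_divide_distrib)
  then show "\<exists>r>0. (%y. (f y + g y) / 2) \<in> H10 (Om - ball x r)" using rs(1,3) by (intro exI[of _ "min r s"]) simp
 qed
 moreover have "hn (%y. h n y - u y) < e"
 proof -
  have "hn (%y. (h n y - t y) - (u y - t y)) <= hn (%y. h n y - t y) + hn (%y. u y - t y)"
   by (intro hn_diff H1_diff h(2) tH uH)
  then show ?thesis using n n0 by (simp add: t_def M_def)
 qed
 ultimately show ?thesis using h(2) by blast
qed

lemma ev_remove_ball:
 fixes Om :: "'a::euclidean_space set"
 assumes dim: "DIM('a) \<ge> 2" and Om: "ev Om k Lar" and L: "0 <= Lar" "Lar < Lar'"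
 shows "\<exists>r>0. ev (Om - ball x r) k Lar'"
proof -
 obtain u where u: "\<forall>i<k. u i \<in> H10 Om" "rb k Lar u" using Om by (auto simp: ev_def)
 have "\<exists>v. rb k Lar' v & (\<forall>i<k. \<exists>r>0. v i \<in> H10 (Om - ball x r))"
  by (rule rb_approx[OF u(2) L, where Q="%i h. \<exists>r>0. h \<in> H10 (Om - ball x r)"]) (use u(1) H10_remove_ball[OF dim] in blast)
 then obtain v where v: "rb k Lar' v" "\<forall>i<k. \<exists>r>0. v i \<in> H10 (Om - ball x r)" by blast
 have "\<forall>i. \<exists>r. 0 < r & (i < k --> v i \<in> H10 (Om - ball x r))" using v(2) by (metis zero_less_one)
 from choice[OF this] obtain r where r: "!!i. 0 < r i" "!!i. i < k ==> v i \<in> H10 (Om - ball x (r i))" by blast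
 define s where "s = Min (insert 1 (r ` {..<k}))"
 have s: "0 < s" "!!i. i < k ==> s <= r i" using r(1) by (auto simp: s_def)
 have "v i \<in> H10 (Om - ball x s)" if "i < k" for i
  using r(2)[OF that] by (rule H10_mono) (use s(2)[OF that] in auto)
 then show ?thesis using v(1) s(1) unfolding ev_def by blast
qed

text \<open>The removal is a greedy pass over a countable base. If the limit set V has room below
  alp, a ball around any point present in every \<open>W n\<close> could be taken away, hence so
  could a base set containing that point; such points therefore lie in D, and V is contained in D up
  to capacity zero.\<close>

lemma minimal_set:
 fixes Om :: "'a::euclidean_space set"
 assumes dim: "DIM('a) \<ge> 2" and D: "quasi_open D" "D \<subseteq> Om" and Om: "Om \<in> sets lebesgue" "emeasure lebesgue Om < \<infinity>"
  and a: "0 < alp" and POm: "!!epsr. 0 < epsr ==> ev Om j (alp + epsr)"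
 shows "(\<exists>Om'. quasi_open Om' & D \<subseteq> Om' & emeasure lebesgue Om' <= emeasure lebesgue Om & ev Om' j alp & \<not> (\<exists>be<alp. ev Om' j be)) \<or>
  (\<exists>be<alp. ev D j be)"
proof -
 obtain B :: "nat => 'a set" where B: "!!n. open (B n)" "!!S. open S ==> \<exists>k. S = \<Union>{B n |n. n \<in> k}"
  by (rule univ_second_countable_sequence) blast
 define P where "P W \<longleftrightarrow> (\<forall>epsr>0. ev W j (alp + epsr))" for W :: "'a set"
 define W where "W = rec_nat Om (%n W. if P (D \<union> (W - B n)) then D \<union> (W - B n) else W)"
 have W0: "W 0 = Om" by (simp add: W_def)
 have WS: "W (Suc n) = (if P (D \<union> (W n - B n)) then D \<union> (W n - B n) else W n)" for n by (simp add: W_def)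
 have PW: "P (W n)" for n
 proof (induction n)
  case 0
  show ?case using POm by (simp add: W0 P_def)
 next
  case (Suc n)
  then show ?case by (simp only: WS) simp
 qed
 have DW: "D \<subseteq> W n" for n by (induction n) (auto simp: W0 WS D)
 have "W (Suc n) \<subseteq> W n" for n using DW[of n] by (auto simp: WS)
 then have anti: "W n \<subseteq> W m" if "m <= n" for m n using lift_Suc_antimono_le[of W m n] that by blast
 have "\<exists>u. (\<forall>i<j. u i \<in> H10 (W n)) & rb j (alp + 1 / real (Suc n)) u & (\<forall>c. nrm2 (cmb j c u) = (\<Sum>i<j. (c i)\<^sup>2))" for n
 proof -
  have "ev (W n) j (alp + 1 / real (Suc n))" using PW[of n] unfolding P_def by simp
  then obtain u where u: "\<forall>i<j. u i \<in> H10 (W n)" "rb j (alp + 1 / real (Suc n)) u" unfolding ev_def by blast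
  from rb_normalize[OF u(2)] obtain w where w: "rb j (alp + 1 / real (Suc n)) (%i. cmb j (w i) u)"
   "\<forall>c. nrm2 (cmb j c (%i. cmb j (w i) u)) = (\<Sum>i<j. (c i)\<^sup>2)" by blast
  have "\<forall>i<j. cmb j (w i) u \<in> H10 (W n)" using u(1) by (blast intro: cmb_H10)
  then show ?thesis using w by (intro exI[of _ "%i. cmb j (w i) u"]) simp
 qed
 then have "\<forall>n. \<exists>u. (\<forall>i<j. u i \<in> H10 (W n)) & rb j (alp + 1 / real (Suc n)) u & (\<forall>c. nrm2 (cmb j c u) = (\<Sum>i<j. (c i)\<^sup>2))" by blast
 from choice[OF this] obtain U where U: "!!n i. i < j ==> U n i \<in> H10 (W n)" "!!n. rb j (alp + 1 / real (Suc n)) (U n)"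
  "!!n c. nrm2 (cmb j c (U n)) = (\<Sum>i<j. (c i)\<^sup>2)" by auto
 have Uz: "AE x in lebesgue. x \<notin> Om --> U n i x = 0" if "i < j" for n i
  using H10_AE_zero[OF H10_mono[OF U(1)[OF that] anti[of 0 n]]] by (simp add: W0)
 have Llim: "(%n. alp + 1 / real (Suc n)) ----> alp"
  using tendsto_add[OF tendsto_const LIMSEQ_inverse_real_of_nat, of alp] by (simp add: inverse_eq_divide)
 have "\<exists>r u. strict_mono (r :: nat => nat) & rb j alp u & (\<forall>i<j. (%n. nrm (%x. U (r n) i x - u i x)) ----> 0)"
  by (rule compact_tuple[OF Om U(3) U(2) Llim Uz])
 then obtain r u where r: "strict_mono (r :: nat => nat)" and u: "rb j alp u" "!!i. i < j ==> (%n. nrm (%x. U (r n) i x - u i x)) ----> 0" by blast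
 have uH10: "u i \<in> H10 (W n)" if i: "i < j" for i n
 proof (rule H10_closed)
  show "U (r (m + n)) i \<in> H10 (W n)" for m
  proof (rule H10_mono[OF U(1)[OF i] anti])
   have "m + n <= r (m + n)" by (rule seq_suble[OF r])
   then show "n <= r (m + n)" by simp
  qed
  show "en (U (r (m + n)) i) <= alp + 1" for m
  proof -
   have "en (U (r (m + n)) i) <= (alp + 1 / real (Suc (r (m + n)))) * nrm2 (U (r (m + n)) i)"
    using rb_bound[OF U(2), of "unitv i" "r (m + n)"] unfolding cmb_unitv[OF i] .
   also have "nrm2 (U (r (m + n)) i) = 1" by (rule nrm2_unitv[OF U(3) i])
   also have "(alp + 1 / real (Suc (r (m + n)))) * 1 <= alp + 1" by simp
   finally show ?thesis .
  qed
  show "L2 (u i)" by (rule H1_L2[OF rb_H1[OF u(1) i]])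
  show "(%m. nrm (%x. U (r (m + n)) i x - u i x)) ----> 0" using u(2)[OF i] by (rule LIMSEQ_ignore_initial_segment)
 qed
 have "\<exists>v. i < j --> quasi_continuous v & (AE x in lebesgue. v x = u i x)" for i
 proof (cases "i < j")
  case True
  show ?thesis by (rule qc_rep[OF rb_H1[OF u(1) True]]) blast
 qed simp
 then have "\<forall>i. \<exists>v. i < j --> quasi_continuous v & (AE x in lebesgue. v x = u i x)" by blast
 from choice[OF this] obtain v where v: "!!i. i < j ==> quasi_continuous (v i)" "!!i. i < j ==> AE x in lebesgue. v i x = u i x" by auto
 \<comment> \<open>Quasi-openness is not claimed for the sets \<open>W n\<close>; V recovers it from
   quasi-continuous representatives of the limit tuple.\<close>
 define V where "V = D \<union> (\<Union>i<j. {x. v i x ~= 0})"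
 have Vq: "quasi_open V" unfolding V_def using v(1) by (intro quasi_open_Un quasi_open_UN quasi_open_nonzero D(1)) auto
 have uV: "u i \<in> H10 V" if "i < j" for i
  by (rule H10_nonzero_set[OF rb_H1[OF u(1) that] v(1)[OF that] v(2)[OF that]]) (use that in \<open>auto simp: V_def\<close>)
 have VW: "cap (V - W n) = 0" for n
 proof (rule cap_null_subset)
  show "cap (\<Union>i\<in>{..<j}. {x. x \<notin> W n & v i x ~= 0}) = 0"
   by (rule cap_null_UN_countable) (auto intro: H10_rep[OF uH10 v(1) v(2)])
  show "V - W n \<subseteq> (\<Union>i\<in>{..<j}. {x. x \<notin> W n & v i x ~= 0})" using DW[of n] by (auto simp: V_def)
 qed
 have Vm: "emeasure lebesgue V <= emeasure lebesgue Om"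
 proof (rule emeasure_mono_AE[OF _ Om(1)])
  have "V - Om \<in> null_sets lebesgue" using cap_zero_null[OF VW[of 0]] by (simp add: W0)
  from AE_not_in[OF this] show "AE x in lebesgue. x \<in> V --> x \<in> Om" by eventually_elim auto
 qed
 have evV: "ev V j alp" using u(1) uV unfolding ev_def by blast
 show ?thesis
 proof (cases "\<exists>be<alp. ev V j be")
  case False
  then have "quasi_open V & D \<subseteq> V & emeasure lebesgue V <= emeasure lebesgue Om & ev V j alp & \<not> (\<exists>be<alp. ev V j be)"
   using Vq Vm evV by (simp add: V_def)
  then show ?thesis by blast
 next
  case True
  then obtain be0 where b0: "be0 < alp" "ev V j be0" by blast
  \<comment> \<open>Clipping at 0 meets the sign condition of \<open>ev_remove_ball\<close>, and alp
    > 0 keeps the value below alp.\<close>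
  define be where "be = max be0 0"
  have b: "0 <= be" "be < alp" "ev V j be" using b0 a ev_mono[OF b0(2), of be] by (auto simp: be_def)
  have "x \<in> D" if x: "!!n. x \<in> W n" for x
  proof -
   obtain r where r: "0 < r" "ev (V - ball x r) j alp" using ev_remove_ball[OF dim b(3,1,2), of x] by blast
   obtain I where I: "ball x r = \<Union>{B n |n. n \<in> I}" using B(2)[of "ball x r"] by auto
   moreover have "x \<in> ball x r" using r(1) by simp
   ultimately obtain n where n: "x \<in> B n" "n \<in> I" by auto
   then have Bn: "B n \<subseteq> ball x r" using I by blast
   \<comment> \<open>V without the ball admits the bound and lies quasi-everywhere in what remains
     of \<open>W n\<close> after dropping \<open>B n\<close>; the greedy rule therefore did drop
     \<open>B n\<close> at stage n.\<close>
   have "ev (D \<union> (W n - B n)) j alp"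
   proof (rule ev_mono_qe[OF r(2)])
    show "cap (V - ball x r - (D \<union> (W n - B n))) = 0" by (rule cap_null_subset[OF VW[of n]]) (use Bn in auto)
   qed
   then have "P (D \<union> (W n - B n))" unfolding P_def using ev_mono by (metis less_imp_le less_add_same_cancel1)
   then have "W (Suc n) = D \<union> (W n - B n)" by (simp add: WS)
   then show "x \<in> D" using x[of "Suc n"] n(1) by blast
  qed
  then have sub: "V - D \<subseteq> (\<Union>n. V - W n)" by blast
  have "cap (\<Union>n. V - W n) = 0" by (rule cap_null_UN_countable) (auto simp: VW)
  then have "cap (V - D) = 0" using sub by (rule cap_null_subset)
  then have "ev D j be" by (rule ev_mono_qe[OF b(3)])
  then show ?thesis using b(2) by blast
 qed
qed

subsection \<open>Eigenvalues and scaling\<close>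

text \<open>Om is squeezed between a compact K and an open T of nearly the same measure. For s close
  to 1 the dilate of K stays in T, and the dilate of the small rest \<open>Om - K\<close> is at most
  2^d times as large because s >= 1/2.\<close>

lemma dilate_measure:
 fixes Om :: "'a::euclidean_space set"
 assumes Om: "Om \<in> sets lebesgue" "emeasure lebesgue Om < \<infinity>" and d: "0 < de"
 shows "\<exists>s>0. s < 1 & emeasure lebesgue (Om \<union> {x. s *\<^sub>R x \<in> Om}) <= emeasure lebesgue Om + ennreal de"
proof -
 \<comment> \<open>The budget: e for \<open>T - Om\<close>, and 2^d times 2 e for the dilate of
   \<open>Om - K\<close>.\<close>
 define e where "e = de / (1 + 2 * 2 ^ DIM('a))"
 have e: "0 < e" using d by (simp add: e_def add_pos_pos)
 obtain T where T: "open T" "Om \<subseteq> T" "(T - Om) \<in> lmeasurable" "emeasure lebesgue (T - Om) < ennreal e"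
  by (rule sets_lebesgue_outer_open[OF Om(1) e])
 obtain F where F: "closed F" "F \<subseteq> Om" "(Om - F) \<in> lmeasurable" "emeasure lebesgue (Om - F) < ennreal e"
  by (rule sets_lebesgue_inner_closed[OF Om(1) e])
 obtain n where n: "emeasure lebesgue (Om - ball 0 (real (Suc n))) < ennreal e" using tail_measure[OF Om e] by blast
 define M where "M = real (Suc n)"
 have M: "0 < M" by (simp add: M_def)
 define K where "K = F \<inter> cball 0 M"
 have K: "compact K" "K \<subseteq> T" "K \<subseteq> Om" using F T by (auto simp: K_def intro: closed_Int_compact)
 obtain rh where rh: "0 < rh" "(\<Union>x\<in>K. ball x rh) \<subseteq> T" by (rule compact_subset_open_imp_ball_epsilon_subset[OF K(1) T(1) K(2)])
 \<comment> \<open>With s >= 1/2 the dilate of K stays in the ball of radius 2M, and 1 - s <=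
   rh/(4M) then moves its points by at most rh/2.\<close>
 define s where "s = max (1/2) (1 - rh / (4 * M))"
 have s: "1/2 <= s" "s < 1" "1 - s <= rh / (4 * M)" using rh(1) M by (auto simp: s_def)
 have s0: "0 < s" using s(1) by linarith
 define Z where "Z = Om - K"
 have Zs: "Z \<in> sets lebesgue" using Om(1) K(1) by (auto simp: Z_def intro!: sets.Diff dest: compact_imp_closed)
 have Fs: "F \<in> sets lebesgue" using F(1) by simp
 have Us: "Om - F \<in> sets lebesgue" "Om - ball 0 M \<in> sets lebesgue" using Fs Om(1) by (auto intro: sets.Diff)
 have Zm: "emeasure lebesgue Z <= ennreal (2 * e)"
 proof -
  have "emeasure lebesgue Z <= emeasure lebesgue ((Om - F) \<union> (Om - ball 0 M))"
   by (intro emeasure_mono sets.Un Us) (auto simp: Z_def K_def)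
  also have "... <= emeasure lebesgue (Om - F) + emeasure lebesgue (Om - ball 0 M)"
   by (intro emeasure_subadditive Us)
  also have "... <= ennreal e + ennreal e" using F(4) n by (intro add_mono less_imp_le) (auto simp: M_def)
  finally show ?thesis using e by (simp add: ennreal_plus[symmetric] del: ennreal_plus)
 qed
 let ?Y = "{x. 0 + s *\<^sub>R x \<in> Z}"
 have Ym: "?Y \<in> sets lebesgue" "emeasure lebesgue ?Y <= ennreal (2 * 2 ^ DIM('a) * e)"
 proof -
  note E = emeasure_affine[OF _ Zs, of s 0]
  show "?Y \<in> sets lebesgue" using E(1) s0 by simp
  have "emeasure lebesgue ?Y = ennreal (2 ^ DIM('a) * (1/2) ^ DIM('a)) * emeasure lebesgue ?Y"
   by (simp add: power_mult_distrib[symmetric])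
  also have "... <= ennreal (2 ^ DIM('a) * s ^ DIM('a)) * emeasure lebesgue ?Y"
   using s(1) by (intro mult_right_mono ennreal_leI mult_left_mono power_mono) auto
  also have "... = ennreal (2 ^ DIM('a)) * (ennreal (s ^ DIM('a)) * emeasure lebesgue ?Y)"
   using s0 by (subst ennreal_mult') (auto simp: mult.assoc)
  also have "ennreal (s ^ DIM('a)) * emeasure lebesgue ?Y = emeasure lebesgue Z" using E(2) s0 by simp
  also have "ennreal (2 ^ DIM('a)) * emeasure lebesgue Z <= ennreal (2 ^ DIM('a)) * ennreal (2 * e)" using Zm by (rule mult_left_mono) simp
  also have "... = ennreal (2 * 2 ^ DIM('a) * e)" using e by (subst ennreal_mult'[symmetric]) (auto simp: mult_ac)
  finally show "emeasure lebesgue ?Y <= ennreal (2 * 2 ^ DIM('a) * e)" .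
 qed
 have sub: "Om \<union> {x. s *\<^sub>R x \<in> Om} \<subseteq> (Om \<union> (T - Om)) \<union> ?Y"
 proof
  fix x assume x: "x \<in> Om \<union> {x. s *\<^sub>R x \<in> Om}"
  show "x \<in> (Om \<union> (T - Om)) \<union> ?Y"
  proof (cases "x \<in> Om \<or> s *\<^sub>R x \<in> Z")
   case False
   then have sx: "s *\<^sub>R x \<in> K" using x by (auto simp: Z_def)
   then have "s * norm x <= M" using s0 by (auto simp: K_def)
   moreover have "1/2 * norm x <= s * norm x" using s(1) by (intro mult_right_mono) auto
   ultimately have nx: "norm x <= 2 * M" by linarith
   have "dist (s *\<^sub>R x) x = (1 - s) * norm x"
   proof -
    have "s *\<^sub>R x - x = (s - 1) *\<^sub>R x" by (simp add: scaleR_left_diff_distrib)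
    then show ?thesis using s(2) by (simp add: dist_norm)
   qed
   also have "... <= rh / (4 * M) * (2 * M)" using s nx M rh(1) by (intro mult_mono) auto
   also have "... < rh" using M rh(1) by simp
   finally have "x \<in> ball (s *\<^sub>R x) rh" by simp
   then show ?thesis using sx rh(2) by blast
  qed auto
 qed
 have Ts: "T \<in> sets lebesgue" using T(1) by simp
 have "emeasure lebesgue (Om \<union> {x. s *\<^sub>R x \<in> Om}) <= emeasure lebesgue ((Om \<union> (T - Om)) \<union> ?Y)"
  using sub Om(1) Ts Ym(1) by (intro emeasure_mono) auto
 also have "... <= emeasure lebesgue (Om \<union> (T - Om)) + emeasure lebesgue ?Y"
  using Om(1) Ts Ym(1) by (intro emeasure_subadditive) auto
 also have "... <= (emeasure lebesgue Om + emeasure lebesgue (T - Om)) + emeasure lebesgue ?Y"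
  using Om(1) Ts by (intro add_mono emeasure_subadditive) auto
 also have "... <= (emeasure lebesgue Om + ennreal e) + ennreal (2 * 2 ^ DIM('a) * e)"
  by (intro add_mono order_refl less_imp_le[OF T(4)] Ym(2))
 also have "... = emeasure lebesgue Om + ennreal (e + 2 * 2 ^ DIM('a) * e)"
  using e by (simp add: ennreal_plus add.assoc)
 also have "e + 2 * 2 ^ DIM('a) * e = de"
 proof -
  have "(1 + 2 * 2 ^ DIM('a)) ~= (0::real)" by (smt (verit) zero_le_power)
  then have "e * (1 + 2 * 2 ^ DIM('a)) = de" unfolding e_def by simp
  moreover have "e + 2 * 2 ^ DIM('a) * e = e * (1 + 2 * 2 ^ DIM('a))" by (simp only: distrib_left mult.commute mult_1_right)
  ultimately show ?thesis by simp
 qed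
 finally show ?thesis using s0 s(2) by blast
qed

lemma rb_nonneg: "rb k Lar u ==> 1 <= k ==> 0 <= Lar"
proof -
 assume u: "rb k Lar u" and k: "1 <= k"
 have "nrm2 (cmb k (unitv 0) u) ~= 0" using rb_zero[OF u, of "unitv 0" 0] k by (auto simp: unitv_def)
 then have "0 < nrm2 (cmb k (unitv 0) u)" using nrm2_nonneg[of "cmb k (unitv 0) u"] by linarith
 moreover have "0 <= Lar * nrm2 (cmb k (unitv 0) u)" using rb_bound[OF u, of "unitv 0"] en_nonneg[of "cmb k (unitv 0) u"] by linarith
 ultimately show "0 <= Lar" by (simp add: zero_le_mult_iff)
qed

section \<open>From tuples to eigenvalues and back\<close>

lemma eig_le:
 assumes "ev Om k Lar" shows "dirichlet_eig Om k <= ereal Lar"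
proof -
 obtain u where u: "\<forall>i<k. u i \<in> H10 Om" "rb k Lar u" using assms by (auto simp: ev_def)
 have H: "cmb k c u \<in> H1" for c by (rule cmb_H1[OF rb_H1[OF u(2)]])
 have ray: "rayleigh (cmb k c u) <= Lar" if c: "\<not> (AE x in lebesgue. cmb k c u x = 0)" for c
 proof -
  have "nrm2 (cmb k c u) ~= 0" using c nrm2_eq_0[OF H1_L2[OF H]] by blast
  then have "0 < nrm2 (cmb k c u)" using nrm2_nonneg[of "cmb k c u"] by linarith
  then have "en (cmb k c u) / nrm2 (cmb k c u) <= Lar" using rb_bound[OF u(2), of c] by (simp add: divide_le_eq)
  then show ?thesis by (simp add: rayleigh_def en_def nrm2_def)
 qed
 have ind: "\<forall>c. (AE x in lebesgue. cmb k c u x = 0) --> (\<forall>i<k. c i = 0)" using u(2) by (simp add: rb_def indep_def)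
 show ?thesis
  unfolding dirichlet_eig_def
  by (rule INF_lower2[of u]) (use u(1) ind ray in \<open>auto simp: cmb_def[abs_def] intro!: SUP_least\<close>)
qed

text \<open>A strict inequality for the infimum yields a tuple whose quotients are bounded by a real
  number. The supremum ignores combinations that vanish almost everywhere, but these have zero
  energy, so the bound holds for all coefficients.\<close>

lemma eig_less:
 assumes "dirichlet_eig Om k < ereal Lar" shows "\<exists>be<Lar. ev Om k be"
proof -
 let ?sup = "%u. SUP c \<in> {c :: nat => real. \<not> (AE x in lebesgue. (\<Sum>i<k. c i * u i x) = 0)}.
      ereal (rayleigh (%x. \<Sum>i<k. c i * u i x))"
 obtain u where uS: "u \<in> {u. (\<forall>i<k. u i \<in> H10 Om) &
   (\<forall>c. (AE x in lebesgue. (\<Sum>i<k. c i * u i x) = 0) --> (\<forall>i<k. c i = 0))}" "?sup u < ereal Lar"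
  using assms unfolding dirichlet_eig_def INF_less_iff by (rule bexE)
 note u = CollectD[OF uS(1), THEN conjunct1] CollectD[OF uS(1), THEN conjunct2] uS(2)
 obtain be where b: "(SUP c \<in> {c :: nat => real. \<not> (AE x in lebesgue. (\<Sum>i<k. c i * u i x) = 0)}.
      ereal (rayleigh (%x. \<Sum>i<k. c i * u i x))) < ereal be" "ereal be < ereal Lar"
  using ereal_dense2[OF u(3)] by blast
 have ray: "rayleigh (cmb k c u) <= be" if "\<not> (AE x in lebesgue. cmb k c u x = 0)" for c
 proof -
  have "ereal (rayleigh (cmb k c u)) <= (SUP c \<in> {c :: nat => real. \<not> (AE x in lebesgue. (\<Sum>i<k. c i * u i x) = 0)}.
      ereal (rayleigh (%x. \<Sum>i<k. c i * u i x)))"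
   by (rule SUP_upper2[of c]) (use that in \<open>auto simp: cmb_def[abs_def]\<close>)
  then have "ereal (rayleigh (cmb k c u)) <= ereal be" using b(1) by (meson less_imp_le order_trans)
  then show ?thesis by simp
 qed
 have uH: "u i \<in> H1" if "i < k" for i using u(1) that by (blast intro: H10_H1)
 have cH: "cmb k c u \<in> H1" for c by (rule cmb_H1[OF uH])
 have "en (cmb k c u) <= be * nrm2 (cmb k c u)" for c
 proof (cases "AE x in lebesgue. cmb k c u x = 0")
  case True
  have "nrm2 (cmb k c u) = 0" using True nrm2_eq_0[OF H1_L2[OF cH]] by blast
  moreover have "en (cmb k c u) = 0" using H1_AE_cong(2)[OF H1_zero(1) True] by (simp add: H1_zero(2))
  ultimately show ?thesis by simp
 next
  case False
  then have "nrm2 (cmb k c u) ~= 0" using nrm2_eq_0[OF H1_L2[OF cH]] by blast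
  then have "0 < nrm2 (cmb k c u)" using nrm2_nonneg[of "cmb k c u"] by linarith
  moreover have "en (cmb k c u) / nrm2 (cmb k c u) <= be" using ray[OF False] by (simp add: rayleigh_def en_def nrm2_def)
  ultimately show ?thesis by (simp add: divide_le_eq)
 qed
 then have "rb k be u" using uH u(2) by (auto simp: rb_def indep_def cmb_def)
 then show ?thesis using u(1) b(2) unfolding ev_def by auto
qed

lemma eig_leI:
 assumes "!!epsr. 0 < epsr ==> ev Om k (Lar + epsr)" shows "dirichlet_eig Om k <= ereal Lar"
proof (rule ereal_le_epsilon2)
 fix e :: real assume "0 < e"
 then show "dirichlet_eig Om k <= ereal Lar + ereal e" using eig_le[OF assms[of e]] by simp
qed

text \<open>Converts tuples into admissible sets: the nonzero set of a quasi-continuous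
  representative is quasi-open and agrees with the pointwise support up to measure zero.\<close>

lemma tuple_set:
 fixes u :: "nat => 'a::euclidean_space => real"
 assumes D: "quasi_open D" and u: "!!i. i < k ==> u i \<in> H1"
 shows "\<exists>Om. quasi_open Om & D \<subseteq> Om & emeasure lebesgue Om = emeasure lebesgue (D \<union> supp k u) & (\<forall>i<k. u i \<in> H10 Om)"
proof -
 have "\<exists>v. i < k --> quasi_continuous v & (AE x in lebesgue. v x = u i x)" for i
 proof (cases "i < k")
  case True
  show ?thesis by (rule qc_rep[OF u[OF True]]) blast
 qed simp
 then have "\<forall>i. \<exists>v. i < k --> quasi_continuous v & (AE x in lebesgue. v x = u i x)" by blast
 from choice[OF this] obtain v where v: "!!i. i < k ==> quasi_continuous (v i)" "!!i. i < k ==> AE x in lebesgue. v i x = u i x" by auto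
 define V where "V = D \<union> (\<Union>i<k. {x. v i x ~= 0})"
 have Vq: "quasi_open V" unfolding V_def using v(1) by (intro quasi_open_Un quasi_open_UN quasi_open_nonzero D) auto
 have uV: "u i \<in> H10 V" if "i < k" for i
  by (rule H10_nonzero_set[OF u[OF that] v(1)[OF that] v(2)[OF that]]) (use that in \<open>auto simp: V_def\<close>)
 have "emeasure lebesgue V = emeasure lebesgue (D \<union> supp k u)"
 proof (rule emeasure_eq_AE)
  have "AE x in lebesgue. \<forall>i\<in>{..<k}. v i x = u i x" using v(2) by (intro AE_finite_allI) auto
  then show "AE x in lebesgue. x \<in> V \<longleftrightarrow> x \<in> D \<union> supp k u" by eventually_elim (auto simp: V_def supp_def)
  show "V \<in> sets lebesgue" by (rule quasi_open_sets[OF Vq])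
  show "D \<union> supp k u \<in> sets lebesgue" using quasi_open_sets[OF D] supp_sets[of k u, OF H1_L2[OF u]] by blast
 qed
 then show ?thesis using Vq uV by (intro exI[of _ V]) (auto simp: V_def)
qed

lemma ev_tuple:
 assumes "ev Om k Lar" shows "\<exists>u. rb k Lar u & supp k u \<subseteq> Om"
proof -
 obtain u where u: "\<forall>i<k. u i \<in> H10 Om" "rb k Lar u" using assms by (auto simp: ev_def)
 have "rb k Lar (%i x. indicator Om x * u i x)"
 proof (rule rb_cong[OF u(2)])
  fix i assume "i < k"
  then have "AE x in lebesgue. x \<notin> Om --> u i x = 0" using u(1) by (blast intro: H10_AE_zero)
  then show "AE x in lebesgue. indicator Om x * u i x = u i x" by eventually_elim (auto simp: indicator_def)
 qed
 moreover have "supp k (%i x. indicator Om x * u i x) \<subseteq> Om" by (auto simp: supp_def indicator_def split: if_splits)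
 ultimately show ?thesis by blast
qed

lemma star_le:
 assumes "ST TYPE('a::euclidean_space) l (ennreal a) Lar" shows "lambda_star TYPE('a) l a <= ereal Lar"
proof -
 obtain w :: "nat => 'a => real" where w: "rb l Lar w" "emeasure lebesgue (supp l w) <= ennreal a" using assms by (auto simp: ST_def)
 obtain Om where "quasi_open Om" "emeasure lebesgue Om = emeasure lebesgue (supp l w)" "\<forall>i<l. w i \<in> H10 Om"
  using tuple_set[OF quasi_open_empty, of l w] rb_H1[OF w(1)] by auto
 then show ?thesis unfolding lambda_star_def using w
  by (intro INF_lower2[of Om] eig_le) (auto simp: ev_def)
qed

lemma star_less:
 assumes "lambda_star TYPE('a::euclidean_space) l a < ereal Lar" shows "\<exists>be<Lar. ST TYPE('a) l (ennreal a) be"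
proof -
 obtain Om :: "'a set" where Om: "quasi_open Om" "emeasure lebesgue Om <= ennreal a" "dirichlet_eig Om l < ereal Lar"
  using assms unfolding lambda_star_def INF_less_iff by blast
 obtain be where b: "be < Lar" "ev Om l be" using eig_less[OF Om(3)] by blast
 obtain u where u: "rb l be u" "supp l u \<subseteq> Om" using ev_tuple[OF b(2)] by blast
 have "emeasure lebesgue (supp l u) <= emeasure lebesgue Om" by (rule emeasure_mono[OF u(2) quasi_open_sets[OF Om(1)]])
 then show ?thesis using u(1) b(1) Om(2) unfolding ST_def by (meson order_trans)
qed

lemma star_leI:
 assumes "!!Lar. alp < Lar ==> ST TYPE('a::euclidean_space) l (ennreal a) Lar" shows "lambda_star TYPE('a) l a <= ereal alp"
proof (rule ereal_le_epsilon2)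
 fix e :: real assume "0 < e"
 then show "lambda_star TYPE('a) l a <= ereal alp + ereal e" using star_le[OF assms[of "alp + e"]] by simp
qed

text \<open>\<open>ennreal\<close> sends nonpositive volumes to 0, and by the weak Faber-Krahn bound
  no nonempty tuple is supported there.\<close>

lemma star_nonpos:
 assumes "1 <= l" "a <= 0" shows "lambda_star TYPE('a::euclidean_space) l a = \<infinity>"
proof (rule ccontr)
 assume "\<not> ?thesis"
 then have "lambda_star TYPE('a) l a < \<infinity>" by simp
 from ereal_dense2[OF this] obtain Lar where "lambda_star TYPE('a) l a < ereal Lar" by blast
 from star_less[OF this] obtain be where b: "ST TYPE('a) l (ennreal a) be" by blast
 obtain c where c: "0 < c" "\<not> ST TYPE('a) l (ennreal c) be" by (rule ST_small[OF assms(1)])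
 show False using c(2) ST_mono[OF b, of "ennreal c" be] assms(2) c(1) by (simp add: ennreal_leI)
qed

text \<open>Dilation trades slack in volume for slack in the level. It also excludes degenerate
  values: with a <= 0 or alp = 0 one would reach a fixed level on volumes that
  \<open>ST_small\<close> forbids.\<close>

lemma ST_closed:
 assumes l: "1 <= l" and a: "0 <= alp"
  and st: "!!epsr de. 0 < epsr ==> 0 < de ==> ST TYPE('a::euclidean_space) l (ennreal (a + de)) (alp + epsr)"
 shows "0 < a & 0 < alp & (\<forall>Lar>alp. ST TYPE('a) l (ennreal a) Lar)"
proof -
 have d: "1 <= DIM('a)" by (simp add: Suc_leI)
 have a0: "0 < a"
 proof (rule ccontr)
  assume n: "\<not> ?thesis"
  obtain c where c: "0 < c" "\<not> ST TYPE('a) l (ennreal c) (alp + 1)" by (rule ST_small[OF l])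
  show False using st[of 1 "c - a"] c n by simp
 qed
 have al: "0 < alp"
 proof (rule ccontr)
  assume n: "\<not> ?thesis"
  then have z: "alp = 0" using a by simp
  obtain c where c: "0 < c" "\<not> ST TYPE('a) l (ennreal c) 1" by (rule ST_small[OF l])
  \<comment> \<open>Large enough for the dilation by s to fit volume a + 1 into c, while the level
    1/s^2 becomes 1.\<close>
  define s where "s = max 1 ((a + 1) / c)"
  have s: "1 <= s" "(a + 1) / c <= s" by (auto simp: s_def)
  have "a + 1 <= s * c" using s(2) c(1) by (simp add: divide_le_eq)
  also have "... <= s ^ DIM('a) * c" using s(1) c(1) d power_increasing[of 1 "DIM('a)" s] by (intro mult_right_mono) auto
  finally have "ST TYPE('a) l (ennreal c) (s\<^sup>2 * (1 / s\<^sup>2))"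
   by (intro ST_scale[of l "a + 1"]) (use st[of "1 / s\<^sup>2" 1] s(1) z in auto)
  then show False using c(2) s(1) by simp
 qed
 have "ST TYPE('a) l (ennreal a) Lar" if L: "alp < Lar" for Lar
 proof -
  define q where "q = (alp + Lar) / 2"
  have q: "alp < q" "q < Lar" using L by (auto simp: q_def)
  \<comment> \<open>The dilation by s raises the level from q to Lar and shrinks volume s^d a to a;
    the volume slack used is (s^d - 1) a.\<close>
  define s where "s = sqrt (Lar / q)"
  have s: "1 < s" "s\<^sup>2 = Lar / q" using q al by (auto simp: s_def less_divide_eq)
  have sd: "1 < s ^ DIM('a)" using s(1) by (intro one_less_power) auto
  have "ST TYPE('a) l (ennreal (a + (s ^ DIM('a) - 1) * a)) (alp + (q - alp))" using sd a0 q by (intro st) auto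
  then have "ST TYPE('a) l (ennreal (s ^ DIM('a) * a)) q" by (simp add: algebra_simps)
  from ST_scale[OF this, of s a] show ?thesis using s q al by simp
 qed
 then show ?thesis using a0 al by blast
qed

text \<open>The gap between be and Lar pays for a dilation that shrinks the support by a definite
  amount.\<close>

lemma ST_shrink:
 assumes st: "ST TYPE('a::euclidean_space) l (ennreal a) be" and a: "0 < a" and L: "be < Lar" "0 < Lar"
 shows "\<exists>de>0. de < a & ST TYPE('a) l (ennreal (a - de)) Lar"
proof -
 define q where "q = (max be 0 + Lar) / 2"
 have q: "be <= q" "0 < q" "q < Lar" using L by (auto simp: q_def)
 define s where "s = sqrt (Lar / q)"
 have s: "1 < s" "s\<^sup>2 = Lar / q" using q by (auto simp: s_def less_divide_eq)
 have sd: "1 < s ^ DIM('a)" using s(1) by (intro one_less_power) auto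
 have "ST TYPE('a) l (ennreal a) q" by (rule ST_mono[OF st order_refl q(1)])
 from ST_scale[OF this, of s "a / s ^ DIM('a)"] have "ST TYPE('a) l (ennreal (a / s ^ DIM('a))) Lar" using s q sd by simp
 moreover have "0 < a - a / s ^ DIM('a)" "a - a / s ^ DIM('a) < a" using a sd by (auto simp: divide_less_eq zero_less_divide_iff)
 ultimately show ?thesis by (intro exI[of _ "a - a / s ^ DIM('a)"]) simp
qed

text \<open>Strict monotonicity in the volume: the spare volume p pays for an enlargement. The
  factor s = 1 - p/(a d) is chosen so that Bernoulli's inequality gives a - p <= s^d a; starting
  from level alp/s one arrives at s alp.\<close>

lemma ST_grow:
 assumes st: "!!Lar. alp < Lar ==> ST TYPE('a::euclidean_space) l (ennreal (a - p)) Lar" and p: "0 < p" "p < a" and al: "0 < alp"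
 shows "\<exists>Lar<alp. ST TYPE('a) l (ennreal a) Lar"
proof -
 define t where "t = p / (a * DIM('a))"
 define s where "s = 1 - t"
 have "1 <= real DIM('a)" by (simp add: Suc_leI)
 then have "a * 1 <= a * DIM('a)" using p by (intro mult_left_mono) auto
 then have "p < a * DIM('a)" using p by linarith
 then have t: "0 < t" "t < 1" using p by (auto simp: t_def divide_less_eq)
 have s: "0 < s" "s < 1" using t by (auto simp: s_def)
 have "1 + real DIM('a) * (- t) <= (1 + (- t)) ^ DIM('a)" by (rule Bernoulli_inequality) (use t in simp)
 then have "1 - p / a <= s ^ DIM('a)" using p by (simp add: s_def t_def)
 then have "(1 - p / a) * a <= s ^ DIM('a) * a" using p by (intro mult_right_mono) auto
 then have "a - p <= s ^ DIM('a) * a" using p by (simp add: left_diff_distrib)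
 moreover have "ST TYPE('a) l (ennreal (a - p)) (alp / s)" using s al by (intro st) (simp add: less_divide_eq)
 ultimately have "ST TYPE('a) l (ennreal a) (s\<^sup>2 * (alp / s))" using s(1) by (intro ST_scale[of l "a - p"])
 moreover have "s\<^sup>2 * (alp / s) < alp" using s al by (simp add: power2_eq_square)
 ultimately show ?thesis by blast
qed

subsection \<open>Existence\<close>

lemma cmb_supp_subset: "supp j (%i. cmb k (w i) u) \<subseteq> supp k u"
proof
 fix x assume "x \<in> supp j (%i. cmb k (w i) u)"
 then obtain i where "cmb k (w i) u x ~= 0" by (auto simp: supp_def)
 then show "x \<in> supp k u" using cmb_supp[of x k u "w i"] by blast
qed

text \<open>Orthonormalization replaces the functions by combinations, whose supports can only
  shrink, so the volume bound is kept.\<close>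

lemma normalized_seq:
 fixes D :: "'a::euclidean_space set"
 assumes D: "D \<in> sets lebesgue"
  and inf: "!!epsr. 0 < epsr ==> \<exists>u. rb k (alp + epsr) u & emeasure lebesgue (D \<union> supp k u) <= ennreal m"
 shows "\<exists>U. \<forall>n. rb k (alp + 1 / real (Suc n)) (U n) & emeasure lebesgue (D \<union> supp k (U n)) <= ennreal m &
  (\<forall>c. nrm2 (cmb k c (U n)) = (\<Sum>i<k. (c i)\<^sup>2))"
proof (rule choice, rule allI)
 fix n
 obtain u where u: "rb k (alp + 1 / real (Suc n)) u" "emeasure lebesgue (D \<union> supp k u) <= ennreal m"
  using inf[of "1 / real (Suc n)"] by auto
 from rb_normalize[OF u(1)] obtain w where w: "rb k (alp + 1 / real (Suc n)) (%i. cmb k (w i) u)"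
  "\<forall>c. nrm2 (cmb k c (%i. cmb k (w i) u)) = (\<Sum>i<k. (c i)\<^sup>2)" by blast
 have "emeasure lebesgue (D \<union> supp k (%i. cmb k (w i) u)) <= emeasure lebesgue (D \<union> supp k u)"
  using D rb_supp_sets[OF u(1)] cmb_supp_subset[of k k w u] by (intro emeasure_mono) auto
 then have "emeasure lebesgue (D \<union> supp k (%i. cmb k (w i) u)) <= ennreal m" using u(2) by (rule order_trans)
 then show "\<exists>U. rb k (alp + 1 / real (Suc n)) U & emeasure lebesgue (D \<union> supp k U) <= ennreal m &
   (\<forall>c. nrm2 (cmb k c U) = (\<Sum>i<k. (c i)\<^sup>2))"
  using w by (intro exI[of _ "%i. cmb k (w i) u"] conjI)
qed

text \<open>The limit part of the splitting is realized by an admissible set. The last clause keeps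
  a trace of nonvanishing: if the first members retain mass in a fixed ball, the local limit is not
  zero and the set has positive volume.\<close>

lemma split_set:
 fixes D :: "'a::euclidean_space set" and U :: "nat => nat => 'a => real"
 assumes D: "quasi_open D" and m: "0 <= m" and a: "0 <= alp"
  and rb: "!!n. rb k (alp + 1 / real (Suc n)) (U n)" and meas: "!!n. emeasure lebesgue (D \<union> supp k (U n)) <= ennreal m"
  and on: "!!n c. nrm2 (cmb k c (U n)) = (\<Sum>i<k. (c i)\<^sup>2)"
 shows "\<exists>l\<le>k. \<exists>Om. quasi_open Om & D \<subseteq> Om & emeasure lebesgue Om <= ennreal m &
  (\<forall>epsr>0. ev Om (k - l) (alp + epsr) & (\<forall>de>0. ST TYPE('a) l (ennreal (m - measure lebesgue Om + de)) (alp + epsr))) &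
  (1 <= k --> (\<exists>c>0. \<exists>R::nat. \<forall>n. c <= nrm (%x. indicator (cball 0 (real R)) x * U n 0 x)) --> 0 < measure lebesgue Om)"
proof -
 have UH: "U n i \<in> H1" if "i < k" for n i by (rule rb_H1[OF rb that])
 have U1: "nrm2 (U n i) = 1" if "i < k" for n i by (rule nrm2_unitv[OF on that])
 have Ue: "en (U n i) <= alp + 1" if "i < k" for n i
 proof -
  have "en (U n i) <= alp + 1 / real (Suc n)"
   using rb_bound[OF rb, of "unitv i" n] unfolding cmb_unitv[OF that] U1[OF that] by simp
  also have "... <= alp + 1" by simp
  finally show ?thesis .
 qed
 have "\<exists>r u. strict_mono (r :: nat => nat) & (\<forall>i<k. L2 (u i) & (AE x in lebesgue. (%n. U (r n) i x) ----> u i x) &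
  (\<forall>R::nat. (%n. nrm (%x. indicator (cball 0 (real R)) x * (U (r n) i x - u i x))) ----> 0))"
  by (rule rellich_tuple[of k U 1 "alp + 1", OF UH _ Ue]) (simp_all add: nrm_def U1)
 then obtain r u where r: "strict_mono (r :: nat => nat)" and u: "!!i. i < k ==> L2 (u i)"
  "!!i. i < k ==> AE x in lebesgue. (%n. U (r n) i x) ----> u i x"
  "!!i R. i < k ==> (%n. nrm (%x. indicator (cball 0 (real R)) x * (U (r n) i x - u i x))) ----> 0" by auto
 have "(%n. alp + 1 / real (Suc n)) ----> alp"
  using tendsto_add[OF tendsto_const LIMSEQ_inverse_real_of_nat, of alp] by (simp add: inverse_eq_divide)
 from LIMSEQ_subseq_LIMSEQ[OF this r] have lim: "(%n. alp + 1 / real (Suc (r n))) ----> alp" by (simp add: o_def)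
 have "(\<forall>i<k. u i \<in> H1) & emeasure lebesgue (D \<union> supp k u) <= ennreal m &
  (\<exists>l\<le>k. \<forall>epsr>0. (\<exists>w. rb (k - l) (alp + epsr) (%i. cmb k (w i) u)) &
   (\<forall>de>0. ST TYPE('a) l (ennreal (m - measure lebesgue (D \<union> supp k u) + de)) (alp + epsr)))"
  by (rule splitting[OF quasi_open_sets[OF D] m meas on rb lim a u])
 then obtain l where uH: "!!i. i < k ==> u i \<in> H1" and mu: "emeasure lebesgue (D \<union> supp k u) <= ennreal m" and l: "l <= k"
  "!!epsr. 0 < epsr ==> \<exists>w. rb (k - l) (alp + epsr) (%i. cmb k (w i) u)"
  "!!epsr de. 0 < epsr ==> 0 < de ==> ST TYPE('a) l (ennreal (m - measure lebesgue (D \<union> supp k u) + de)) (alp + epsr)" by auto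
 have "\<exists>Om. quasi_open Om & D \<subseteq> Om & emeasure lebesgue Om = emeasure lebesgue (D \<union> supp k u) & (\<forall>i<k. u i \<in> H10 Om)"
  by (rule tuple_set[OF D uH])
 then obtain Om where Om: "quasi_open Om" "D \<subseteq> Om" "emeasure lebesgue Om = emeasure lebesgue (D \<union> supp k u)" "\<forall>i<k. u i \<in> H10 Om"
  by blast
 have mOm: "measure lebesgue Om = measure lebesgue (D \<union> supp k u)" by (simp add: measure_def Om(3))
 have evO: "ev Om (k - l) (alp + epsr)" if "0 < epsr" for epsr
 proof -
  obtain w where w: "rb (k - l) (alp + epsr) (%i. cmb k (w i) u)" using l(2)[OF \<open>0 < epsr\<close>] by blast
  have "cmb k (w i) u \<in> H10 Om" for i by (rule cmb_H10) (use Om(4) in blast)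
  then show ?thesis unfolding ev_def by (intro exI[of _ "%i. cmb k (w i) u"] conjI w) simp
 qed
 have pos: "0 < measure lebesgue Om" if k: "1 <= k" and c: "0 < c" "!!n. c <= nrm (%x. indicator (cball 0 (real R)) x * U n 0 x)" for c and R :: nat
 proof (rule ccontr)
  assume "\<not> ?thesis"
  then have z: "measure lebesgue (D \<union> supp k u) = 0" unfolding mOm using measure_nonneg[of lebesgue "D \<union> supp k u"] by linarith
  have k0: "0 < k" using k by simp
  have "emeasure lebesgue (D \<union> supp k u) = 0" using emeasure_finite_eq[OF mu] z by simp
  then have "D \<union> supp k u \<in> null_sets lebesgue"
   using quasi_open_sets[OF D] supp_sets[of k u, OF u(1)] by auto
  from AE_not_in[OF this] have u0: "AE x in lebesgue. u 0 x = 0" by eventually_elim (use k0 in \<open>auto simp: supp_def\<close>)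
  have eq: "nrm (%x. indicator (cball 0 (real R)) x * (U (r n) 0 x - u 0 x)) = nrm (%x. indicator (cball 0 (real R)) x * U (r n) 0 x)" for n
  proof -
   have L: "L2 (%x. indicator (cball 0 (real R)) x * U (r n) 0 x)" "L2 (%x. indicator (cball 0 (real R)) x * (U (r n) 0 x - u 0 x))"
    by (intro L2_indicator_mult L2_diff u(1) k0 H1_L2 UH; simp)+
   have "nrm2 (%x. indicator (cball 0 (real R)) x * (U (r n) 0 x - u 0 x)) = nrm2 (%x. indicator (cball 0 (real R)) x * U (r n) 0 x)"
   proof (rule nrm2_cong)
    show "AE x in lebesgue. indicator (cball 0 (real R)) x * (U (r n) 0 x - u 0 x) = indicator (cball 0 (real R)) x * U (r n) 0 x"
     using u0 by eventually_elim simp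
   qed (use L in \<open>simp_all add: L2_def\<close>)
   then show ?thesis by (simp add: nrm_def)
  qed
  have "(%n. nrm (%x. indicator (cball 0 (real R)) x * U (r n) 0 x)) ----> 0" using u(3)[OF k0, of R] unfolding eq .
  then have "c <= 0" by (rule LIMSEQ_le_const) (use c(2) in blast)
  then show False using c(1) by simp
 qed
 show ?thesis
 proof (rule exI[of _ l], intro conjI l(1), rule exI[of _ Om], intro conjI allI impI)
  show "emeasure lebesgue Om <= ennreal m" using Om(3) mu by simp
  show "0 < measure lebesgue Om" if "1 <= k" "\<exists>c>0. \<exists>R::nat. \<forall>n. c <= nrm (%x. indicator (cball 0 (real R)) x * U n 0 x)"
   using pos[OF that(1)] that(2) by blast
 qed (use Om evO l(3) in \<open>simp_all add: mOm\<close>)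
qed

text \<open>Each tuple is translated so that the ball provided by \<open>nonvanishing\<close> is
  centred at 0. No obstacle D appears, as it would not move along; the empty set takes its place so
  that the result fits \<open>split_set\<close>.\<close>

lemma recentred_seq:
 assumes a: "0 <= alp" and b: "0 <= b" and k: "1 <= k"
  and inf: "!!epsr. 0 < epsr ==> ST TYPE('a::euclidean_space) k (ennreal b) (alp + epsr)"
 shows "\<exists>(U :: nat => nat => 'a => real) c R. 0 < c & (\<forall>n. rb k (alp + 1 / real (Suc n)) (U n) & emeasure lebesgue ({} \<union> supp k (U n)) <= ennreal b &
  (\<forall>d. nrm2 (cmb k d (U n)) = (\<Sum>i<k. (d i)\<^sup>2)) & c <= nrm (%x. indicator (cball 0 (real (R::nat))) x * U n 0 x))"
proof -
 have "\<exists>W :: nat => nat => 'a => real. \<forall>n. rb k (alp + 1 / real (Suc n)) (W n) & emeasure lebesgue ({} \<union> supp k (W n)) <= ennreal b &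
  (\<forall>c. nrm2 (cmb k c (W n)) = (\<Sum>i<k. (c i)\<^sup>2))"
  by (rule normalized_seq) (use inf in \<open>simp_all add: ST_def\<close>)
 then obtain W :: "nat => nat => 'a => real" where W: "!!n. rb k (alp + 1 / real (Suc n)) (W n)" "!!n. emeasure lebesgue (supp k (W n)) <= ennreal b"
  "!!n c. nrm2 (cmb k c (W n)) = (\<Sum>i<k. (c i)\<^sup>2)" by auto
 have k0: "0 < k" using k by simp
 have a1: "0 <= alp + 1" using a by simp
 obtain e c where ec: "0 < e" "0 < c" "!!(u::'a => real) A. u \<in> H1 ==> A \<in> sets lebesgue ==> emeasure lebesgue A <= ennreal b ==>
  (AE x in lebesgue. x \<notin> A --> u x = 0) ==> en u <= alp + 1 ==> nrm2 u = 1 ==> \<exists>x. c <= nrm2 (%y. indicator (cball x e) y * u y)"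
  by (rule nonvanishing[OF b a1]) blast
 have W1: "nrm2 (W n 0) = 1" for n by (rule nrm2_unitv[OF W(3) k0])
 have WH: "W n 0 \<in> H1" for n by (rule rb_H1[OF W(1) k0])
 have "\<exists>x. c <= nrm2 (%y. indicator (cball x e) y * W n 0 y)" for n
 proof (rule ec(3)[OF WH rb_supp_sets[OF W(1)] W(2)])
  show "AE x in lebesgue. x \<notin> supp k (W n) --> W n 0 x = 0" using k0 by (auto simp: supp_def)
  have "en (W n 0) <= alp + 1 / real (Suc n)"
   using rb_bound[OF W(1), of "unitv 0" n] unfolding cmb_unitv[OF k0] W1 by simp
  also have "... <= alp + 1" by simp
  finally show "en (W n 0) <= alp + 1" .
 qed (rule W1)
 then have "\<forall>n. \<exists>x. c <= nrm2 (%y. indicator (cball x e) y * W n 0 y)" by blast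
 from choice[OF this] obtain x where x: "!!n. c <= nrm2 (%y. indicator (cball (x n) e) y * W n 0 y)" by blast
 define U where "U n i y = W n i (x n + 1 *\<^sub>R y)" for n i y
 obtain R :: nat where R: "e <= real R" using real_arch_simple by blast
 have cU: "cmb k d (U n) = (%y. cmb k d (W n) (x n + 1 *\<^sub>R y))" for d n by (simp add: cmb_def[abs_def] U_def)
 show ?thesis
 proof (intro exI[of _ U] exI[of _ "sqrt c"] exI[of _ R] conjI allI)
  show "0 < sqrt c" using ec(2) by simp
  fix n
  show "rb k (alp + 1 / real (Suc n)) (U n)" using rb_affine[OF W(1), of 1 n "x n"] by (simp add: U_def[abs_def])
  have "supp k (U n) = {y. x n + 1 *\<^sub>R y \<in> supp k (W n)}" unfolding U_def[abs_def] by (rule supp_affine)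
  moreover have "emeasure lebesgue (supp k (W n)) = emeasure lebesgue {y. x n + 1 *\<^sub>R y \<in> supp k (W n)}"
   using emeasure_affine(2)[OF one_neq_zero rb_supp_sets[OF W(1)], of n "x n"] by simp
  ultimately show "emeasure lebesgue ({} \<union> supp k (U n)) <= ennreal b" using W(2)[of n] by simp
  show "nrm2 (cmb k d (U n)) = (\<Sum>i<k. (d i)\<^sup>2)" for d
  proof -
   have "cmb k d (W n) \<in> H1" by (rule cmb_H1[OF rb_H1[OF W(1)]])
   from nrm2_affine[OF one_neq_zero H1_L2[OF this], of "x n"] show ?thesis unfolding cU W(3) by simp
  qed
  have L: "L2 (%y. indicator (cball (x n) e) y * W n 0 y)" by (intro L2_indicator_mult H1_L2 WH) simp
  have U0: "L2 (U n 0)" unfolding U_def[abs_def] by (rule H1_L2[OF en_affine(1)[OF WH]]) simp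
  have "c <= nrm2 (%y. indicator (cball (x n) e) y * W n 0 y)" by (rule x)
  also have "... = nrm2 (%y. indicator (cball (x n) e) (x n + 1 *\<^sub>R y) * W n 0 (x n + 1 *\<^sub>R y))"
   using nrm2_affine[OF one_neq_zero L, of "x n"] by simp
  also have "... <= nrm2 (%y. indicator (cball 0 (real R)) y * U n 0 y)"
  proof (rule nrm2_mono)
   show "L2 (%y. indicator (cball 0 (real R)) y * U n 0 y)" by (intro L2_indicator_mult U0) simp
   show "(%y. indicator (cball (x n) e) (x n + 1 *\<^sub>R y) * W n 0 (x n + 1 *\<^sub>R y)) \<in> borel_measurable lebesgue"
    using L2_affine[OF one_neq_zero L, of "x n"] by (simp add: L2_def)
   show "AE y in lebesgue. \<bar>indicator (cball (x n) e) (x n + 1 *\<^sub>R y) * W n 0 (x n + 1 *\<^sub>R y)\<bar> <= \<bar>indicator (cball 0 (real R)) y * U n 0 y\<bar>"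
    using R by (intro AE_I2) (auto simp: indicator_def U_def dist_norm)
  qed
  finally show "sqrt c <= nrm (%y. indicator (cball 0 (real R)) y * U n 0 y)" by (simp add: nrm_def)
 qed
qed

lemma measure_ennreal_eq: "emeasure M A <= ennreal m ==> 0 <= m ==> A \<in> sets M ==> emeasure M A = ennreal (measure M A) & measure M A <= m"
 using emeasure_finite_eq measure_le_real by blast

text \<open>If everything escapes, the volume b = m - |D| alone reaches the level alp, and by
  optimality nothing lower. A recentred sequence on volume b leaves a limit set of positive volume,
  so a second total loss would put the level alp on strictly less volume than b, and
  \<open>ST_grow\<close> would beat alp.\<close>

lemma split_pair:
 fixes D :: "'a::euclidean_space set"
 assumes D: "quasi_open D" "emeasure lebesgue D <= ennreal m" and m: "0 <= m" and k: "1 <= k"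
  and inf: "!!epsr. 0 < epsr ==> \<exists>u. rb k (alp + epsr) u & emeasure lebesgue (D \<union> supp k u) <= ennreal m"
  and optA: "\<forall>Lar u. Lar < alp --> rb k Lar u --> \<not> emeasure lebesgue (D \<union> supp k u) <= ennreal m"
 shows "\<exists>l<k. \<exists>Om. quasi_open Om & D \<subseteq> Om & emeasure lebesgue Om <= ennreal m &
  (\<forall>epsr>0. ev Om (k - l) (alp + epsr) & (\<forall>de>0. ST TYPE('a) l (ennreal (m - measure lebesgue Om + de)) (alp + epsr)))"
proof -
 note opt = optA[rule_format]
 have a: "0 <= alp"
 proof (rule field_le_epsilon)
  fix e :: real assume "0 < e"
  then show "0 <= alp + e" using inf[of e] rb_nonneg k by blast
 qed
 have Ds: "D \<in> sets lebesgue" by (rule quasi_open_sets[OF D(1)])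
 note mD = measure_ennreal_eq[OF D(2) m Ds]
 from normalized_seq[OF Ds inf] obtain U where U: "!!n. rb k (alp + 1 / real (Suc n)) (U n)"
  "!!n. emeasure lebesgue (D \<union> supp k (U n)) <= ennreal m" "!!n c. nrm2 (cmb k c (U n)) = (\<Sum>i<k. (c i)\<^sup>2)" by auto
 from split_set[OF D(1) m a U] obtain l Om where l: "l <= k" and Om: "quasi_open Om" "D \<subseteq> Om" "emeasure lebesgue Om <= ennreal m"
  "\<forall>epsr>0. ev Om (k - l) (alp + epsr) & (\<forall>de>0. ST TYPE('a) l (ennreal (m - measure lebesgue Om + de)) (alp + epsr))" by auto
 show ?thesis
 proof (cases "l < k")
  case True
  then show ?thesis using Om by blast
 next
  case False
  then have lk: "l = k" using l by simp
  have os: "Om \<in> sets lebesgue" by (rule quasi_open_sets[OF Om(1)])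
  note mO = measure_ennreal_eq[OF Om(3) m os]
  have "0 < m - measure lebesgue Om & 0 < alp & (\<forall>Lar>alp. ST TYPE('a) k (ennreal (m - measure lebesgue Om)) Lar)"
   by (rule ST_closed[OF k a]) (use Om(4) lk in blast)
  then have a1: "0 < m - measure lebesgue Om" "0 < alp" "!!Lar. alp < Lar ==> ST TYPE('a) k (ennreal (m - measure lebesgue Om)) Lar" by auto
  have "emeasure lebesgue D <= emeasure lebesgue Om" by (rule emeasure_mono[OF Om(2) os])
  then have DO: "measure lebesgue D <= measure lebesgue Om" using mD mO by (simp add: ennreal_le_iff)
  define b where "b = m - measure lebesgue D"
  have b: "0 < b" "m - measure lebesgue Om <= b" using a1(1) DO by (auto simp: b_def)
  have Sb: "ST TYPE('a) k (ennreal b) (alp + epsr)" if "0 < epsr" for epsr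
   by (rule ST_mono[OF a1(3)[of "alp + epsr"] ennreal_leI[OF b(2)] order_refl]) (use that in simp)
  \<comment> \<open>A tuple supported on volume b can be added to D within the volume m.\<close>
  have nS: "\<not> ST TYPE('a) k (ennreal b) Lar" if "Lar < alp" for Lar
  proof
   assume "ST TYPE('a) k (ennreal b) Lar"
   then obtain w :: "nat => 'a => real" where w: "rb k Lar w" "emeasure lebesgue (supp k w) <= ennreal b" by (auto simp: ST_def)
   have "emeasure lebesgue (D \<union> supp k w) <= emeasure lebesgue D + emeasure lebesgue (supp k w)"
    by (rule emeasure_subadditive[OF Ds rb_supp_sets[OF w(1)]])
   also have "... <= ennreal (measure lebesgue D) + ennreal b" using mD w(2) by (intro add_mono) auto
   also have "... = ennreal m" using b(1) by (simp add: ennreal_plus[symmetric] b_def del: ennreal_plus)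
   finally show False using opt[OF that w(1)] by blast
  qed
  from recentred_seq[OF a less_imp_le[OF b(1)] k Sb] obtain U :: "nat => nat => 'a => real" and c and R :: nat where c: "0 < c" and
   UA: "\<forall>n. rb k (alp + 1 / real (Suc n)) (U n) & emeasure lebesgue ({} \<union> supp k (U n)) <= ennreal b &
    (\<forall>d. nrm2 (cmb k d (U n)) = (\<Sum>i<k. (d i)\<^sup>2)) & c <= nrm (%x. indicator (cball 0 (real R)) x * U n 0 x)"
   by blast
  note UA' = UA[THEN spec]
  have U: "rb k (alp + 1 / real (Suc n)) (U n)" "emeasure lebesgue ({} \<union> supp k (U n)) <= ennreal b"
   "nrm2 (cmb k d (U n)) = (\<Sum>i<k. (d i)\<^sup>2)" "c <= nrm (%x. indicator (cball 0 (real R)) x * U n 0 x)" for n d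
   by (rule UA'[of n, THEN conjunct1], rule UA'[of n, THEN conjunct2, THEN conjunct1],
    rule UA'[of n, THEN conjunct2, THEN conjunct2, THEN conjunct1, THEN spec, of d], rule UA'[of n, THEN conjunct2, THEN conjunct2, THEN conjunct2])
  note cR = U(4)
  from split_set[OF quasi_open_empty less_imp_le[OF b(1)] a U(1-3)] obtain l' and Om' :: "'a set" where l': "l' <= k" and
   O': "quasi_open Om'" "emeasure lebesgue Om' <= ennreal b"
   "\<forall>epsr>0. ev Om' (k - l') (alp + epsr) & (\<forall>de>0. ST TYPE('a) l' (ennreal (b - measure lebesgue Om' + de)) (alp + epsr))"
   and p: "1 <= k --> (\<exists>c>0. \<exists>R::nat. \<forall>n. c <= nrm (%x. indicator (cball 0 (real R)) x * U n 0 x)) --> 0 < measure lebesgue Om'" by blast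
  have p': "0 < measure lebesgue Om'" using p k c cR by blast
  have "l' ~= k"
  proof
   assume lk: "l' = k"
   have "0 < b - measure lebesgue Om' & 0 < alp & (\<forall>Lar>alp. ST TYPE('a) k (ennreal (b - measure lebesgue Om')) Lar)"
    by (rule ST_closed[OF k a]) (use O'(3) lk in blast)
   then have "\<exists>Lar<alp. ST TYPE('a) k (ennreal b) Lar" by (intro ST_grow[of alp k b "measure lebesgue Om'"] p') auto
   then show False using nS by blast
  qed
  then have l'': "l' < k" using l' by simp
  \<comment> \<open>Adding D costs at most its measure, so V leaves at least as much of m as
    \<open>Om'\<close> leaves of b.\<close>
  define V where "V = D \<union> Om'"
  have s': "Om' \<in> sets lebesgue" by (rule quasi_open_sets[OF O'(1)])
  note mO' = measure_ennreal_eq[OF O'(2) less_imp_le[OF b(1)] s']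
  have "emeasure lebesgue V <= emeasure lebesgue D + emeasure lebesgue Om'" unfolding V_def by (rule emeasure_subadditive[OF Ds s'])
  also have "... = ennreal (measure lebesgue D + measure lebesgue Om')" using mD mO' by (simp add: ennreal_plus)
  finally have V1: "emeasure lebesgue V <= ennreal (measure lebesgue D + measure lebesgue Om')" .
  have Vs: "V \<in> sets lebesgue" using Ds s' by (simp add: V_def)
  have V2: "measure lebesgue V <= measure lebesgue D + measure lebesgue Om'" by (rule measure_le_real[OF Vs _ V1]) simp
  have V3: "emeasure lebesgue V <= ennreal m" by (rule order_trans[OF V1 ennreal_leI]) (use mO' in \<open>simp add: b_def\<close>)
  have "b - measure lebesgue Om' + de <= m - measure lebesgue V + de" for de using V2 by (simp add: b_def)
  then have "ST TYPE('a) l' (ennreal (m - measure lebesgue V + de)) (alp + epsr)" if "0 < epsr" "0 < de" for epsr de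
   using O'(3) that by (blast intro: ST_mono ennreal_leI order_refl)
  moreover have "ev V (k - l') (alp + epsr)" if "0 < epsr" for epsr using O'(3) that unfolding V_def by (blast intro: ev_mono_set)
  moreover have "quasi_open V" "D \<subseteq> V" using D(1) O'(1) by (auto simp: V_def intro: quasi_open_Un)
  ultimately show ?thesis using l'' V3 by blast
 qed
qed

text \<open>The contradiction behind both equalities with \<open>lambda_star\<close>: if the part
  that stays with D and the distant part both lie strictly below alp and fit into volume m, gluing
  them yields dimension k below alp.\<close>

lemma glue_contra:
 fixes D :: "'a::euclidean_space set"
 assumes optA: "\<forall>Lar u. Lar < alp --> rb k Lar u --> \<not> emeasure lebesgue (D \<union> supp k u) <= ennreal m"
  and al: "0 < alp" and l: "l <= k" and v: "rb (k - l) be v" "be < alp" and st: "ST TYPE('a) l (ennreal p) ga" "ga < alp"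
  and G: "G \<in> sets lebesgue" "D \<subseteq> G" "supp (k - l) v \<subseteq> G" "emeasure lebesgue G <= ennreal q" "0 <= q" "0 <= p" "q + p <= m"
 shows False
proof -
 note opt = optA[rule_format]
 \<comment> \<open>A common nonnegative level for both parts; halfway between it and alp there is
   room for the loss in gluing.\<close>
 define Lar where "Lar = max 0 (max be ga)"
 have L: "0 <= Lar" "be <= Lar" "ga <= Lar" "Lar < (Lar + alp) / 2" "(Lar + alp) / 2 < alp" using al v(2) st(2) by (auto simp: Lar_def)
 obtain w :: "nat => 'a => real" where w: "rb l ga w" "emeasure lebesgue (supp l w) <= ennreal p" using st by (auto simp: ST_def)
 from glue[OF rb_mono[OF v(1) L(2)] rb_mono[OF w(1) L(3)] L(1,4)] obtain z T where z: "rb (k - l + l) ((Lar + alp) / 2) z"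
  "supp (k - l + l) z \<subseteq> supp (k - l) v \<union> T" "T \<in> sets lebesgue" "emeasure lebesgue T <= emeasure lebesgue (supp l w)" by blast
 have kl: "k - l + l = k" using l by simp
 have "emeasure lebesgue (D \<union> supp k z) <= emeasure lebesgue (G \<union> T)"
  using z(2) G z(3) unfolding kl by (intro emeasure_mono) auto
 also have "... <= emeasure lebesgue G + emeasure lebesgue T" by (rule emeasure_subadditive[OF G(1) z(3)])
 also have "... <= ennreal q + ennreal p" using G(4) z(4) w(2) by (intro add_mono) (auto intro: order_trans)
 also have "... <= ennreal m" using G by (simp add: ennreal_plus[symmetric] ennreal_leI del: ennreal_plus)
 finally show False using opt[OF L(5)] z(1) unfolding kl by blast
qed

section \<open>The three alternatives\<close>

theorem theorem3p5:
  fixes D :: "'a::euclidean_space set" and m :: real and k :: nat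
  assumes "DIM('a) \<ge> 2"
    and "quasi_open D" and "emeasure lebesgue D < \<infinity>"
    and "m > 0" and "k \<ge> 2"
  defines "\<alpha> \<equiv> (INF \<Omega> \<in> {\<Omega>. quasi_open \<Omega> \<and> D \<subseteq> \<Omega> \<and> emeasure lebesgue \<Omega> \<le> ennreal m}.
                    dirichlet_eig \<Omega> k)"
  shows "(\<exists>\<Omega>. quasi_open \<Omega> \<and> D \<subseteq> \<Omega> \<and> emeasure lebesgue \<Omega> \<le> ennreal m \<and>
             dirichlet_eig \<Omega> k = \<alpha>)
       \<or> (\<exists>l \<in> {1..k-1}. \<exists>\<Omega>. quasi_open \<Omega> \<and> D \<subseteq> \<Omega> \<and> emeasure lebesgue \<Omega> \<le> ennreal m \<and>
             \<alpha> = dirichlet_eig \<Omega> (k - l) \<and>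
             \<alpha> = (lambda_star TYPE('a) l (m - measure lebesgue \<Omega>)))
       \<or> (\<exists>l \<in> {1..k-1}. \<alpha> = lambda_star TYPE('a) l (m - measure lebesgue D)
             \<and> lambda_star TYPE('a) l (m - measure lebesgue D) > dirichlet_eig D (k - l))"
    (is "?A \<or> ?B \<or> ?C")
proof -
 have Ds: "D \<in> sets lebesgue" by (rule quasi_open_sets[OF assms(2)])
 have m0: "0 <= m" using assms(4) by simp
 have fD: "emeasure lebesgue D = ennreal (measure lebesgue D)" using assms(3) by (intro emeasure_eq_ennreal_measure) auto
 have k1: "1 <= k" using assms(5) by simp
 have low: "\<alpha> <= dirichlet_eig Om k" if "quasi_open Om" "D \<subseteq> Om" "emeasure lebesgue Om <= ennreal m" for Om
  unfolding \<alpha>_def by (rule INF_lower) (use that in simp)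
 have less: "\<exists>be<Lar. \<exists>u. rb k be u & emeasure lebesgue (D \<union> supp k u) <= ennreal m" if lt: "\<alpha> < ereal Lar" for Lar
 proof -
  obtain Om where Om: "quasi_open Om" "D \<subseteq> Om" "emeasure lebesgue Om <= ennreal m" "dirichlet_eig Om k < ereal Lar"
   using lt unfolding \<alpha>_def INF_less_iff by blast
  obtain be where b: "be < Lar" "ev Om k be" using eig_less[OF Om(4)] by blast
  obtain u where u: "rb k be u" "supp k u \<subseteq> Om" using ev_tuple[OF b(2)] by blast
  have "emeasure lebesgue (D \<union> supp k u) <= emeasure lebesgue Om"
   using u(2) Om(2) by (intro emeasure_mono quasi_open_sets[OF Om(1)]) auto
  then show ?thesis using u(1) b(1) Om(3) by (meson order_trans)
 qed
 show ?thesis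
 proof (cases "emeasure lebesgue D <= ennreal m")
  case False
  then have big: "m < measure lebesgue D" unfolding fD using m0 by (metis ennreal_leI not_le)
  have "{Om. quasi_open Om & D \<subseteq> Om & emeasure lebesgue Om <= ennreal m} = {}"
   using False emeasure_mono[OF _ quasi_open_sets] by (auto dest: order_trans)
  \<comment> \<open>There is no admissible set, so \<alpha> is the infimum of the empty set.
    Alternative (iii) will hold with l = k - 1, for which only the first eigenvalue of D has to be
    finite.\<close>
  then have ai: "\<alpha> = \<infinity>" unfolding \<alpha>_def by (simp only: image_empty Inf_empty top_ereal_def)
  have star: "lambda_star TYPE('a) (k - 1) (m - measure lebesgue D) = \<infinity>"
   using assms(5) big by (intro star_nonpos) auto
  have "0 < emeasure lebesgue D" unfolding fD using big m0 by simp
  from H10_nontrivial[OF assms(2) this] obtain u where u: "u \<in> H10 D" "\<not> (AE x in lebesgue. u x = 0)" .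
  have uH: "u \<in> H1" by (rule H10_H1[OF u(1)])
  have n: "nrm2 u ~= 0" using u(2) nrm2_eq_0[OF H1_L2[OF uH]] by blast
  have c1: "cmb (Suc 0) c (%_. u) = (%x. c 0 * u x)" for c by (simp add: cmb_def[abs_def])
  have "rb 1 (en u / nrm2 u) (%_. u)"
   by (rule rbI) (use uH n in \<open>simp_all add: c1 nrm2_cmult H1_cmult(2)\<close>)
  then have "ev D 1 (en u / nrm2 u)" using u(1) unfolding ev_def by (intro exI[of _ "%_. u"]) simp
  then have "dirichlet_eig D 1 <= ereal (en u / nrm2 u)" by (rule eig_le)
  then have "dirichlet_eig D 1 < \<infinity>" by (rule order.strict_trans1) simp
  moreover have "k - (k - 1) = 1" "k - 1 \<in> {1..k - 1}" using assms(5) by auto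
  ultimately have ?C using ai star by (intro bexI[of _ "k - 1"]) auto
  then show ?thesis by blast
 next
  case True
  note mD = measure_ennreal_eq[OF True m0 Ds]
  show ?thesis
  proof (cases \<alpha>)
   \<comment> \<open>D itself is admissible and attains an infinite infimum.\<close>
   case PInf
   then have "dirichlet_eig D k = \<alpha>" using low[OF assms(2) order_refl True] by simp
   then have ?A using assms(2) True by blast
   then show ?thesis by blast
  next
   \<comment> \<open>Excluded, since levels of nonempty tuples are nonnegative.\<close>
   case MInf
   then obtain be and u :: "nat => 'a => real" where "be < -1" "rb k be u" using less[of "-1"] by auto
   then show ?thesis using rb_nonneg[OF _ k1] by fastforce
  next
   case (real a)
   have inf: "\<exists>u. rb k (a + epsr) u & emeasure lebesgue (D \<union> supp k u) <= ennreal m" if "0 < epsr" for epsr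
    using less[of "a + epsr"] that real rb_mono by (metis ereal_less_eq(3) less_add_same_cancel1 less_ereal.simps(1) less_imp_le)
   have opt: "\<not> emeasure lebesgue (D \<union> supp k u) <= ennreal m" if L: "Lar < a" and u: "rb k Lar u" for Lar u
   proof
    assume s: "emeasure lebesgue (D \<union> supp k u) <= ennreal m"
    obtain Om where Om: "quasi_open Om" "D \<subseteq> Om" "emeasure lebesgue Om = emeasure lebesgue (D \<union> supp k u)" "\<forall>i<k. u i \<in> H10 Om"
     using tuple_set[OF assms(2), of k u] rb_H1[OF u] by blast
    have "ev Om k Lar" using u Om(4) unfolding ev_def by blast
    then have "\<alpha> <= ereal Lar" using low[OF Om(1,2)] Om(3) s eig_le by (metis order_trans)
    then show False using L real by simp
   qed
   have optA: "\<forall>Lar u. Lar < a --> rb k Lar u --> \<not> emeasure lebesgue (D \<union> supp k u) <= ennreal m" using opt by blast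
   have "\<exists>l<k. \<exists>Om. quasi_open Om & D \<subseteq> Om & emeasure lebesgue Om <= ennreal m &
    (\<forall>epsr>0. ev Om (k - l) (a + epsr) & (\<forall>de>0. ST TYPE('a) l (ennreal (m - measure lebesgue Om + de)) (a + epsr)))"
    by (rule split_pair[OF assms(2) True m0 k1 inf optA])
   then obtain l Om where l: "l < k" and Om: "quasi_open Om" "D \<subseteq> Om" "emeasure lebesgue Om <= ennreal m"
    "!!epsr. 0 < epsr ==> ev Om (k - l) (a + epsr)"
    "!!epsr de. 0 < epsr ==> 0 < de ==> ST TYPE('a) l (ennreal (m - measure lebesgue Om + de)) (a + epsr)" by auto
   show ?thesis
   proof (cases "l = 0")
    \<comment> \<open>Nothing escapes: the set delivered by the splitting is optimal.\<close>
    case True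
    have "dirichlet_eig Om k <= ereal a" using eig_leI[of Om "k - l" a, OF Om(4)] True by simp
    then have "dirichlet_eig Om k = \<alpha>" using low[OF Om(1-3)] real by simp
    then have ?A using Om(1-3) by blast
    then show ?thesis by blast
   next
    case False
    then have l1: "1 <= l" "l \<in> {1..k-1}" "l <= k" using l by auto
    have a0: "0 <= a"
    proof (rule field_le_epsilon)
     fix e :: real assume "0 < e"
     then show "0 <= a + e" using inf[of e] rb_nonneg k1 by blast
    qed
    have os: "Om \<in> sets lebesgue" by (rule quasi_open_sets[OF Om(1)])
    note mO = measure_ennreal_eq[OF Om(3) m0 os]
    have cl: "0 < m - measure lebesgue Om & 0 < a & (\<forall>Lar>a. ST TYPE('a) l (ennreal (m - measure lebesgue Om)) Lar)"
     by (rule ST_closed[OF l1(1) a0 Om(5)])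
    have al: "0 < a" using cl by blast
    \<comment> \<open>One half of the equality with \<open>lambda_star\<close>: a set no larger than
      Om leaves at least the volume on which the escaping tuples live.\<close>
    have starS: "lambda_star TYPE('a) l (m - measure lebesgue G) <= \<alpha>" if "measure lebesgue G <= measure lebesgue Om" for G :: "'a set"
     unfolding real
    proof (rule star_leI)
     fix Lar assume "a < Lar"
     then have "ST TYPE('a) l (ennreal (m - measure lebesgue Om)) Lar" using cl by blast
     then show "ST TYPE('a) l (ennreal (m - measure lebesgue G)) Lar" by (rule ST_mono) (use that in \<open>auto intro: ennreal_leI\<close>)
    qed
    have Ofin: "emeasure lebesgue Om < \<infinity>" using mO by (metis ennreal_less_top infinity_ennreal_def)
    \<comment> \<open>The dichotomy between (ii) and (iii): either the value \<alpha> is attained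
      exactly in dimension k - l, or D alone lies strictly below it.\<close>
    have "(\<exists>Om'. quasi_open Om' & D \<subseteq> Om' & emeasure lebesgue Om' <= emeasure lebesgue Om & ev Om' (k - l) a & \<not> (\<exists>be<a. ev Om' (k - l) be)) \<or>
      (\<exists>be<a. ev D (k - l) be)"
     by (rule minimal_set[OF assms(1,2) Om(2) os Ofin al Om(4)])
    then show ?thesis
    proof (elim disjE exE conjE)
     fix V assume V: "quasi_open V" "D \<subseteq> V" "emeasure lebesgue V <= emeasure lebesgue Om" "ev V (k - l) a" "\<not> (\<exists>be<a. ev V (k - l) be)"
     have Vs: "V \<in> sets lebesgue" by (rule quasi_open_sets[OF V(1)])
     have Vm: "emeasure lebesgue V <= ennreal m" using V(3) Om(3) by (rule order_trans)
     note mV = measure_ennreal_eq[OF Vm m0 Vs]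
     have VO: "measure lebesgue V <= measure lebesgue Om" using V(3) mV mO by (simp add: ennreal_le_iff)
     have e1: "dirichlet_eig V (k - l) = \<alpha>"
      using eig_le[OF V(4)] eig_less[of V "k - l" a] V(5) unfolding real by (meson antisym not_le)
     have "lambda_star TYPE('a) l (m - measure lebesgue V) = \<alpha>"
     proof (rule antisym[OF starS[OF VO]], rule ccontr)
      assume "\<not> \<alpha> <= lambda_star TYPE('a) l (m - measure lebesgue V)"
      then have "lambda_star TYPE('a) l (m - measure lebesgue V) < ereal a" using real by simp
      from star_less[OF this] obtain be where b: "be < a" "ST TYPE('a) l (ennreal (m - measure lebesgue V)) be" by blast
      \<comment> \<open>Only the distant part is strictly below \<alpha> so far. Its gap is turned
        into spare volume \<open>de\<close>, which pays for adding a dilate of V to V; the dilated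
        tuple brings the remaining part below \<alpha> too, and D stays inside the union.\<close>
      define q where "q = m - measure lebesgue V"
      have q: "0 < q" using cl VO by (simp add: q_def)
      define Lar where "Lar = (max be 0 + a) / 2"
      have L: "be < Lar" "0 < Lar" "Lar < a" using b(1) al by (auto simp: Lar_def)
      obtain de where d: "0 < de" "de < q" "ST TYPE('a) l (ennreal (q - de)) Lar"
       using ST_shrink[OF b(2)[folded q_def] q L(1,2)] by blast
      have Vfin: "emeasure lebesgue V < \<infinity>" using mV by (metis ennreal_less_top infinity_ennreal_def)
      obtain s where s: "0 < s" "s < 1" "emeasure lebesgue (V \<union> {x. s *\<^sub>R x \<in> V}) <= emeasure lebesgue V + ennreal de"
       using dilate_measure[OF Vs Vfin d(1)] by blast
      obtain v where v: "rb (k - l) a v" "supp (k - l) v \<subseteq> V" using ev_tuple[OF V(4)] by blast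
      let ?v = "%i x. v i (0 + s *\<^sub>R x)"
      have "s\<^sup>2 < 1\<^sup>2" using s by (intro power_strict_mono) auto
      then have s2: "s\<^sup>2 * a < a" using al by simp
      have sets: "V \<union> {x. s *\<^sub>R x \<in> V} \<in> sets lebesgue" using emeasure_affine(1)[OF _ Vs, of s 0] Vs s(1) by auto
      show False
      proof (rule glue_contra[OF optA al l1(3) rb_affine[OF v(1) s(1), of 0] s2 d(3) L(3) sets])
       show "supp (k - l) ?v \<subseteq> V \<union> {x. s *\<^sub>R x \<in> V}" using v(2) unfolding supp_affine by auto
       show "emeasure lebesgue (V \<union> {x. s *\<^sub>R x \<in> V}) <= ennreal (measure lebesgue V + de)"
        using s(3) mV d(1) by (simp add: ennreal_plus)
      qed (use V(2) d q in \<open>auto simp: q_def\<close>)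
     qed
     then have ?B using e1 V(1,2) Vm l1(2) by (intro bexI[of _ l] exI[of _ V]) auto
     then show ?thesis by blast
    next
     fix be assume b: "be < a" "ev D (k - l) be"
     have "emeasure lebesgue D <= emeasure lebesgue Om" by (rule emeasure_mono[OF Om(2) os])
     then have DO: "measure lebesgue D <= measure lebesgue Om" using mD mO by (simp add: ennreal_le_iff)
     have "lambda_star TYPE('a) l (m - measure lebesgue D) = \<alpha>"
     proof (rule antisym[OF starS[OF DO]], rule ccontr)
      assume "\<not> \<alpha> <= lambda_star TYPE('a) l (m - measure lebesgue D)"
      then have "lambda_star TYPE('a) l (m - measure lebesgue D) < ereal a" using real by simp
      from star_less[OF this] obtain ga where g: "ga < a" "ST TYPE('a) l (ennreal (m - measure lebesgue D)) ga" by blast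
      obtain v where v: "rb (k - l) be v" "supp (k - l) v \<subseteq> D" using ev_tuple[OF b(2)] by blast
      \<comment> \<open>Here D already lies strictly below \<alpha>, so gluing beats \<alpha>
        directly.\<close>
      show False
       by (rule glue_contra[OF optA al l1(3) v(1) b(1) g(2,1) Ds order_refl v(2) eq_refl[OF fD]]) (use mD in auto)
     qed
     moreover have "dirichlet_eig D (k - l) < \<alpha>"
      using eig_le[OF b(2)] b(1) unfolding real by (meson ereal_less(2) le_less_trans less_ereal.simps(1))
     ultimately have ?C using l1(2) by (intro bexI[of _ l]) auto
     then show ?thesis by blast
    qed
   qed
  qed
 qed
qed

end
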